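(* Let $A$ be a set of points in Euclidean space $\mathbb{R}^d$ with a balanced coloring into $\ell$ colors, let $k$ be a constant, and let $\varepsilon>0$. Then there exists an algorithm that computes, in time $O(n^{\mathrm{poly}(k/\varepsilon)})$, a $(1+\varepsilon)$-approximation for fair $k$-median, for fair $k$-means, and for fair $k$-center on $A$.
   Context: Here $n$ is the number of input points. A coloring is balanced if every color class has the same size; a cluster is balanced if it contains equally many points of every color. A fair $k$-clustering partitions $A$ into at most $k$ balanced clusters, each with a center in $\mathbb{R}^d$. Fair $k$-median minimizes the sum of Euclidean distances from points to their centers, fair $k$-means minimizes the sum of squared Euclidean distances, and fair $k$-center minimizes the maximum Euclidean distance. A $(1+\varepsilon)$-approximation is a feasible solution of cost at most $(1+\varepsilon)$ times the optimum. *)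

theory Defs
  imports
    "HOL-Analysis.L2_Norm"
    "HOL-Library.Disjoint_Sets"
    "HOL-Computational_Algebra.Polynomial"
begin

section \<open>Fair clustering in Euclidean space\<close>

text \<open>
  The dimension has to be quantified inside the statement (neither the exponent of the running time
  nor the program may depend on it), so the points of \<open>d\<close>-dimensional Euclidean space are functions
  vanishing from index \<open>d\<close> on rather than elements of a type indexed by a finite type.
\<close>

type_synonym point = "nat \<Rightarrow> real"

definition euclid :: "nat \<Rightarrow> point set" where
  "euclid d = {x. \<forall>i\<ge>d. x i = 0}"

definition edist :: "nat \<Rightarrow> point \<Rightarrow> point \<Rightarrow> real" where
  "edist d x y = L2_set (\<lambda>i. x i - y i) {..<d}"

text \<open>The same predicate describes a balanced coloring (on the whole input) and a balanced cluster.\<close>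

definition balanced :: "nat \<Rightarrow> (point \<Rightarrow> nat) \<Rightarrow> point set \<Rightarrow> bool" where
  "balanced l col S \<longleftrightarrow>
     (\<forall>i<l. \<forall>j<l. card {a \<in> S. col a = i} = card {a \<in> S. col a = j})"

definition balanced_coloring :: "nat \<Rightarrow> (point \<Rightarrow> nat) \<Rightarrow> point set \<Rightarrow> bool" where
  "balanced_coloring l col A \<longleftrightarrow> col ` A \<subseteq> {..<l} \<and> balanced l col A"

definition fair_clustering ::
  "nat \<Rightarrow> nat \<Rightarrow> nat \<Rightarrow> (point \<Rightarrow> nat) \<Rightarrow> point set \<Rightarrow> point set set \<Rightarrow> (point set \<Rightarrow> point) \<Rightarrow> bool"
where
  "fair_clustering d k l col A \<C> \<mu> \<longleftrightarrow>
     partition_on A \<C> \<and> card \<C> \<le> k \<and> (\<forall>C\<in>\<C>. balanced l col C \<and> \<mu> C \<in> euclid d)"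

datatype objective = K_Median | K_Means | K_Center

fun cost :: "objective \<Rightarrow> nat \<Rightarrow> point set set \<Rightarrow> (point set \<Rightarrow> point) \<Rightarrow> real" where
  "cost K_Median d \<C> \<mu> = (\<Sum>C\<in>\<C>. \<Sum>a\<in>C. edist d a (\<mu> C))"
| "cost K_Means d \<C> \<mu> = (\<Sum>C\<in>\<C>. \<Sum>a\<in>C. (edist d a (\<mu> C))\<^sup>2)"
| "cost K_Center d \<C> \<mu> = Max (\<Union>C\<in>\<C>. (\<lambda>a. edist d a (\<mu> C)) ` C)"

definition opt ::
  "objective \<Rightarrow> nat \<Rightarrow> nat \<Rightarrow> nat \<Rightarrow> (point \<Rightarrow> nat) \<Rightarrow> point set \<Rightarrow> real"
where
  "opt obj d k l col A = Inf {cost obj d \<C> \<mu> | \<C> \<mu>. fair_clustering d k l col A \<C> \<mu>}"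

definition approximation ::
  "objective \<Rightarrow> real \<Rightarrow> nat \<Rightarrow> nat \<Rightarrow> nat \<Rightarrow> (point \<Rightarrow> nat) \<Rightarrow> point set \<Rightarrow>
   point set set \<Rightarrow> (point set \<Rightarrow> point) \<Rightarrow> bool"
where
  "approximation obj \<alpha> d k l col A \<C> \<mu> \<longleftrightarrow>
     fair_clustering d k l col A \<C> \<mu> \<and> cost obj d \<C> \<mu> \<le> \<alpha> * opt obj d k l col A"


section \<open>The machine model\<close>

text \<open>
  A real RAM, presented as a structured imperative language. Memory consists of named arrays of
  naturals and named arrays of reals; a program mentions only finitely many names, and a scalar
  variable is an array used at index 0 only. Every operation has unit cost.

  The operations are restricted so that unit cost is the usual notion of time:
  \<^item> naturals, which serve as indices, have only addition and truncated subtraction;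
  \<^item> reals have the field operations, square root and comparison, but there is no rounding and no
    conversion of reals to naturals;
  \<^item> constants in programs are naturals or rationals, so that a program is a finite object.

  Division by zero and roots of negative numbers follow the total conventions of HOL.
\<close>

datatype nexp =
    NConst nat
  | NRead string nexp
  | NPlus nexp nexp
  | NMinus nexp nexp

datatype rexp =
    RConst rat
  | RRead string nexp
  | RPlus rexp rexp
  | RMinus rexp rexp
  | RTimes rexp rexp
  | RDivide rexp rexp
  | RSqrt rexp

datatype bexp =
    NLess nexp nexp
  | RLess rexp rexp
  | BNot bexp
  | BAnd bexp bexp

datatype com =
    Skip
  | NAssign string nexp nexp
  | RAssign string nexp rexp
  | Seq com com
  | Cond bexp com com
  | While bexp com

record state =
  nmem :: "string \<Rightarrow> nat \<Rightarrow> nat"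
  rmem :: "string \<Rightarrow> nat \<Rightarrow> real"

fun nval :: "nexp \<Rightarrow> state \<Rightarrow> nat" where
  "nval (NConst c) s = c"
| "nval (NRead x e) s = nmem s x (nval e s)"
| "nval (NPlus e f) s = nval e s + nval f s"
| "nval (NMinus e f) s = nval e s - nval f s"

fun rval :: "rexp \<Rightarrow> state \<Rightarrow> real" where
  "rval (RConst c) s = of_rat c"
| "rval (RRead x e) s = rmem s x (nval e s)"
| "rval (RPlus e f) s = rval e s + rval f s"
| "rval (RMinus e f) s = rval e s - rval f s"
| "rval (RTimes e f) s = rval e s * rval f s"
| "rval (RDivide e f) s = rval e s / rval f s"
| "rval (RSqrt e) s = sqrt (rval e s)"

fun bval :: "bexp \<Rightarrow> state \<Rightarrow> bool" where
  "bval (NLess e f) s \<longleftrightarrow> nval e s < nval f s"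
| "bval (RLess e f) s \<longleftrightarrow> rval e s < rval f s"
| "bval (BNot b) s \<longleftrightarrow> \<not> bval b s"
| "bval (BAnd b c) s \<longleftrightarrow> bval b s \<and> bval c s"

fun ntime :: "nexp \<Rightarrow> nat" where
  "ntime (NConst c) = 1"
| "ntime (NRead x e) = 1 + ntime e"
| "ntime (NPlus e f) = 1 + ntime e + ntime f"
| "ntime (NMinus e f) = 1 + ntime e + ntime f"

fun rtime :: "rexp \<Rightarrow> nat" where
  "rtime (RConst c) = 1"
| "rtime (RRead x e) = 1 + ntime e"
| "rtime (RPlus e f) = 1 + rtime e + rtime f"
| "rtime (RMinus e f) = 1 + rtime e + rtime f"
| "rtime (RTimes e f) = 1 + rtime e + rtime f"
| "rtime (RDivide e f) = 1 + rtime e + rtime f"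
| "rtime (RSqrt e) = 1 + rtime e"

fun btime :: "bexp \<Rightarrow> nat" where
  "btime (NLess e f) = 1 + ntime e + ntime f"
| "btime (RLess e f) = 1 + rtime e + rtime f"
| "btime (BNot b) = 1 + btime b"
| "btime (BAnd b c) = 1 + btime b + btime c"

fun nwrite :: "string \<Rightarrow> nat \<Rightarrow> nat \<Rightarrow> state \<Rightarrow> state" where
  "nwrite x i v s = s\<lparr>nmem := (nmem s)(x := (nmem s x)(i := v))\<rparr>"

fun rwrite :: "string \<Rightarrow> nat \<Rightarrow> real \<Rightarrow> state \<Rightarrow> state" where
  "rwrite x i v s = s\<lparr>rmem := (rmem s)(x := (rmem s x)(i := v))\<rparr>"

text \<open>\<open>exec c s t s'\<close>: started in \<open>s\<close>, the program \<open>c\<close> halts in \<open>s'\<close> after time \<open>t\<close>.\<close>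

inductive exec :: "com \<Rightarrow> state \<Rightarrow> nat \<Rightarrow> state \<Rightarrow> bool" where
  Skip: "exec Skip s 1 s"
| NAssign: "exec (NAssign x e f) s (1 + ntime e + ntime f) (nwrite x (nval e s) (nval f s) s)"
| RAssign: "exec (RAssign x e f) s (1 + ntime e + rtime f) (rwrite x (nval e s) (rval f s) s)"
| Seq: "exec c\<^sub>1 s t\<^sub>1 s' \<Longrightarrow> exec c\<^sub>2 s' t\<^sub>2 s'' \<Longrightarrow> exec (Seq c\<^sub>1 c\<^sub>2) s (t\<^sub>1 + t\<^sub>2) s''"
| CondTrue: "bval b s \<Longrightarrow> exec c\<^sub>1 s t s' \<Longrightarrow> exec (Cond b c\<^sub>1 c\<^sub>2) s (1 + btime b + t) s'"
| CondFalse: "\<not> bval b s \<Longrightarrow> exec c\<^sub>2 s t s' \<Longrightarrow> exec (Cond b c\<^sub>1 c\<^sub>2) s (1 + btime b + t) s'"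
| WhileFalse: "\<not> bval b s \<Longrightarrow> exec (While b c) s (1 + btime b) s"
| WhileTrue: "bval b s \<Longrightarrow> exec c s t\<^sub>1 s' \<Longrightarrow> exec (While b c) s' t\<^sub>2 s'' \<Longrightarrow>
    exec (While b c) s (1 + btime b + t\<^sub>1 + t\<^sub>2) s''"

text \<open>Programs are deterministic, so that running time and output are functions of the input.\<close>

lemma exec_deterministic:
  "exec c s t s' \<Longrightarrow> exec c s u s'' \<Longrightarrow> u = t \<and> s'' = s'"
proof (induction arbitrary: u s'' rule: exec.induct)
  case (Skip s)
  then show ?case by (auto elim: exec.cases)
next
  case (NAssign x e f s)
  then show ?case by (auto elim: exec.cases)
next
  case (RAssign x e f s)
  then show ?case by (auto elim: exec.cases)
next
  case (Seq c1 s t1 s1 c2 t2 s2)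
  from Seq.prems obtain u1 u2 r where "exec c1 s u1 r" "exec c2 r u2 s''" "u = u1 + u2"
    by (auto elim: exec.cases)
  with Seq.IH show ?case by blast
next
  case (CondTrue b s c1 t s' c2)
  from CondTrue.prems CondTrue.hyps obtain v where "exec c1 s v s''" "u = 1 + btime b + v"
    by (auto elim: exec.cases)
  with CondTrue.IH show ?case by blast
next
  case (CondFalse b s c2 t s' c1)
  from CondFalse.prems CondFalse.hyps obtain v where "exec c2 s v s''" "u = 1 + btime b + v"
    by (auto elim: exec.cases)
  with CondFalse.IH show ?case by blast
next
  case (WhileFalse b s c)
  then show ?case by (auto elim: exec.cases)
next
  case (WhileTrue b s c t1 s1 t2 s2)
  from WhileTrue.prems WhileTrue.hyps obtain u1 u2 r
    where "exec c s u1 r" "exec (While b c) r u2 s''" "u = 1 + btime b + u1 + u2"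
    by (cases rule: exec.cases) auto
  with WhileTrue.IH show ?case by blast
qed


section \<open>Input and output encoding\<close>

text \<open>
  The input points are enumerated as \<open>P 0, \<dots>, P (n - 1)\<close>; their coordinates are stored row by
  row. All memory not occupied by the input is zero.
\<close>

definition input :: "nat \<Rightarrow> nat \<Rightarrow> nat \<Rightarrow> (nat \<Rightarrow> point) \<Rightarrow> (point \<Rightarrow> nat) \<Rightarrow> state" where
  "input n d l P col =
    \<lparr>nmem = (\<lambda>x i.
        if x = ''n'' \<and> i = 0 then n
        else if x = ''d'' \<and> i = 0 then d
        else if x = ''l'' \<and> i = 0 then l
        else if x = ''color'' \<and> i < n then col (P i)
        else 0),
     rmem = (\<lambda>x i.
        if x = ''point'' \<and> i < n * d then P (i div d) (i mod d)
        else 0)\<rparr>"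

text \<open>
  A program outputs a cluster number for every point and a center for every cluster number below
  \<open>k\<close>. Numbers that are not used do not contribute a cluster.
\<close>

definition output_cluster :: "state \<Rightarrow> nat \<Rightarrow> (nat \<Rightarrow> point) \<Rightarrow> nat \<Rightarrow> point set" where
  "output_cluster s n P j = P ` {i. i < n \<and> nmem s ''cluster'' i = j}"

definition output_center :: "state \<Rightarrow> nat \<Rightarrow> nat \<Rightarrow> point" where
  "output_center s d j = (\<lambda>i. if i < d then rmem s ''center'' (j * d + i) else 0)"

definition outputs ::
  "state \<Rightarrow> nat \<Rightarrow> nat \<Rightarrow> nat \<Rightarrow> (nat \<Rightarrow> point) \<Rightarrow> point set set \<Rightarrow> (point set \<Rightarrow> point) \<Rightarrow> bool"
where
  "outputs s n d k P \<C> \<mu> \<longleftrightarrow>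
     \<C> = output_cluster s n P ` {..<k} - {{}} \<and>
     (\<forall>j<k. output_cluster s n P j \<noteq> {} \<longrightarrow>
        \<mu> (output_cluster s n P j) = output_center s d j)"

text \<open>
  The time bound \<open>T n d\<close> is required for all inputs, and in particular for all dimensions, numbers
  of colors and enumerations of the input set, with the same program.
\<close>

definition solves_within ::
  "com \<Rightarrow> objective \<Rightarrow> real \<Rightarrow> nat \<Rightarrow> (nat \<Rightarrow> nat \<Rightarrow> real) \<Rightarrow> bool"
where
  "solves_within prog obj \<alpha> k T \<longleftrightarrow>
     (\<forall>d l A col P. d \<ge> 1 \<longrightarrow> A \<subseteq> euclid d \<longrightarrow> finite A \<longrightarrow> A \<noteq> {} \<longrightarrow>
        balanced_coloring l col A \<longrightarrow> bij_betw P {..<card A} A \<longrightarrow>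
        (\<exists>t s \<C> \<mu>. exec prog (input (card A) d l P col) t s \<and>
           real t \<le> T (card A) d \<and>
           outputs s (card A) d k P \<C> \<mu> \<and>
           approximation obj \<alpha> d k l col A \<C> \<mu>))"

end

theory Submission imports Defs begin

text \<open>
  For \<open>\<epsilon> < 883\<close>, exhaustive search: some average of \<open>O(1/\<epsilon>\<^sup>2)\<close> input points (with repetition) is a
  \<open>(1 + \<epsilon>)\<close>-approximate center of an optimal cluster, and for fixed centers and cluster sizes an
  optimal assignment of a color class is given by one threshold point for each pair of centers. Since
  fairness only says that all colors have the same cluster sizes, the colors can be treated one by
  one once the sizes are guessed.

  For \<open>\<epsilon> \<ge> 883\<close> the exponent \<open>poly(k/\<epsilon>)\<close> may stay bounded while \<open>k\<close> grows, so a constant factor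
  has to be reached in time \<open>f(k) n\<^sup>O\<^sup>(\<^sup>1\<^sup>)\<close>. A greedily chosen pool of \<open>O(k log n)\<close> input points
  contains good centers; some color, assigned to nearest centers, provides good cluster sizes; and a
  transportation plan with forest support is reproduced by \<open>2 k\<close> greedy moves between clusters.
\<close>

section \<open>A language of bounded loops\<close>

text \<open>Below 883, both k and 1/eps are at most constant multiples of k/eps, so every polynomial
  in k and 1/eps is an admissible exponent. From 883 on, only O(k) guesses from ranges of size O(k
  log n) are affordable, besides a few loops over n, because (log n)^O(k) is at most f(k) n. The
  threshold comes from 884 = 34 * 26: centers taken from the pool lose a factor 26, and giving all
  colors the same cluster sizes loses a factor 34. Both are that large because one argument serves
  all three objectives, and squared distances obey the triangle inequality only up to a factor 2.
  Both algorithms are instances of the same search, which keeps only assignments that it has checked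
  and whose cost it has computed. Wrong guesses are therefore harmless, and completeness asks for
  one good value of each guess. Loops whose limits are fixed beforehand have a denotation and a
  compositional time bound, so the operational semantics enters only through one simulation
  lemma.\<close>

datatype lp =
    LSkip
  | LN string nexp nexp
  | LR string nexp rexp
  | LSeq lp lp  (infixr ";;" 60)
  | LIf bexp lp lp
  | LFor string nat nexp lp

primrec den :: "lp \<Rightarrow> state \<Rightarrow> state" where
  "den LSkip = (\<lambda>s. s)"
| "den (LN x e f) = (\<lambda>s. nwrite x (nval e s) (nval f s) s)"
| "den (LR x e f) = (\<lambda>s. rwrite x (nval e s) (rval f s) s)"
| "den (c ;; c') = (\<lambda>s. den c' (den c s))"
| "den (LIf b c c') = (\<lambda>s. if bval b s then den c s else den c' s)"
| "den (LFor x i e c) = (\<lambda>s. fold (\<lambda>j s. den c (nwrite x i j s)) [0..<nval e s] s)"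

text \<open>Loop counters and limits live in the array \<^term>\<open>''#''\<close>, two cells per nesting level.\<close>

primrec compile :: "nat \<Rightarrow> lp \<Rightarrow> com" where
  "compile \<delta> LSkip = Skip"
| "compile \<delta> (LN x e f) = NAssign x e f"
| "compile \<delta> (LR x e f) = RAssign x e f"
| "compile \<delta> (c ;; c') = Seq (compile \<delta> c) (compile \<delta> c')"
| "compile \<delta> (LIf b c c') = Cond b (compile \<delta> c) (compile \<delta> c')"
| "compile \<delta> (LFor x i e c) =
     (let ctr = NRead ''#'' (NConst (2 * \<delta>)); lim = NRead ''#'' (NConst (2 * \<delta> + 1)) in
      Seq (NAssign ''#'' (NConst (2 * \<delta>)) (NConst 0))
       (Seq (NAssign ''#'' (NConst (2 * \<delta> + 1)) e)
         (While (NLess ctr lim)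
           (Seq (NAssign x (NConst i) ctr)
             (Seq (compile (Suc \<delta>) c)
               (NAssign ''#'' (NConst (2 * \<delta>)) (NPlus ctr (NConst 1))))))))"

section \<open>Variables, write sets and loop limits\<close>

primrec nvars :: "nexp \<Rightarrow> string set" where
  "nvars (NConst c) = {}"
| "nvars (NRead x e) = insert x (nvars e)"
| "nvars (NPlus e f) = nvars e \<union> nvars f"
| "nvars (NMinus e f) = nvars e \<union> nvars f"

primrec rvars :: "rexp \<Rightarrow> string set" where
  "rvars (RConst c) = {}"
| "rvars (RRead x e) = nvars e"
| "rvars (RPlus e f) = rvars e \<union> rvars f"
| "rvars (RMinus e f) = rvars e \<union> rvars f"
| "rvars (RTimes e f) = rvars e \<union> rvars f"
| "rvars (RDivide e f) = rvars e \<union> rvars f"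
| "rvars (RSqrt e) = rvars e"

primrec bvars :: "bexp \<Rightarrow> string set" where
  "bvars (NLess e f) = nvars e \<union> nvars f"
| "bvars (RLess e f) = rvars e \<union> rvars f"
| "bvars (BNot b) = bvars b"
| "bvars (BAnd b c) = bvars b \<union> bvars c"

primrec vars :: "lp \<Rightarrow> string set" where
  "vars LSkip = {}"
| "vars (LN x e f) = insert x (nvars e \<union> nvars f)"
| "vars (LR x e f) = nvars e \<union> rvars f"
| "vars (c ;; c') = vars c \<union> vars c'"
| "vars (LIf b c c') = bvars b \<union> vars c \<union> vars c'"
| "vars (LFor x i e c) = insert x (nvars e \<union> vars c)"

primrec nw :: "lp \<Rightarrow> string set" where
  "nw LSkip = {}"
| "nw (LN x e f) = {x}"
| "nw (LR x e f) = {}"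
| "nw (c ;; c') = nw c \<union> nw c'"
| "nw (LIf b c c') = nw c \<union> nw c'"
| "nw (LFor x i e c) = insert x (nw c)"

primrec rw :: "lp \<Rightarrow> string set" where
  "rw LSkip = {}"
| "rw (LN x e f) = {}"
| "rw (LR x e f) = {x}"
| "rw (c ;; c') = rw c \<union> rw c'"
| "rw (LIf b c c') = rw c \<union> rw c'"
| "rw (LFor x i e c) = rw c"

primrec bounds :: "lp \<Rightarrow> nexp set" where
  "bounds LSkip = {}"
| "bounds (LN x e f) = {}"
| "bounds (LR x e f) = {}"
| "bounds (c ;; c') = bounds c \<union> bounds c'"
| "bounds (LIf b c c') = bounds c \<union> bounds c'"
| "bounds (LFor x i e c) = insert e (bounds c)"

lemma nmem_nwrite [simp]:
  "nmem (nwrite x i v s) y = (if y = x then (nmem s x)(i := v) else nmem s y)"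
  and rmem_nwrite [simp]: "rmem (nwrite x i v s) = rmem s"
  and rmem_rwrite [simp]:
  "rmem (rwrite x i r s) y = (if y = x then (rmem s x)(i := r) else rmem s y)"
  and nmem_rwrite [simp]: "nmem (rwrite x i r s) = nmem s"
  by auto

declare nwrite.simps [simp del] rwrite.simps [simp del]

text \<open>The frame condition behind all claims that a program leaves something alone. Two sets
  are needed because the memories of naturals and of reals have separate name spaces.\<close>

definition agree :: "string set \<Rightarrow> string set \<Rightarrow> state \<Rightarrow> state \<Rightarrow> bool" where
  "agree A B s s' \<longleftrightarrow> (\<forall>y. y \<notin> A \<longrightarrow> nmem s' y = nmem s y) \<and> (\<forall>y. y \<notin> B \<longrightarrow> rmem s' y = rmem s y)"

lemma agree_refl [simp]: "agree A B s s"
  by (simp add: agree_def)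

lemma agree_trans: "agree A B s s' \<Longrightarrow> agree A B s' s'' \<Longrightarrow> agree A B s s''"
  by (simp add: agree_def)

lemma agree_mono: "agree A B s s' \<Longrightarrow> A \<subseteq> A' \<Longrightarrow> B \<subseteq> B' \<Longrightarrow> agree A' B' s s'"
  by (auto simp: agree_def)

lemma agree_nmem: "agree A B s s' \<Longrightarrow> y \<notin> A \<Longrightarrow> nmem s' y = nmem s y"
  and agree_rmem: "agree A B s s' \<Longrightarrow> y \<notin> B \<Longrightarrow> rmem s' y = rmem s y"
  by (auto simp: agree_def)

lemma fold_upt_invariant:
  assumes "I 0 s" "\<And>j s'. j < N \<Longrightarrow> I j s' \<Longrightarrow> I (Suc j) (f j s')"
  shows "I N (fold f [0..<N] s)"
proof -
  have "M \<le> N \<Longrightarrow> I M (fold f [0..<M] s)" for M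
    by (induction M) (use assms in auto)
  then show ?thesis by simp
qed

lemma den_agree: "agree (nw c) (rw c) s (den c s)"
proof (induction c arbitrary: s)
  case (LSeq c1 c2)
  have "agree (nw c1 \<union> nw c2) (rw c1 \<union> rw c2) s (den c1 s)"
    using LSeq.IH(1)[of s] by (rule agree_mono) auto
  moreover have "agree (nw c1 \<union> nw c2) (rw c1 \<union> rw c2) (den c1 s) (den c2 (den c1 s))"
    using LSeq.IH(2) by (rule agree_mono) auto
  ultimately show ?case by (auto intro: agree_trans)
next
  case (LIf b c1 c2)
  show ?case
    using agree_mono[OF LIf.IH(1)[of s], of "nw (LIf b c1 c2)" "rw (LIf b c1 c2)"]
      agree_mono[OF LIf.IH(2)[of s], of "nw (LIf b c1 c2)" "rw (LIf b c1 c2)"] by auto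
next
  case (LFor x i e c)
  have "agree (nw (LFor x i e c)) (rw (LFor x i e c)) s
      (fold (\<lambda>j s. den c (nwrite x i j s)) [0..<nval e s] s)"
  proof (rule fold_upt_invariant)
    fix j s' assume "agree (nw (LFor x i e c)) (rw (LFor x i e c)) s s'"
    moreover have "agree (nw (LFor x i e c)) (rw (LFor x i e c)) s' (nwrite x i j s')"
      by (simp add: agree_def)
    moreover have "agree (nw (LFor x i e c)) (rw (LFor x i e c)) (nwrite x i j s')
        (den c (nwrite x i j s'))"
      using LFor.IH[of "nwrite x i j s'"] by (rule agree_mono) auto
    ultimately show "agree (nw (LFor x i e c)) (rw (LFor x i e c)) s (den c (nwrite x i j s'))"
      by (blast intro: agree_trans)
  qed simp
  then show ?case by simp
qed (auto simp: agree_def)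

lemma nmem_den: "y \<notin> nw c \<Longrightarrow> nmem (den c s) y = nmem s y"
  and rmem_den: "y \<notin> rw c \<Longrightarrow> rmem (den c s) y = rmem s y"
  using den_agree[of c s] by (auto simp: agree_def)

text \<open>The frame condition of the loop is available in every round, so the invariants of later
  loops mention only what the body changes.\<close>

lemma den_For:
  assumes "I 0 s" and "nval e s = N"
    and "\<And>j s'. j < N \<Longrightarrow> agree (insert x (nw c)) (rw c) s s' \<Longrightarrow> I j s' \<Longrightarrow>
      I (Suc j) (den c (nwrite x i j s'))"
  shows "I N (den (LFor x i e c) s)"
proof -
  have "(agree (insert x (nw c)) (rw c) s (fold (\<lambda>j s. den c (nwrite x i j s)) [0..<N] s)) \<and>
      I N (fold (\<lambda>j s. den c (nwrite x i j s)) [0..<N] s)"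
  proof (rule fold_upt_invariant)
    fix j s' assume j: "j < N" and s': "agree (insert x (nw c)) (rw c) s s' \<and> I j s'"
    have "agree (insert x (nw c)) (rw c) s' (nwrite x i j s')"
      by (simp add: agree_def)
    moreover have "agree (insert x (nw c)) (rw c) (nwrite x i j s') (den c (nwrite x i j s'))"
      using den_agree by (rule agree_mono) auto
    ultimately show "agree (insert x (nw c)) (rw c) s (den c (nwrite x i j s')) \<and>
        I (Suc j) (den c (nwrite x i j s'))"
      using s' assms(3)[OF j] by (blast intro: agree_trans)
  qed (use assms in auto)
  then show ?thesis using assms(2) by simp
qed

lemma nval_cong: "(\<And>y. y \<in> nvars e \<Longrightarrow> nmem s y = nmem s' y) \<Longrightarrow> nval e s = nval e s'"
  by (induction e) auto

lemma rval_cong: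
  "(\<And>y. y \<in> rvars e \<Longrightarrow> nmem s y = nmem s' y) \<Longrightarrow> rmem s = rmem s' \<Longrightarrow> rval e s = rval e s'"
  by (induction e) (auto intro: arg_cong[OF nval_cong])

lemma bval_cong:
  "(\<And>y. y \<in> bvars b \<Longrightarrow> nmem s y = nmem s' y) \<Longrightarrow> rmem s = rmem s' \<Longrightarrow> bval b s = bval b s'"
proof (induction b)
  case (NLess e f)
  then show ?case using nval_cong[of e s s'] nval_cong[of f s s'] by auto
next
  case (RLess e f)
  then show ?case using rval_cong[of e s s'] rval_cong[of f s s'] by auto
qed auto

lemma agree_hash_nval: "agree {''#''} {} s r \<Longrightarrow> ''#'' \<notin> nvars e \<Longrightarrow> nval e r = nval e s"
  and agree_hash_rval: "agree {''#''} {} s r \<Longrightarrow> ''#'' \<notin> rvars f \<Longrightarrow> rval f r = rval f s"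
  and agree_hash_bval: "agree {''#''} {} s r \<Longrightarrow> ''#'' \<notin> bvars b \<Longrightarrow> bval b r = bval b s"
proof -
  assume a: "agree {''#''} {} s r"
  have m: "nmem r y = nmem s y" if "y \<noteq> ''#''" for y using a that by (simp add: agree_def)
  have r: "rmem r = rmem s" using a by (auto simp: agree_def)
  show "''#'' \<notin> nvars e \<Longrightarrow> nval e r = nval e s" by (rule nval_cong) (metis m)
  show "''#'' \<notin> rvars f \<Longrightarrow> rval f r = rval f s" by (rule rval_cong) (metis m, rule r)
  show "''#'' \<notin> bvars b \<Longrightarrow> bval b r = bval b s" by (rule bval_cong) (metis m, rule r)
qed

text \<open>The loop bounds are evaluated in the initial state: this bounds the running time of programs
  that do not write the variables occurring in loop bounds.\<close>

primrec tb :: "lp \<Rightarrow> state \<Rightarrow> nat" where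
  "tb LSkip = (\<lambda>s. 1)"
| "tb (LN x e f) = (\<lambda>s. 1 + ntime e + ntime f)"
| "tb (LR x e f) = (\<lambda>s. 1 + ntime e + rtime f)"
| "tb (c ;; c') = (\<lambda>s. tb c s + tb c' s)"
| "tb (LIf b c c') = (\<lambda>s. 1 + btime b + tb c s + tb c' s)"
| "tb (LFor x i e c) = (\<lambda>s. nval e s * (tb c s + 16) + 11 + ntime e)"

text \<open>The state enters \<open>tb\<close> only through loop limits. Hence the bounds of
  consecutive parts may all be taken in the initial state and added, provided that no part writes a
  variable of a limit.\<close>

lemma tb_cong:
  "(\<And>e y. e \<in> bounds c \<Longrightarrow> y \<in> nvars e \<Longrightarrow> nmem s y = nmem s' y) \<Longrightarrow> tb c s = tb c s'"
proof (induction c)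
  case (LFor x i e c)
  have "nval e s = nval e s'" using LFor.prems by (intro nval_cong) auto
  moreover have "tb c s = tb c s'" using LFor by auto
  ultimately show ?case by simp
next
  case (LSeq c1 c2)
  then show ?case by (metis UnCI bounds.simps(4) tb.simps(4))
next
  case (LIf b c1 c2)
  then show ?case by (metis UnCI bounds.simps(5) tb.simps(5))
qed auto

text \<open>The cells below \<open>2 * \<delta>\<close> hold the counters and limits of the
  enclosing loops, which code at nesting level \<open>\<delta>\<close> must preserve.\<close>

definition hidden :: "nat \<Rightarrow> state \<Rightarrow> state \<Rightarrow> bool" where
  "hidden \<delta> r s \<longleftrightarrow> (\<forall>i<2*\<delta>. nmem s ''#'' i = nmem r ''#'' i)"

text \<open>Simulation up to the array of loop counters. \<open>M\<close> stands for all that the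
  surrounding program writes: the limits of a part must avoid this larger set, not only the writes
  of the part itself, and the induction passes \<open>M\<close> on unchanged.\<close>

lemma exec_compile:
  assumes "''#'' \<notin> vars c" "agree {''#''} {} s r"
    and "nw c \<subseteq> M" "\<And>e. e \<in> bounds c \<Longrightarrow> nvars e \<inter> M = {}"
  shows "\<exists>t r'. exec (compile \<delta> c) r t r' \<and> agree {''#''} {} (den c s) r' \<and> hidden \<delta> r r' \<and> t \<le> tb c s"
  using assms
proof (induction c arbitrary: s r \<delta>)
  case LSkip
  show ?case using exec.Skip LSkip(2) by (auto simp: hidden_def)
next
  case (LN x e f)
  have "nval e r = nval e s" "nval f r = nval f s"
    using LN by (auto intro!: agree_hash_nval)
  then have "exec (compile \<delta> (LN x e f)) r (tb (LN x e f) s) (nwrite x (nval e s) (nval f s) r)"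
    using exec.NAssign[of x e f r] by simp
  moreover have "agree {''#''} {} (den (LN x e f) s) (nwrite x (nval e s) (nval f s) r)"
    "hidden \<delta> r (nwrite x (nval e s) (nval f s) r)"
    using LN(1,2) by (auto simp: hidden_def agree_def)
  ultimately show ?case by blast
next
  case (LR x e f)
  have "nval e r = nval e s" using LR by (auto intro!: agree_hash_nval)
  moreover have "rval f r = rval f s" using LR by (auto intro!: agree_hash_rval)
  ultimately have "exec (compile \<delta> (LR x e f)) r (tb (LR x e f) s) (rwrite x (nval e s) (rval f s) r)"
    using exec.RAssign[of x e f r] by simp
  moreover have "agree {''#''} {} (den (LR x e f) s) (rwrite x (nval e s) (rval f s) r)"
    "hidden \<delta> r (rwrite x (nval e s) (rval f s) r)"
    using LR(1,2) by (auto simp: hidden_def agree_def)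
  ultimately show ?case by blast
next
  case (LSeq c1 c2)
  have b: "nw c1 \<subseteq> M" "nw c2 \<subseteq> M" "''#'' \<notin> vars c1" "''#'' \<notin> vars c2"
    "\<And>e. e \<in> bounds c1 \<Longrightarrow> nvars e \<inter> M = {}" "\<And>e. e \<in> bounds c2 \<Longrightarrow> nvars e \<inter> M = {}"
    using LSeq.prems by auto
  obtain t1 r1 where 1: "exec (compile \<delta> c1) r t1 r1" "agree {''#''} {} (den c1 s) r1"
      "hidden \<delta> r r1" "t1 \<le> tb c1 s"
    using LSeq.IH(1)[OF b(3) LSeq.prems(2) b(1) b(5)] by blast
  obtain t2 r2 where 2: "exec (compile \<delta> c2) r1 t2 r2"
      "agree {''#''} {} (den c2 (den c1 s)) r2" "hidden \<delta> r1 r2" "t2 \<le> tb c2 (den c1 s)"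
    using LSeq.IH(2)[OF b(4) 1(2) b(2) b(6)] by blast
  have "tb c2 (den c1 s) = tb c2 s"
    using b(1,6) by (intro tb_cong nmem_den) auto
  then show ?case using exec.Seq[OF 1(1) 2(1)] 1 2
    by (auto simp: hidden_def intro!: exI[of _ "t1 + t2"] exI[of _ r2])
next
  case (LIf b c1 c2)
  have b: "nw c1 \<subseteq> M" "nw c2 \<subseteq> M" "''#'' \<notin> vars c1" "''#'' \<notin> vars c2"
    "\<And>e. e \<in> bounds c1 \<Longrightarrow> nvars e \<inter> M = {}" "\<And>e. e \<in> bounds c2 \<Longrightarrow> nvars e \<inter> M = {}"
    using LIf.prems by auto
  have bv: "bval b r = bval b s" using LIf.prems by (auto intro!: agree_hash_bval)
  show ?case
  proof (cases "bval b s")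
    case True
    obtain t1 r1 where 1: "exec (compile \<delta> c1) r t1 r1" "agree {''#''} {} (den c1 s) r1"
        "hidden \<delta> r r1" "t1 \<le> tb c1 s"
      using LIf.IH(1)[OF b(3) LIf.prems(2) b(1) b(5)] by blast
    then show ?thesis using exec.CondTrue[OF _ 1(1), of b "compile \<delta> c2"] True bv
      by (auto intro!: exI[of _ "1 + btime b + t1"] exI[of _ r1])
  next
    case False
    obtain t1 r1 where 1: "exec (compile \<delta> c2) r t1 r1" "agree {''#''} {} (den c2 s) r1"
        "hidden \<delta> r r1" "t1 \<le> tb c2 s"
      using LIf.IH(2)[OF b(4) LIf.prems(2) b(2) b(6)] by blast
    then show ?thesis using exec.CondFalse[OF _ 1(1), of b "compile \<delta> c1"] False bv
      by (auto intro!: exI[of _ "1 + btime b + t1"] exI[of _ r1])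
  qed
next
  case (LFor x i e c)
  have b: "nw c \<subseteq> M" "x \<in> M" "''#'' \<notin> vars c" "''#'' \<noteq> x" "''#'' \<notin> nvars e"
    "\<And>e. e \<in> bounds c \<Longrightarrow> nvars e \<inter> M = {}"
    using LFor.prems by auto
  let ?ctr = "NRead ''#'' (NConst (2 * \<delta>))" and ?lim = "NRead ''#'' (NConst (2 * \<delta> + 1))"
  let ?inc = "NAssign ''#'' (NConst (2 * \<delta>)) (NPlus ?ctr (NConst 1))"
  let ?body = "Seq (NAssign x (NConst i) ?ctr) (Seq (compile (Suc \<delta>) c) ?inc)"
  let ?it = "\<lambda>j s. den c (nwrite x i j s)"
  let ?N = "nval e s"
  \<comment> \<open>Induction on the number \<open>p\<close> of remaining rounds. A round costs 16
    in addition to its body: 6 for the test, 4 for setting the loop variable and 6 for the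
    increment. The final failing test costs another 6.\<close>
  have while: "\<exists>t r'. exec (While (NLess ?ctr ?lim) ?body) r1 t r' \<and>
      agree {''#''} {} (fold ?it [?N-p..<?N] s1) r' \<and> hidden \<delta> r1 r' \<and> t \<le> p * (tb c s + 16) + 6"
    if "p \<le> ?N" "agree {''#''} {} s1 r1" "nmem r1 ''#'' (2*\<delta>) = ?N - p" "nmem r1 ''#'' (2*\<delta>+1) = ?N"
      "agree M UNIV s s1" for p s1 r1
    using that
  proof (induction p arbitrary: s1 r1)
    case 0
    then show ?case
      using exec.WhileFalse[of "NLess ?ctr ?lim" r1 ?body] by (fastforce simp: hidden_def)
  next
    case (Suc p)
    let ?j = "?N - Suc p"
    let ?s2 = "nwrite x i ?j s1" and ?r2 = "nwrite x i ?j r1"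
    have ctr: "nval ?ctr r1 = ?j" using Suc.prems by simp
    have e1: "exec (NAssign x (NConst i) ?ctr) r1 4 ?r2"
      using exec.NAssign[of x "NConst i" ?ctr r1] Suc.prems(3) by (simp add: eval_nat_numeral)
    have a2: "agree {''#''} {} ?s2 ?r2" using Suc.prems(2) by (auto simp: agree_def)
    obtain t3 r3 where 3: "exec (compile (Suc \<delta>) c) ?r2 t3 r3"
        "agree {''#''} {} (den c ?s2) r3" "hidden (Suc \<delta>) ?r2 r3" "t3 \<le> tb c ?s2"
      using LFor.IH[OF b(3) a2 b(1) b(6)] by blast
    have t3: "tb c ?s2 = tb c s"
    proof (rule tb_cong)
      fix e' y assume "e' \<in> bounds c" "y \<in> nvars e'"
      then have "y \<notin> M" using b(6) by auto
      then show "nmem ?s2 y = nmem s y" using Suc.prems(5) b(2) by (auto simp: agree_def)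
    qed
    have c3: "nmem r3 ''#'' (2*\<delta>) = ?j" "nmem r3 ''#'' (2*\<delta>+1) = ?N"
      using 3(3) Suc.prems b(4) by (auto simp: hidden_def)
    let ?r4 = "nwrite ''#'' (2*\<delta>) (?j + 1) r3"
    have e4: "exec ?inc r3 6 ?r4"
      using exec.NAssign[of "''#''" "NConst (2*\<delta>)" "NPlus ?ctr (NConst 1)" r3] c3 by (simp add: eval_nat_numeral)
    have a4: "agree {''#''} {} (den c ?s2) ?r4" using 3(2) by (auto simp: agree_def)
    have "agree M UNIV ?s2 (den c ?s2)" using agree_mono[OF den_agree b(1)] by blast
    moreover have "agree M UNIV s1 ?s2" using b(2) by (auto simp: agree_def)
    ultimately have "agree M UNIV s1 (den c ?s2)" by (rule agree_trans[rotated])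
    then have a5: "agree M UNIV s (den c ?s2)" using Suc.prems(5) agree_trans by blast
    have j1: "?j + 1 = ?N - p" using Suc.prems(1) by simp
    obtain t5 r5 where 5: "exec (While (NLess ?ctr ?lim) ?body) ?r4 t5 r5"
        "agree {''#''} {} (fold ?it [?N-p..<?N] (den c ?s2)) r5" "hidden \<delta> ?r4 r5"
        "t5 \<le> p * (tb c s + 16) + 6"
      using Suc.IH[OF _ a4 _ _ a5] Suc.prems(1) c3 j1 by (auto simp: Suc_diff_Suc)
    have up: "[?j..<?N] = ?j # [?N-p..<?N]"
      using Suc.prems(1) j1 by (metis Suc_eq_plus1 diff_less upt_conv_Cons zero_less_Suc order_less_le_trans)
    have "exec (While (NLess ?ctr ?lim) ?body) r1 (1 + 5 + (4 + (t3 + 6)) + t5) r5"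
      using exec.WhileTrue[OF _ exec.Seq[OF e1 exec.Seq[OF 3(1) e4]] 5(1)]
        Suc.prems by simp
    moreover have "hidden \<delta> r1 r5"
      using 5(3) 3(3) b(4) by (auto simp: hidden_def)
    moreover have "1 + 5 + (4 + (t3 + 6)) + t5 \<le> Suc p * (tb c s + 16) + 6"
      using 3(4) 5(4) t3 by simp
    moreover have "fold ?it [?N - Suc p..<?N] s1 = fold ?it [?N-p..<?N] (den c ?s2)"
      using up by simp
    ultimately show ?case using 5(2)
      by (intro exI[of _ "1 + 5 + (4 + (t3 + 6)) + t5"] exI[of _ r5]) (simp only: simp_thms)
  qed
  let ?ra = "nwrite ''#'' (2*\<delta>) 0 r"
  let ?rb = "nwrite ''#'' (2*\<delta>+1) ?N ?ra"
  have N: "nval e ?ra = ?N"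
    using b(5) LFor.prems(2) by (intro agree_hash_nval) (auto simp: agree_def)
  have ea: "exec (NAssign ''#'' (NConst (2*\<delta>)) (NConst 0)) r 3 ?ra"
    using exec.NAssign[of "''#''" "NConst (2*\<delta>)" "NConst 0" r] by (simp add: eval_nat_numeral)
  have eb: "exec (NAssign ''#'' (NConst (2*\<delta>+1)) e) ?ra (2 + ntime e) ?rb"
    using exec.NAssign[of "''#''" "NConst (2*\<delta>+1)" e ?ra] N by simp
  have "agree {''#''} {} s ?rb" using LFor.prems(2) by (auto simp: agree_def)
  then obtain t r' where w: "exec (While (NLess ?ctr ?lim) ?body) ?rb t r'"
      "agree {''#''} {} (fold ?it [0..<?N] s) r'" "hidden \<delta> ?rb r'" "t \<le> ?N * (tb c s + 16) + 6"
    using while[of ?N s ?rb] by auto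
  have "hidden \<delta> r r'" using w(3) by (auto simp: hidden_def)
  then show ?case
    using exec.Seq[OF ea exec.Seq[OF eb w(1)]] w
    by (auto simp: Let_def intro!: exI[of _ "3 + (2 + ntime e + t)"] exI[of _ r'])
qed

section \<open>Polynomial bounds on the running time\<close>

primrec cst :: "lp \<Rightarrow> nat" where
  "cst LSkip = 1"
| "cst (LN x e f) = 1 + ntime e + ntime f"
| "cst (LR x e f) = 1 + ntime e + rtime f"
| "cst (c ;; c') = cst c + cst c'"
| "cst (LIf b c c') = 1 + btime b + cst c + cst c'"
| "cst (LFor x i e c) = cst c + 27 + ntime e"

primrec depth :: "(nexp \<Rightarrow> bool) \<Rightarrow> lp \<Rightarrow> nat" where
  "depth Q LSkip = 0"
| "depth Q (LN x e f) = 0"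
| "depth Q (LR x e f) = 0"
| "depth Q (c ;; c') = max (depth Q c) (depth Q c')"
| "depth Q (LIf b c c') = max (depth Q c) (depth Q c')"
| "depth Q (LFor x i e c) = (if Q e then 1 else 0) + depth Q c"

text \<open>Loops over coordinates are counted apart, because the time has to be linear in the
  dimension while \<open>n\<close> may get a large exponent.\<close>

definition is_dim :: "nexp \<Rightarrow> bool" where
  "is_dim e \<longleftrightarrow> e = NRead ''d'' (NConst 0)"

text \<open>Nested loops multiply their limits, so each class of limits contributes a power given by
  its nesting depth. The class \<open>Q\<close> has its own base because the guesses of the greedy
  algorithm run over small ranges and are nested about \<open>5 * k\<close> deep, which would be too
  much for the base \<open>X\<close>.\<close>

lemma tb_le:
  assumes "\<And>e. e \<in> bounds c \<Longrightarrow> is_dim e \<Longrightarrow> nval e s \<le> D"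
    and "\<And>e. e \<in> bounds c \<Longrightarrow> Q e \<Longrightarrow> \<not> is_dim e \<Longrightarrow> nval e s \<le> Y"
    and "\<And>e. e \<in> bounds c \<Longrightarrow> \<not> Q e \<Longrightarrow> \<not> is_dim e \<Longrightarrow> nval e s \<le> X"
    and pos: "D \<ge> 1" "X \<ge> 1" "Y \<ge> 1"
  shows "tb c s \<le> cst c * (D ^ depth is_dim c * X ^ depth (\<lambda>e. \<not> Q e \<and> \<not> is_dim e) c *
    Y ^ depth (\<lambda>e. Q e \<and> \<not> is_dim e) c)"
  using assms(1-3)
proof (induction c)
  case (LSeq c1 c2)
  let ?B = "\<lambda>c. D ^ depth is_dim c * X ^ depth (\<lambda>e. \<not> Q e \<and> \<not> is_dim e) c *
    Y ^ depth (\<lambda>e. Q e \<and> \<not> is_dim e) c"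
  have m: "?B c1 \<le> ?B (c1 ;; c2)" "?B c2 \<le> ?B (c1 ;; c2)"
    using pos by (auto intro!: mult_mono power_increasing)
  have "tb c1 s \<le> cst c1 * ?B c1" "tb c2 s \<le> cst c2 * ?B c2" using LSeq by auto
  then have "tb c1 s \<le> cst c1 * ?B (c1 ;; c2)" "tb c2 s \<le> cst c2 * ?B (c1 ;; c2)"
    using m by (meson mult_le_mono2 le_trans)+
  then show ?case by (simp add: distrib_right)
next
  case (LIf b c1 c2)
  let ?B = "\<lambda>c. D ^ depth is_dim c * X ^ depth (\<lambda>e. \<not> Q e \<and> \<not> is_dim e) c *
    Y ^ depth (\<lambda>e. Q e \<and> \<not> is_dim e) c"
  let ?c = "LIf b c1 c2"
  have m: "?B c1 \<le> ?B ?c" "?B c2 \<le> ?B ?c"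
    using pos by (auto intro!: mult_mono power_increasing)
  have "tb c1 s \<le> cst c1 * ?B c1" "tb c2 s \<le> cst c2 * ?B c2" using LIf by auto
  then have "tb c1 s \<le> cst c1 * ?B ?c" "tb c2 s \<le> cst c2 * ?B ?c"
    using m by (meson mult_le_mono2 le_trans)+
  moreover have "1 \<le> ?B ?c" using pos by (auto simp: Suc_le_eq)
  then have "(1 + btime b) * 1 \<le> (1 + btime b) * ?B ?c" by (rule mult_le_mono2)
  ultimately have "tb ?c s \<le> (1 + btime b) * ?B ?c + cst c1 * ?B ?c + cst c2 * ?B ?c"
    unfolding tb.simps mult_1_right by linarith
  then show ?case by (simp only: cst.simps distrib_right)
next
  case (LFor x i e c)
  let ?B = "\<lambda>c. D ^ depth is_dim c * X ^ depth (\<lambda>e. \<not> Q e \<and> \<not> is_dim e) c *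
    Y ^ depth (\<lambda>e. Q e \<and> \<not> is_dim e) c"
  let ?c = "LFor x i e c"
  have 1: "tb c s \<le> cst c * ?B c" using LFor by auto
  have p: "1 \<le> ?B c" "1 \<le> ?B ?c" using pos by (auto simp: Suc_le_eq)
  have e: "nval e s * ?B c \<le> ?B ?c"
    using LFor.prems by (auto simp: algebra_simps)
  have "tb c s + 16 \<le> (cst c + 16) * ?B c" 
    using 1 mult_le_mono2[OF p(1), of 16] unfolding distrib_right mult_1_right by linarith
  then have "nval e s * (tb c s + 16) \<le> nval e s * ((cst c + 16) * ?B c)" by simp
  also have "\<dots> = (cst c + 16) * (nval e s * ?B c)" by simp
  also have "\<dots> \<le> (cst c + 16) * ?B ?c" using e by simp
  finally have "tb ?c s \<le> (cst c + 16) * ?B ?c + (11 + ntime e) * 1" by simp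
  also have "\<dots> \<le> (cst c + 16) * ?B ?c + (11 + ntime e) * ?B ?c"
    using p(2) by (meson add_left_mono mult_le_mono2)
  also have "\<dots> = cst ?c * ?B ?c" unfolding distrib_right[symmetric] by simp
  finally show ?case .
next
  case (LN x e f)
  then show ?case by simp
qed simp_all

text \<open>Nested loops that run through all digit vectors stored in the first \<open>j\<close> cells of \<open>x\<close>.\<close>

primrec nest :: "nat \<Rightarrow> string \<Rightarrow> nexp \<Rightarrow> lp \<Rightarrow> lp" where
  "nest 0 x e c = c"
| "nest (Suc j) x e c = LFor x j e (nest j x e c)"

lemma nw_nest: "nw (nest j x e c) = (if j = 0 then {} else {x}) \<union> nw c"
  and rw_nest [simp]: "rw (nest j x e c) = rw c"
  and vars_nest: "vars (nest j x e c) = (if j = 0 then {} else insert x (nvars e)) \<union> vars c"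
  and bounds_nest: "bounds (nest j x e c) = (if j = 0 then {} else {e}) \<union> bounds c"
  and depth_nest: "depth Q (nest j x e c) = (if Q e then j else 0) + depth Q c"
  by (induction j) auto

text \<open>The rule of exhaustive search. \<open>G g\<close> is whatever the visit of digit vector
  \<open>g\<close> achieves; since no later step destroys it, it holds at the end for every
  \<open>g\<close> within range.\<close>

lemma nest_search:
  assumes "Inv s" "\<And>s. Inv s \<Longrightarrow> nval e s = N"
    and upd: "\<And>s i v. Inv s \<Longrightarrow> Inv (nwrite x i v s)"
    and body: "\<And>s. Inv s \<Longrightarrow> Inv (den c s)"
    and keepw: "\<And>s i v g. Inv s \<Longrightarrow> G g s \<Longrightarrow> G g (nwrite x i v s)"
    and keep: "\<And>s g. Inv s \<Longrightarrow> G g s \<Longrightarrow> G g (den c s)"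
    and est: "\<And>s g. Inv s \<Longrightarrow> (\<And>i. i < J \<Longrightarrow> nmem s x i = g i) \<Longrightarrow> G g (den c s)"
    and untouched: "x \<notin> nw c"
  shows "Inv (den (nest J x e c) s) \<and> (\<forall>g. (\<forall>i<J. g i < N) \<longrightarrow> G g (den (nest J x e c) s))"
proof -
  \<comment> \<open>Generalized to the \<open>j\<close> inner loops: the cells from \<open>j\<close>
    on belong to the outer loops, stay fixed, and are assumed to hold the digits of \<open>g\<close>
    already.\<close>
  have "Inv (den (nest j x e c) s) \<and> (\<forall>g. G g s \<longrightarrow> G g (den (nest j x e c) s)) \<and>
      (\<forall>i\<ge>j. nmem (den (nest j x e c) s) x i = nmem s x i) \<and>
      (\<forall>g. (\<forall>i<j. g i < N) \<longrightarrow> (\<forall>i. j \<le> i \<longrightarrow> i < J \<longrightarrow> nmem s x i = g i) \<longrightarrow>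
        G g (den (nest j x e c) s))" if "Inv s" for j s
    using that
  proof (induction j arbitrary: s)
    case 0
    then show ?case using body keep est untouched by (auto simp: nmem_den)
  next
    case (Suc j)
    note IH = Suc.IH
    let ?f = "\<lambda>v s. den (nest j x e c) (nwrite x j v s)"
    let ?I = "\<lambda>M s'. Inv s' \<and> (\<forall>g. G g s \<longrightarrow> G g s') \<and> (\<forall>i\<ge>Suc j. nmem s' x i = nmem s x i) \<and>
      (\<forall>g. (\<forall>i<Suc j. g i < N) \<longrightarrow> g j < M \<longrightarrow> (\<forall>i. Suc j \<le> i \<longrightarrow> i < J \<longrightarrow> nmem s x i = g i) \<longrightarrow> G g s')"
    have "?I N (fold ?f [0..<N] s)"
    proof (rule fold_upt_invariant[where I = ?I])
      show "?I 0 s" using Suc.prems by simp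
    next
      fix M s' assume M: "M < N" and I: "?I M s'"
      have W: "Inv (nwrite x j M s')" using I upd by blast
      have 1: "Inv (?f M s')" "\<And>g. G g (nwrite x j M s') \<Longrightarrow> G g (?f M s')"
        "\<And>i. i \<ge> j \<Longrightarrow> nmem (?f M s') x i = nmem (nwrite x j M s') x i"
        "\<And>g. (\<forall>i<j. g i < N) \<Longrightarrow> (\<And>i. j \<le> i \<Longrightarrow> i < J \<Longrightarrow> nmem (nwrite x j M s') x i = g i) \<Longrightarrow>
          G g (?f M s')"
        using IH[OF W] by blast+
      have "G g (?f M s')" if g: "\<forall>i<Suc j. g i < N" "g j < Suc M"
        "\<forall>i. Suc j \<le> i \<longrightarrow> i < J \<longrightarrow> nmem s x i = g i" for g
      proof (cases "g j = M")
        case True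
        show ?thesis
        proof (rule 1(4))
          fix i assume i: "j \<le> i" "i < J"
          show "nmem (nwrite x j M s') x i = g i"
            using True g(3) I i by (cases "i = j") auto
        qed (use g in auto)
      next
        case False
        then have "G g s'" using I g by auto
        then show ?thesis using 1(2) I keepw by blast
      qed
      moreover have "\<forall>i\<ge>Suc j. nmem (?f M s') x i = nmem s x i" using 1(3) I by auto
      moreover have "\<forall>g. G g s \<longrightarrow> G g (?f M s')" using 1(2) I keepw by blast
      ultimately show "?I (Suc M) (?f M s')" using 1(1) by blast
    qed
    moreover have "nval e s = N" using Suc.prems assms(2) by blast
    ultimately show ?case by simp
  qed
  from this[OF assms(1), of J] show ?thesis by auto
qed

section \<open>Aggregated distances and sampled centers\<close>

definition sqdist :: "nat \<Rightarrow> point \<Rightarrow> point \<Rightarrow> real" where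
  "sqdist d x y = (\<Sum>i<d. (x i - y i)\<^sup>2)"

text \<open>The cost of a single point. Whether these costs are added or maximized is left to
  \<open>agg\<close>, so that most proofs treat the three objectives at once.\<close>

definition zc :: "objective \<Rightarrow> nat \<Rightarrow> point \<Rightarrow> point \<Rightarrow> real" where
  "zc obj d x y = (if obj = K_Means then sqdist d x y else sqrt (sqdist d x y))"

lemma sqdist_nonneg [simp]: "sqdist d x y \<ge> 0"
  by (simp add: sqdist_def sum_nonneg)

lemma zc_nonneg [simp]: "zc obj d x y \<ge> 0"
  by (simp add: zc_def)

lemma sqdist_commute: "sqdist d x y = sqdist d y x"
  by (simp add: sqdist_def power2_commute)

lemma zc_commute: "zc obj d x y = zc obj d y x"
  by (simp add: zc_def sqdist_commute)

lemma edist_eq: "edist d x y = sqrt (sqdist d x y)"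
  by (simp add: edist_def sqdist_def L2_set_def)

lemma sqrt_sqdist_triangle: "sqrt (sqdist d x z) \<le> sqrt (sqdist d x y) + sqrt (sqdist d y z)"
  using L2_set_triangle_ineq[of "\<lambda>i. x i - y i" "\<lambda>i. y i - z i" "{..<d}"]
  by (simp add: sqdist_def L2_set_def)

text \<open>Squares satisfy (u + v)^2 \<le> 2 u^2 + 2 v^2. Distances would not need the factor 2,
  but a common inequality avoids separate proofs; all constants of the greedy algorithm stem from
  it.\<close>

lemma zc_triangle: "zc obj d x z \<le> 2 * (zc obj d x y + zc obj d y z)"
proof (cases "obj = K_Means")
  case True
  have "(x i - z i)\<^sup>2 \<le> 2 * (x i - y i)\<^sup>2 + 2 * (y i - z i)\<^sup>2" for i
    using zero_le_power2[of "(x i - y i) - (y i - z i)"]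
    by (simp add: power2_eq_square algebra_simps)
  then have "sqdist d x z \<le> (\<Sum>i<d. 2 * (x i - y i)\<^sup>2 + 2 * (y i - z i)\<^sup>2)"
    unfolding sqdist_def by (intro sum_mono)
  then show ?thesis using True
    by (simp add: zc_def sqdist_def sum.distrib sum_distrib_left)
next
  case False
  then have e: "zc obj d u v = sqrt (sqdist d u v)" for u v by (simp add: zc_def)
  have "zc obj d x z \<le> zc obj d x y + zc obj d y z"
    using sqrt_sqdist_triangle[of d x z y] by (simp add: e)
  moreover have "zc obj d x y \<ge> 0" "zc obj d y z \<ge> 0" by simp_all
  ultimately show ?thesis by argo
qed

text \<open>The adjoined 0 makes the maximum over the empty set agree with the empty sum. For the
  nonnegative costs considered here it is otherwise invisible.\<close>

definition agg :: "objective \<Rightarrow> 'a set \<Rightarrow> ('a \<Rightarrow> real) \<Rightarrow> real" where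
  "agg obj S f = (if obj = K_Center then Max (insert 0 (f ` S)) else sum f S)"

lemma agg_le_iff_center:
  "finite S \<Longrightarrow> agg K_Center S f \<le> c \<longleftrightarrow> 0 \<le> c \<and> (\<forall>a\<in>S. f a \<le> c)"
  by (simp add: agg_def)

lemma agg_center_ge: "finite S \<Longrightarrow> a \<in> S \<Longrightarrow> f a \<le> agg K_Center S f"
  by (simp add: agg_def)

lemma agg_nonneg: "finite S \<Longrightarrow> (\<And>a. a \<in> S \<Longrightarrow> 0 \<le> f a) \<Longrightarrow> 0 \<le> agg obj S f"
  by (simp add: agg_def sum_nonneg)

lemma agg_empty [simp]: "agg obj {} f = 0"
  by (simp add: agg_def)

lemma agg_insert:
  assumes "finite S" "a \<notin> S"
  shows "agg obj (insert a S) f = (if obj = K_Center then max (agg obj S f) (f a) else agg obj S f + f a)"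
proof -
  have "insert 0 (insert (f a) (f ` S)) = insert (f a) (insert 0 (f ` S))" by blast
  then show ?thesis using assms by (simp add: agg_def max.commute)
qed

lemma agg_cong: "S = T \<Longrightarrow> (\<And>a. a \<in> T \<Longrightarrow> f a = g a) \<Longrightarrow> agg obj S f = agg obj T g"
  by (simp add: agg_def cong: image_cong)

lemma agg_mono:
  assumes "finite S" "\<And>a. a \<in> S \<Longrightarrow> f a \<le> g a"
  shows "agg obj S f \<le> agg obj S g"
proof (cases "obj = K_Center")
  case True
  have "0 \<le> agg K_Center S g" using assms by (simp add: agg_def)
  then show ?thesis using True assms agg_center_ge[OF assms(1), of _ g]
    by (auto simp: agg_le_iff_center intro: order_trans)
qed (simp add: agg_def assms sum_mono)

lemma agg_add:
  assumes "finite S"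
  shows "agg obj S (\<lambda>a. f a + g a) \<le> agg obj S f + agg obj S g"
proof (cases "obj = K_Center")
  case True
  have "0 \<le> agg K_Center S f" "0 \<le> agg K_Center S g" using assms by (auto simp: agg_def)
  then show ?thesis using True assms agg_center_ge[OF assms, of _ f] agg_center_ge[OF assms, of _ g]
    by (auto simp: agg_le_iff_center intro: add_mono)
qed (simp add: agg_def sum.distrib)

lemma agg_cmult:
  assumes "finite S" "c \<ge> 0"
  shows "agg obj S (\<lambda>a. c * f a) \<le> c * agg obj S f"
proof (cases "obj = K_Center")
  case True
  have "0 \<le> agg K_Center S f" using assms by (auto simp: agg_def)
  then show ?thesis using True assms agg_center_ge[OF assms(1), of _ f]
    by (auto simp: agg_le_iff_center intro: mult_left_mono)
qed (simp add: agg_def sum_distrib_left)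

lemma agg_subset:
  assumes "finite T" "S \<subseteq> T" "\<And>a. a \<in> T \<Longrightarrow> 0 \<le> f a"
  shows "agg obj S f \<le> agg obj T f"
proof (cases "obj = K_Center")
  case True
  have "finite S" using assms finite_subset by blast
  moreover have "0 \<le> agg K_Center T f" using assms by (auto simp: agg_def)
  ultimately show ?thesis using True assms agg_center_ge[OF assms(1), of _ f]
    by (auto simp: agg_le_iff_center)
next
  case False
  have "sum f S \<le> sum f T" using assms by (intro sum_mono2) auto
  then show ?thesis using False by (simp add: agg_def)
qed

text \<open>A factor that holds on every cluster holds globally: sums add up, and a maximum is
  attained in one of the clusters.\<close>

lemma agg_parts_le:
  fixes part :: "'a \<Rightarrow> nat"
  assumes "finite S" "c \<ge> 0" "\<And>a. a \<in> S \<Longrightarrow> part a < k"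
    and "\<And>j. j < k \<Longrightarrow> agg obj {a\<in>S. part a = j} f \<le> c * agg obj {a\<in>S. part a = j} g"
    and nn: "\<And>a. a \<in> S \<Longrightarrow> 0 \<le> g a"
  shows "agg obj S f \<le> c * agg obj S g"
proof (cases "obj = K_Center")
  case True
  have g0: "0 \<le> agg K_Center S g" using assms by (auto simp: agg_def)
  have "f a \<le> c * agg K_Center S g" if a: "a \<in> S" for a
  proof -
    have "f a \<le> agg K_Center {b\<in>S. part b = part a} f"
      using a assms(1) by (intro agg_center_ge) auto
    also have "\<dots> \<le> c * agg K_Center {b\<in>S. part b = part a} g"
      using assms(3,4) a True by blast
    also have "\<dots> \<le> c * agg K_Center S g"
      using assms(1,2) nn by (intro mult_left_mono agg_subset) auto
    finally show ?thesis .
  qed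
  then show ?thesis using True assms(1,2) g0 by (simp add: agg_le_iff_center)
next
  case False
  have *: "sum h S = (\<Sum>j<k. sum h {a\<in>S. part a = j})" for h :: "'a \<Rightarrow> real"
    using assms(1,3) by (intro sum.group[symmetric]) auto
  have "(\<Sum>j<k. sum f {a\<in>S. part a = j}) \<le> (\<Sum>j<k. c * sum g {a\<in>S. part a = j})"
    using assms(4) False by (intro sum_mono) (auto simp: agg_def)
  then show ?thesis using False *[of f] *[of g] by (simp add: agg_def sum_distrib_left)
qed

section \<open>Averages of few points as approximate centers\<close>

definition average :: "nat \<Rightarrow> (nat \<Rightarrow> point) \<Rightarrow> point" where
  "average r y = (\<lambda>i. (\<Sum>t<r. y t i) / real r)"

lemma average_const: "r \<ge> 1 \<Longrightarrow> average r (\<lambda>t. x) = x"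
  by (simp add: average_def)

definition wmean :: "('a \<Rightarrow> real) \<Rightarrow> ('a \<Rightarrow> point) \<Rightarrow> 'a set \<Rightarrow> point" where
  "wmean w x C = (\<lambda>i. (\<Sum>a\<in>C. w a * x a i) / sum w C)"

lemma wmean_centered:
  assumes "sum w C \<noteq> 0"
  shows "(\<Sum>a\<in>C. w a * (x a i - wmean w x C i)) = 0"
proof -
  have "(\<Sum>a\<in>C. w a * wmean w x C i) = (\<Sum>a\<in>C. w a * x a i)"
    using assms unfolding sum_distrib_right[symmetric] by (simp add: wmean_def)
  then show ?thesis by (simp add: right_diff_distrib sum_subtractf)
qed

text \<open>The parallel axis theorem: the mixed terms cancel because deviations from the weighted
  mean sum to zero. \<open>Y\<close> will be the accumulated deviation of earlier samples, or the
  shift from the mean to another center.\<close>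

lemma sum_sqdist_wmean:
  assumes "sum w C \<noteq> 0"
  shows "(\<Sum>a\<in>C. w a * (\<Sum>i<d. (Y i + (x a i - wmean w x C i))\<^sup>2)) =
    sum w C * (\<Sum>i<d. (Y i)\<^sup>2) + (\<Sum>a\<in>C. w a * sqdist d (x a) (wmean w x C))"
proof -
  let ?M = "wmean w x C"
  have "(\<Sum>a\<in>C. w a * (Y i + (x a i - ?M i))\<^sup>2) =
      sum w C * (Y i)\<^sup>2 + (\<Sum>a\<in>C. w a * (x a i - ?M i)\<^sup>2)" for i
  proof -
    have "(\<Sum>a\<in>C. w a * (Y i + (x a i - ?M i))\<^sup>2) =
        (\<Sum>a\<in>C. w a * (Y i)\<^sup>2 + 2 * Y i * (w a * (x a i - ?M i)) + w a * (x a i - ?M i)\<^sup>2)"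
      by (intro sum.cong) (simp_all add: power2_eq_square algebra_simps)
    also have "\<dots> = sum w C * (Y i)\<^sup>2 + 2 * Y i * (\<Sum>a\<in>C. w a * (x a i - ?M i)) +
        (\<Sum>a\<in>C. w a * (x a i - ?M i)\<^sup>2)"
      by (simp add: sum.distrib sum_distrib_left sum_distrib_right)
    finally show ?thesis using wmean_centered[OF assms] by simp
  qed
  then have "(\<Sum>i<d. \<Sum>a\<in>C. w a * (Y i + (x a i - ?M i))\<^sup>2) =
      (\<Sum>i<d. sum w C * (Y i)\<^sup>2 + (\<Sum>a\<in>C. w a * (x a i - ?M i)\<^sup>2))" by simp
  then show ?thesis
    by (simp add: sqdist_def sum_distrib_left sum.distrib sum.swap[of _ "{..<d}" C])
qed

text \<open>Derandomized sampling: the deviation of a sum of \<open>m\<close> independent samples is \<open>m\<close> times the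
  variance in expectation, so that the samples can be fixed one after the other.\<close>

lemma sampled_sum:
  assumes C: "finite C" "C \<noteq> {}" and w: "\<And>a. a \<in> C \<Longrightarrow> w a > 0"
  shows "\<exists>g::nat \<Rightarrow> 'a. (\<forall>t<m. g t \<in> C) \<and>
    sum w C * (\<Sum>i<d. (\<Sum>t<m. x (g t) i - wmean w x C i)\<^sup>2) \<le>
      real m * (\<Sum>a\<in>C. w a * sqdist d (x a) (wmean w x C))"
proof (induction m)
  case 0
  then show ?case by simp
next
  case (Suc m)
  then obtain g where g: "\<forall>t<m. g t \<in> C" and le: "sum w C * (\<Sum>i<d. (\<Sum>t<m. x (g t) i - wmean w x C i)\<^sup>2) \<le>
      real m * (\<Sum>a\<in>C. w a * sqdist d (x a) (wmean w x C))" by blast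
  let ?M = "wmean w x C" and ?V = "\<Sum>a\<in>C. w a * sqdist d (x a) (wmean w x C)"
  define Y where "Y i = (\<Sum>t<m. x (g t) i - ?M i)" for i
  have W: "sum w C > 0" using C w by (simp add: sum_pos)
  let ?f = "\<lambda>a. \<Sum>i<d. (Y i + (x a i - ?M i))\<^sup>2"
  \<comment> \<open>Some value is at most the weighted average of all values, and that average is
    computed by the parallel axis theorem.\<close>
  have "\<exists>a\<in>C. sum w C * ?f a \<le> sum w C * (\<Sum>i<d. (Y i)\<^sup>2) + ?V"
  proof (rule ccontr)
    assume "\<not> ?thesis"
    then have "\<forall>a\<in>C. (sum w C * (\<Sum>i<d. (Y i)\<^sup>2) + ?V) < sum w C * ?f a" by auto
    then have "(\<Sum>a\<in>C. w a * (sum w C * (\<Sum>i<d. (Y i)\<^sup>2) + ?V)) < (\<Sum>a\<in>C. w a * (sum w C * ?f a))"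
      using C w by (intro sum_strict_mono mult_strict_left_mono) auto
    also have "\<dots> = sum w C * (\<Sum>a\<in>C. w a * ?f a)"
      by (simp add: sum_distrib_left mult.left_commute)
    also have "\<dots> = sum w C * (sum w C * (\<Sum>i<d. (Y i)\<^sup>2) + ?V)"
      using sum_sqdist_wmean[of w C Y x d] W by simp
    finally show False by (simp add: sum_distrib_right)
  qed
  then obtain a where a: "a \<in> C" "sum w C * ?f a \<le> sum w C * (\<Sum>i<d. (Y i)\<^sup>2) + ?V" by blast
  have "(\<Sum>t<Suc m. x ((g(m := a)) t) i - ?M i) = Y i + (x a i - ?M i)" for i
    by (simp add: Y_def)
  then have "sum w C * (\<Sum>i<d. (\<Sum>t<Suc m. x ((g(m := a)) t) i - ?M i)\<^sup>2) \<le> real (Suc m) * ?V"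
    using a(2) le unfolding Y_def by (simp add: distrib_right)
  moreover have "\<forall>t<Suc m. (g(m := a)) t \<in> C" using g a(1) by (simp add: less_Suc_eq)
  ultimately show ?case by blast
qed

text \<open>The mean is the optimal center, and moving to another point costs the total weight times
  the squared shift. The average of the samples is shifted by 1/m times the sampled deviation, so
  its squared shift costs at most a fraction 1/m of the optimum.\<close>

lemma weighted_sampling:
  assumes C: "finite C" "C \<noteq> {}" and w: "\<And>a. a \<in> C \<Longrightarrow> w a > 0" and m: "m \<ge> 1"
  shows "\<exists>g::nat \<Rightarrow> 'a. (\<forall>t<m. g t \<in> C) \<and>
    (\<Sum>a\<in>C. w a * sqdist d (x a) (average m (\<lambda>t. x (g t)))) \<le>
      (1 + 1 / real m) * (\<Sum>a\<in>C. w a * sqdist d (x a) \<mu>)"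
proof -
  let ?M = "wmean w x C"
  let ?V = "\<Sum>a\<in>C. w a * sqdist d (x a) ?M"
  obtain g where g: "\<forall>t<m. g t \<in> C" and le: "sum w C * (\<Sum>i<d. (\<Sum>t<m. x (g t) i - ?M i)\<^sup>2) \<le> real m * ?V"
    using sampled_sum[OF C, of w m x d] w by blast
  have W: "sum w C > 0" using C w by (simp add: sum_pos)
  have shift: "(\<Sum>a\<in>C. w a * sqdist d (x a) p) = sum w C * sqdist d ?M p + ?V" for p
  proof -
    have "sqdist d (x a) p = (\<Sum>i<d. ((?M i - p i) + (x a i - ?M i))\<^sup>2)" for a
      by (simp add: sqdist_def)
    then show ?thesis using sum_sqdist_wmean[of w C "\<lambda>i. ?M i - p i" x d] W
      by (simp add: sqdist_def)
  qed
  let ?p = "average m (\<lambda>t. x (g t))"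
  have "(?M i - ?p i)\<^sup>2 = (\<Sum>t<m. x (g t) i - ?M i)\<^sup>2 / (real m)\<^sup>2" for i
  proof -
    have "?M i - ?p i = - ((\<Sum>t<m. x (g t) i - ?M i) / real m)"
      using m by (simp add: average_def sum_subtractf field_simps)
    then show ?thesis by (simp add: power_divide)
  qed
  then have "sqdist d ?M ?p = (\<Sum>i<d. (\<Sum>t<m. x (g t) i - ?M i)\<^sup>2) / (real m)\<^sup>2"
    by (simp add: sqdist_def sum_divide_distrib)
  then have "sum w C * sqdist d ?M ?p = (sum w C * (\<Sum>i<d. (\<Sum>t<m. x (g t) i - ?M i)\<^sup>2)) / (real m)\<^sup>2"
    by simp
  also have "\<dots> \<le> (real m * ?V) / (real m)\<^sup>2"
    using le by (rule divide_right_mono) simp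
  also have "\<dots> = ?V / real m" using m by (simp add: power2_eq_square)
  finally have "(\<Sum>a\<in>C. w a * sqdist d (x a) ?p) \<le> (1 + 1 / real m) * ?V"
    using shift[of ?p] by (simp add: distrib_right)
  also have "\<dots> \<le> (1 + 1 / real m) * (\<Sum>a\<in>C. w a * sqdist d (x a) \<mu>)"
    using shift[of \<mu>] W by (intro mult_left_mono) (auto intro: mult_nonneg_nonneg)
  finally show ?thesis using g by blast
qed

text \<open>Weighting by reciprocal distances turns squared distances into distances, as in Weiszfeld's
  algorithm.\<close>

lemma median_sampling:
  assumes C: "finite C" "C \<noteq> {}" and m: "m \<ge> 1"
  shows "\<exists>g::nat \<Rightarrow> 'a. (\<forall>t<m. g t \<in> C) \<and>
    (\<Sum>a\<in>C. sqrt (sqdist d (x a) (average m (\<lambda>t. x (g t))))) \<le>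
      (1 + 1 / real m) * (\<Sum>a\<in>C. sqrt (sqdist d (x a) \<mu>))"
proof (cases "\<exists>a\<in>C. sqdist d (x a) \<mu> = 0")
  case True
  then obtain a where a: "a \<in> C" "sqdist d (x a) \<mu> = 0" by blast
  have "sqrt (sqdist d (x b) (x a)) \<le> sqrt (sqdist d (x b) \<mu>)" for b
    using sqrt_sqdist_triangle[of d "x b" "x a" \<mu>] a(2) by (simp add: sqdist_commute)
  then have "(\<Sum>b\<in>C. sqrt (sqdist d (x b) (x a))) \<le> (\<Sum>b\<in>C. sqrt (sqdist d (x b) \<mu>))"
    by (rule sum_mono)
  also have "\<dots> \<le> (1 + 1 / real m) * (\<Sum>b\<in>C. sqrt (sqdist d (x b) \<mu>))"
    using mult_right_mono[of 1 "1 + 1 / real m" "\<Sum>b\<in>C. sqrt (sqdist d (x b) \<mu>)"]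
    by (simp add: sum_nonneg)
  finally show ?thesis using a(1) average_const[OF m, of "x a"] by (intro exI[of _ "\<lambda>t. a"]) simp
next
  case False
  define D where "D a = sqrt (sqdist d (x a) \<mu>)" for a
  have D: "D a > 0" "sqdist d (x a) \<mu> = (D a)\<^sup>2" if "a \<in> C" for a
    using False that by (auto simp: D_def less_le)
  obtain g where g: "\<forall>t<m. g t \<in> C" and le:
    "(\<Sum>a\<in>C. 1 / D a * sqdist d (x a) (average m (\<lambda>t. x (g t)))) \<le>
      (1 + 1 / real m) * (\<Sum>a\<in>C. 1 / D a * sqdist d (x a) \<mu>)"
    using weighted_sampling[OF C _ m, of "\<lambda>a. 1 / D a" d x \<mu>] D by auto
  let ?p = "average m (\<lambda>t. x (g t))"
  have sD: "(\<Sum>a\<in>C. 1 / D a * sqdist d (x a) \<mu>) = sum D C"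
    using D by (intro sum.cong) (auto simp: power2_eq_square)
  \<comment> \<open>The inequality of arithmetic and geometric means, with equality if the distance
    to the new center equals \<open>D a\<close>. It bounds distances by the reweighted
    squares.\<close>
  have "sqrt (sqdist d (x a) ?p) \<le> (1 / D a * sqdist d (x a) ?p + D a) / 2" if "a \<in> C" for a
  proof -
    define q where "q = sqrt (sqdist d (x a) ?p)"
    have "2 * q * D a \<le> q\<^sup>2 + (D a)\<^sup>2"
      using zero_le_power2[of "q - D a"] by (simp add: power2_eq_square algebra_simps)
    then have "q \<le> (1 / D a * q\<^sup>2 + D a) / 2"
      using D(1)[OF that] by (simp add: field_simps power2_eq_square)
    then show ?thesis by (simp add: q_def)
  qed
  then have "(\<Sum>a\<in>C. sqrt (sqdist d (x a) ?p)) \<le> (\<Sum>a\<in>C. (1 / D a * sqdist d (x a) ?p + D a) / 2)"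
    by (rule sum_mono)
  also have "\<dots> = ((\<Sum>a\<in>C. 1 / D a * sqdist d (x a) ?p) + sum D C) / 2"
    by (simp add: sum.distrib flip: sum_divide_distrib)
  also have "\<dots> \<le> ((1 + 1 / real m) * sum D C + sum D C) / 2"
    using le sD by simp
  also have "\<dots> \<le> (1 + 1 / real m) * sum D C"
  proof -
    have "sum D C \<ge> 0" by (simp add: D_def sum_nonneg)
    define T where "T = sum D C / real m"
    have "T \<ge> 0" using \<open>sum D C \<ge> 0\<close> by (simp add: T_def)
    moreover have "(1 + 1 / real m) * sum D C = sum D C + T" by (simp add: distrib_right T_def)
    ultimately show ?thesis by simp
  qed
  finally show ?thesis using g unfolding D_def by blast
qed

text \<open>Badoiu and Clarkson: repeatedly adding a point that is farthest from the current average. As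
  long as the average is not good enough, the potential decreases.\<close>

lemma center_sampling:
  assumes C: "finite C" "C \<noteq> {}" and E: "E \<ge> 1"
    and R: "\<And>a. a \<in> C \<Longrightarrow> sqrt (sqdist d (x a) \<mu>) \<le> R"
  shows "\<exists>(g::nat \<Rightarrow> 'a) r. 1 \<le> r \<and> r \<le> 4 * E\<^sup>2 \<and> (\<forall>t<r. g t \<in> C) \<and>
    (\<forall>a\<in>C. sqrt (sqdist d (x a) (average r (\<lambda>t. x (g t)))) \<le> (1 + 1 / real E) * R)"
proof (rule ccontr)
  assume contra: "\<not> ?thesis"
  have R0: "R \<ge> 0" using R C by (metis all_not_in_conv order_trans real_sqrt_ge_zero sqdist_nonneg)
  have R2: "sqdist d (x a) \<mu> \<le> R\<^sup>2" if "a \<in> C" for a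
    using R[OF that] R0 by (simp add: real_sqrt_le_iff sqrt_le_D)
  \<comment> \<open>Let Y be the sum of r deviations from the center and y the deviation of a point
    farther than (1 + 1/E) R from the average. Expanding that distance bounds the scalar product of
    y and Y, and |Y + y|^2 is then at most |Y|^2 (1 + 1/r) + (1 - 2 r/E) R^2. Dividing by r + 1
    turns this recursion into the displayed sum.\<close>
  have step: "\<exists>g::nat \<Rightarrow> 'a. (\<forall>t<r. g t \<in> C) \<and>
      (\<Sum>i<d. (\<Sum>t<r. x (g t) i - \<mu> i)\<^sup>2) \<le> real r * (R\<^sup>2 * (1 + (\<Sum>j\<in>{1..<r}. (1 - 2 * real j / real E) / real (Suc j))))
      \<and> (r > 1 \<longrightarrow> R > 0)"
    if "1 \<le> r" "r \<le> 4 * E\<^sup>2" for r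
    using that
  proof (induction r rule: nat_induct_at_least)
    case base
    obtain a where "a \<in> C" using C by blast
    then show ?case using R2 by (intro exI[of _ "\<lambda>t. a"]) (auto simp: sqdist_def)
  next
    case (Suc r)
    then obtain g where g: "\<forall>t<r. g t \<in> C" and le: "(\<Sum>i<d. (\<Sum>t<r. x (g t) i - \<mu> i)\<^sup>2) \<le>
        real r * (R\<^sup>2 * (1 + (\<Sum>j\<in>{1..<r}. (1 - 2 * real j / real E) / real (Suc j))))"
      by auto
    define Y where "Y i = (\<Sum>t<r. x (g t) i - \<mu> i)" for i
    define YY where "YY = (\<Sum>i<d. (Y i)\<^sup>2)"
    let ?p = "average r (\<lambda>t. x (g t))"
    obtain a where a: "a \<in> C" "sqrt (sqdist d (x a) ?p) > (1 + 1 / real E) * R"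
      using contra g Suc.hyps Suc.prems by (meson not_le Suc_leD)
    \<comment> \<open>With radius 0 all points of \<open>C\<close> lie at the center, hence so does
      their average, which would then be good. The final contradiction needs \<open>R\<close> to be
      positive.\<close>
    have "R \<noteq> 0"
    proof
      assume "R = 0"
      then have z: "x b i = \<mu> i" if "b \<in> C" "i < d" for b i
        using R2[OF that(1)] that(2) sum_nonneg_eq_0_iff[of "{..<d}" "\<lambda>i. (x b i - \<mu> i)\<^sup>2"]
          sqdist_nonneg[of d "x b" \<mu>] by (auto simp: sqdist_def)
      have "?p i = \<mu> i" if "i < d" for i
        using z[OF _ that] g Suc.hyps by (simp add: average_def)
      then have "sqdist d (x a) ?p = 0" using z[OF a(1)] by (simp add: sqdist_def)
      then show False using a(2) \<open>R = 0\<close> by simp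
    qed
    then have Rp: "R > 0" using R0 by simp
    define y where "y i = x a i - \<mu> i" for i
    have r0: "real r > 0" using Suc.hyps by simp
    have "((1 + 1 / real E) * R)\<^sup>2 < sqdist d (x a) ?p"
    proof -
      have "((1 + 1 / real E) * R)\<^sup>2 < (sqrt (sqdist d (x a) ?p))\<^sup>2"
        using a(2) R0 by (intro power_strict_mono) auto
      then show ?thesis by simp
    qed
    moreover have "(1 + 2 / real E) * R\<^sup>2 \<le> ((1 + 1 / real E) * R)\<^sup>2"
      by (simp add: power2_eq_square algebra_simps)
    moreover have "sqdist d (x a) ?p = (\<Sum>i<d. (y i)\<^sup>2) - 2 / real r * (\<Sum>i<d. y i * Y i) + YY / (real r)\<^sup>2"
    proof -
      have "(x a i - ?p i)\<^sup>2 = (y i)\<^sup>2 - 2 / real r * (y i * Y i) + (Y i)\<^sup>2 / (real r)\<^sup>2" for i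
      proof -
        have "x a i - ?p i = y i - Y i / real r"
          using r0 by (simp add: average_def y_def Y_def sum_subtractf field_simps)
        then show ?thesis by (simp add: power2_diff power_divide)
      qed
      then show ?thesis
        by (simp add: sqdist_def YY_def sum.distrib sum_subtractf sum_distrib_left sum_divide_distrib)
    qed
    moreover have yR: "(\<Sum>i<d. (y i)\<^sup>2) \<le> R\<^sup>2" using R2[OF a(1)] by (simp add: sqdist_def y_def)
    ultimately have "(1 + 2 / real E) * R\<^sup>2 < R\<^sup>2 - 2 / real r * (\<Sum>i<d. y i * Y i) + YY / (real r)\<^sup>2"
      by linarith
    then have "2 / real r * (\<Sum>i<d. y i * Y i) < YY / (real r)\<^sup>2 - 2 / real E * R\<^sup>2"
      by (simp add: algebra_simps)
    then have "real r * (2 / real r * (\<Sum>i<d. y i * Y i)) < real r * (YY / (real r)\<^sup>2 - 2 / real E * R\<^sup>2)"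
      using r0 by (rule mult_strict_left_mono)
    then have yY: "2 * (\<Sum>i<d. y i * Y i) < YY / real r - 2 * real r / real E * R\<^sup>2"
      using r0 by (simp add: power2_eq_square right_diff_distrib mult_ac)
    let ?S = "\<Sum>j\<in>{1..<r}. (1 - 2 * real j / real E) / real (Suc j)"
    have "(\<Sum>i<d. (Y i + y i)\<^sup>2) = YY + 2 * (\<Sum>i<d. y i * Y i) + (\<Sum>i<d. (y i)\<^sup>2)"
      by (simp add: YY_def power2_sum sum.distrib sum_distrib_left algebra_simps)
    also have "\<dots> \<le> YY + YY / real r + (1 - 2 * real r / real E) * R\<^sup>2"
      using yY yR by (simp add: left_diff_distrib)
    also have "\<dots> = YY / real r * real (Suc r) + (1 - 2 * real r / real E) * R\<^sup>2"
      using r0 by (simp add: field_simps)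
    also have "YY / real r \<le> R\<^sup>2 * (1 + ?S)"
      using le r0 by (simp add: YY_def Y_def divide_le_eq mult.commute)
    then have "YY / real r * real (Suc r) + (1 - 2 * real r / real E) * R\<^sup>2 \<le>
        R\<^sup>2 * (1 + ?S) * real (Suc r) + (1 - 2 * real r / real E) * R\<^sup>2"
      by (intro add_right_mono mult_right_mono) auto
    also have "\<dots> = real (Suc r) * (R\<^sup>2 * (1 + (?S + (1 - 2 * real r / real E) / real (Suc r))))"
      by (simp add: field_simps del: of_nat_Suc)
    also have "?S + (1 - 2 * real r / real E) / real (Suc r) =
        (\<Sum>j\<in>{1..<Suc r}. (1 - 2 * real j / real E) / real (Suc j))"
      using Suc.hyps by (simp add: sum.atLeastLessThan_Suc)
    finally have "(\<Sum>i<d. (\<Sum>t<Suc r. x ((g(r := a)) t) i - \<mu> i)\<^sup>2) \<le>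
        real (Suc r) * (R\<^sup>2 * (1 + (\<Sum>j\<in>{1..<Suc r}. (1 - 2 * real j / real E) / real (Suc j))))"
      by (simp add: Y_def y_def)
    moreover have "\<forall>t<Suc r. (g(r := a)) t \<in> C" using g a(1) by (simp add: less_Suc_eq)
    ultimately show ?case using Rp by blast
  qed
  \<comment> \<open>The summands below E are at most 1/2, the others at most -1/(2 E). With 4 E^2
    rounds they total at most (E - 1)/2 - (4 E - 1)/2 = -3 E/2, which makes a sum of squares
    negative.\<close>
  let ?m = "4 * E\<^sup>2"
  have E0: "real E \<ge> 1" using E by simp
  have m4: "?m \<ge> 4" using E by (simp add: Suc_le_eq)
  obtain g :: "nat \<Rightarrow> 'a" where g: "\<forall>t<?m. g t \<in> C" "R > 0" "(\<Sum>i<d. (\<Sum>t<?m. x (g t) i - \<mu> i)\<^sup>2) \<le>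
      real ?m * (R\<^sup>2 * (1 + (\<Sum>j\<in>{1..<?m}. (1 - 2 * real j / real E) / real (Suc j))))"
    using step[of ?m] m4 by auto
  let ?h = "\<lambda>j. (1 - 2 * real j / real E) / real (Suc j)"
  have "sum ?h {1..<?m} = sum ?h {1..<E} + sum ?h {E..<?m}"
    using E E0 by (intro sum.atLeastLessThan_concat[symmetric]) (auto simp: power2_eq_square intro: order_trans[of _ "E * E"])
  moreover have "sum ?h {1..<E} \<le> (\<Sum>j\<in>{1..<E}. 1/2)"
  proof (rule sum_mono)
    fix j assume j: "j \<in> {1..<E}"
    have "?h j \<le> 1 / real (Suc j)" using E0 by (intro divide_right_mono) auto
    also have "\<dots> \<le> 1/2" using j by (intro divide_left_mono) auto
    finally show "?h j \<le> 1/2" .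
  qed
  moreover have "sum ?h {E..<?m} \<le> (\<Sum>j\<in>{E..<?m}. - (1 / (2 * real E)))"
  proof (rule sum_mono)
    fix j assume j: "j \<in> {E..<?m}"
    then have jE: "real j \<ge> real E" by simp
    have "1 - 2 * real j / real E \<le> - (real j / real E)"
      using jE E0 by (simp add: field_simps)
    then have "?h j \<le> - (real j / real E) / real (Suc j)" by (rule divide_right_mono) simp
    also have "\<dots> \<le> - (1 / (2 * real E))"
    proof -
      have "1 / (2 * real E) \<le> real j / real E / real (Suc j)"
      proof -
        have "1 / 2 \<le> real j / real (Suc j)" using jE E0 by (simp add: le_divide_eq)
        then have "1 / 2 / real E \<le> real j / real (Suc j) / real E" by (rule divide_right_mono) simp
        then show ?thesis by (simp add: divide_divide_eq_left mult.commute del: of_nat_Suc)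
      qed
      then show ?thesis by simp
    qed
    finally show "?h j \<le> - (1 / (2 * real E))" .
  qed
  moreover have "(\<Sum>j\<in>{1..<E}. 1/2 :: real) = (real E - 1) / 2" using E by (simp add: of_nat_diff)
  moreover have "(\<Sum>j\<in>{E..<?m}. - (1 / (2 * real E))) = - ((4 * (real E)\<^sup>2 - real E) / (2 * real E))"
    using E by (simp add: of_nat_diff power2_eq_square)
  ultimately have "sum ?h {1..<?m} \<le> (real E - 1) / 2 - (4 * (real E)\<^sup>2 - real E) / (2 * real E)"
    by linarith
  also have "\<dots> = - (3/2) * real E" using E0 by (simp add: field_simps power2_eq_square)
  finally have "1 + sum ?h {1..<?m} < 0" using E0 by simp
  then have "real ?m * (R\<^sup>2 * (1 + sum ?h {1..<?m})) < 0"
    using g(2) E by (intro mult_pos_neg) auto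
  then have "(\<Sum>i<d. (\<Sum>t<?m. x (g t) i - \<mu> i)\<^sup>2) < 0" using g(3) by linarith
  moreover have "(\<Sum>i<d. (\<Sum>t<?m. x (g t) i - \<mu> i)\<^sup>2) \<ge> 0" by (simp add: sum_nonneg)
  ultimately show False by linarith
qed

text \<open>For median and means E samples are enough; the 4 E^2 is needed for the center objective.
  The number \<open>r\<close> is left open, so that later encodings have to allow for
  padding.\<close>

lemma candidate_center:
  assumes C: "finite C" "C \<noteq> {}" and E: "E \<ge> 1"
  shows "\<exists>(g::nat \<Rightarrow> 'a) r. 1 \<le> r \<and> r \<le> 4 * E\<^sup>2 \<and> (\<forall>t<r. g t \<in> C) \<and>
    agg obj C (\<lambda>a. zc obj d (x a) (average r (\<lambda>t. x (g t)))) \<le>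
      (1 + 1 / real E) * agg obj C (\<lambda>a. zc obj d (x a) \<mu>)"
proof -
  have m: "E \<le> 4 * E\<^sup>2" by (simp add: power2_eq_square)
  show ?thesis
  proof (cases obj)
    case K_Median
    then show ?thesis using median_sampling[OF C E, of d x \<mu>] E m
      by (auto simp: agg_def zc_def)
  next
    case K_Means
    then show ?thesis using weighted_sampling[OF C _ E, of "\<lambda>_. 1" d x \<mu>] E m
      by (auto simp: agg_def zc_def)
  next
    case K_Center
    let ?R = "agg K_Center C (\<lambda>a. sqrt (sqdist d (x a) \<mu>))"
    have R: "0 \<le> (1 + 1 / real E) * ?R" using agg_nonneg[OF C(1)] by (intro mult_nonneg_nonneg) auto
    obtain g :: "nat \<Rightarrow> 'a" and r where "1 \<le> r" "r \<le> 4 * E\<^sup>2" "\<forall>t<r. g t \<in> C"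
      "\<forall>a\<in>C. sqrt (sqdist d (x a) (average r (\<lambda>t. x (g t)))) \<le> (1 + 1 / real E) * ?R"
      using center_sampling[OF C E, of d x \<mu> ?R] agg_center_ge[OF C(1), of _ "\<lambda>a. sqrt (sqdist d (x a) \<mu>)"]
      by blast
    then show ?thesis using K_Center C(1) R
      by (intro exI[of _ g] exI[of _ r]) (simp add: agg_le_iff_center zc_def)
  qed
qed

section \<open>Assignments with prescribed cluster sizes as threshold rules\<close>

text \<open>\<open>W a v - W a u\<close> is the loss when \<open>a\<close> moves from
  \<open>u\<close> to \<open>v\<close>. The tie rule turns around when \<open>u\<close> and
  \<open>v\<close> are exchanged, as the order by losses does, so both sides of a pair of clusters
  use compatible orders.\<close>

definition beats :: "(nat \<Rightarrow> nat \<Rightarrow> real) \<Rightarrow> nat \<Rightarrow> nat \<Rightarrow> nat \<Rightarrow> nat \<Rightarrow> bool" where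
  "beats W u v a b \<longleftrightarrow> W b v - W b u < W a v - W a u \<or>
     W b v - W b u = W a v - W a u \<and> (if u < v then b < a else a < b)"

text \<open>\<open>b (k * u + v)\<close> is the threshold of \<open>u\<close> against
  \<open>v\<close>; the value \<open>n\<close> stands for no threshold, as is right for an empty
  cluster \<open>v\<close>.\<close>

definition selects :: "nat \<Rightarrow> nat \<Rightarrow> (nat \<Rightarrow> nat \<Rightarrow> real) \<Rightarrow> (nat \<Rightarrow> nat) \<Rightarrow> nat \<Rightarrow> nat \<Rightarrow> bool" where
  "selects n k W b u a \<longleftrightarrow> (\<forall>v<k. v \<noteq> u \<longrightarrow> b (k * u + v) < n \<longrightarrow> beats W u v a (b (k * u + v)))"

lemma beats_max:
  assumes "finite L" "L \<noteq> {}"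
  shows "\<exists>m\<in>L. \<forall>x\<in>L. x \<noteq> m \<longrightarrow> beats W u v m x"
  using assms
proof (induction L rule: finite_ne_induct)
  case (insert x L)
  then obtain m where m: "m \<in> L" "\<forall>y\<in>L. y \<noteq> m \<longrightarrow> beats W u v m y" by blast
  have total: "beats W u v m x \<or> beats W u v x m"
  proof -
    have "m \<noteq> x" using insert.hyps m(1) by auto
    then show ?thesis by (auto simp: beats_def)
  qed
  have trans: "beats W u v x m \<Longrightarrow> beats W u v m y \<Longrightarrow> beats W u v x y" for y
    by (auto simp: beats_def split: if_splits)
  show ?case
  proof (cases "beats W u v m x")
    case True
    then show ?thesis using m by auto
  next
    case False
    then have "beats W u v x m" using total by blast
    then have "\<forall>y\<in>insert x L. y \<noteq> x \<longrightarrow> beats W u v x y" using m trans by (metis insertE)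
    then show ?thesis by blast
  qed
qed simp

lemma beats_antisym: "beats W u v a b \<Longrightarrow> \<not> beats W u v b a"
  by (auto simp: beats_def split: if_splits)

lemma card_swap:
  assumes "a \<in> S" "b \<in> S"
  shows "card {x\<in>S. (h(a := h b, b := h a)) x = t} = card {x\<in>S. h x = t}"
proof -
  let ?\<tau> = "\<lambda>x. if x = a then b else if x = b then a else x"
  have "{x\<in>S. (h(a := h b, b := h a)) x = t} = ?\<tau> ` {x\<in>S. h x = t}"
  proof
    show "{x\<in>S. (h(a := h b, b := h a)) x = t} \<subseteq> ?\<tau> ` {x\<in>S. h x = t}"
    proof
      fix x assume "x \<in> {x\<in>S. (h(a := h b, b := h a)) x = t}"
      then have "?\<tau> x \<in> {x\<in>S. h x = t}" "x = ?\<tau> (?\<tau> x)"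
        using assms by (auto split: if_splits)
      then show "x \<in> ?\<tau> ` {x\<in>S. h x = t}" by blast
    qed
  qed (use assms in auto)
  moreover have "inj_on ?\<tau> {x\<in>S. h x = t}" by (auto simp: inj_on_def)
  ultimately show ?thesis using card_image[of ?\<tau> "{x\<in>S. h x = t}"] by argo
qed

lemma sum_swap:
  fixes f :: "'a \<Rightarrow> 'b \<Rightarrow> 'c::ab_group_add"
  assumes "finite S" "a \<in> S" "b \<in> S" "a \<noteq> b"
  shows "(\<Sum>x\<in>S. f x ((h(a := h b, b := h a)) x)) =
    (\<Sum>x\<in>S. f x (h x)) - f a (h a) - f b (h b) + f a (h b) + f b (h a)"
proof -
  have S: "S = insert a (insert b (S - {a, b}))" using assms by auto
  have *: "sum g S = g a + (g b + sum g (S - {a, b}))" for g :: "'a \<Rightarrow> 'c"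
    using assms by (subst S) simp
  have "(\<Sum>x\<in>S - {a, b}. f x ((h(a := h b, b := h a)) x)) = (\<Sum>x\<in>S - {a, b}. f x (h x))"
    by (intro sum.cong) auto
  then show ?thesis using assms(4)
    unfolding *[of "\<lambda>x. f x ((h(a := h b, b := h a)) x)"] *[of "\<lambda>x. f x (h x)"] by simp
qed

text \<open>In an optimal assignment with lexicographically extremal tie breaking, exchanging two points
  does not help, so any two clusters are separated by a threshold.\<close>

lemma thr_rule_complete:
  assumes S: "S \<subseteq> {..<n}" and h0: "\<And>a. a \<in> S \<Longrightarrow> h0 a < k"
  shows "\<exists>b h. (\<forall>i. b i \<le> n) \<and> (\<forall>a\<in>S. h a < k \<and> (\<forall>u<k. selects n k W b u a \<longleftrightarrow> u = h a)) \<and>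
    (\<forall>v<k. card {a\<in>S. h a = v} = card {a\<in>S. h0 a = v}) \<and>
    (\<Sum>a\<in>S. W a (h a)) \<le> (\<Sum>a\<in>S. W a (h0 a))"
proof -
  have finS: "finite S" using S finite_subset by blast
  define F where "F = {h \<in> S \<rightarrow>\<^sub>E {..<k}. \<forall>v<k. card {a\<in>S. h a = v} = card {a\<in>S. h0 a = v}}"
  define w where "w h = (\<Sum>a\<in>S. W a (h a))" for h
  \<comment> \<open>The secondary objective. Exchanging the labels of \<open>a\<close> and
    \<open>b\<close> changes it by \<open>(a - b) * (h b - h a)\<close>, so minimizing it among
    cheapest assignments enforces exactly the tie rule of \<open>beats\<close>.\<close>
  define p where "p h = (\<Sum>a\<in>S. int a * int (h a))" for h
  have finF: "finite F" unfolding F_def using finS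
    by (intro finite_subset[OF _ finite_PiE[of S "\<lambda>_. {..<k}"]]) auto
  have "{a\<in>S. restrict h0 S a = v} = {a\<in>S. h0 a = v}" for v by auto
  then have h0F: "restrict h0 S \<in> F" unfolding F_def using h0 by auto
  define F1 where "F1 = {h\<in>F. \<forall>h'\<in>F. w h \<le> w h'}"
  have "arg_min_on w F \<in> F1"
    using arg_min_if_finite[OF finF, of w] h0F by (auto simp: F1_def not_less)
  moreover have finF1: "finite F1" using finF by (simp add: F1_def)
  ultimately obtain h where h: "h \<in> F1" "\<And>h'. h' \<in> F1 \<Longrightarrow> p h \<le> p h'"
    using arg_min_if_finite[of F1 p] by (metis empty_iff not_less)
  have hF: "h \<in> F" using h(1) by (simp add: F1_def)
  then have hk: "a \<in> S \<Longrightarrow> h a < k" for a by (auto simp: F_def)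
  \<comment> \<open>The exchange of two labels preserves all cluster sizes. By minimality it
    increases \<open>w\<close>, or keeps \<open>w\<close> and does not decrease \<open>p\<close>;
    these are the two cases of \<open>beats\<close>.\<close>
  have beat: "beats W (h a) (h b) a b" if ab: "a \<in> S" "b \<in> S" "h a \<noteq> h b" for a b
  proof -
    have ne: "a \<noteq> b" using ab by auto
    let ?h = "h(a := h b, b := h a)"
    have hF': "?h \<in> F"
      using hF ab card_swap[OF ab(1,2), of h] unfolding F_def by (auto simp: PiE_iff extensional_def)
    have w': "w ?h = w h - W a (h a) - W b (h b) + W a (h b) + W b (h a)"
      unfolding w_def by (rule sum_swap[OF finS ab(1,2) ne])
    have p': "p ?h = p h - int a * int (h a) - int b * int (h b) + int a * int (h b) + int b * int (h a)"
      unfolding p_def by (rule sum_swap[OF finS ab(1,2) ne])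
    have le: "w h \<le> w ?h" using h(1) hF' by (auto simp: F1_def)
    show ?thesis
    proof (cases "w h = w ?h")
      case True
      then have "?h \<in> F1" using h(1) hF' by (auto simp: F1_def)
      then have "p h \<le> p ?h" using h(2) by blast
      then have "0 \<le> (int a - int b) * (int (h b) - int (h a))" using p' by (simp add: algebra_simps)
      then have "if h a < h b then b < a else a < b"
        using ab(3) ne by (auto simp: zero_le_mult_iff)
      then show ?thesis using w' True by (auto simp: beats_def)
    next
      case False
      then show ?thesis using w' le by (auto simp: beats_def)
    qed
  qed
  define L where "L v = {x\<in>S. h x = v}" for v
  \<comment> \<open>The threshold of \<open>u\<close> against \<open>v\<close> is the strongest
    point of cluster \<open>v\<close>: whoever beats it beats the whole cluster.\<close>
  define mx where "mx u v = (SOME m. m \<in> L v \<and> (\<forall>x\<in>L v. x \<noteq> m \<longrightarrow> beats W u v m x))" for u v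
  have mx: "mx u v \<in> L v \<and> (\<forall>x\<in>L v. x \<noteq> mx u v \<longrightarrow> beats W u v (mx u v) x)" if "L v \<noteq> {}" for u v
    unfolding mx_def by (rule someI_ex) (use beats_max[of "L v" W u v] that finS in \<open>auto simp: L_def\<close>)
  define b where "b i = (if L (i mod k) = {} then n else mx (i div k) (i mod k))" for i
  have bk: "b (k * u + v) = (if L v = {} then n else mx u v)" if "v < k" for u v
    using that by (simp add: b_def)
  have "b i \<le> n" for i
    using mx[of "i mod k" "i div k"] S by (auto simp: b_def L_def intro: less_imp_le)
  moreover have "selects n k W b u a \<longleftrightarrow> u = h a" if a: "a \<in> S" and u: "u < k" for a u
  proof
    assume sel: "selects n k W b u a"
    \<comment> \<open>Otherwise \<open>a\<close> would beat the strongest point of its own cluster,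
      although it is that point or is beaten by it.\<close>
    show "u = h a"
    proof (rule ccontr)
      assume ne: "u \<noteq> h a"
      have aL: "a \<in> L (h a)" using a by (simp add: L_def)
      then have m: "mx u (h a) \<in> L (h a)" "\<forall>x\<in>L (h a). x \<noteq> mx u (h a) \<longrightarrow> beats W u (h a) (mx u (h a)) x"
        using mx[of "h a" u] by auto
      have "mx u (h a) < n" using m(1) S by (auto simp: L_def)
      then have "beats W u (h a) a (mx u (h a))"
        using sel[unfolded selects_def, rule_format, of "h a"] hk[OF a] ne aL bk[of "h a" u]
        by (auto split: if_splits)
      then show False using m(2) aL beats_antisym by (metis)
    qed
  next
    assume ua: "u = h a"
    show "selects n k W b u a"
      unfolding selects_def
    proof (intro allI impI)
      fix v assume v: "v < k" "v \<noteq> u" "b (k * u + v) < n"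
      then have "L v \<noteq> {}" by (auto simp: bk)
      then have "mx u v \<in> S" "h (mx u v) = v" using mx[of v u] by (auto simp: L_def)
      then show "beats W u v a (b (k * u + v))"
        using beat[OF a, of "mx u v"] ua v \<open>L v \<noteq> {}\<close> by (auto simp: bk)
    qed
  qed
  moreover have "(\<Sum>a\<in>S. W a (h a)) \<le> (\<Sum>a\<in>S. W a (h0 a))"
    using h(1) h0F by (auto simp: F1_def w_def)
  moreover have "\<forall>v<k. card {a\<in>S. h a = v} = card {a\<in>S. h0 a = v}" using hF by (simp add: F_def)
  ultimately show ?thesis using hk by blast
qed

section \<open>Transportation plans with independent support\<close>

text \<open>Gaussian elimination: the equation \<open>i0\<close> is solved for an unknown
  \<open>e0\<close> that occurs in it, and the remaining system has one equation and one unknown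
  less.\<close>

lemma homogeneous_system:
  fixes c :: "'i \<Rightarrow> 'e \<Rightarrow> real"
  assumes "finite I" "finite E" "card I < card E"
  shows "\<exists>y. (\<exists>e\<in>E. y e \<noteq> 0) \<and> (\<forall>e. e \<notin> E \<longrightarrow> y e = 0) \<and> (\<forall>i\<in>I. (\<Sum>e\<in>E. c i e * y e) = 0)"
  using assms
proof (induction I arbitrary: E c rule: finite_induct)
  case empty
  then obtain e where "e \<in> E" by (metis card_gt_0_iff card.empty all_not_in_conv)
  then show ?case by (intro exI[of _ "\<lambda>x. if x = e then 1 else 0"]) auto
next
  case (insert i0 I)
  have cI: "card I < card E" using insert by simp
  show ?case
  proof (cases "\<forall>e\<in>E. c i0 e = 0")
    case True
    then show ?thesis using insert.IH[OF insert.prems(1) cI, of c] by auto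
  next
    case False
    then obtain e0 where e0: "e0 \<in> E" "c i0 e0 \<noteq> 0" by blast
    let ?E = "E - {e0}"
    have fin: "finite ?E" "card I < card ?E" using insert e0 by auto
    obtain y where y: "\<exists>e\<in>?E. y e \<noteq> 0" "\<forall>e. e \<notin> ?E \<longrightarrow> y e = 0"
      "\<forall>i\<in>I. (\<Sum>e\<in>?E. (c i e - c i e0 * c i0 e / c i0 e0) * y e) = 0"
      using insert.IH[OF fin, of "\<lambda>i e. c i e - c i e0 * c i0 e / c i0 e0"] by blast
    let ?s = "\<Sum>e\<in>?E. c i0 e * y e"
    let ?y = "y(e0 := - ?s / c i0 e0)"
    have sum: "(\<Sum>e\<in>E. c i e * ?y e) = (\<Sum>e\<in>?E. c i e * y e) - c i e0 * ?s / c i0 e0" for i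
      using e0(1) insert.prems(1) by (simp add: sum.remove[of E e0])
    have "(\<Sum>e\<in>E. c i e * ?y e) = 0" if "i \<in> insert i0 I" for i
    proof (cases "i = i0")
      case True
      then show ?thesis using sum[of i] e0(2) by simp
    next
      case False
      have "(\<Sum>e\<in>?E. (c i e - c i e0 * c i0 e / c i0 e0) * y e) =
          (\<Sum>e\<in>?E. c i e * y e - c i e0 / c i0 e0 * (c i0 e * y e))"
        by (intro sum.cong) (auto simp: left_diff_distrib)
      also have "\<dots> = (\<Sum>e\<in>?E. c i e * y e) - c i e0 * ?s / c i0 e0"
        by (simp add: sum_subtractf sum_distrib_left sum_divide_distrib)
      finally show ?thesis using sum[of i] y(3) False that by auto
    qed
    moreover have "\<exists>e\<in>E. ?y e \<noteq> 0" using y(1) by auto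
    moreover have "\<forall>e. e \<notin> E \<longrightarrow> ?y e = 0" using y(2) e0(1) by auto
    ultimately show ?thesis by blast
  qed
qed

definition circulation :: "nat \<Rightarrow> (nat \<times> nat \<Rightarrow> real) \<Rightarrow> bool" where
  "circulation k y \<longleftrightarrow> (\<forall>u. (\<Sum>v<k. y (u, v)) = 0) \<and> (\<forall>v. (\<Sum>u<k. y (u, v)) = 0)"

text \<open>With \<open>E\<close> read as the edges of a bipartite graph on two copies of the
  centers, a nonzero circulation inside \<open>E\<close> exists exactly if there is a cycle. So this
  says that \<open>E\<close> is a forest, in a form that suits linear algebra.\<close>

definition independent_support :: "nat \<Rightarrow> (nat \<times> nat) set \<Rightarrow> bool" where
  "independent_support k E \<longleftrightarrow> E \<subseteq> {..<k} \<times> {..<k} \<and>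
    (\<forall>y. circulation k y \<longrightarrow> (\<forall>e. e \<notin> E \<longrightarrow> y e = 0) \<longrightarrow> (\<forall>e. y e = 0))"

lemma sum_row:
  fixes y :: "nat \<times> nat \<Rightarrow> real"
  assumes "E \<subseteq> {..<k} \<times> {..<k}" "\<forall>e. e \<notin> E \<longrightarrow> y e = 0"
  shows "(\<Sum>e\<in>E. (if fst e = u then 1 else 0) * y e) = (\<Sum>v<k. y (u, v))"
    and "(\<Sum>e\<in>E. (if snd e = u then 1 else 0) * y e) = (\<Sum>v<k. y (v, u))"
proof -
  have 1: "(\<Sum>e\<in>E. g e * y e) = (\<Sum>e\<in>{..<k}\<times>{..<k}. g e * y e)" for g :: "nat \<times> nat \<Rightarrow> real"
    using assms by (intro sum.mono_neutral_left) auto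
  have out: "y (u, v) = 0" "y (v, u) = 0" if "\<not> u < k" for v using assms that by auto
  have "(\<Sum>e\<in>{..<k}\<times>{..<k}. (if fst e = u then 1 else 0) * y e) =
      (\<Sum>a<k. \<Sum>v<k. (if a = u then 1 else 0) * y (a, v))"
    by (simp add: sum.cartesian_product')
  also have "\<dots> = (\<Sum>a<k. if a = u then (\<Sum>v<k. y (u, v)) else 0)" by (intro sum.cong) auto
  finally show "(\<Sum>e\<in>E. (if fst e = u then 1 else 0) * y e) = (\<Sum>v<k. y (u, v))"
    using out by (simp add: 1)
  have "(\<Sum>e\<in>{..<k}\<times>{..<k}. (if snd e = u then 1 else 0) * y e) =
      (\<Sum>a<k. \<Sum>v<k. (if v = u then 1 else 0) * y (a, v))"
    by (simp add: sum.cartesian_product')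
  also have "\<dots> = (\<Sum>a<k. \<Sum>v<k. if v = u then y (a, u) else 0)" by (intro sum.cong) auto
  finally show "(\<Sum>e\<in>E. (if snd e = u then 1 else 0) * y e) = (\<Sum>v<k. y (v, u))"
    using out by (cases "u < k") (simp_all add: 1)
qed

text \<open>A circulation on \<open>E\<close> is a solution of \<open>2 * k\<close> homogeneous
  equations; with more edges than that, a nonzero one exists.\<close>

lemma independent_support_card:
  assumes "independent_support k E"
  shows "card E \<le> 2 * k"
proof (rule ccontr)
  assume "\<not> card E \<le> 2 * k"
  have E: "E \<subseteq> {..<k} \<times> {..<k}" using assms by (simp add: independent_support_def)
  then have finE: "finite E" by (rule finite_subset) simp
  let ?I = "{..<k} <+> {..<k}"
  let ?c = "\<lambda>i e. case i of Inl u \<Rightarrow> if fst e = u then 1 else 0 | Inr v \<Rightarrow> if snd e = v then 1 else (0::real)"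
  have "card ?I < card E" using \<open>\<not> card E \<le> 2 * k\<close> by (simp add: card_Plus)
  then obtain y where y: "\<exists>e\<in>E. y e \<noteq> 0" "\<forall>e. e \<notin> E \<longrightarrow> y e = 0"
    "\<forall>i\<in>?I. (\<Sum>e\<in>E. ?c i e * y e) = 0"
    using homogeneous_system[of ?I E ?c] finE by auto
  have out: "y (u, v) = 0" "y (v, u) = 0" if "\<not> u < k" for u v using E y(2) that by auto
  have "(\<Sum>v<k. y (u, v)) = 0" for u
    using y(3)[rule_format, of "Inl u"] sum_row(1)[OF E y(2), of u] out(1)[of u] by (cases "u < k") auto
  moreover have "(\<Sum>v<k. y (v, u)) = 0" for u
    using y(3)[rule_format, of "Inr u"] sum_row(2)[OF E y(2), of u] out(2)[of u] by (cases "u < k") auto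
  ultimately have "circulation k y" by (simp add: circulation_def)
  then show False using assms y(1,2) by (auto simp: independent_support_def)
qed

text \<open>The existence of leaves in a forest, by counting: if all occurring vertices had degree
  at least 2, there would be at least as many edges as vertices, hence a nonzero
  circulation.\<close>

lemma independent_support_leaf:
  assumes ind: "independent_support k E" and ne: "E \<noteq> {}"
  shows "\<exists>u v. (u, v) \<in> E \<and> ((\<forall>v'. (u, v') \<in> E \<longrightarrow> v' = v) \<or> (\<forall>u'. (u', v) \<in> E \<longrightarrow> u' = u))"
proof (rule ccontr)
  assume contra: "\<not> ?thesis"
  have E: "E \<subseteq> {..<k} \<times> {..<k}" using ind by (simp add: independent_support_def)
  then have finE: "finite E" by (rule finite_subset) simp
  have ge2: "2 \<le> card A" if "finite A" "x \<in> A" "y \<in> A" "x \<noteq> y" for A and x y :: nat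
    using card_mono[of A "{x, y}"] that by auto
  have finrow: "finite {v. (u, v) \<in> E}" "finite {v. (v, u) \<in> E}" for u
    by (rule finite_subset[of _ "{..<k}"]; use E in auto)+
  have "E = Sigma (fst ` E) (\<lambda>u. {v. (u, v) \<in> E})" by force
  then have "card E = card (Sigma (fst ` E) (\<lambda>u. {v. (u, v) \<in> E}))" by (rule arg_cong)
  also have "\<dots> = (\<Sum>u\<in>fst ` E. card {v. (u, v) \<in> E})"
    using finE finrow by (intro card_SigmaI) auto
  also have "\<dots> \<ge> (\<Sum>u\<in>fst ` E. 2)"
  proof (rule sum_mono)
    fix u assume "u \<in> fst ` E"
    then obtain v where "(u, v) \<in> E" by auto
    moreover from this obtain v' where "(u, v') \<in> E" "v' \<noteq> v" using contra by blast
    moreover have "finite {v. (u, v) \<in> E}"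
      by (rule finrow)
    ultimately show "2 \<le> card {v. (u, v) \<in> E}" using ge2[of "{v. (u, v) \<in> E}" v v'] by auto
  qed
  finally have 1: "2 * card (fst ` E) \<le> card E" by simp
  have "card E = card ((\<lambda>(u, v). (v, u)) ` E)" by (intro card_image[symmetric]) (auto simp: inj_on_def)
  also have "(\<lambda>(u, v). (v, u)) ` E = Sigma (snd ` E) (\<lambda>v. {u. (u, v) \<in> E})" by force
  also have "card \<dots> = (\<Sum>v\<in>snd ` E. card {u. (u, v) \<in> E})"
    using finE finrow by (intro card_SigmaI) auto
  also have "\<dots> \<ge> (\<Sum>u\<in>snd ` E. 2)"
  proof (rule sum_mono)
    fix v assume "v \<in> snd ` E"
    then obtain u where "(u, v) \<in> E" by auto
    moreover from this obtain u' where "(u', v) \<in> E" "u' \<noteq> u" using contra by blast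
    moreover have "finite {u. (u, v) \<in> E}"
      by (rule finrow)
    ultimately show "2 \<le> card {u. (u, v) \<in> E}" using ge2[of "{u. (u, v) \<in> E}" u u'] by auto
  qed
  finally have 2: "2 * card (snd ` E) \<le> card E" by simp
  \<comment> \<open>The equation of the column \<open>v0\<close> is dropped, since the other
    equations imply it: rows and columns have the same total. Only then are there fewer equations
    than edges.\<close>
  obtain v0 where v0: "v0 \<in> snd ` E" using ne by auto
  let ?I = "(fst ` E) <+> (snd ` E - {v0})"
  let ?c = "\<lambda>i e. case i of Inl u \<Rightarrow> if fst e = u then 1 else 0 | Inr v \<Rightarrow> if snd e = v then 1 else (0::real)"
  have "card (snd ` E) > 0" using v0 finE by (auto simp: card_gt_0_iff)
  then have "card ?I < card E" using 1 2 v0 finE by (simp add: card_Plus)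
  then obtain y where y: "\<exists>e\<in>E. y e \<noteq> 0" "\<forall>e. e \<notin> E \<longrightarrow> y e = 0"
    "\<forall>i\<in>?I. (\<Sum>e\<in>E. ?c i e * y e) = 0"
    using homogeneous_system[of ?I E ?c] finE by auto
  have row: "(\<Sum>v<k. y (u, v)) = 0" for u
  proof (cases "u \<in> fst ` E")
    case True
    then show ?thesis using y(3)[rule_format, of "Inl u"] sum_row(1)[OF E y(2), of u] by auto
  next
    case False
    then have "y (u, v) = 0" for v using y(2) by force
    then show ?thesis by simp
  qed
  have col: "(\<Sum>v<k. y (v, u)) = 0" if "u \<noteq> v0" for u
  proof (cases "u \<in> snd ` E")
    case True
    then show ?thesis using y(3)[rule_format, of "Inr u"] sum_row(2)[OF E y(2), of u] that by auto
  next
    case False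
    then have "y (v, u) = 0" for v using y(2) by force
    then show ?thesis by simp
  qed
  have "(\<Sum>v<k. \<Sum>u<k. y (u, v)) = (\<Sum>u<k. \<Sum>v<k. y (u, v))" by (rule sum.swap)
  also have "\<dots> = 0" using row by simp
  also have "(\<Sum>v<k. \<Sum>u<k. y (u, v)) = (\<Sum>v<k. if v = v0 then (\<Sum>u<k. y (u, v0)) else 0)"
    using col by (intro sum.cong) auto
  finally have "(\<Sum>u<k. y (u, v0)) = 0" using v0 E by auto
  then have "(\<Sum>v<k. y (v, u)) = 0" for u using col by (cases "u = v0") auto
  then have "circulation k y" using row by (simp add: circulation_def)
  then show False using ind y(1,2) by (auto simp: independent_support_def)
qed

definition support :: "(nat \<times> nat \<Rightarrow> real) \<Rightarrow> (nat \<times> nat) set" where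
  "support x = {e. x e \<noteq> 0}"

text \<open>The passage to a vertex of the transportation polytope. Adding a circulation preserves
  all row and column sums, and with the right sign it does not raise the cost; going on until some
  entry vanishes shrinks the support.\<close>

lemma reduce_support:
  assumes "\<And>e. x e \<ge> 0" "support x \<subseteq> {..<k} \<times> {..<k}"
  shows "\<exists>x'. (\<forall>e. x' e \<ge> 0) \<and> support x' \<subseteq> support x \<and> independent_support k (support x') \<and>
    (\<forall>u. (\<Sum>v<k. x' (u, v)) = (\<Sum>v<k. x (u, v))) \<and> (\<forall>v. (\<Sum>u<k. x' (u, v)) = (\<Sum>u<k. x (u, v))) \<and>
    (\<Sum>e\<in>{..<k}\<times>{..<k}. D e * x' e) \<le> (\<Sum>e\<in>{..<k}\<times>{..<k}. D e * x e)"
  using assms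
proof (induction "card (support x)" arbitrary: x rule: less_induct)
  case less
  show ?case
  proof (cases "independent_support k (support x)")
    case True
    then show ?thesis using less.prems by blast
  next
    case False
    then obtain y0 e0 where y0: "circulation k y0" "\<forall>e. e \<notin> support x \<longrightarrow> y0 e = 0" "y0 e0 \<noteq> 0"
      using less.prems by (auto simp: independent_support_def)
    define y where "y = (if (\<Sum>e\<in>{..<k}\<times>{..<k}. D e * y0 e) \<le> 0 then y0 else (\<lambda>e. - y0 e))"
    have y: "circulation k y" "\<forall>e. e \<notin> support x \<longrightarrow> y e = 0" "y e0 \<noteq> 0"
      "(\<Sum>e\<in>{..<k}\<times>{..<k}. D e * y e) \<le> 0"
      using y0 by (auto simp: y_def circulation_def sum_negf)
    have finx: "finite (support x)" using less.prems(2) by (rule finite_subset) simp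
    let ?N = "{e. y e < 0}"
    have Nx: "?N \<subseteq> support x" using y(2) by force
    then have finN: "finite ?N" using finx finite_subset by blast
    have "?N \<noteq> {}"
    proof
      assume "?N = {}"
      then have nn: "\<And>e. y e \<ge> 0" by (auto simp: not_less)
      obtain u v where uv: "e0 = (u, v)" by fastforce
      have "v < k" using y(2,3) less.prems(2) uv by (auto simp: subset_iff)
      moreover have "(\<Sum>v<k. y (u, v)) = 0" using y(1) by (simp add: circulation_def)
      ultimately have "y (u, v) = 0" using nn by (subst (asm) sum_nonneg_eq_0_iff) auto
      then show False using y(3) uv by simp
    qed
    then have q: "\<exists>e1\<in>?N. \<forall>e\<in>?N. q e1 \<le> q e" for q :: "nat \<times> nat \<Rightarrow> real"
      using arg_min_if_finite[OF finN, of q] by (meson not_less)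
    obtain e1 where e1: "e1 \<in> ?N" "\<And>e. e \<in> ?N \<Longrightarrow> x e1 / - y e1 \<le> x e / - y e"
      using q[of "\<lambda>e. x e / - y e"] by blast
    \<comment> \<open>The ratio test: \<open>t\<close> is the largest step that keeps all entries
      nonnegative, and it makes the entry \<open>e1\<close> zero.\<close>
    define t where "t = x e1 / - y e1"
    have t0: "t \<ge> 0" using less.prems(1)[of e1] e1(1) by (simp add: t_def divide_nonneg_neg)
    define x1 where "x1 e = x e + t * y e" for e
    have nn: "x1 e \<ge> 0" for e
    proof (cases "y e < 0")
      case True
      then have "t \<le> x e / - y e" using e1(2)[of e] by (simp add: t_def)
      moreover have "0 < - y e" using True by simp
      ultimately have "t * (- y e) \<le> x e" by (simp only: pos_le_divide_eq)
      then show ?thesis by (simp add: x1_def)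
    next
      case False
      then show ?thesis using t0 less.prems(1)[of e] by (simp add: x1_def)
    qed
    have "x1 e1 = 0" using e1(1) by (simp add: x1_def t_def)
    moreover have "e1 \<in> support x" using e1(1) Nx by blast
    moreover have sub: "support x1 \<subseteq> support x" using y(2) by (auto simp: support_def x1_def)
    ultimately have "support x1 \<subset> support x" by (auto simp: support_def)
    then have "card (support x1) < card (support x)" using finx by (rule psubset_card_mono[rotated])
    then obtain x' where x': "\<forall>e. x' e \<ge> 0" "support x' \<subseteq> support x1" "independent_support k (support x')"
        "\<forall>u. (\<Sum>v<k. x' (u, v)) = (\<Sum>v<k. x1 (u, v))" "\<forall>v. (\<Sum>u<k. x' (u, v)) = (\<Sum>u<k. x1 (u, v))"
        "(\<Sum>e\<in>{..<k}\<times>{..<k}. D e * x' e) \<le> (\<Sum>e\<in>{..<k}\<times>{..<k}. D e * x1 e)"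
      using less.hyps[of x1] nn sub less.prems(2) by blast
    have r: "(\<Sum>v<k. x1 (u, v)) = (\<Sum>v<k. x (u, v))" for u
      using y(1) by (simp add: x1_def sum.distrib circulation_def flip: sum_distrib_left)
    have c: "(\<Sum>u<k. x1 (u, v)) = (\<Sum>u<k. x (u, v))" for v
      using y(1) by (simp add: x1_def sum.distrib circulation_def flip: sum_distrib_left)
    have d: "(\<Sum>e\<in>{..<k}\<times>{..<k}. D e * x1 e) \<le> (\<Sum>e\<in>{..<k}\<times>{..<k}. D e * x e)"
    proof -
      have "(\<Sum>e\<in>{..<k}\<times>{..<k}. D e * x1 e) =
          (\<Sum>e\<in>{..<k}\<times>{..<k}. D e * x e) + t * (\<Sum>e\<in>{..<k}\<times>{..<k}. D e * y e)"
        by (simp add: x1_def sum.distrib sum_distrib_left algebra_simps)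
      then show ?thesis using y(4) t0 by (simp add: mult_nonneg_nonpos)
    qed
    show ?thesis
      using x'(1,3) x'(4)[unfolded r] x'(5)[unfolded c] order_trans[OF x'(6) d] subset_trans[OF x'(2) sub]
      by blast
  qed
qed

text \<open>A greedy step \<open>(u, v)\<close> assigns as many unassigned points near \<open>u\<close> to cluster \<open>v\<close> as its remaining
  size permits; the value \<open>k\<close> marks unassigned points.\<close>

definition moved :: "nat \<Rightarrow> nat set \<Rightarrow> (nat \<Rightarrow> nat) \<Rightarrow> nat \<times> nat \<Rightarrow>
    (nat \<Rightarrow> nat) \<times> (nat \<Rightarrow> nat) \<Rightarrow> (nat \<Rightarrow> nat) \<times> (nat \<Rightarrow> nat) \<Rightarrow> bool" where
  "moved k S near = (\<lambda>(u, v) (f, rem) (f', rem').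
     \<exists>M \<subseteq> {a\<in>S. f a = k \<and> near a = u}. card M = min (card {a\<in>S. f a = k \<and> near a = u}) (rem v) \<and>
       (\<forall>a\<in>S. f' a = (if a \<in> M then v else f a)) \<and> (\<forall>w<k. rem' w = (if w = v then rem v - card M else rem w)))"

fun runs :: "nat \<Rightarrow> nat set \<Rightarrow> (nat \<Rightarrow> nat) \<Rightarrow> (nat \<times> nat) list \<Rightarrow>
    (nat \<Rightarrow> nat) \<times> (nat \<Rightarrow> nat) \<Rightarrow> (nat \<Rightarrow> nat) \<times> (nat \<Rightarrow> nat) \<Rightarrow> bool" where
  "runs k S near [] s s' \<longleftrightarrow> s' = s"
| "runs k S near (p # ps) s s' \<longleftrightarrow> (\<exists>t. moved k S near p s t \<and> runs k S near ps t s')"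

text \<open>A step does not determine which points it moves, so the list must realize the plan for
  every choice. Some points may be assigned already, because the induction resumes after the first
  step.\<close>

definition ships :: "nat \<Rightarrow> nat set \<Rightarrow> (nat \<Rightarrow> nat) \<Rightarrow> (nat \<times> nat \<Rightarrow> real) \<Rightarrow> (nat \<times> nat) list \<Rightarrow> bool" where
  "ships k S near x ps \<longleftrightarrow> (\<forall>f rem f' rem'. (\<forall>u<k. (\<Sum>v<k. x (u, v)) = real (card {a\<in>S. f a = k \<and> near a = u})) \<longrightarrow>
      (\<forall>v<k. (\<Sum>u<k. x (u, v)) = real (rem v)) \<longrightarrow> runs k S near ps (f, rem) (f', rem') \<longrightarrow>
      (\<forall>a\<in>S. f a \<noteq> k \<longrightarrow> f' a = f a) \<and> (\<forall>a\<in>S. f' a \<noteq> k) \<and>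
      (\<forall>u<k. \<forall>v<k. real (card {a\<in>S. f a = k \<and> near a = u \<and> f' a = v}) = x (u, v)))"

lemmas shipsD = ships_def[THEN iffD1, THEN spec, THEN spec, THEN spec, THEN spec, THEN mp, THEN mp, THEN mp]

text \<open>Leaves are removed one by one. An entry of the plan exceeds neither its row total nor
  its column total and equals one of them at a leaf, so a step that moves as many points as possible
  moves exactly the planned number. What remains is a plan on a smaller forest.\<close>

lemma ships_along_support:
  assumes finS: "finite S" and near: "\<And>a. a \<in> S \<Longrightarrow> near a < k"
  assumes "\<And>e. x e \<ge> 0" "independent_support k (support x)"
  shows "\<exists>ps. length ps = card (support x) \<and> set ps \<subseteq> {..<k} \<times> {..<k} \<and> ships k S near x ps"
  using assms(3-)
proof (induction "card (support x)" arbitrary: x)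
  case 0
  have "support x \<subseteq> {..<k} \<times> {..<k}" using 0(3) by (simp add: independent_support_def)
  then have "finite (support x)" by (rule finite_subset) simp
  then have "support x = {}" using 0(1) by simp
  then have x0: "x e = 0" for e unfolding support_def by blast
  have "(\<forall>a\<in>S. f a \<noteq> k) \<and> (\<forall>u<k. \<forall>v<k. real (card {a\<in>S. f a = k \<and> near a = u \<and> f a = v}) = x (u, v))"
    if r: "\<forall>u<k. (\<Sum>v<k. x (u, v)) = real (card {a\<in>S. f a = k \<and> near a = u})" for f
  proof -
    have fa: "f a \<noteq> k" if a: "a \<in> S" for a
    proof
      assume "f a = k"
      then have "{b\<in>S. f b = k \<and> near b = near a} \<noteq> {}" using a by blast
      moreover have "card {b\<in>S. f b = k \<and> near b = near a} = 0"
        using r[rule_format, OF near[OF a]] x0 by simp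
      ultimately show False using finS by (auto simp: card_eq_0_iff)
    qed
    have e: "{a\<in>S. f a = k \<and> near a = u \<and> f a = v} = {}" for u v using fa by auto
    have "real (card {a\<in>S. f a = k \<and> near a = u \<and> f a = v}) = x (u, v)" for u v
      by (simp only: e card.empty x0 of_nat_0)
    then show ?thesis using fa by blast
  qed
  then have "ships k S near x []"
    unfolding ships_def runs.simps by blast
  moreover have "length [] = card (support x)" "set [] \<subseteq> {..<k} \<times> {..<k}" using 0(1) by simp_all
  ultimately show ?case by blast
next
  case (Suc m)
  have ind: "independent_support k (support x)" by fact
  have sub: "support x \<subseteq> {..<k} \<times> {..<k}" using ind by (simp add: independent_support_def)
  then have fin: "finite (support x)" by (rule finite_subset) simp
  have "support x \<noteq> {}" using Suc(2) by auto
  then obtain u v where uv: "(u, v) \<in> support x"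
    "(\<forall>v'. (u, v') \<in> support x \<longrightarrow> v' = v) \<or> (\<forall>u'. (u', v) \<in> support x \<longrightarrow> u' = u)"
    using independent_support_leaf[OF ind] by blast
  have uvk: "u < k" "v < k" using uv(1) sub by auto
  define x1 where "x1 = x((u, v) := 0)"
  have supp1: "support x1 = support x - {(u, v)}" by (auto simp: support_def x1_def)
  have card1: "m = card (support x1)" using Suc(2) uv(1) fin by (simp add: supp1)
  have nn1: "x1 e \<ge> 0" for e using Suc.prems(1) by (simp add: x1_def)
  have ind1: "independent_support k (support x1)"
    using ind unfolding supp1 independent_support_def by blast
  have row1: "(\<Sum>v'<k. x1 (u', v')) = (\<Sum>v'<k. x (u', v')) - (if u' = u then x (u, v) else 0)" for u'
  proof -
    have "(\<Sum>v'<k. x1 (u', v')) = (\<Sum>v'<k. x (u', v') - (if v' = v then if u' = u then x (u, v) else 0 else 0))"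
      by (intro sum.cong) (auto simp: x1_def)
    then show ?thesis using uvk by (simp add: sum_subtractf)
  qed
  have col1: "(\<Sum>u'<k. x1 (u', v')) = (\<Sum>u'<k. x (u', v')) - (if v' = v then x (u, v) else 0)" for v'
  proof -
    have "(\<Sum>u'<k. x1 (u', v')) = (\<Sum>u'<k. x (u', v') - (if u' = u then if v' = v then x (u, v) else 0 else 0))"
      by (intro sum.cong) (auto simp: x1_def)
    then show ?thesis using uvk by (simp add: sum_subtractf)
  qed
  obtain ps where ps: "length ps = card (support x1)" "set ps \<subseteq> {..<k} \<times> {..<k}"
    and run: "ships k S near x1 ps"
    using Suc.hyps(1)[OF card1 nn1 ind1] by blast
  have "(\<forall>a\<in>S. f a \<noteq> k \<longrightarrow> f' a = f a) \<and> (\<forall>a\<in>S. f' a \<noteq> k) \<and>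
      (\<forall>u<k. \<forall>v<k. real (card {a\<in>S. f a = k \<and> near a = u \<and> f' a = v}) = x (u, v))"
    if row: "\<forall>u<k. (\<Sum>v<k. x (u, v)) = real (card {a\<in>S. f a = k \<and> near a = u})"
      and col: "\<forall>v<k. (\<Sum>u<k. x (u, v)) = real (rem v)"
      and r: "runs k S near ((u, v) # ps) (f, rem) (f', rem')" for f rem f' rem'
  proof -
    let ?R = "{a\<in>S. f a = k \<and> near a = u}"
    have le: "x (u, v) \<le> real (card ?R)" "x (u, v) \<le> real (rem v)"
      using member_le_sum[of v "{..<k}" "\<lambda>v. x (u, v)"] member_le_sum[of u "{..<k}" "\<lambda>u. x (u, v)"]
        uvk Suc.prems row col by auto
    \<comment> \<open>At a leaf, one of the two totals is carried by the edge \<open>(u, v)\<close>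
      alone.\<close>
    have "x (u, v) = real (card ?R) \<or> x (u, v) = real (rem v)"
      using uv(2)
    proof
      assume l: "\<forall>v'. (u, v') \<in> support x \<longrightarrow> v' = v"
      have "(\<Sum>v'<k. x (u, v')) = (\<Sum>v'<k. if v' = v then x (u, v) else 0)"
        using l by (intro sum.cong) (auto simp: support_def)
      then show ?thesis using uvk row by simp
    next
      assume l: "\<forall>u'. (u', v) \<in> support x \<longrightarrow> u' = u"
      have "(\<Sum>u'<k. x (u', v)) = (\<Sum>u'<k. if u' = u then x (u, v) else 0)"
        using l by (intro sum.cong) (auto simp: support_def)
      then show ?thesis using uvk col by simp
    qed
    then have xm: "x (u, v) = real (min (card ?R) (rem v))" using le by auto
    obtain f1 rem1 where mv: "moved k S near (u, v) (f, rem) (f1, rem1)"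
      and r1: "runs k S near ps (f1, rem1) (f', rem')"
      using r by auto
    obtain M where M: "M \<subseteq> ?R" "real (card M) = x (u, v)"
      "\<And>a. a \<in> S \<Longrightarrow> f1 a = (if a \<in> M then v else f a)"
      "\<And>w. w < k \<Longrightarrow> rem1 w = (if w = v then rem v - card M else rem w)"
      using mv xm unfolding moved_def by auto
    have finM: "finite M" using M(1) finS by (auto intro: finite_subset)
    have row': "\<forall>u'<k. (\<Sum>v<k. x1 (u', v)) = real (card {a\<in>S. f1 a = k \<and> near a = u'})"
    proof (intro allI impI)
      fix u' assume u': "u' < k"
      have "{a\<in>S. f1 a = k \<and> near a = u'} = {a\<in>S. f a = k \<and> near a = u'} - (if u' = u then M else {})"
        using M(1,3) uvk by (auto split: if_splits)
      moreover have "real (card (?R - M)) = real (card ?R) - real (card M)"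
        using M(1) finM finS card_mono[OF _ M(1)] by (simp add: card_Diff_subset of_nat_diff)
      ultimately show "(\<Sum>v<k. x1 (u', v)) = real (card {a\<in>S. f1 a = k \<and> near a = u'})"
        using row u' M(2) by (auto simp: row1)
    qed
    have col': "\<forall>v'<k. (\<Sum>u<k. x1 (u, v')) = real (rem1 v')"
      using col M(2,4) xm by (auto simp: col1 of_nat_diff)
    note R = shipsD[OF run row' col' r1]
    have "f' a = f a" if "a \<in> S" "f a \<noteq> k" for a
    proof -
      have "f1 a = f a" using M(1,3) that by auto
      then show ?thesis using R that by auto
    qed
    moreover have "real (card {a\<in>S. f a = k \<and> near a = u' \<and> f' a = v'}) = x (u', v')"
      if "u' < k" "v' < k" for u' v'
    proof -
      have Mf': "f' a = v" if "a \<in> M" for a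
      proof -
        have "a \<in> S" "f1 a = v" "v \<noteq> k" using M(1,3) that uvk by auto
        then show ?thesis using conjunct1[OF R] by simp
      qed
      let ?B = "{a\<in>S. f1 a = k \<and> near a = u' \<and> f' a = v'}"
      have B: "real (card ?B) = x1 (u', v')" using R that by blast
      have eq: "{a\<in>S. f a = k \<and> near a = u' \<and> f' a = v'} = ?B \<union> (if (u', v') = (u, v) then M else {})"
      proof (rule set_eqI)
        fix a
        show "a \<in> {a\<in>S. f a = k \<and> near a = u' \<and> f' a = v'} \<longleftrightarrow>
          a \<in> ?B \<union> (if (u', v') = (u, v) then M else {})"
        proof (cases "a \<in> M")
          case True
          then have "a \<in> S" "f a = k" "near a = u" "f1 a = v" "v \<noteq> k" using M(1,3) uvk by auto
          then show ?thesis using True Mf'[OF True] by auto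
        next
          case False
          then show ?thesis using M(3)[of a] by (cases "a \<in> S") simp_all
        qed
      qed
      show ?thesis
      proof (cases "(u', v') = (u, v)")
        case True
        then have "x1 (u', v') = 0" by (simp add: x1_def)
        then have "?B = {}" using B finS by (simp add: card_eq_0_iff)
        then show ?thesis using M(2) True unfolding eq by (simp only: if_True Un_empty_left prod.inject simp_thms)
      next
        case False
        then show ?thesis using eq B by (auto simp: x1_def)
      qed
    qed
    ultimately show ?thesis using R by blast
  qed
  then have "ships k S near x ((u, v) # ps)" unfolding ships_def by blast
  moreover have "length ((u, v) # ps) = card (support x)" "set ((u, v) # ps) \<subseteq> {..<k} \<times> {..<k}"
    using ps uvk Suc(2) card1 by auto
  ultimately show ?case by blast
qed

lemma runs_append:
  "runs k S near (ps @ qs) s s' \<longleftrightarrow> (\<exists>t. runs k S near ps s t \<and> runs k S near qs t s')"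
  by (induction ps arbitrary: s) auto

lemma runs_assigned:
  "runs k S near ps s s' \<Longrightarrow> \<forall>a\<in>S. fst s a \<noteq> k \<Longrightarrow> \<forall>a\<in>S. fst s' a = fst s a"
proof (induction ps arbitrary: s)
  case (Cons p ps)
  then obtain t where t: "moved k S near p s t" "runs k S near ps t s'" by auto
  then have "\<forall>a\<in>S. fst t a = fst s a" using Cons.prems(2) by (auto simp: moved_def split: prod.splits)
  then show ?case using Cons.IH[OF t(2)] Cons.prems(2) by auto
qed simp

lemma runs_range:
  "runs k S near ps s s' \<Longrightarrow> set ps \<subseteq> {..<k} \<times> {..<k} \<Longrightarrow> \<forall>a\<in>S. fst s a \<le> k \<Longrightarrow> \<forall>a\<in>S. fst s' a \<le> k"
proof (induction ps arbitrary: s)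
  case (Cons p ps)
  then obtain t where t: "moved k S near p s t" "runs k S near ps t s'" by auto
  then have "\<forall>a\<in>S. fst t a \<le> k" using Cons.prems(2,3) by (auto simp: moved_def split: prod.splits)
  then show ?case using Cons.IH[OF t(2)] Cons.prems(2) by auto
qed simp

lemma sum_card_fibres:
  assumes "finite S" "\<And>a. a \<in> S \<Longrightarrow> g a < (k::nat)"
  shows "(\<Sum>v<k. card {a\<in>S. P a \<and> g a = v}) = card {a\<in>S. P a}"
proof -
  have "card {a\<in>S. P a} = (\<Sum>v<k. card {x\<in>{a\<in>S. P a}. g x = v})"
  proof -
    have "g ` {a\<in>S. P a} \<subseteq> {..<k}" using assms(2) by auto
    then show ?thesis using sum.group[of "{a\<in>S. P a}" "{..<k}" g "\<lambda>_. 1::nat"] assms(1) by simp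
  qed
  also have "\<dots> = (\<Sum>v<k. card {a\<in>S. P a \<and> g a = v})" by (simp add: conj_assoc)
  finally show ?thesis by simp
qed

lemma sum_by_fibres:
  fixes \<delta> :: "nat \<Rightarrow> nat \<Rightarrow> real"
  assumes "finite S" "\<And>a. a \<in> S \<Longrightarrow> near a < k" "\<And>a. a \<in> S \<Longrightarrow> g a < k"
  shows "(\<Sum>a\<in>S. \<delta> (near a) (g a)) =
    (\<Sum>e\<in>{..<k}\<times>{..<k}. \<delta> (fst e) (snd e) * real (card {a\<in>S. near a = fst e \<and> g a = snd e}))"
proof -
  have "(\<Sum>a\<in>S. \<delta> (near a) (g a)) =
      (\<Sum>e\<in>{..<k}\<times>{..<k}. \<Sum>a\<in>{a\<in>S. (near a, g a) = e}. \<delta> (near a) (g a))"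
    using assms by (intro sum.group[symmetric]) auto
  also have "\<dots> = (\<Sum>e\<in>{..<k}\<times>{..<k}. \<Sum>a\<in>{a\<in>S. near a = fst e \<and> g a = snd e}. \<delta> (fst e) (snd e))"
    by (intro sum.cong) auto
  finally show ?thesis by (simp add: mult.commute)
qed

text \<open>The cost \<open>\<delta>\<close> depends on a point only through its nearest center, so
  an assignment matters only through the numbers of points going from \<open>u\<close> to
  \<open>v\<close>. These form a transportation plan that can be reduced to a forest.\<close>

lemma seq_rule_complete:
  assumes finS: "finite S" and k: "k \<ge> 1" and near: "\<And>a. a \<in> S \<Longrightarrow> near a < k" and g: "\<And>a. a \<in> S \<Longrightarrow> g a < k"
    and \<delta>: "\<And>u v. \<delta> u v \<ge> 0"
  shows "\<exists>ps. length ps = 2 * k \<and> set ps \<subseteq> {..<k} \<times> {..<k} \<and>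
    (\<forall>f rem f' rem'. (\<forall>a\<in>S. f a = k) \<longrightarrow> (\<forall>v<k. rem v = card {a\<in>S. g a = v}) \<longrightarrow>
      runs k S near ps (f, rem) (f', rem') \<longrightarrow>
      (\<forall>a\<in>S. f' a < k) \<and> (\<forall>v<k. card {a\<in>S. f' a = v} = card {a\<in>S. g a = v}) \<and>
      agg obj S (\<lambda>a. \<delta> (near a) (f' a)) \<le> agg obj S (\<lambda>a. \<delta> (near a) (g a)))"
proof -
  define x where "x = (\<lambda>(u, v). real (card {a\<in>S. near a = u \<and> g a = v}))"
  have x: "x (u, v) = real (card {a\<in>S. near a = u \<and> g a = v})" for u v by (simp add: x_def)
  have suppx: "support x \<subseteq> {..<k} \<times> {..<k}"
  proof
    fix e assume "e \<in> support x"
    then have "{a\<in>S. near a = fst e \<and> g a = snd e} \<noteq> {}"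
      by (auto simp: support_def x_def card_gt_0_iff split: prod.splits)
    then show "e \<in> {..<k} \<times> {..<k}" using near g by (cases e) auto
  qed
  obtain x' where x': "\<forall>e. x' e \<ge> 0" "support x' \<subseteq> support x" "independent_support k (support x')"
    "\<forall>u. (\<Sum>v<k. x' (u, v)) = (\<Sum>v<k. x (u, v))" "\<forall>v. (\<Sum>u<k. x' (u, v)) = (\<Sum>u<k. x (u, v))"
    "(\<Sum>e\<in>{..<k}\<times>{..<k}. \<delta> (fst e) (snd e) * x' e) \<le> (\<Sum>e\<in>{..<k}\<times>{..<k}. \<delta> (fst e) (snd e) * x e)"
    using reduce_support[of x k "\<lambda>e. \<delta> (fst e) (snd e)"] suppx by (auto simp: x_def)
  have rowx: "(\<Sum>v<k. x (u, v)) = real (card {a\<in>S. near a = u})" for u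
    using sum_card_fibres[OF finS g, where P = "\<lambda>a. near a = u"] by (simp add: x flip: of_nat_sum)
  have colx: "(\<Sum>u<k. x (u, v)) = real (card {a\<in>S. g a = v})" for v
    using sum_card_fibres[OF finS near, where P = "\<lambda>a. g a = v"] by (simp add: x conj_commute flip: of_nat_sum)
  obtain ps where ps: "length ps = card (support x')" "set ps \<subseteq> {..<k} \<times> {..<k}"
    and run: "ships k S near x' ps"
    using ships_along_support[of S near k x', OF finS _ _ x'(3)] near x'(1) by blast
  \<comment> \<open>Padding to the fixed length \<open>2 * k\<close> that the search enumerates;
    these moves find no unassigned point.\<close>
  let ?qs = "replicate (2 * k - length ps) (0::nat, 0::nat)"
  have "length ps \<le> 2 * k" using independent_support_card[OF x'(3)] ps(1) by simp
  then have len: "length (ps @ ?qs) = 2 * k" by simp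
  have psk: "set (ps @ ?qs) \<subseteq> {..<k} \<times> {..<k}" using ps(2) k by auto
  have "(\<forall>a\<in>S. f' a < k) \<and> (\<forall>v<k. card {a\<in>S. f' a = v} = card {a\<in>S. g a = v}) \<and>
      agg obj S (\<lambda>a. \<delta> (near a) (f' a)) \<le> agg obj S (\<lambda>a. \<delta> (near a) (g a))"
    if f: "\<forall>a\<in>S. f a = k" and rem: "\<forall>v<k. rem v = card {a\<in>S. g a = v}"
      and r: "runs k S near (ps @ ?qs) (f, rem) (f', rem')" for f rem f' rem'
  proof -
    obtain f1 rem1 where r1: "runs k S near ps (f, rem) (f1, rem1)"
      and r2: "runs k S near ?qs (f1, rem1) (f', rem')"
      using r unfolding runs_append by auto
    have Sf: "{a\<in>S. f a = k \<and> P a} = {a\<in>S. P a}" for P using f by auto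
    have 1: "(\<forall>a\<in>S. f1 a \<noteq> k) \<and> (\<forall>u<k. \<forall>v<k. real (card {a\<in>S. near a = u \<and> f1 a = v}) = x' (u, v))"
      using shipsD[OF run _ _ r1] f rem x'(4,5) rowx colx unfolding Sf by auto
    then have "\<forall>a\<in>S. f' a = f1 a" using runs_assigned[OF r2] by simp
    then have Sf': "{a\<in>S. P a \<and> f' a = v} = {a\<in>S. P a \<and> f1 a = v}" for P v by auto
    have "\<forall>a\<in>S. f' a \<noteq> k" using 1 \<open>\<forall>a\<in>S. f' a = f1 a\<close> by auto
    then have fk: "\<forall>a\<in>S. f' a < k" using runs_range[OF r psk] f by (force simp: less_le)
    have cnt: "real (card {a\<in>S. near a = u \<and> f' a = v}) = x' (u, v)" if "u < k" "v < k" for u v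
      using 1 that Sf'[of "\<lambda>a. near a = u" v] by auto
    \<comment> \<open>The reduction stays inside the support, so every pair of nearest center and
      target that occurs occurs for \<open>g\<close> too. For a maximum this replaces the comparison
      of total costs.\<close>
    have sup: "{a\<in>S. near a = u \<and> g a = v} \<noteq> {}" if "u < k" "v < k" "{a\<in>S. near a = u \<and> f' a = v} \<noteq> {}" for u v
    proof -
      have "x' (u, v) \<noteq> 0" using cnt[OF that(1,2)] that(3) finS by (auto simp: card_eq_0_iff)
      then have "x (u, v) \<noteq> 0" using x'(2) by (auto simp: support_def)
      then show ?thesis by (auto simp: x card_gt_0_iff)
    qed
    show ?thesis
    proof (intro conjI)
      show "\<forall>a\<in>S. f' a < k" by (rule fk)
      show "\<forall>v<k. card {a\<in>S. f' a = v} = card {a\<in>S. g a = v}"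
      proof (intro allI impI)
        fix v assume v: "v < k"
        have "real (card {a\<in>S. f' a = v}) = (\<Sum>u<k. real (card {a\<in>S. f' a = v \<and> near a = u}))"
          using sum_card_fibres[OF finS near, where P = "\<lambda>a. f' a = v"] by (simp flip: of_nat_sum)
        also have "\<dots> = (\<Sum>u<k. x' (u, v))" using cnt v by (intro sum.cong) (auto simp: conj_commute)
        finally show "card {a\<in>S. f' a = v} = card {a\<in>S. g a = v}" using x'(5) colx by simp
      qed
      show "agg obj S (\<lambda>a. \<delta> (near a) (f' a)) \<le> agg obj S (\<lambda>a. \<delta> (near a) (g a))"
      proof (cases "obj = K_Center")
        case True
        have nn: "0 \<le> agg K_Center S (\<lambda>a. \<delta> (near a) (g a))" using finS \<delta> by (intro agg_nonneg) auto
        have "\<delta> (near a) (f' a) \<le> agg K_Center S (\<lambda>a. \<delta> (near a) (g a))" if a: "a \<in> S" for a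
        proof -
          have "{b\<in>S. near b = near a \<and> g b = f' a} \<noteq> {}"
            using sup[of "near a" "f' a"] near[OF a] fk a by blast
          then obtain b where "b \<in> S" "near b = near a" "g b = f' a" by blast
          then show ?thesis using agg_center_ge[OF finS, of b "\<lambda>a. \<delta> (near a) (g a)"] by simp
        qed
        then show ?thesis using True finS nn by (simp add: agg_le_iff_center)
      next
        case False
        have "(\<Sum>a\<in>S. \<delta> (near a) (f' a)) = (\<Sum>e\<in>{..<k}\<times>{..<k}. \<delta> (fst e) (snd e) * x' e)"
          using sum_by_fibres[of S near k f' \<delta>] finS near fk cnt by (auto intro!: sum.cong)
        also have "\<dots> \<le> (\<Sum>e\<in>{..<k}\<times>{..<k}. \<delta> (fst e) (snd e) * x e)" by (rule x'(6))
        also have "\<dots> = (\<Sum>a\<in>S. \<delta> (near a) (g a))"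
          using sum_by_fibres[of S near k g \<delta>] finS near g by (auto simp: x intro!: sum.cong)
        finally show ?thesis using False by (simp add: agg_def)
      qed
    qed
  qed
  then show ?thesis using len psk by blast
qed

section \<open>Completeness of the enumerated candidates\<close>

text \<open>For a maximum, the greedy rule bounds each color by a maximum of \<open>p\<close> plus a
  maximum of \<open>q\<close>. Keeping the two apart lets this form survive the passage to all
  colors.\<close>

lemma agg_parts_add:
  fixes part :: "nat \<Rightarrow> nat"
  assumes "finite S" "\<And>a. a \<in> S \<Longrightarrow> part a < l"
    and "\<And>c. c < l \<Longrightarrow> agg obj {a\<in>S. part a = c} f \<le> agg obj {a\<in>S. part a = c} p + agg obj {a\<in>S. part a = c} q"
    and nn: "\<And>a. 0 \<le> p a" "\<And>a. 0 \<le> q a"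
  shows "agg obj S f \<le> agg obj S p + agg obj S q"
proof (cases "obj = K_Center")
  case True
  have g0: "0 \<le> agg K_Center S p" "0 \<le> agg K_Center S q" using assms by (auto intro: agg_nonneg)
  have "f a \<le> agg K_Center S p + agg K_Center S q" if a: "a \<in> S" for a
  proof -
    let ?C = "{b\<in>S. part b = part a}"
    have "f a \<le> agg K_Center ?C f" using a assms(1) by (intro agg_center_ge) auto
    also have "\<dots> \<le> agg K_Center ?C p + agg K_Center ?C q" using assms(2,3) a True by blast
    also have "\<dots> \<le> agg K_Center S p + agg K_Center S q"
      using assms(1) nn by (intro add_mono agg_subset) auto
    finally show ?thesis .
  qed
  then show ?thesis using True assms(1) g0 by (simp add: agg_le_iff_center)
next
  case False
  have *: "sum h S = (\<Sum>j<l. sum h {a\<in>S. part a = j})" for h :: "nat \<Rightarrow> real"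
    using assms(1,2) by (intro sum.group[symmetric]) auto
  have "(\<Sum>j<l. sum f {a\<in>S. part a = j}) \<le> (\<Sum>j<l. sum p {a\<in>S. part a = j} + sum q {a\<in>S. part a = j})"
    using assms(3) False by (intro sum_mono) (auto simp: agg_def)
  then show ?thesis using False *[of f] *[of p] *[of q] by (simp add: agg_def sum.distrib)
qed

subsection \<open>Averages of input points\<close>

text \<open>Each center has a block of \<open>m\<close> digits. Digits from \<open>n\<close> on are
  padding, which allows averages of fewer points. A block of padding only gives 0/0 = 0, still a
  legitimate center.\<close>

definition digit_center :: "nat \<Rightarrow> nat \<Rightarrow> (nat \<Rightarrow> point) \<Rightarrow> (nat \<Rightarrow> nat) \<Rightarrow> nat \<Rightarrow> point" where
  "digit_center n m P g j = (\<lambda>i. (\<Sum>t<m. if g (m * j + t) < n then P (g (m * j + t)) i else 0) /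
     real (\<Sum>t<m. if g (m * j + t) < n then 1 else 0))"

lemma digit_centers_complete:
  assumes E: "E \<ge> 1" and m: "m = 4 * E\<^sup>2" and cl: "\<And>a. a < n \<Longrightarrow> cl a < k"
  shows "\<exists>g. (\<forall>i. g i \<le> n) \<and> agg obj {..<n} (\<lambda>a. zc obj d (P a) (digit_center n m P g (cl a))) \<le>
    (1 + 1 / real E) * agg obj {..<n} (\<lambda>a. zc obj d (P a) (\<nu> (cl a)))"
proof -
  let ?C = "\<lambda>j. {a\<in>{..<n}. cl a = j}"
  define Q where "Q j g r \<longleftrightarrow> 1 \<le> r \<and> r \<le> m \<and> (\<forall>t<r. g t \<in> ?C j) \<and>
      agg obj (?C j) (\<lambda>a. zc obj d (P a) (average r (\<lambda>t. P (g t)))) \<le>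
      (1 + 1 / real E) * agg obj (?C j) (\<lambda>a. zc obj d (P a) (\<nu> j))" for j and g :: "nat \<Rightarrow> nat" and r
  have "\<exists>g r. ?C j \<noteq> {} \<longrightarrow> Q j g r" for j
  proof (cases "?C j = {}")
    case False
    have fin: "finite (?C j)" by simp
    show ?thesis
      using candidate_center[OF fin False E, of obj d P "\<nu> j"] unfolding Q_def m by blast
  qed blast
  then obtain G r where GQ: "\<And>j. ?C j \<noteq> {} \<Longrightarrow> Q j (G j) (r j)" by metis
  note G = GQ[unfolded Q_def]
  define g where "g i = (if ?C (i div m) \<noteq> {} \<and> i mod m < r (i div m) then G (i div m) (i mod m) else n)" for i
  have m0: "m > 0" using E m by simp
  have gn: "g i \<le> n" for i
    using G[of "i div m"] by (auto simp: g_def intro: less_imp_le)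
  have gm: "g (m * j + t) = (if t < r j then G j t else n)" if "t < m" "?C j \<noteq> {}" for j t
    using that by (simp add: g_def)
  have dc: "digit_center n m P g j = average (r j) (\<lambda>t. P (G j t))" if ne: "?C j \<noteq> {}" for j
  proof
    fix i
    have rj: "r j \<le> m" "\<And>t. t < r j \<Longrightarrow> G j t < n" using G[OF ne] by auto
    have sub: "{..<r j} \<subseteq> {..<m}" using rj by auto
    have *: "(\<Sum>t<m. if g (m * j + t) < n then h (g (m * j + t)) else 0) = (\<Sum>t<r j. h (G j t))"
      for h :: "nat \<Rightarrow> 'b::comm_monoid_add"
    proof -
      have "(\<Sum>t<m. if g (m * j + t) < n then h (g (m * j + t)) else 0) =
          (\<Sum>t<r j. if g (m * j + t) < n then h (g (m * j + t)) else 0)"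
        using sub ne by (intro sum.mono_neutral_right) (auto simp: gm)
      also have "\<dots> = (\<Sum>t<r j. h (G j t))"
        using rj ne by (intro sum.cong) (auto simp: gm)
      finally show ?thesis .
    qed
    show "digit_center n m P g j i = average (r j) (\<lambda>t. P (G j t)) i"
      using *[of "\<lambda>a. P a i"] *[of "\<lambda>a. 1::nat"] by (simp add: digit_center_def average_def)
  qed
  have "agg obj {..<n} (\<lambda>a. zc obj d (P a) (digit_center n m P g (cl a))) \<le>
      (1 + 1 / real E) * agg obj {..<n} (\<lambda>a. zc obj d (P a) (\<nu> (cl a)))"
  proof (rule agg_parts_le[of _ _ cl k])
    fix j assume "j < k"
    have c: "agg obj (?C j) (\<lambda>a. zc obj d (P a) (x (cl a))) = agg obj (?C j) (\<lambda>a. zc obj d (P a) (x j))" for x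
      by (intro agg_cong) auto
    show "agg obj (?C j) (\<lambda>a. zc obj d (P a) (digit_center n m P g (cl a))) \<le>
        (1 + 1 / real E) * agg obj (?C j) (\<lambda>a. zc obj d (P a) (\<nu> (cl a)))"
    proof (cases "?C j = {}")
      case True
      show ?thesis unfolding True by simp
    next
      case False
      show ?thesis unfolding c[of "digit_center n m P g"] c[of \<nu>] dc[OF False] using G[OF False] by blast
    qed
  qed (use cl in auto)
  then show ?thesis using gn by blast
qed

text \<open>For \<open>k\<close>-center the weights only record which distances exceed a guessed radius.\<close>

definition rule_weight :: "objective \<Rightarrow> (nat \<Rightarrow> nat \<Rightarrow> real) \<Rightarrow> real \<Rightarrow> nat \<Rightarrow> nat \<Rightarrow> real" where
  "rule_weight obj D \<theta> a v = (if obj = K_Center then if \<theta> < D a v then 1 else 0 else D a v)"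

text \<open>For k-center the radius can be the largest distance in the reference assignment, hence
  an entry of the table. With weights 0 and 1 the reference then has total weight 0, so an
  assignment minimizing the sum has too and stays within the radius.\<close>

lemma threshold_assignment:
  assumes S: "S \<subseteq> {..<n}" "S \<noteq> {}" and h0: "\<And>a. a \<in> S \<Longrightarrow> h0 a < k"
    and D: "\<And>a v. a \<in> S \<Longrightarrow> v < k \<Longrightarrow> D a v \<ge> 0"
  shows "\<exists>a0<n. \<exists>v0<k. \<exists>b h. (\<forall>i. b i \<le> n) \<and>
    (\<forall>a\<in>S. h a < k \<and> (\<forall>u<k. selects n k (rule_weight obj D (D a0 v0)) b u a \<longleftrightarrow> u = h a)) \<and>
    (\<forall>v<k. card {a\<in>S. h a = v} = card {a\<in>S. h0 a = v}) \<and>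
    agg obj S (\<lambda>a. D a (h a)) \<le> agg obj S (\<lambda>a. D a (h0 a))"
proof -
  have finS: "finite S" using S finite_subset by blast
  define \<theta> where "\<theta> = Max ((\<lambda>a. D a (h0 a)) ` S)"
  have "\<theta> \<in> (\<lambda>a. D a (h0 a)) ` S" unfolding \<theta>_def using finS S by (intro Max_in) auto
  then obtain a0 where a0: "a0 \<in> S" "\<theta> = D a0 (h0 a0)" by blast
  have \<theta>: "D a (h0 a) \<le> \<theta>" if "a \<in> S" for a unfolding \<theta>_def using finS that by (intro Max_ge) auto
  obtain b h where bh: "\<forall>i. b i \<le> n"
    "\<forall>a\<in>S. h a < k \<and> (\<forall>u<k. selects n k (rule_weight obj D \<theta>) b u a \<longleftrightarrow> u = h a)"
    "\<forall>v<k. card {a\<in>S. h a = v} = card {a\<in>S. h0 a = v}"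
    "(\<Sum>a\<in>S. rule_weight obj D \<theta> a (h a)) \<le> (\<Sum>a\<in>S. rule_weight obj D \<theta> a (h0 a))"
  proof -
    note thr_rule_complete[of S n h0 k "rule_weight obj D \<theta>"]
    moreover have "a \<in> S \<Longrightarrow> h0 a < k" for a by (rule h0)
    ultimately have "\<exists>b h. (\<forall>i. b i \<le> n) \<and> (\<forall>a\<in>S. h a < k \<and>
        (\<forall>u<k. selects n k (rule_weight obj D \<theta>) b u a \<longleftrightarrow> u = h a)) \<and>
      (\<forall>v<k. card {a\<in>S. h a = v} = card {a\<in>S. h0 a = v}) \<and>
      (\<Sum>a\<in>S. rule_weight obj D \<theta> a (h a)) \<le> (\<Sum>a\<in>S. rule_weight obj D \<theta> a (h0 a))"
      using S(1) by blast
    then show ?thesis by (elim exE conjE) (rule that; assumption)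
  qed
  have "agg obj S (\<lambda>a. D a (h a)) \<le> agg obj S (\<lambda>a. D a (h0 a))"
  proof (cases "obj = K_Center")
    case True
    have "(\<Sum>a\<in>S. rule_weight obj D \<theta> a (h0 a)) = 0"
      using True \<theta> by (intro sum.neutral) (auto simp: rule_weight_def not_less)
    then have "(\<Sum>a\<in>S. rule_weight obj D \<theta> a (h a)) \<le> 0" using bh(4) by simp
    moreover have nn: "\<And>a. rule_weight obj D \<theta> a (h a) \<ge> 0" using True by (simp add: rule_weight_def)
    ultimately have "(\<Sum>a\<in>S. rule_weight obj D \<theta> a (h a)) = 0" by (intro antisym sum_nonneg) auto
    then have "\<forall>a\<in>S. rule_weight obj D \<theta> a (h a) = 0" 
      using sum_nonneg_eq_0_iff[OF finS, of "\<lambda>a. rule_weight obj D \<theta> a (h a)"] nn by simp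
    then have le: "\<forall>a\<in>S. D a (h a) \<le> D a0 (h0 a0)"
      using True a0(2) by (auto simp: rule_weight_def split: if_splits)
    have "D a0 (h0 a0) \<le> agg K_Center S (\<lambda>a. D a (h0 a))"
      using agg_center_ge[OF finS a0(1), of "\<lambda>a. D a (h0 a)"] .
    moreover have "0 \<le> agg K_Center S (\<lambda>a. D a (h0 a))" using finS D h0 by (intro agg_nonneg) auto
    ultimately show ?thesis using True finS le by (auto simp: agg_le_iff_center intro: order_trans)
  next
    case False
    then show ?thesis using bh(4) by (simp add: agg_def rule_weight_def)
  qed
  moreover have "a0 < n" using a0(1) S(1) by auto
  ultimately show ?thesis
    using bh(1) bh(2)[unfolded a0(2)] bh(3) h0[OF a0(1)]
    by (intro exI[of _ a0] exI[of _ "h0 a0"] exI[of _ b] exI[of _ h] conjI)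
qed

subsection \<open>Greedy assignments\<close>

text \<open>Fairness of the reference lets every point be matched with a point of color
  \<open>b\<close> in the same reference cluster. Sending a point where its partner has its nearest
  center gives every color the sizes that color \<open>b\<close> has under nearest centers, and the
  detour is paid by costs of the point and of its partner.\<close>

lemma greedy_assignment:
  fixes cl near col \<sigma> :: "nat \<Rightarrow> nat" and l :: nat
  assumes n: "n \<ge> 1" and k: "k \<ge> 1" and col: "\<And>a. a < n \<Longrightarrow> col a < l" and cl: "\<And>a. a < n \<Longrightarrow> cl a < k"
    and sizes: "\<And>c j. c < l \<Longrightarrow> j < k \<Longrightarrow> card {a\<in>{..<n}. col a = c \<and> cl a = j} = \<sigma> j"
    and near: "\<And>a. a < n \<Longrightarrow> near a < k"
      "\<And>a v. a < n \<Longrightarrow> v < k \<Longrightarrow> zc obj d (P a) (cen (near a)) \<le> zc obj d (P a) (cen v)"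
  shows "\<exists>b<l. \<exists>p q. (\<forall>a. 0 \<le> p a \<and> 0 \<le> q a) \<and>
    agg obj {..<n} p + agg obj {..<n} q \<le> 34 * agg obj {..<n} (\<lambda>a. zc obj d (P a) (cen (cl a))) \<and>
    (\<forall>c<l. \<exists>ps. length ps = 2 * k \<and> set ps \<subseteq> {..<k} \<times> {..<k} \<and>
      (\<forall>f rem f' rem'. (\<forall>a\<in>{a\<in>{..<n}. col a = c}. f a = k) \<longrightarrow>
        (\<forall>v<k. rem v = card {a\<in>{..<n}. col a = b \<and> near a = v}) \<longrightarrow>
        runs k {a\<in>{..<n}. col a = c} near ps (f, rem) (f', rem') \<longrightarrow>
        (\<forall>a\<in>{a\<in>{..<n}. col a = c}. f' a < k) \<and>
        (\<forall>v<k. card {a\<in>{a\<in>{..<n}. col a = c}. f' a = v} = card {a\<in>{..<n}. col a = b \<and> near a = v}) \<and>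
        agg obj {a\<in>{..<n}. col a = c} (\<lambda>a. zc obj d (P a) (cen (f' a))) \<le>
          agg obj {a\<in>{..<n}. col a = c} p + agg obj {a\<in>{..<n}. col a = c} q))"
proof -
  let ?A = "{..<n}" and ?S = "\<lambda>c. {a\<in>{..<n}. col a = c}"
  let ?D = "\<lambda>a v. zc obj d (P a) (cen v)"
  let ?\<delta> = "\<lambda>u v. zc obj d (cen u) (cen v)"
  have l: "l \<ge> 1" using n col[of 0] by simp
  \<comment> \<open>Bijections between two colors inside one reference cluster; the common sizes
    \<open>\<sigma>\<close> provide them.\<close>
  define \<phi> where "\<phi> c b j = (SOME \<phi>. bij_betw \<phi> {a\<in>?A. col a = c \<and> cl a = j} {a\<in>?A. col a = b \<and> cl a = j})" for c b j
  have \<phi>: "bij_betw (\<phi> c b j) {a\<in>?A. col a = c \<and> cl a = j} {a\<in>?A. col a = b \<and> cl a = j}"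
    if "c < l" "b < l" "j < k" for c b j
  proof -
    have "\<exists>\<phi>. bij_betw \<phi> {a\<in>?A. col a = c \<and> cl a = j} {a\<in>?A. col a = b \<and> cl a = j}"
      by (rule finite_same_card_bij) (use that sizes in auto)
    then show ?thesis unfolding \<phi>_def by (rule someI_ex)
  qed
  define \<Phi> where "\<Phi> b a = \<phi> (col a) b (cl a) a" for b a
  have \<Phi>: "\<Phi> b a < n" "col (\<Phi> b a) = b" "cl (\<Phi> b a) = cl a" if "a < n" "b < l" for a b
    using bij_betwE[OF \<phi>[OF col[OF that(1)] that(2) cl[OF that(1)]]] that by (auto simp: \<Phi>_def)
  have bij: "bij_betw (\<Phi> b) (?S c) (?S b)" if "c < l" "b < l" for b c
  proof -
    have inj: "inj_on (\<Phi> b) (?S c)"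
    proof (rule inj_onI)
      fix x y assume xy: "x \<in> ?S c" "y \<in> ?S c" "\<Phi> b x = \<Phi> b y"
      then have "cl x = cl y" using \<Phi>(3)[of x b] \<Phi>(3)[of y b] that by auto
      moreover have "inj_on (\<phi> c b (cl x)) {a\<in>?A. col a = c \<and> cl a = cl x}"
        using \<phi>[OF that cl[of x]] xy by (auto simp: bij_betw_def)
      moreover have "\<phi> c b (cl x) x = \<phi> c b (cl y) y" using xy by (simp add: \<Phi>_def)
      ultimately show "x = y" using xy inj_onD[of "\<phi> c b (cl x)" _ x y] by simp
    qed
    have sub: "\<Phi> b ` ?S c \<subseteq> ?S b" using \<Phi> that by auto
    have "card (?S e) = (\<Sum>j<k. \<sigma> j)" if "e < l" for e
      using sum_card_fibres[of ?A cl k, where P = "\<lambda>a. col a = e"] cl sizes[OF that] by simp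
    then have "card (?S c) = card (?S b)" using that by presburger
    then have "card (\<Phi> b ` ?S c) = card (?S b)" using card_image[OF inj] by presburger
    then have "\<Phi> b ` ?S c = ?S b" using sub by (intro card_subset_eq) auto
    then show ?thesis using inj by (simp add: bij_betw_def)
  qed
  define h where "h a = ?D a (near a) + ?D a (cl a)" for a
  have h0: "h a \<ge> 0" for a by (simp add: h_def)
  \<comment> \<open>For sums, the color with the smallest total of \<open>h\<close> works: every
    color class is mapped bijectively onto that class, so the left side is \<open>l\<close> times
    the smallest total. For a maximum any color works.\<close>
  have "\<exists>b<l. agg obj ?A (\<lambda>a. h (\<Phi> b a)) \<le> agg obj ?A h"
  proof (cases "obj = K_Center")
    case True
    have "agg K_Center ?A (\<lambda>a. h (\<Phi> 0 a)) \<le> agg K_Center ?A h"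
      using \<Phi>(1) l h0 agg_nonneg[of ?A h K_Center]
      by (auto simp: agg_le_iff_center intro!: agg_center_ge)
    then show ?thesis using True l by (intro exI[of _ 0]) auto
  next
    case False
    let ?s = "\<lambda>b. sum h (?S b)"
    have ne: "{..<l} \<noteq> {}" using l by (metis lessThan_iff empty_iff less_le_trans zero_less_one)
    have amin: "\<exists>b<l. \<forall>c<l. f b \<le> f c" for f :: "nat \<Rightarrow> real"
      using arg_min_if_finite[OF finite_lessThan ne, of f] by (meson lessThan_iff not_less)
    obtain b where b: "b < l" "\<And>c. c < l \<Longrightarrow> ?s b \<le> ?s c"
      using amin[of ?s] by blast
    have part: "sum g ?A = (\<Sum>c<l. sum g (?S c))" for g :: "nat \<Rightarrow> real"
      using col by (intro sum.group[symmetric]) auto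
    have "(\<Sum>a\<in>?A. h (\<Phi> b a)) = (\<Sum>c<l. \<Sum>a\<in>?S c. h (\<Phi> b a))" by (rule part)
    also have "\<dots> = (\<Sum>c<l. ?s b)"
      using b(1) by (intro sum.cong refl sum.reindex_bij_betw bij) auto
    also have "\<dots> \<le> (\<Sum>c<l. ?s c)" using b(2) by (intro sum_mono) auto
    also have "\<dots> = sum h ?A" by (rule part[symmetric])
    finally show ?thesis using b(1) False by (auto simp: agg_def)
  qed
  then obtain b where b: "b < l" "agg obj ?A (\<lambda>a. h (\<Phi> b a)) \<le> agg obj ?A h" by blast
  define g where "g a = near (\<Phi> b a)" for a
  define p where "p a = 2 * ?D a (near a)" for a
  define q where "q a = 8 * (h a + h (\<Phi> b a))" for a
  \<comment> \<open>The route goes from \<open>near a\<close> past \<open>a\<close> to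
    \<open>cl a\<close>, and on past the partner to \<open>g a\<close>. Two doubled triangle
    inequalities in a row give a factor 4; the remaining 2 is the one with which the detour is
    charged to \<open>a\<close>.\<close>
  have \<delta>g: "2 * ?\<delta> (near a) (g a) \<le> q a" if a: "a < n" for a
  proof -
    let ?b = "\<Phi> b a"
    have "?\<delta> (near a) (g a) \<le> 2 * (?\<delta> (near a) (cl a) + ?\<delta> (cl a) (g a))" by (rule zc_triangle)
    moreover have "?\<delta> (near a) (cl a) \<le> 2 * (?D a (near a) + ?D a (cl a))"
      using zc_triangle[of obj d "cen (near a)" "cen (cl a)" "P a"] by (simp add: zc_commute)
    moreover have "?\<delta> (cl a) (g a) \<le> 2 * (?D ?b (cl a) + ?D ?b (g a))"
      using zc_triangle[of obj d "cen (cl a)" "cen (g a)" "P ?b"] by (simp add: zc_commute)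
    moreover have "cl ?b = cl a" using \<Phi>(3)[OF a b(1)] .
    ultimately show ?thesis by (simp add: q_def h_def g_def)
  qed
  \<comment> \<open>34 = 2 + 8 * 4: \<open>h\<close> aggregates to at most twice the reference cost,
    and so does \<open>h\<close> at the partners, while \<open>p\<close> contributes twice the cost
    of nearest centers.\<close>
  have total: "agg obj ?A p + agg obj ?A q \<le> 34 * agg obj ?A (\<lambda>a. ?D a (cl a))"
  proof -
    have Dn: "agg obj ?A (\<lambda>a. ?D a (near a)) \<le> agg obj ?A (\<lambda>a. ?D a (cl a))"
      using near(2) cl by (intro agg_mono) auto
    have "agg obj ?A p \<le> 2 * agg obj ?A (\<lambda>a. ?D a (near a))"
      unfolding p_def by (intro agg_cmult) auto
    moreover have "agg obj ?A q \<le> 8 * agg obj ?A (\<lambda>a. h a + h (\<Phi> b a))"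
      unfolding q_def by (intro agg_cmult) auto
    moreover have "agg obj ?A (\<lambda>a. h a + h (\<Phi> b a)) \<le> agg obj ?A h + agg obj ?A (\<lambda>a. h (\<Phi> b a))"
      by (intro agg_add) auto
    moreover have "agg obj ?A h \<le> agg obj ?A (\<lambda>a. ?D a (near a)) + agg obj ?A (\<lambda>a. ?D a (cl a))"
      unfolding h_def by (intro agg_add) auto
    ultimately show ?thesis using Dn b(2) by linarith
  qed
  have "\<exists>ps. length ps = 2 * k \<and> set ps \<subseteq> {..<k} \<times> {..<k} \<and>
      (\<forall>f rem f' rem'. (\<forall>a\<in>?S c. f a = k) \<longrightarrow>
        (\<forall>v<k. rem v = card {a\<in>?A. col a = b \<and> near a = v}) \<longrightarrow>
        runs k (?S c) near ps (f, rem) (f', rem') \<longrightarrow>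
        (\<forall>a\<in>?S c. f' a < k) \<and>
        (\<forall>v<k. card {a\<in>?S c. f' a = v} = card {a\<in>?A. col a = b \<and> near a = v}) \<and>
        agg obj (?S c) (\<lambda>a. ?D a (f' a)) \<le> agg obj (?S c) p + agg obj (?S c) q)" if c: "c < l" for c
  proof -
    have gk: "g a < k" if "a \<in> ?S c" for a using that near(1) \<Phi>(1) b(1) by (auto simp: g_def)
    have cnt: "card {a\<in>?S c. g a = v} = card {a\<in>?A. col a = b \<and> near a = v}" for v
    proof (rule bij_betw_same_card)
      have "\<Phi> b ` {a\<in>?S c. g a = v} = {a\<in>?S b. near a = v}"
      proof (intro subset_antisym subsetI)
        fix x assume x: "x \<in> {a\<in>?S b. near a = v}"
        then have "x \<in> \<Phi> b ` ?S c" using bij[OF c b(1)] unfolding bij_betw_def by blast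
        then obtain a where "a \<in> ?S c" "x = \<Phi> b a" by blast
        then show "x \<in> \<Phi> b ` {a\<in>?S c. g a = v}" using x by (intro image_eqI[of x _ a]) (auto simp: g_def)
      next
        fix x assume "x \<in> \<Phi> b ` {a\<in>?S c. g a = v}"
        then show "x \<in> {a\<in>?S b. near a = v}" using \<Phi> b(1) by (auto simp: g_def)
      qed
      then show "bij_betw (\<Phi> b) {a\<in>?S c. g a = v} {a\<in>?A. col a = b \<and> near a = v}"
        using bij[OF c b(1)] by (auto simp: bij_betw_def inj_on_def)
    qed
    have ex: "\<exists>ps. length ps = 2 * k \<and> set ps \<subseteq> {..<k} \<times> {..<k} \<and>
      (\<forall>f rem f' rem'. (\<forall>a\<in>?S c. f a = k) \<longrightarrow> (\<forall>v<k. rem v = card {a\<in>?S c. g a = v}) \<longrightarrow>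
      runs k (?S c) near ps (f, rem) (f', rem') \<longrightarrow>
      (\<forall>a\<in>?S c. f' a < k) \<and> (\<forall>v<k. card {a\<in>?S c. f' a = v} = card {a\<in>?S c. g a = v}) \<and>
      agg obj (?S c) (\<lambda>a. ?\<delta> (near a) (f' a)) \<le> agg obj (?S c) (\<lambda>a. ?\<delta> (near a) (g a)))"
    proof (rule seq_rule_complete)
      show "finite (?S c)" by simp
      show "1 \<le> k" by (rule k)
      show "near a < k" if "a \<in> ?S c" for a using that near(1) by simp
      show "g a < k" if "a \<in> ?S c" for a using that by (rule gk)
    qed (rule zc_nonneg)
    then obtain ps where ps: "length ps = 2 * k" "set ps \<subseteq> {..<k} \<times> {..<k}" and
      run: "\<forall>f rem f' rem'. (\<forall>a\<in>?S c. f a = k) \<longrightarrow> (\<forall>v<k. rem v = card {a\<in>?S c. g a = v}) \<longrightarrow>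
      runs k (?S c) near ps (f, rem) (f', rem') \<longrightarrow>
      (\<forall>a\<in>?S c. f' a < k) \<and> (\<forall>v<k. card {a\<in>?S c. f' a = v} = card {a\<in>?S c. g a = v}) \<and>
      agg obj (?S c) (\<lambda>a. ?\<delta> (near a) (f' a)) \<le> agg obj (?S c) (\<lambda>a. ?\<delta> (near a) (g a))"
      by (elim exE conjE) (rule that; assumption)
    have bound: "agg obj (?S c) (\<lambda>a. ?D a (f' a)) \<le> agg obj (?S c) p + agg obj (?S c) q"
      if "agg obj (?S c) (\<lambda>a. ?\<delta> (near a) (f' a)) \<le> agg obj (?S c) (\<lambda>a. ?\<delta> (near a) (g a))" for f'
    proof -
      have "agg obj (?S c) (\<lambda>a. ?D a (f' a)) \<le> agg obj (?S c) (\<lambda>a. p a + 2 * ?\<delta> (near a) (f' a))"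
      proof (rule agg_mono)
        fix a
        show "?D a (f' a) \<le> p a + 2 * ?\<delta> (near a) (f' a)"
          using zc_triangle[of obj d "P a" "cen (f' a)" "cen (near a)"] by (simp add: p_def)
      qed simp
      also have "\<dots> \<le> agg obj (?S c) p + agg obj (?S c) (\<lambda>a. 2 * ?\<delta> (near a) (f' a))" by (intro agg_add) auto
      also have "agg obj (?S c) (\<lambda>a. 2 * ?\<delta> (near a) (f' a)) \<le> 2 * agg obj (?S c) (\<lambda>a. ?\<delta> (near a) (f' a))"
        by (intro agg_cmult) auto
      also have "\<dots> \<le> 2 * agg obj (?S c) (\<lambda>a. ?\<delta> (near a) (g a))" using that by simp
      also have "\<dots> = 2 * agg obj (?S c) (\<lambda>a. 1 / 2 * (2 * ?\<delta> (near a) (g a)))" by simp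
      also have "\<dots> \<le> 2 * (1 / 2 * agg obj (?S c) (\<lambda>a. 2 * ?\<delta> (near a) (g a)))"
        by (intro mult_left_mono agg_cmult) auto
      also have "\<dots> \<le> agg obj (?S c) q" using \<delta>g by (auto intro!: agg_mono)
      finally show ?thesis by simp
    qed
    show ?thesis
    proof (intro exI[of _ ps] conjI[OF ps(1) conjI[OF ps(2)]] allI impI)
      fix f rem f' rem'
      assume as: "\<forall>a\<in>?S c. f a = k" "\<forall>v<k. rem v = card {a\<in>?A. col a = b \<and> near a = v}"
        "runs k (?S c) near ps (f, rem) (f', rem')"
      note r = run[unfolded cnt, THEN spec, THEN spec, THEN spec, THEN spec, THEN mp, THEN mp, THEN mp, OF as]
      show "(\<forall>a\<in>?S c. f' a < k) \<and>
        (\<forall>v<k. card {a\<in>?S c. f' a = v} = card {a\<in>?A. col a = b \<and> near a = v}) \<and>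
        agg obj (?S c) (\<lambda>a. ?D a (f' a)) \<le> agg obj (?S c) p + agg obj (?S c) q"
        using r bound by blast
    qed
  qed
  then show ?thesis using total b(1) h0 by (intro exI[of _ b] conjI exI[of _ p] exI[of _ q]) (auto simp: p_def q_def)
qed

subsection \<open>Greedy pools of centers\<close>

definition pool_dist :: "objective \<Rightarrow> nat \<Rightarrow> (nat \<Rightarrow> point) \<Rightarrow> nat set \<Rightarrow> nat \<Rightarrow> real" where
  "pool_dist obj d P T a = Min ((\<lambda>t. zc obj d (P a) (P t)) ` T)"

lemma pool_dist_le: "finite T \<Longrightarrow> t \<in> T \<Longrightarrow> pool_dist obj d P T a \<le> zc obj d (P a) (P t)"
  by (simp add: pool_dist_def)

lemma pool_dist_attained: "finite T \<Longrightarrow> T \<noteq> {} \<Longrightarrow> \<exists>t\<in>T. pool_dist obj d P T a = zc obj d (P a) (P t)"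
  unfolding pool_dist_def by (metis (no_types, lifting) Min_in finite_imageI image_iff image_is_empty)

lemma pool_dist_antimono: "finite T' \<Longrightarrow> T \<subseteq> T' \<Longrightarrow> T \<noteq> {} \<Longrightarrow> pool_dist obj d P T' a \<le> pool_dist obj d P T a"
  unfolding pool_dist_def by (intro Min_antimono) auto

lemma pool_dist_insert:
  "finite T \<Longrightarrow> T \<noteq> {} \<Longrightarrow>
    pool_dist obj d P (insert t T) a = min (zc obj d (P a) (P t)) (pool_dist obj d P T a)"
  by (simp add: pool_dist_def)

text \<open>Two points per round: a farthest point, as in farthest-first traversal, controls the
  largest distance, and the best further point decreases the sum.\<close>

definition pool_step :: "objective \<Rightarrow> nat \<Rightarrow> (nat \<Rightarrow> point) \<Rightarrow> nat \<Rightarrow> nat set \<Rightarrow> nat set \<Rightarrow> bool" where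
  "pool_step obj d P n T T' \<longleftrightarrow> (\<exists>f<n. \<exists>t<n. T' = insert t (insert f T) \<and>
    (\<forall>a<n. pool_dist obj d P T a \<le> pool_dist obj d P T f) \<and>
    (\<forall>t'<n. (\<Sum>a<n. pool_dist obj d P T' a) \<le> (\<Sum>a<n. pool_dist obj d P (insert t' (insert f T)) a)))"

lemma half_power: "k \<ge> 1 \<Longrightarrow> (1 - 1 / real k) ^ (k * L) \<le> 1 / 2 ^ L"
proof -
  assume k: "k \<ge> 1"
  have "(1 - 1 / real k) ^ k \<le> exp (- 1 / real k) ^ k"
    using k exp_ge_add_one_self[of "- 1 / real k"] by (intro power_mono) auto
  also have "\<dots> = exp (- 1)" using k by (simp flip: exp_of_nat_mult)
  also have "\<dots> \<le> 1 / 2"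
    using exp_ge_add_one_self[of 1] by (simp add: exp_minus field_simps)
  finally have "((1 - 1 / real k) ^ k) ^ L \<le> (1 / 2) ^ L"
    using k by (intro power_mono) auto
  then show ?thesis by (simp add: power_mult power_one_over)
qed

text \<open>The first \<open>k\<close> rounds bring every distance below 4 times the largest
  reference cost, which settles k-center. For sums this bounds the excess over 4 times the optimum
  by \<open>4 * n\<close> times the optimum; each later round shrinks it by a factor 1 - 1/k, so
  \<open>k * L\<close> rounds divide it by 2^L, leaving at most one more optimum.\<close>

lemma greedy_pool:
  assumes n: "n \<ge> 1" and k: "k \<ge> 1" and cl: "\<And>a. a < n \<Longrightarrow> cl a < k"
    and T0: "T 0 = {0}" and step: "\<And>i. i < k + k * L \<Longrightarrow> pool_step obj d P n (T i) (T (Suc i))"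
    and L: "4 * n \<le> 2 ^ L"
  shows "agg obj {..<n} (pool_dist obj d P (T (k + k * L))) \<le>
    5 * agg obj {..<n} (\<lambda>a. zc obj d (P a) (\<nu> (cl a)))"
proof -
  let ?A = "{..<n}" and ?N = "k + k * L"
  let ?pd = "pool_dist obj d P" and ?O = "\<lambda>a. zc obj d (P a) (\<nu> (cl a))"
  let ?F = "\<lambda>T. \<Sum>a<n. ?pd T a"
  have Tn: "T i \<subseteq> ?A \<and> 0 \<in> T i" if "i \<le> ?N" for i
    using that
  proof (induction i)
    case (Suc i)
    then show ?case using step[of i] by (auto simp: pool_step_def)
  qed (use T0 n in auto)
  then have fin: "finite (T i)" "T i \<noteq> {}" if "i \<le> ?N" for i
    using that finite_subset[of "T i" ?A] by auto
  have mono: "T i \<subseteq> T j" if "i \<le> j" "j \<le> ?N" for i j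
    using that
  proof (induction j)
    case (Suc j)
    then have "T j \<subseteq> T (Suc j)" using step[of j] by (auto simp: pool_step_def)
    then show ?case using Suc by (cases "i = Suc j") auto
  qed simp
  have "\<exists>f t. i < ?N \<longrightarrow> f < n \<and> t < n \<and> T (Suc i) = insert t (insert f (T i)) \<and>
    (\<forall>a<n. ?pd (T i) a \<le> ?pd (T i) f) \<and> (\<forall>t'<n. ?F (T (Suc i)) \<le> ?F (insert t' (insert f (T i))))" for i
  proof (cases "i < ?N")
    case True
    show ?thesis using step[OF True] unfolding pool_step_def by blast
  qed blast
  then obtain f t where ft: "\<And>i. i < ?N \<Longrightarrow> f i < n \<and> t i < n \<and> T (Suc i) = insert (t i) (insert (f i) (T i)) \<and>
    (\<forall>a<n. ?pd (T i) a \<le> ?pd (T i) (f i)) \<and> (\<forall>t'<n. ?F (T (Suc i)) \<le> ?F (insert t' (insert (f i) (T i))))"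
    by metis
  have kN: "k \<le> ?N" by simp
  \<comment> \<open>The pigeonhole principle: of the first \<open>k\<close> farthest points and a
    point still too far away, two lie in the same reference cluster and are therefore close, yet the
    earlier one was in the pool when the later one was far from it.\<close>
  have far: "?pd (T k) a \<le> 4 * M" if M: "\<And>a. a < n \<Longrightarrow> ?O a \<le> M" and a: "a < n" for M a
  proof (rule ccontr)
    assume "\<not> ?pd (T k) a \<le> 4 * M"
    then have gt: "4 * M < ?pd (T k) a" by simp
    define F where "F i = (if i < k then f i else a)" for i
    have Fn: "F i < n" for i using ft[of i] a by (auto simp: F_def)
    have Fgt: "4 * M < ?pd (T i) (F i)" if "i \<le> k" for i
    proof (cases "i < k")
      case True
      have "?pd (T k) a \<le> ?pd (T i) a"
        using that fin[of k] fin[of i] mono[of i k] by (intro pool_dist_antimono) auto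
      also have "\<dots> \<le> ?pd (T i) (f i)" using ft[of i] True a by auto
      finally show ?thesis using gt True by (simp add: F_def)
    next
      case False
      then show ?thesis using gt that by (simp add: F_def)
    qed
    have "\<not> inj_on (\<lambda>i. cl (F i)) {..k}"
    proof
      assume inj: "inj_on (\<lambda>i. cl (F i)) {..k}"
      have "(\<lambda>i. cl (F i)) ` {..k} \<subseteq> {..<k}" using cl Fn by auto
      then show False using card_inj_on_le[OF inj, of "{..<k}"] by simp
    qed
    then obtain i j where ij: "i < j" "j \<le> k" "cl (F i) = cl (F j)"
      unfolding inj_on_def by (metis atMost_iff linorder_neqE_nat)
    have "F i \<in> T (Suc i)" using ft[of i] ij by (auto simp: F_def)
    then have "F i \<in> T j" using mono[of "Suc i" j] ij by auto
    then have "?pd (T j) (F j) \<le> zc obj d (P (F j)) (P (F i))"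
      using fin[of j] ij by (intro pool_dist_le) auto
    also have "\<dots> \<le> 2 * (?O (F j) + ?O (F i))"
      using zc_triangle[of obj d "P (F j)" "P (F i)" "\<nu> (cl (F j))"] ij(3) by (simp add: zc_commute)
    also have "\<dots> \<le> 4 * M" using M[OF Fn[of j]] M[OF Fn[of i]] by simp
    finally show False using Fgt[of j] ij by simp
  qed
  show ?thesis
  proof (cases "obj = K_Center")
    case True
    let ?M = "agg K_Center ?A ?O"
    have M0: "0 \<le> ?M" by (intro agg_nonneg) auto
    have "?pd (T ?N) a \<le> 5 * ?M" if "a < n" for a
    proof -
      have "?pd (T ?N) a \<le> ?pd (T k) a"
        using fin[of k] fin[of ?N] mono[of k ?N] by (intro pool_dist_antimono) auto
      also have "\<dots> \<le> 4 * ?M" using that agg_center_ge[of ?A _ ?O] by (intro far) auto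
      finally show ?thesis using M0 by simp
    qed
    then show ?thesis using True M0 by (simp add: agg_le_iff_center)
  next
    case False
    define OPT where "OPT = (\<Sum>a<n. ?O a)"
    have O0: "OPT \<ge> 0" by (simp add: OPT_def sum_nonneg)
    \<comment> \<open>Input points can serve as centers: the member of a cluster closest to its
      center costs every other member at most 2 + 2 times its own cost.\<close>
    have rep: "\<exists>t<n. \<forall>a<n. cl a = j \<longrightarrow> zc obj d (P a) (P t) \<le> 4 * ?O a" for j
    proof (cases "\<exists>a<n. cl a = j")
      case True
      let ?C = "{a. a < n \<and> cl a = j}"
      have C: "finite ?C" "?C \<noteq> {}" using True by auto
      let ?t = "arg_min_on ?O ?C"
      have t: "?t \<in> ?C" "\<And>a. a \<in> ?C \<Longrightarrow> ?O ?t \<le> ?O a"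
        using arg_min_if_finite[OF C, of ?O] by (auto simp: not_less)
      have "zc obj d (P a) (P ?t) \<le> 4 * ?O a" if a: "a < n" "cl a = j" for a
        using zc_triangle[of obj d "P a" "P ?t" "\<nu> j"] t(1) t(2)[of a] a by (simp add: zc_commute)
      then show ?thesis using t(1) by blast
    next
      case False
      then show ?thesis using n by (intro exI[of _ 0]) auto
    qed
    obtain \<tau> where \<tau>: "\<And>j. \<tau> j < n" "\<And>j a. a < n \<Longrightarrow> cl a = j \<Longrightarrow> zc obj d (P a) (P (\<tau> j)) \<le> 4 * ?O a"
      using rep by metis
    \<comment> \<open>Inserting the representative of cluster \<open>j\<close> would save the excess
      of that cluster over 4 times its cost, and the greedy choice saves at least as much. Summed
      over the \<open>k\<close> clusters, one round saves a fraction 1/k of the whole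
      excess.\<close>
    have dec: "?F (T (Suc i)) - 4 * OPT \<le> (1 - 1 / real k) * (?F (T i) - 4 * OPT)" if i: "i < ?N" for i
    proof -
      have le: "?F (T (Suc i)) \<le> (\<Sum>a<n. min (zc obj d (P a) (P (\<tau> j))) (?pd (T i) a))" for j
      proof -
        have "?F (T (Suc i)) \<le> ?F (insert (\<tau> j) (insert (f i) (T i)))" using ft[OF i] \<tau>(1) by blast
        also have "\<dots> \<le> ?F (insert (\<tau> j) (T i))"
          using fin[of i] i by (intro sum_mono pool_dist_antimono) auto
        finally show ?thesis using fin[of i] i by (simp add: pool_dist_insert)
      qed
      have j: "(\<Sum>a\<in>{a\<in>?A. cl a = j}. ?pd (T i) a - 4 * ?O a) \<le> ?F (T i) - ?F (T (Suc i))" for j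
      proof -
        have "(\<Sum>a\<in>{a\<in>?A. cl a = j}. ?pd (T i) a - 4 * ?O a) \<le>
            (\<Sum>a\<in>{a\<in>?A. cl a = j}. ?pd (T i) a - min (zc obj d (P a) (P (\<tau> j))) (?pd (T i) a))"
        proof (rule sum_mono)
          fix a assume "a \<in> {a\<in>?A. cl a = j}"
          then have "zc obj d (P a) (P (\<tau> j)) \<le> 4 * ?O a" using \<tau>(2) by auto
          then show "?pd (T i) a - 4 * ?O a \<le> ?pd (T i) a - min (zc obj d (P a) (P (\<tau> j))) (?pd (T i) a)"
            by linarith
        qed
        also have "\<dots> \<le> (\<Sum>a<n. ?pd (T i) a - min (zc obj d (P a) (P (\<tau> j))) (?pd (T i) a))"
          by (intro sum_mono2) auto
        also have "\<dots> \<le> ?F (T i) - ?F (T (Suc i))" using le[of j] by (simp add: sum_subtractf)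
        finally show ?thesis .
      qed
      have "?F (T i) - 4 * OPT = (\<Sum>a<n. ?pd (T i) a - 4 * ?O a)"
        by (simp add: OPT_def sum_subtractf sum_distrib_left)
      also have "\<dots> = (\<Sum>j<k. \<Sum>a\<in>{a\<in>?A. cl a = j}. ?pd (T i) a - 4 * ?O a)"
        using cl by (intro sum.group[symmetric]) auto
      also have "\<dots> \<le> (\<Sum>j<k. ?F (T i) - ?F (T (Suc i)))" using j by (intro sum_mono)
      finally have "?F (T i) - 4 * OPT \<le> real k * (?F (T i) - ?F (T (Suc i)))" by simp
      then have "(?F (T i) - 4 * OPT) / real k \<le> ?F (T i) - ?F (T (Suc i))"
        using k by (simp add: divide_le_eq mult.commute)
      then show ?thesis by (simp add: left_diff_distrib)
    qed
    have k1: "0 \<le> 1 - 1 / real k" using k by simp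
    have "?F (T (k + i)) - 4 * OPT \<le> (1 - 1 / real k) ^ i * (?F (T k) - 4 * OPT)" if "i \<le> k * L" for i
      using that
    proof (induction i)
      case (Suc i)
      have "?F (T (k + Suc i)) - 4 * OPT \<le> (1 - 1 / real k) * (?F (T (k + i)) - 4 * OPT)"
        using dec[of "k + i"] Suc.prems by simp
      also have "\<dots> \<le> (1 - 1 / real k) * ((1 - 1 / real k) ^ i * (?F (T k) - 4 * OPT))"
        using Suc k1 by (intro mult_left_mono) auto
      finally show ?case by simp
    qed simp
    from this[of "k * L"]
    have "?F (T ?N) - 4 * OPT \<le> (1 - 1 / real k) ^ (k * L) * (?F (T k) - 4 * OPT)" by simp
    also have "\<dots> \<le> (1 - 1 / real k) ^ (k * L) * (4 * real n * OPT)"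
    proof (rule mult_left_mono)
      have "?O a \<le> OPT" if "a < n" for a
        unfolding OPT_def using that by (intro member_le_sum) auto
      then have "?F (T k) \<le> (\<Sum>a<n. 4 * OPT)" by (intro sum_mono far) auto
      then show "?F (T k) - 4 * OPT \<le> 4 * real n * OPT" using O0 by simp
    qed (use k1 in simp)
    also have "\<dots> \<le> 1 / 2 ^ L * (4 * real n * OPT)"
      using half_power[OF k, of L] O0 by (intro mult_right_mono) auto
    also have "\<dots> \<le> OPT"
    proof -
      have "real (4 * n) \<le> real (2 ^ L)" using L by (simp only: of_nat_le_iff)
      then have "4 * real n * OPT \<le> 2 ^ L * OPT" using O0 by (intro mult_right_mono) auto
      then show ?thesis by (simp add: divide_le_eq mult.commute)
    qed
    finally have "?F (T ?N) \<le> 5 * OPT" by simp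
    then show ?thesis using False by (simp add: agg_def OPT_def)
  qed
qed

text \<open>26 = 6 + 4 * 5: a reference center is replaced by the closest pool point, which is no
  farther from it than the pool point next to \<open>a\<close>. The 5 is the guarantee of the
  pool.\<close>

lemma pool_centers:
  assumes T: "finite T" "T \<noteq> {}"
    and le: "agg obj {..<n} (pool_dist obj d P T) \<le> 5 * agg obj {..<n} (\<lambda>a. zc obj d (P a) (\<nu> (cl a)))"
  shows "\<exists>\<tau>. (\<forall>j. \<tau> j \<in> T) \<and> agg obj {..<n} (\<lambda>a. zc obj d (P a) (P (\<tau> (cl a)))) \<le>
    26 * agg obj {..<n} (\<lambda>a. zc obj d (P a) (\<nu> (cl a)))"
proof -
  let ?O = "\<lambda>a. zc obj d (P a) (\<nu> (cl a))"
  define \<tau> where "\<tau> j = arg_min_on (\<lambda>t. zc obj d (P t) (\<nu> j)) T" for j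
  have \<tau>: "\<tau> j \<in> T" "\<And>t. t \<in> T \<Longrightarrow> zc obj d (P (\<tau> j)) (\<nu> j) \<le> zc obj d (P t) (\<nu> j)" for j
    using arg_min_if_finite[OF T, of "\<lambda>t. zc obj d (P t) (\<nu> j)"] by (auto simp: \<tau>_def not_less)
  have "zc obj d (P a) (P (\<tau> (cl a))) \<le> 6 * ?O a + 4 * pool_dist obj d P T a" for a
  proof -
    obtain t where t: "t \<in> T" "pool_dist obj d P T a = zc obj d (P a) (P t)"
      using pool_dist_attained[OF T] by blast
    have "zc obj d (P a) (P (\<tau> (cl a))) \<le> 2 * (?O a + zc obj d (P (\<tau> (cl a))) (\<nu> (cl a)))"
      using zc_triangle[of obj d "P a" "P (\<tau> (cl a))" "\<nu> (cl a)"] by (simp add: zc_commute)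
    moreover have "zc obj d (P (\<tau> (cl a))) (\<nu> (cl a)) \<le> zc obj d (P t) (\<nu> (cl a))" using \<tau>(2) t by blast
    moreover have "zc obj d (P t) (\<nu> (cl a)) \<le> 2 * (zc obj d (P a) (P t) + ?O a)"
      using zc_triangle[of obj d "P t" "\<nu> (cl a)" "P a"] by (simp add: zc_commute)
    ultimately show ?thesis using t(2) by argo
  qed
  then have "agg obj {..<n} (\<lambda>a. zc obj d (P a) (P (\<tau> (cl a)))) \<le>
      agg obj {..<n} (\<lambda>a. 6 * ?O a + 4 * pool_dist obj d P T a)" by (intro agg_mono) auto
  also have "\<dots> \<le> agg obj {..<n} (\<lambda>a. 6 * ?O a) + agg obj {..<n} (\<lambda>a. 4 * pool_dist obj d P T a)"
    by (intro agg_add) auto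
  also have "\<dots> \<le> 6 * agg obj {..<n} ?O + 4 * agg obj {..<n} (pool_dist obj d P T)"
    by (intro add_mono agg_cmult) auto
  finally show ?thesis using le \<tau>(1) by (intro exI[of _ \<tau>]) auto
qed

section \<open>Programs for centers and distances\<close>

abbreviation "nv x \<equiv> NRead x (NConst 0)"
abbreviation "rv x \<equiv> RRead x (NConst 0)"
abbreviation "SN x e \<equiv> LN x (NConst 0) e"
abbreviation "SR x e \<equiv> LR x (NConst 0) e"

text \<open>Naturals cannot be multiplied on the machine; a multiple by a constant of the program is
  unrolled into additions.\<close>

primrec kmul :: "nat \<Rightarrow> nexp \<Rightarrow> nexp" where
  "kmul 0 e = NConst 0"
| "kmul (Suc c) e = NPlus e (kmul c e)"

lemma nval_kmul [simp]: "nval (kmul c e) s = c * nval e s"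
  and nvars_kmul [simp]: "nvars (kmul c e) = (if c = 0 then {} else nvars e)"
  by (induction c) auto

definition NEq :: "nexp \<Rightarrow> nexp \<Rightarrow> bexp" where
  "NEq e f = BAnd (BNot (NLess e f)) (BNot (NLess f e))"

lemma bval_NEq [simp]: "bval (NEq e f) s \<longleftrightarrow> nval e s = nval f s"
  and bvars_NEq [simp]: "bvars (NEq e f) = nvars e \<union> nvars f"
  by (auto simp: NEq_def)

lemma den_For_all:
  assumes "nval e s = N"
    and "\<And>j s'. j < N \<Longrightarrow> agree (insert x (nw c)) (rw c) s s' \<Longrightarrow> \<forall>j'<j. Q j' s' \<Longrightarrow>
      Q j (den c (nwrite x i j s')) \<and> (\<forall>j'<j. Q j' (den c (nwrite x i j s')))"
  shows "\<forall>j<N. Q j (den (LFor x i e c) s)"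
  by (rule den_For[where I = "\<lambda>M s'. \<forall>j<M. Q j s'"]) (use assms in \<open>auto simp: less_Suc_eq\<close>)

text \<open>The row offsets \<open>a * d\<close> are tabulated in \<open>''md''\<close>, since
  \<open>d\<close> is not a constant of the program. The \<open>n + k\<close> entries cover the rows
  of the points and those of the centers.\<close>

definition env :: "nat \<Rightarrow> nat \<Rightarrow> nat \<Rightarrow> nat \<Rightarrow> (nat \<Rightarrow> point) \<Rightarrow> (nat \<Rightarrow> nat) \<Rightarrow> state \<Rightarrow> bool" where
  "env n d l k P col s \<longleftrightarrow> nmem s ''n'' 0 = n \<and> nmem s ''d'' 0 = d \<and> nmem s ''l'' 0 = l \<and>
     (\<forall>a<n. nmem s ''color'' a = col a) \<and> (\<forall>a<n. \<forall>i<d. rmem s ''point'' (a * d + i) = P a i) \<and>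
     (\<forall>a<n+k. nmem s ''md'' a = a * d)"

lemma envD:
  assumes "env n d l k P col s"
  shows "nmem s ''n'' 0 = n" "nmem s ''d'' 0 = d" "nmem s ''l'' 0 = l"
    "a < n \<Longrightarrow> nmem s ''color'' a = col a" "a < n \<Longrightarrow> i < d \<Longrightarrow> rmem s ''point'' (a * d + i) = P a i"
    "a < n + k \<Longrightarrow> nmem s ''md'' a = a * d"
  using assms by (auto simp: env_def)

lemma env_agree:
  "env n d l k P col s \<Longrightarrow> agree A B s s' \<Longrightarrow> A \<inter> {''n'', ''d'', ''l'', ''color'', ''md''} = {} \<Longrightarrow>
    ''point'' \<notin> B \<Longrightarrow> env n d l k P col s'"
  by (simp add: env_def agree_def)

lemma env_den:
  "env n d l k P col s \<Longrightarrow> nw c \<inter> {''n'', ''d'', ''l'', ''color'', ''md''} = {} \<Longrightarrow>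
    ''point'' \<notin> rw c \<Longrightarrow> env n d l k P col (den c s)"
  by (rule env_agree[OF _ den_agree])

lemma env_nwrite: "env n d l k P col s \<Longrightarrow> x \<notin> {''n'', ''d'', ''l'', ''color'', ''md''} \<Longrightarrow>
    env n d l k P col (nwrite x i v s)"
  and env_rwrite: "env n d l k P col s \<Longrightarrow> x \<noteq> ''point'' \<Longrightarrow> env n d l k P col (rwrite x i r s)"
  by (erule env_agree[of _ _ _ _ _ _ _ "{x}" "{}"]; simp add: agree_def)
    (erule env_agree[of _ _ _ _ _ _ _ "{}" "{x}"]; simp add: agree_def)

definition row_table :: "nat \<Rightarrow> lp" where
  "row_table k = SN ''t'' (NConst 0) ;;
     LFor ''a'' 0 (NPlus (nv ''n'') (NConst k))
       (LN ''md'' (nv ''a'') (nv ''t'') ;; SN ''t'' (NPlus (nv ''t'') (nv ''d'')))"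

lemma row_table_sets [simp]: "nw (row_table k) = {''t'', ''a'', ''md''}" "rw (row_table k) = {}"
  by (auto simp: row_table_def)

lemma den_row_table:
  assumes "nmem s ''n'' 0 = n" "nmem s ''d'' 0 = d"
  shows "\<forall>a<n+k. nmem (den (row_table k) s) ''md'' a = a * d"
proof -
  let ?s = "nwrite ''t'' 0 0 s"
  let ?c = "LN ''md'' (nv ''a'') (nv ''t'') ;; SN ''t'' (NPlus (nv ''t'') (nv ''d''))"
  have "nmem (den (LFor ''a'' 0 (NPlus (nv ''n'') (NConst k)) ?c) ?s) ''t'' 0 = (n + k) * d \<and>
      (\<forall>a<n+k. nmem (den (LFor ''a'' 0 (NPlus (nv ''n'') (NConst k)) ?c) ?s) ''md'' a = a * d)"
  proof (rule den_For[where I = "\<lambda>j s'. nmem s' ''t'' 0 = j * d \<and> (\<forall>a<j. nmem s' ''md'' a = a * d)"])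
    fix j s' assume "agree (insert ''a'' (nw ?c)) (rw ?c) ?s s'"
      and I: "nmem s' ''t'' 0 = j * d \<and> (\<forall>a<j. nmem s' ''md'' a = a * d)"
    note ag = agree_nmem[OF this(1)]
    show "nmem (den ?c (nwrite ''a'' 0 j s')) ''t'' 0 = Suc j * d \<and>
        (\<forall>a<Suc j. nmem (den ?c (nwrite ''a'' 0 j s')) ''md'' a = a * d)"
      using I assms by (auto simp: ag less_Suc_eq)
  qed (use assms in auto)
  then show ?thesis by (simp add: row_table_def)
qed

definition zdist :: "objective \<Rightarrow> string \<Rightarrow> nexp \<Rightarrow> string \<Rightarrow> nexp \<Rightarrow> lp" where
  "zdist obj X xo Y yo = SR ''z'' (RConst 0) ;;
     LFor ''i'' 0 (nv ''d'') (SR ''z'' (RPlus (rv ''z'')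
       (RTimes (RMinus (RRead X (NPlus xo (nv ''i''))) (RRead Y (NPlus yo (nv ''i''))))
               (RMinus (RRead X (NPlus xo (nv ''i''))) (RRead Y (NPlus yo (nv ''i'')))))))  ;;
     (if obj = K_Means then LSkip else SR ''z'' (RSqrt (rv ''z'')))"

lemma zdist_sets [simp]: "nw (zdist obj X xo Y yo) = {''i''}" "rw (zdist obj X xo Y yo) = {''z''}"
  by (auto simp: zdist_def)

lemma den_zdist:
  assumes d: "nmem s ''d'' 0 = d" and vs: "''i'' \<notin> nvars xo" "''i'' \<notin> nvars yo" "X \<noteq> ''z''" "Y \<noteq> ''z''"
    and x: "\<And>i. i < d \<Longrightarrow> rmem s X (nval xo s + i) = x i"
    and y: "\<And>i. i < d \<Longrightarrow> rmem s Y (nval yo s + i) = y i"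
  shows "rmem (den (zdist obj X xo Y yo) s) ''z'' 0 = zc obj d x y"
proof -
  let ?c = "SR ''z'' (RPlus (rv ''z'')
       (RTimes (RMinus (RRead X (NPlus xo (nv ''i''))) (RRead Y (NPlus yo (nv ''i''))))
               (RMinus (RRead X (NPlus xo (nv ''i''))) (RRead Y (NPlus yo (nv ''i''))))))"
  let ?s = "rwrite ''z'' 0 0 s"
  have "rmem (den (LFor ''i'' 0 (nv ''d'') ?c) ?s) ''z'' 0 = (\<Sum>i<d. (x i - y i)\<^sup>2)"
  proof (rule den_For[where I = "\<lambda>j s'. rmem s' ''z'' 0 = (\<Sum>i<j. (x i - y i)\<^sup>2)"])
    fix j s' assume j: "j < d" and ag: "agree (insert ''i'' (nw ?c)) (rw ?c) ?s s'"
      and I: "rmem s' ''z'' 0 = (\<Sum>i<j. (x i - y i)\<^sup>2)"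
    have e: "nval e (nwrite ''i'' 0 j s') = nval e s" if "''i'' \<notin> nvars e" for e
      by (rule nval_cong) (use that agree_nmem[OF ag] in auto)
    have "rmem s' X = rmem s X" "rmem s' Y = rmem s Y"
      using agree_rmem[OF ag] vs by auto
    then show "rmem (den ?c (nwrite ''i'' 0 j s')) ''z'' 0 = (\<Sum>i<Suc j. (x i - y i)\<^sup>2)"
      using I x[OF j] y[OF j] e vs by (simp add: power2_eq_square)
  qed (use d in auto)
  then show ?thesis by (simp add: zdist_def zc_def sqdist_def)
qed

definition center_prog :: "nat \<Rightarrow> nat \<Rightarrow> lp" where
  "center_prog k m = LFor ''j'' 0 (NConst k) (LFor ''i'' 0 (nv ''d'')
     (SR ''z'' (RConst 0) ;; SR ''w'' (RConst 0) ;;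
      LFor ''t'' 0 (NConst m)
        (LIf (NLess (NRead ''g'' (NPlus (kmul m (nv ''j'')) (nv ''t''))) (nv ''np''))
           (SR ''z'' (RPlus (rv ''z'') (RRead ''point'' (NPlus (NRead ''md'' (NRead ''pool''
              (NRead ''g'' (NPlus (kmul m (nv ''j'')) (nv ''t''))))) (nv ''i'')))) ;;
            SR ''w'' (RPlus (rv ''w'') (RConst 1)))
           LSkip) ;;
      LR ''cen'' (NPlus (NRead ''md'' (nv ''j'')) (nv ''i'')) (RDivide (rv ''z'') (rv ''w''))))"

lemma center_prog_sets [simp]:
  "nw (center_prog k m) = {''j'', ''i'', ''t''}" "rw (center_prog k m) = {''z'', ''w'', ''cen''}"
  by (auto simp: center_prog_def)

lemma row_index_inj: "i < d \<Longrightarrow> i' < d \<Longrightarrow> a * d + i = a' * d + i' \<longleftrightarrow> a = a' \<and> i = (i'::nat)"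
  by (metis add.commute add_right_imp_eq div_mult_self3 div_less add_cancel_right_left gr_implies_not0)

lemma den_center_prog:
  assumes env: "env n d l k P col s" and np: "nmem s ''np'' 0 = np"
    and pool: "\<And>x. x < np \<Longrightarrow> nmem s ''pool'' x < n"
  shows "\<forall>j<k. \<forall>i<d. rmem (den (center_prog k m) s) ''cen'' (j * d + i) =
    digit_center np m (\<lambda>x. P (nmem s ''pool'' x)) (nmem s ''g'') j i"
proof -
  let ?P = "\<lambda>x. P (nmem s ''pool'' x)" and ?g = "nmem s ''g''"
  let ?t = "LIf (NLess (NRead ''g'' (NPlus (kmul m (nv ''j'')) (nv ''t''))) (nv ''np''))
           (SR ''z'' (RPlus (rv ''z'') (RRead ''point'' (NPlus (NRead ''md'' (NRead ''pool''
              (NRead ''g'' (NPlus (kmul m (nv ''j'')) (nv ''t''))))) (nv ''i'')))) ;;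
            SR ''w'' (RPlus (rv ''w'') (RConst 1)))
           LSkip"
  let ?i = "SR ''z'' (RConst 0) ;; SR ''w'' (RConst 0) ;;
      LFor ''t'' 0 (NConst m) ?t ;;
      LR ''cen'' (NPlus (NRead ''md'' (nv ''j'')) (nv ''i'')) (RDivide (rv ''z'') (rv ''w''))"
  let ?Q = "\<lambda>j i s'. rmem s' ''cen'' (j * d + i) = digit_center np m ?P ?g j i"
  have inner: "rmem (den ?i s1) ''cen'' = (rmem s1 ''cen'')(j * d + i := digit_center np m ?P ?g j i)"
    if ag1: "agree {''j'', ''i'', ''t''} {''z'', ''w'', ''cen''} s s1"
      and ji: "nmem s1 ''j'' 0 = j" "nmem s1 ''i'' 0 = i" "j < k" "i < d" for s1 i j
  proof -
    let ?s = "rwrite ''w'' 0 0 (rwrite ''z'' 0 0 s1)"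
    let ?h = "\<lambda>t. ?g (m * j + t)"
    let ?s2 = "den (LFor ''t'' 0 (NConst m) ?t) ?s"
    have "rmem ?s2 ''z'' 0 = (\<Sum>t<m. if ?h t < np then ?P (?h t) i else 0) \<and>
        rmem ?s2 ''w'' 0 = real (\<Sum>t<m. if ?h t < np then 1 else 0)"
    proof (rule den_For[where I = "\<lambda>M s'. rmem s' ''z'' 0 = (\<Sum>t<M. if ?h t < np then ?P (?h t) i else 0) \<and>
        rmem s' ''w'' 0 = real (\<Sum>t<M. if ?h t < np then 1 else 0)"])
      fix t s' assume t: "t < m" and ag: "agree (insert ''t'' (nw ?t)) (rw ?t) ?s s'"
        and I: "rmem s' ''z'' 0 = (\<Sum>t<t. if ?h t < np then ?P (?h t) i else 0) \<and>
          rmem s' ''w'' 0 = real (\<Sum>t<t. if ?h t < np then 1 else 0)"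
      have vals: "nmem s' ''g'' = ?g" "nmem s' ''np'' = nmem s ''np''" "nmem s' ''pool'' = nmem s ''pool''"
        "nmem s' ''md'' = nmem s ''md''" "rmem s' ''point'' = rmem s ''point''" "nmem s' ''j'' 0 = j" "nmem s' ''i'' 0 = i"
        using ji by (simp_all add: agree_nmem[OF ag] agree_rmem[OF ag] agree_nmem[OF ag1] agree_rmem[OF ag1])
      have "rmem s ''point'' (nmem s ''md'' (nmem s ''pool'' x) + i) = ?P x i" if "x < np" for x
        using envD(5)[OF env pool[OF that] ji(4)] envD(6)[OF env, of "nmem s ''pool'' x"] pool[OF that] by simp
      then show "rmem (den ?t (nwrite ''t'' 0 t s')) ''z'' 0 = (\<Sum>t<Suc t. if ?h t < np then ?P (?h t) i else 0) \<and>
          rmem (den ?t (nwrite ''t'' 0 t s')) ''w'' 0 = real (\<Sum>t<Suc t. if ?h t < np then 1 else 0)"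
        using I np by (simp add: vals)
    qed auto
    moreover have "nmem ?s2 ''j'' 0 = j" "nmem ?s2 ''i'' 0 = i" "nmem ?s2 ''md'' j = j * d"
      "rmem ?s2 ''cen'' = rmem s1 ''cen''"
      using ji envD(6)[OF env, of j]
      by (simp_all add: nmem_den rmem_den agree_nmem[OF ag1] del: den.simps)
    ultimately show ?thesis by (simp add: digit_center_def del: den.simps(6))
  qed
  have "\<forall>j<k. \<forall>i<d. ?Q j i (den (LFor ''j'' 0 (NConst k) (LFor ''i'' 0 (nv ''d'') ?i)) s)"
  proof (rule den_For_all)
    fix j s' assume j: "j < k" and ag: "agree (insert ''j'' (nw (LFor ''i'' 0 (nv ''d'') ?i))) (rw (LFor ''i'' 0 (nv ''d'') ?i)) s s'"
      and Q: "\<forall>j'<j. \<forall>i<d. ?Q j' i s'"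
    let ?s = "nwrite ''j'' 0 j s'"
    let ?s1 = "den (LFor ''i'' 0 (nv ''d'') ?i) ?s"
    have dd: "nmem ?s ''d'' 0 = d" using envD(2)[OF env] by (simp add: agree_nmem[OF ag])
    have "(\<forall>i<d. ?Q j i ?s1) \<and> (\<forall>j'<j. \<forall>i<d. ?Q j' i ?s1)"
    proof (rule den_For[where I = "\<lambda>M s1. (\<forall>i<M. ?Q j i s1) \<and> (\<forall>j'<j. \<forall>i<d. ?Q j' i s1)"])
      fix i s1 assume i: "i < d" and ag1: "agree (insert ''i'' (nw ?i)) (rw ?i) ?s s1"
        and I: "(\<forall>i'<i. ?Q j i' s1) \<and> (\<forall>j'<j. \<forall>i<d. ?Q j' i s1)"
      let ?s2 = "nwrite ''i'' 0 i s1"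
      have "agree {''j'', ''i'', ''t''} {''z'', ''w'', ''cen''} s ?s2"
        using ag ag1 by (simp add: agree_def)
      then have e: "rmem (den ?i ?s2) ''cen'' = (rmem ?s2 ''cen'')(j * d + i := digit_center np m ?P ?g j i)"
        using i j ag1 by (intro inner) (simp_all add: agree_nmem[OF ag1])
      show "(\<forall>i'<Suc i. ?Q j i' (den ?i ?s2)) \<and> (\<forall>j'<j. \<forall>i<d. ?Q j' i (den ?i ?s2))"
        using I i j unfolding e by (auto simp: less_Suc_eq row_index_inj)
    qed (use dd Q in simp_all)
    then show "(\<forall>i<d. ?Q j i ?s1) \<and> (\<forall>j'<j. \<forall>i<d. ?Q j' i ?s1)" .
  qed simp
  then show ?thesis unfolding center_prog_def .
qed

definition table_prog :: "objective \<Rightarrow> nat \<Rightarrow> lp" where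
  "table_prog obj k = LFor ''a'' 0 (nv ''n'') (LFor ''j'' 0 (NConst k)
     (zdist obj ''point'' (NRead ''md'' (nv ''a'')) ''cen'' (NRead ''md'' (nv ''j'')) ;;
      LR ''D'' (NPlus (kmul k (nv ''a'')) (nv ''j'')) (rv ''z'')))"

lemma table_prog_sets [simp]:
  "nw (table_prog obj k) = {''j'', ''i'', ''a''}" "rw (table_prog obj k) = {''z'', ''D''}"
  by (auto simp: table_prog_def)

lemma den_table_prog:
  assumes env: "env n d l k P col s" and cen: "\<And>j i. j < k \<Longrightarrow> i < d \<Longrightarrow> rmem s ''cen'' (j * d + i) = cen j i"
  shows "\<forall>a<n. \<forall>j<k. rmem (den (table_prog obj k) s) ''D'' (k * a + j) = zc obj d (P a) (cen j)"
proof -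
  let ?z = "zdist obj ''point'' (NRead ''md'' (nv ''a'')) ''cen'' (NRead ''md'' (nv ''j''))"
  let ?c = "?z ;; LR ''D'' (NPlus (kmul k (nv ''a'')) (nv ''j'')) (rv ''z'')"
  let ?L = "LFor ''j'' 0 (NConst k) ?c"
  let ?Q = "\<lambda>a j s'. rmem s' ''D'' (k * a + j) = zc obj d (P a) (cen j)"
  have "\<forall>a<n. \<forall>j<k. ?Q a j (den (LFor ''a'' 0 (nv ''n'') ?L) s)"
  proof (rule den_For_all)
    fix a s' assume a: "a < n" and ag: "agree (insert ''a'' (nw ?L)) (rw ?L) s s'"
      and Q: "\<forall>a'<a. \<forall>j<k. ?Q a' j s'"
    let ?s = "nwrite ''a'' 0 a s'"
    have "(\<forall>j<k. ?Q a j (den ?L ?s)) \<and> (\<forall>a'<a. \<forall>j<k. ?Q a' j (den ?L ?s))"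
    proof (rule den_For[where I = "\<lambda>M s1. (\<forall>j<M. ?Q a j s1) \<and> (\<forall>a'<a. \<forall>j<k. ?Q a' j s1)"])
      fix j s1 assume j: "j < k" and ag1: "agree (insert ''j'' (nw ?c)) (rw ?c) ?s s1"
        and I: "(\<forall>j'<j. ?Q a j' s1) \<and> (\<forall>a'<a. \<forall>j<k. ?Q a' j s1)"
      let ?s2 = "nwrite ''j'' 0 j s1"
      have vals: "nmem ?s2 ''md'' = nmem s ''md''" "rmem ?s2 ''point'' = rmem s ''point''"
        "rmem ?s2 ''cen'' = rmem s ''cen''" "nmem ?s2 ''a'' 0 = a" "nmem ?s2 ''j'' 0 = j" "nmem ?s2 ''d'' 0 = d"
        using envD(2)[OF env]
        by (simp_all add: agree_nmem[OF ag1] agree_rmem[OF ag1] agree_nmem[OF ag] agree_rmem[OF ag])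
      have "rmem (den ?z ?s2) ''z'' 0 = zc obj d (P a) (cen j)"
        using a j envD(5,6)[OF env] cen vals by (intro den_zdist) auto
      then have e: "rmem (den ?c ?s2) ''D'' = (rmem s1 ''D'')(k * a + j := zc obj d (P a) (cen j))"
        using vals(4,5) by (simp add: nmem_den rmem_den)
      show "(\<forall>j'<Suc j. ?Q a j' (den ?c ?s2)) \<and> (\<forall>a'<a. \<forall>j<k. ?Q a' j (den ?c ?s2))"
        using I j row_index_inj[of _ k] unfolding e by (auto simp: less_Suc_eq mult.commute[of k])
    qed (use Q in simp_all)
    then show "(\<forall>j<k. ?Q a j (den ?L ?s)) \<and> (\<forall>a'<a. \<forall>j<k. ?Q a' j (den ?L ?s))" .
  qed (use envD(1)[OF env] in simp)
  then show ?thesis unfolding table_prog_def .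
qed

section \<open>Programs for assignment rules\<close>

text \<open>Digit \<open>k * k\<close> of \<open>''b''\<close> follows the thresholds and is a flat
  index into the distance table; the entry found there is the guessed radius.\<close>

definition weight_prog :: "objective \<Rightarrow> nat \<Rightarrow> lp" where
  "weight_prog obj k = SR ''th'' (RRead ''D'' (NRead ''b'' (NConst (k * k)))) ;;
     LFor ''t'' 0 (kmul k (nv ''n''))
       (if obj = K_Center
        then LIf (RLess (rv ''th'') (RRead ''D'' (nv ''t''))) (LR ''W'' (nv ''t'') (RConst 1)) (LR ''W'' (nv ''t'') (RConst 0))
        else LR ''W'' (nv ''t'') (RRead ''D'' (nv ''t'')))"

lemma weight_prog_sets [simp]: "nw (weight_prog obj k) = {''t''}" "rw (weight_prog obj k) = {''th'', ''W''}"
  by (auto simp: weight_prog_def)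

lemma den_weight_prog:
  assumes "nmem s ''n'' 0 = n" "a < n" "v < k"
  shows "rmem (den (weight_prog obj k) s) ''W'' (k * a + v) =
    rule_weight obj (\<lambda>a v. rmem s ''D'' (k * a + v)) (rmem s ''D'' (nmem s ''b'' (k * k))) a v"
proof -
  let ?th = "rmem s ''D'' (nmem s ''b'' (k * k))"
  let ?s = "rwrite ''th'' 0 ?th s"
  let ?c = "if obj = K_Center
        then LIf (RLess (rv ''th'') (RRead ''D'' (nv ''t''))) (LR ''W'' (nv ''t'') (RConst 1)) (LR ''W'' (nv ''t'') (RConst 0))
        else LR ''W'' (nv ''t'') (RRead ''D'' (nv ''t''))"
  \<comment> \<open>The table is treated as one row with index \<open>t\<close>; the row number 0 is
    a dummy.\<close>
  have "\<forall>t<k * n. rmem (den (LFor ''t'' 0 (kmul k (nv ''n'')) ?c) ?s) ''W'' t =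
      rule_weight obj (\<lambda>_ t. rmem s ''D'' t) ?th 0 t"
  proof (rule den_For_all)
    fix t s' assume "agree (insert ''t'' (nw ?c)) (rw ?c) ?s s'"
      and Q: "\<forall>t'<t. rmem s' ''W'' t' = rule_weight obj (\<lambda>_ t. rmem s ''D'' t) ?th 0 t'"
    note ag = agree_nmem[OF this(1)] agree_rmem[OF this(1)]
    have "rmem s' ''D'' = rmem s ''D''" "rmem s' ''th'' 0 = ?th" by (simp_all add: ag)
    then show "rmem (den ?c (nwrite ''t'' 0 t s')) ''W'' t = rule_weight obj (\<lambda>_ t. rmem s ''D'' t) ?th 0 t \<and>
      (\<forall>t'<t. rmem (den ?c (nwrite ''t'' 0 t s')) ''W'' t' = rule_weight obj (\<lambda>_ t. rmem s ''D'' t) ?th 0 t')"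
      using Q by (auto simp: rule_weight_def)
  qed (use assms in simp)
  moreover have "k * a + v < k * n"
  proof -
    have "k * a + v < k * Suc a" using assms by simp
    also have "\<dots> \<le> k * n" using assms by (intro mult_le_mono2) simp
    finally show ?thesis .
  qed
  ultimately show ?thesis by (simp add: weight_prog_def rule_weight_def)
qed

definition beats_test :: "nat \<Rightarrow> bexp" where
  "beats_test k = (let a = nv ''a''; u = nv ''u''; v = nv ''v''; b = NRead ''b'' (NPlus (kmul k u) v);
     L = RMinus (RRead ''W'' (NPlus (kmul k a) v)) (RRead ''W'' (NPlus (kmul k a) u));
     R = RMinus (RRead ''W'' (NPlus (kmul k b) v)) (RRead ''W'' (NPlus (kmul k b) u));
     tie = BNot (BAnd (BNot (BAnd (NLess u v) (NLess b a))) (BNot (BAnd (BNot (NLess u v)) (NLess a b))))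
     in BNot (BAnd (BNot (RLess R L)) (BNot (BAnd (BNot (RLess L R)) tie))))"

lemma bval_beats_test:
  "bval (beats_test k) s \<longleftrightarrow> beats (\<lambda>a v. rmem s ''W'' (k * a + v)) (nmem s ''u'' 0) (nmem s ''v'' 0)
     (nmem s ''a'' 0) (nmem s ''b'' (k * nmem s ''u'' 0 + nmem s ''v'' 0))"
  by (auto simp: beats_test_def beats_def Let_def)

lemma bvars_beats_test: "bvars (beats_test k) \<subseteq> {''a'', ''u'', ''v'', ''b''}"
  by (auto simp: beats_test_def Let_def split: if_splits)

definition selects_prog :: "nat \<Rightarrow> lp" where
  "selects_prog k = SN ''ok1'' (NConst 1) ;; LFor ''v'' 0 (NConst k)
     (LIf (BAnd (BNot (NEq (nv ''v'') (nv ''u'')))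
            (BAnd (NLess (NRead ''b'' (NPlus (kmul k (nv ''u'')) (nv ''v''))) (nv ''n'')) (BNot (beats_test k))))
        (SN ''ok1'' (NConst 0)) LSkip)"

lemma selects_prog_sets [simp]: "nw (selects_prog k) = {''ok1'', ''v''}" "rw (selects_prog k) = {}"
  by (auto simp: selects_prog_def)

lemma den_selects_prog:
  assumes n: "nmem s ''n'' 0 = n" and W: "\<And>a v. a < n \<Longrightarrow> v < k \<Longrightarrow> rmem s ''W'' (k * a + v) = W a v"
    and u: "nmem s ''u'' 0 = u" "u < k" and a: "nmem s ''a'' 0 = a" "a < n"
  shows "nmem (den (selects_prog k) s) ''ok1'' 0 = (if selects n k W (nmem s ''b'') u a then 1 else 0)"
proof -
  let ?s = "nwrite ''ok1'' 0 1 s"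
  let ?c = "LIf (BAnd (BNot (NEq (nv ''v'') (nv ''u'')))
            (BAnd (NLess (NRead ''b'' (NPlus (kmul k (nv ''u'')) (nv ''v''))) (nv ''n'')) (BNot (beats_test k))))
        (SN ''ok1'' (NConst 0)) LSkip"
  let ?b = "nmem s ''b''"
  let ?T = "\<lambda>v. v \<noteq> u \<longrightarrow> ?b (k * u + v) < n \<longrightarrow> beats W u v a (?b (k * u + v))"
  have "nmem (den (LFor ''v'' 0 (NConst k) ?c) ?s) ''ok1'' 0 = (if \<forall>v<k. ?T v then 1 else 0)"
  proof (rule den_For[where I = "\<lambda>M s'. nmem s' ''ok1'' 0 = (if \<forall>v<M. ?T v then 1 else 0)"])
    fix v s' assume v: "v < k" and "agree (insert ''v'' (nw ?c)) (rw ?c) ?s s'"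
      and I: "nmem s' ''ok1'' 0 = (if \<forall>v'<v. ?T v' then 1 else 0)"
    note ag = agree_nmem[OF this(2)] agree_rmem[OF this(2)]
    have vals: "nmem s' ''n'' 0 = n" "nmem s' ''b'' = ?b" "nmem s' ''u'' 0 = u" "nmem s' ''a'' 0 = a" "rmem s' ''W'' = rmem s ''W''"
      using n u a by (simp_all add: ag)
    have "beats (\<lambda>a v. rmem s ''W'' (k * a + v)) u v a (?b (k * u + v)) \<longleftrightarrow> beats W u v a (?b (k * u + v))"
      if "?b (k * u + v) < n"
      unfolding beats_def using W[OF a(2) v] W[OF a(2) u(2)] W[OF that v] W[OF that u(2)] by simp
    then show "nmem (den ?c (nwrite ''v'' 0 v s')) ''ok1'' 0 = (if \<forall>v'<Suc v. ?T v' then 1 else 0)"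
      using I by (auto simp: bval_beats_test vals less_Suc_eq)
  qed auto
  then show ?thesis by (simp add: selects_prog_def selects_def)
qed

text \<open>Every center that selects a point claims it, and the last one wins. The outcome is
  meaningful for points selected exactly once; otherwise it is left to
  \<open>check_prog\<close>.\<close>

definition threshold_prog :: "objective \<Rightarrow> nat \<Rightarrow> lp" where
  "threshold_prog obj k = weight_prog obj k ;; LFor ''a'' 0 (nv ''n'')
     (LFor ''u'' 0 (NConst k) (selects_prog k ;; LIf (NLess (NConst 0) (nv ''ok1'')) (LN ''f'' (nv ''a'') (nv ''u'')) LSkip))"

lemma threshold_prog_sets [simp]:
  "nw (threshold_prog obj k) = {''t'', ''a'', ''u'', ''v'', ''ok1'', ''f''}" "rw (threshold_prog obj k) = {''th'', ''W''}"
  by (auto simp: threshold_prog_def)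

lemma den_threshold_prog:
  assumes n: "nmem s ''n'' 0 = n" and a: "a < n" and h: "h a < k"
    "\<forall>u<k. selects n k (rule_weight obj (\<lambda>a v. rmem s ''D'' (k * a + v)) (rmem s ''D'' (nmem s ''b'' (k * k)))) (nmem s ''b'') u a
      \<longleftrightarrow> u = h a"
  shows "nmem (den (threshold_prog obj k) s) ''f'' a = h a"
proof -
  let ?W = "rule_weight obj (\<lambda>a v. rmem s ''D'' (k * a + v)) (rmem s ''D'' (nmem s ''b'' (k * k)))"
  let ?s = "den (weight_prog obj k) s"
  let ?b = "nmem s ''b''"
  let ?c = "selects_prog k ;; LIf (NLess (NConst 0) (nv ''ok1'')) (LN ''f'' (nv ''a'') (nv ''u'')) LSkip"
  let ?L = "LFor ''u'' 0 (NConst k) ?c"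
  let ?good = "\<lambda>a. h a < k \<and> (\<forall>u<k. selects n k ?W ?b u a \<longleftrightarrow> u = h a)"
  have "\<forall>a<n. ?good a \<longrightarrow> nmem (den (LFor ''a'' 0 (nv ''n'') ?L) ?s) ''f'' a = h a"
  proof (rule den_For_all)
    fix a s' assume a: "a < n" and ag: "agree (insert ''a'' (nw ?L)) (rw ?L) ?s s'"
      and Q: "\<forall>a'<a. ?good a' \<longrightarrow> nmem s' ''f'' a' = h a'"
    let ?s1 = "nwrite ''a'' 0 a s'"
    have "(?good a \<longrightarrow> h a < k \<longrightarrow> nmem (den ?L ?s1) ''f'' a = h a) \<and> (\<forall>a'. a' \<noteq> a \<longrightarrow> nmem (den ?L ?s1) ''f'' a' = nmem s' ''f'' a')"
    proof (rule den_For[where I = "\<lambda>M s2. (?good a \<longrightarrow> h a < M \<longrightarrow> nmem s2 ''f'' a = h a) \<and> (\<forall>a'. a' \<noteq> a \<longrightarrow> nmem s2 ''f'' a' = nmem s' ''f'' a')"])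
      fix u s2 assume u: "u < k" and ag1: "agree (insert ''u'' (nw ?c)) (rw ?c) ?s1 s2"
        and I: "(?good a \<longrightarrow> h a < u \<longrightarrow> nmem s2 ''f'' a = h a) \<and> (\<forall>a'. a' \<noteq> a \<longrightarrow> nmem s2 ''f'' a' = nmem s' ''f'' a')"
      let ?s3 = "nwrite ''u'' 0 u s2"
      have vals: "nmem ?s3 ''n'' 0 = n" "nmem ?s3 ''u'' 0 = u" "nmem ?s3 ''a'' 0 = a" "nmem ?s3 ''b'' = ?b" "rmem ?s3 ''W'' = rmem ?s ''W''"
        using n by (simp_all add: agree_nmem[OF ag1] agree_rmem[OF ag1] agree_nmem[OF ag] agree_rmem[OF ag] nmem_den)
      have ok: "nmem (den (selects_prog k) ?s3) ''ok1'' 0 = (if selects n k ?W ?b u a then 1 else 0)"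
        using den_selects_prog[of ?s3 n k ?W u a] vals den_weight_prog[OF n, of _ _ k obj] u a by simp
      have fr: "nmem (den (selects_prog k) ?s3) ''f'' = nmem s2 ''f''" "nmem (den (selects_prog k) ?s3) ''a'' 0 = a"
        "nmem (den (selects_prog k) ?s3) ''u'' 0 = u"
        using vals by (simp_all add: nmem_den)
      show "(?good a \<longrightarrow> h a < Suc u \<longrightarrow> nmem (den ?c ?s3) ''f'' a = h a) \<and> (\<forall>a'. a' \<noteq> a \<longrightarrow> nmem (den ?c ?s3) ''f'' a' = nmem s' ''f'' a')"
      proof (cases "selects n k ?W ?b u a")
        case True
        then have e: "nmem (den ?c ?s3) ''f'' = (nmem s2 ''f'')(a := u)" using ok fr by simp
        have "?good a \<longrightarrow> u = h a" using True u by blast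
        then show ?thesis using I unfolding e by simp
      next
        case False
        then have e: "nmem (den ?c ?s3) ''f'' = nmem s2 ''f''" using ok fr by simp
        have "?good a \<longrightarrow> u \<noteq> h a" using False u by blast
        then show ?thesis using I unfolding e less_Suc_eq by blast
      qed
    qed auto
    then show "(?good a \<longrightarrow> nmem (den ?L ?s1) ''f'' a = h a) \<and> (\<forall>a'<a. ?good a' \<longrightarrow> nmem (den ?L ?s1) ''f'' a' = h a')"
      using Q by simp
  qed (use n in \<open>simp add: nmem_den\<close>)
  then show ?thesis using a h by (simp add: threshold_prog_def)
qed

definition near_prog :: "nat \<Rightarrow> lp" where
  "near_prog k = LFor ''a'' 0 (nv ''n'') (LN ''near'' (nv ''a'') (NConst 0) ;; LFor ''v'' 0 (NConst k)
     (LIf (RLess (RRead ''D'' (NPlus (kmul k (nv ''a'')) (nv ''v''))) (RRead ''D'' (NPlus (kmul k (nv ''a'')) (NRead ''near'' (nv ''a'')))))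
       (LN ''near'' (nv ''a'') (nv ''v'')) LSkip))"

lemma near_prog_sets [simp]: "nw (near_prog k) = {''a'', ''v'', ''near''}" "rw (near_prog k) = {}"
  by (auto simp: near_prog_def)

text \<open>The least index among the closest centers is what the strict comparison in
  \<open>near_prog\<close> leaves behind. A fixed choice is needed, since cluster sizes are counted
  with it.\<close>

definition nearest :: "nat \<Rightarrow> (nat \<Rightarrow> real) \<Rightarrow> nat \<Rightarrow> nat" where
  "nearest k D a = (LEAST v. v < k \<and> (\<forall>w<k. D (k * a + v) \<le> D (k * a + w)))"

lemma nearest:
  assumes "k \<ge> 1"
  shows "nearest k D a < k \<and> (\<forall>w<k. D (k * a + nearest k D a) \<le> D (k * a + w))"
proof -
  have ne: "{..<k} \<noteq> {}" using assms by (metis lessThan_iff empty_iff less_le_trans zero_less_one)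
  have "\<exists>v<k. \<forall>w<k. D (k * a + v) \<le> D (k * a + w)"
    using arg_min_if_finite[OF finite_lessThan ne, of "\<lambda>v. D (k * a + v)"] by (meson lessThan_iff not_less)
  then show ?thesis unfolding nearest_def by (rule LeastI_ex)
qed

lemma nearest_eqI:
  assumes "v < k" "\<And>w. w < k \<Longrightarrow> D (k * a + v) \<le> D (k * a + w)" "\<And>w. w < v \<Longrightarrow> D (k * a + v) < D (k * a + w)"
  shows "nearest k D a = v"
  unfolding nearest_def by (rule Least_equality) (use assms in \<open>meson not_less order_less_le_trans\<close>)+

lemma den_near_prog:
  assumes n: "nmem s ''n'' 0 = n" and k: "k \<ge> 1"
  shows "\<forall>a<n. nmem (den (near_prog k) s) ''near'' a = nearest k (rmem s ''D'') a"
proof -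
  let ?c = "LIf (RLess (RRead ''D'' (NPlus (kmul k (nv ''a'')) (nv ''v''))) (RRead ''D'' (NPlus (kmul k (nv ''a'')) (NRead ''near'' (nv ''a'')))))
       (LN ''near'' (nv ''a'') (nv ''v'')) LSkip"
  let ?L = "LFor ''v'' 0 (NConst k) ?c"
  let ?b = "LN ''near'' (nv ''a'') (NConst 0) ;; ?L"
  let ?D = "\<lambda>a v. rmem s ''D'' (k * a + v)"
  let ?Q = "\<lambda>a x. x < k \<and> (\<forall>v<k. ?D a x \<le> ?D a v) \<and> (\<forall>v<x. ?D a x < ?D a v)"
  have "\<forall>a<n. ?Q a (nmem (den (LFor ''a'' 0 (nv ''n'') ?b) s) ''near'' a)"
  proof (rule den_For_all)
    fix a s' assume a: "a < n" and ag: "agree (insert ''a'' (nw ?b)) (rw ?b) s s'"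
      and Q: "\<forall>a'<a. ?Q a' (nmem s' ''near'' a')"
    let ?s1 = "nwrite ''near'' a 0 (nwrite ''a'' 0 a s')"
    let ?I = "\<lambda>M s2. nmem s2 ''near'' a < k \<and> (\<forall>v<M. ?D a (nmem s2 ''near'' a) \<le> ?D a v) \<and>
        (\<forall>v<nmem s2 ''near'' a. ?D a (nmem s2 ''near'' a) < ?D a v) \<and> (\<forall>a'. a' \<noteq> a \<longrightarrow> nmem s2 ''near'' a' = nmem s' ''near'' a')"
    have "?I k (den ?L ?s1)"
    proof (rule den_For[where I = ?I])
      fix v s2 assume v: "v < k" and ag1: "agree (insert ''v'' (nw ?c)) (rw ?c) ?s1 s2" and I: "?I v s2"
      have vals: "nmem s2 ''a'' 0 = a" "rmem s2 ''D'' = rmem s ''D''"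
        by (simp_all add: agree_nmem[OF ag1] agree_rmem[OF ag1] agree_rmem[OF ag])
      show "?I (Suc v) (den ?c (nwrite ''v'' 0 v s2))"
        using I v by (auto simp: vals less_Suc_eq not_less intro: less_imp_le order_trans less_le_trans)
    qed (use k in auto)
    then show "?Q a (nmem (den ?b (nwrite ''a'' 0 a s')) ''near'' a) \<and>
        (\<forall>a'<a. ?Q a' (nmem (den ?b (nwrite ''a'' 0 a s')) ''near'' a'))"
      using Q by (simp del: den.simps(6))
  qed (use n in simp)
  then have "\<forall>a<n. ?Q a (nmem (den (near_prog k) s) ''near'' a)" unfolding near_prog_def .
  then show ?thesis by (metis nearest_eqI)
qed

lemma card_filter_Suc:
  "card {a\<in>{..<Suc M}. Q a} = card {a\<in>{..<M}. Q a} + (if Q M then 1 else 0)"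
proof -
  have "{a\<in>{..<Suc M}. Q a} = (if Q M then insert M {a\<in>{..<M}. Q a} else {a\<in>{..<M}. Q a})"
    by (auto simp: less_Suc_eq)
  then show ?thesis by simp
qed

definition base_size_prog :: "nat \<Rightarrow> lp" where
  "base_size_prog k = near_prog k ;; LFor ''v'' 0 (NConst k) (LN ''S'' (nv ''v'') (NConst 0)) ;;
     LFor ''a'' 0 (nv ''n'') (LIf (NEq (NRead ''color'' (nv ''a'')) (NRead ''s'' (NConst 0)))
       (LN ''S'' (NRead ''near'' (nv ''a'')) (NPlus (NRead ''S'' (NRead ''near'' (nv ''a''))) (NConst 1))) LSkip)"

lemma base_size_prog_sets [simp]:
  "nw (base_size_prog k) = {''a'', ''v'', ''near'', ''S''}" "rw (base_size_prog k) = {}"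
  by (auto simp: base_size_prog_def)

lemma den_base_size_prog:
  assumes env: "env n d l k P col s"
  shows "\<forall>v<k. nmem (den (base_size_prog k) s) ''S'' v =
      card {a\<in>{..<n}. col a = nmem s ''s'' 0 \<and> nmem (den (base_size_prog k) s) ''near'' a = v}"
    and "nmem (den (base_size_prog k) s) ''near'' = nmem (den (near_prog k) s) ''near''"
proof -
  let ?s1 = "den (near_prog k) s"
  let ?near = "nmem ?s1 ''near''"
  let ?c1 = "LN ''S'' (nv ''v'') (NConst 0)"
  let ?s2 = "den (LFor ''v'' 0 (NConst k) ?c1) ?s1"
  let ?c = "LIf (NEq (NRead ''color'' (nv ''a'')) (NRead ''s'' (NConst 0)))
       (LN ''S'' (NRead ''near'' (nv ''a'')) (NPlus (NRead ''S'' (NRead ''near'' (nv ''a''))) (NConst 1))) LSkip"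
  let ?s3 = "den (LFor ''a'' 0 (nv ''n'') ?c) ?s2"
  have z: "\<forall>v<k. nmem ?s2 ''S'' v = 0" by (rule den_For_all) auto
  have v2: "nmem ?s2 ''near'' = ?near" "nmem ?s2 ''color'' = nmem s ''color''" "nmem ?s2 ''s'' = nmem s ''s''" "nmem ?s2 ''n'' 0 = n"
    using envD(1)[OF env] by (simp_all add: nmem_den del: den.simps)
  let ?I = "\<lambda>M s'. \<forall>v<k. nmem s' ''S'' v = card {a\<in>{..<M}. col a = nmem s ''s'' 0 \<and> ?near a = v}"
  have I: "?I n ?s3"
  proof (rule den_For[where I = ?I])
    fix a s' assume a: "a < n" and ag: "agree (insert ''a'' (nw ?c)) (rw ?c) ?s2 s'" and I: "?I a s'"
    have vals: "nmem s' ''near'' = ?near" "nmem s' ''color'' a = col a" "nmem s' ''s'' 0 = nmem s ''s'' 0"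
      using envD(4)[OF env a] by (simp_all add: agree_nmem[OF ag] v2 del: den.simps)
    show "?I (Suc a) (den ?c (nwrite ''a'' 0 a s'))"
      using I unfolding card_filter_Suc by (auto simp: vals)
  qed (use z v2 in \<open>simp_all del: den.simps\<close>)
  have n3: "nmem ?s3 ''near'' = ?near" by (simp add: nmem_den v2 del: den.simps)
  have e: "den (base_size_prog k) s = ?s3" by (simp add: base_size_prog_def)
  show "\<forall>v<k. nmem (den (base_size_prog k) s) ''S'' v =
      card {a\<in>{..<n}. col a = nmem s ''s'' 0 \<and> nmem (den (base_size_prog k) s) ''near'' a = v}"
    unfolding e n3 by (rule I)
  show "nmem (den (base_size_prog k) s) ''near'' = ?near" unfolding e n3 ..
qed

definition move_prog :: lp where
  "move_prog = LFor ''a'' 0 (nv ''n'')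
     (LIf (BAnd (NEq (NRead ''color'' (nv ''a'')) (nv ''c'')) (BAnd (NEq (NRead ''f'' (nv ''a'')) (nv ''k''))
         (BAnd (NEq (NRead ''near'' (nv ''a'')) (nv ''u'')) (NLess (NConst 0) (NRead ''rem'' (nv ''v''))))))
       (LN ''f'' (nv ''a'') (nv ''v'') ;; LN ''rem'' (nv ''v'') (NMinus (NRead ''rem'' (nv ''v'')) (NConst 1))) LSkip)"

lemma move_prog_sets [simp]: "nw move_prog = {''a'', ''f'', ''rem''}" "rw move_prog = {}"
  by (auto simp: move_prog_def)

lemma den_move_prog:
  assumes env: "env n d l k P col s" and kk: "nmem s ''k'' 0 = k" and v: "nmem s ''v'' 0 < k"
  shows "moved k {a\<in>{..<n}. col a = nmem s ''c'' 0} (nmem s ''near'') (nmem s ''u'' 0, nmem s ''v'' 0)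
    (nmem s ''f'', nmem s ''rem'') (nmem (den move_prog s) ''f'', nmem (den move_prog s) ''rem'')"
proof -
  let ?near = "nmem s ''near''" and ?f = "nmem s ''f''" and ?rem = "nmem s ''rem''"
  let ?u = "nmem s ''u'' 0" and ?v = "nmem s ''v'' 0" and ?cc = "nmem s ''c'' 0"
  let ?c = "LIf (BAnd (NEq (NRead ''color'' (nv ''a'')) (nv ''c'')) (BAnd (NEq (NRead ''f'' (nv ''a'')) (nv ''k''))
         (BAnd (NEq (NRead ''near'' (nv ''a'')) (nv ''u'')) (NLess (NConst 0) (NRead ''rem'' (nv ''v''))))))
       (LN ''f'' (nv ''a'') (nv ''v'') ;; LN ''rem'' (nv ''v'') (NMinus (NRead ''rem'' (nv ''v'')) (NConst 1))) LSkip"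
  let ?C = "\<lambda>N. {a\<in>{..<N}. col a = ?cc \<and> ?f a = k \<and> ?near a = ?u}"
  \<comment> \<open>\<open>M\<close> consists of the points moved so far: all eligible ones in order
    of their index until the remaining size of the target is used up.\<close>
  let ?I = "\<lambda>N s'. \<exists>M \<subseteq> ?C N. card M = min (card (?C N)) (?rem ?v) \<and>
      nmem s' ''f'' = (\<lambda>a. if a \<in> M then ?v else ?f a) \<and> nmem s' ''rem'' = ?rem(?v := ?rem ?v - card M)"
  have "?I n (den (LFor ''a'' 0 (nv ''n'') ?c) s)"
  proof (rule den_For[where I = ?I])
    fix a s' assume a: "a < n" and ag: "agree (insert ''a'' (nw ?c)) (rw ?c) s s'" and "?I a s'"
    then obtain M where M: "M \<subseteq> ?C a" "card M = min (card (?C a)) (?rem ?v)"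
      "nmem s' ''f'' = (\<lambda>a. if a \<in> M then ?v else ?f a)" "nmem s' ''rem'' = ?rem(?v := ?rem ?v - card M)" by blast
    have aM: "a \<notin> M" using M(1) by auto
    have finM: "finite M" using M(1) finite_subset by fastforce
    have vals: "nmem s' ''near'' = ?near" "nmem s' ''color'' a = col a" "nmem s' ''c'' 0 = ?cc" "nmem s' ''k'' 0 = k"
      "nmem s' ''u'' 0 = ?u" "nmem s' ''v'' 0 = ?v"
      using envD(4)[OF env a] kk by (simp_all add: agree_nmem[OF ag])
    let ?s' = "den ?c (nwrite ''a'' 0 a s')"
    have C: "?C (Suc a) = (if col a = ?cc \<and> ?f a = k \<and> ?near a = ?u then insert a (?C a) else ?C a)"
      by (auto simp: less_Suc_eq)
    have cs: "card (?C (Suc a)) = (if col a = ?cc \<and> ?f a = k \<and> ?near a = ?u then Suc (card (?C a)) else card (?C a))"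
      unfolding C by simp
    have gen: "m = min x r \<Longrightarrow> m < r \<Longrightarrow> Suc m = min (Suc x) r"
      and gen': "m = min x r \<Longrightarrow> \<not> m < r \<Longrightarrow> m = min (Suc x) r" for m x r :: nat by auto
    show "?I (Suc a) ?s'"
    proof (cases "col a = ?cc \<and> ?f a = k \<and> ?near a = ?u \<and> card M < ?rem ?v")
      case True
      have "nmem ?s' ''f'' = (\<lambda>b. if b \<in> insert a M then ?v else ?f b)"
        using True aM M(3,4) by (auto simp: vals)
      moreover have "nmem ?s' ''rem'' = ?rem(?v := ?rem ?v - card (insert a M))"
        using True aM finM M(3,4) by (auto simp: vals)
      moreover have "card (insert a M) = min (card (?C (Suc a))) (?rem ?v)"
      proof -
        have "card (?C (Suc a)) = Suc (card (?C a))" using cs True by presburger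
        then show ?thesis
          unfolding card_insert_disjoint[OF finM aM] by (simp only:) (rule gen[OF M(2)], use True in blast)
      qed
      moreover have "insert a M \<subseteq> ?C (Suc a)" using M(1) True unfolding C by auto
      ultimately show ?thesis by blast
    next
      case False
      have "nmem ?s' ''f'' = (\<lambda>b. if b \<in> M then ?v else ?f b)" "nmem ?s' ''rem'' = ?rem(?v := ?rem ?v - card M)"
        using False aM M(3,4) by (auto simp: vals)
      moreover have "card M = min (card (?C (Suc a))) (?rem ?v)"
      proof (cases "col a = ?cc \<and> ?f a = k \<and> ?near a = ?u")
        case True
        then have "\<not> card M < ?rem ?v" using False by blast
        moreover have "card (?C (Suc a)) = Suc (card (?C a))" using cs True by presburger
        ultimately show ?thesis by (simp only:) (rule gen'[OF M(2)])
      next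
        case False
        then have "card (?C (Suc a)) = card (?C a)" using cs by presburger
        then show ?thesis using M(2) by (simp only:)
      qed
      moreover have "M \<subseteq> ?C (Suc a)" using M(1) unfolding C by auto
      ultimately show ?thesis by blast
    qed
  qed (use envD(1)[OF env] in auto)
  then have "?I n (den move_prog s)" unfolding move_prog_def .
  then obtain M where M: "M \<subseteq> ?C n" "card M = min (card (?C n)) (?rem ?v)"
      "nmem (den move_prog s) ''f'' = (\<lambda>a. if a \<in> M then ?v else ?f a)"
      "nmem (den move_prog s) ''rem'' = ?rem(?v := ?rem ?v - card M)" by blast
  have "{a\<in>{a\<in>{..<n}. col a = ?cc}. ?f a = k \<and> ?near a = ?u} = ?C n" by auto
  then show ?thesis unfolding moved_def prod.case
    by (intro exI[of _ M] conjI) (simp_all only: M simp_thms fun_upd_apply ball_simps)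
qed

text \<open>The digits \<open>2 * t\<close> and \<open>2 * t + 1\<close> are source and target of
  move \<open>t\<close>. The value \<open>k\<close> in \<open>''f''\<close> marks unassigned
  points.\<close>

definition greedy_prog :: "nat \<Rightarrow> lp" where
  "greedy_prog k = LFor ''a'' 0 (nv ''n'') (LN ''f'' (nv ''a'') (NConst k)) ;;
     LFor ''v'' 0 (NConst k) (LN ''rem'' (nv ''v'') (NRead ''S'' (nv ''v''))) ;; SN ''k'' (NConst k) ;;
     LFor ''t'' 0 (NConst (2 * k)) (SN ''u'' (NRead ''b'' (NPlus (nv ''t'') (nv ''t''))) ;;
       SN ''v'' (NRead ''b'' (NPlus (NPlus (nv ''t'') (nv ''t'')) (NConst 1))) ;; move_prog)"

lemma greedy_prog_sets [simp]:
  "nw (greedy_prog k) = {''a'', ''f'', ''rem'', ''v'', ''u'', ''k'', ''t''}" "rw (greedy_prog k) = {}"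
  by (auto simp: greedy_prog_def)

lemma den_greedy_prog:
  assumes env: "env n d l k P col s" and b: "\<And>i. i < 4 * k \<Longrightarrow> nmem s ''b'' i < k"
  shows "\<exists>f rem rem'. (\<forall>a<n. f a = k) \<and> (\<forall>v<k. rem v = nmem s ''S'' v) \<and>
    runs k {a\<in>{..<n}. col a = nmem s ''c'' 0} (nmem s ''near'')
      (map (\<lambda>t. (nmem s ''b'' (2 * t), nmem s ''b'' (2 * t + 1))) [0..<2 * k]) (f, rem)
      (nmem (den (greedy_prog k) s) ''f'', rem')"
proof -
  let ?S = "{a\<in>{..<n}. col a = nmem s ''c'' 0}" and ?near = "nmem s ''near''" and ?b = "nmem s ''b''"
  let ?p = "\<lambda>t. (?b (2 * t), ?b (2 * t + 1))"
  let ?s1 = "den (LFor ''a'' 0 (nv ''n'') (LN ''f'' (nv ''a'') (NConst k))) s"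
  let ?s2 = "den (LFor ''v'' 0 (NConst k) (LN ''rem'' (nv ''v'') (NRead ''S'' (nv ''v'')))) ?s1"
  let ?s3 = "nwrite ''k'' 0 k ?s2"
  let ?c = "SN ''u'' (NRead ''b'' (NPlus (nv ''t'') (nv ''t''))) ;;
       SN ''v'' (NRead ''b'' (NPlus (NPlus (nv ''t'') (nv ''t'')) (NConst 1))) ;; move_prog"
  let ?s4 = "den (LFor ''t'' 0 (NConst (2 * k)) ?c) ?s3"
  have f: "\<forall>a<n. nmem ?s1 ''f'' a = k"
    by (rule den_For_all) (use envD(1)[OF env] in auto)
  have r: "\<forall>v<k. nmem ?s2 ''rem'' v = nmem s ''S'' v"
  proof (rule den_For_all)
    fix v s' assume ag: "agree (insert ''v'' (nw (LN ''rem'' (nv ''v'') (NRead ''S'' (nv ''v''))))) (rw (LN ''rem'' (nv ''v'') (NRead ''S'' (nv ''v'')))) ?s1 s'"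
      and Q: "\<forall>v'<v. nmem s' ''rem'' v' = nmem s ''S'' v'"
    have "nmem s' ''S'' = nmem s ''S''" by (simp add: agree_nmem[OF ag] nmem_den del: den.simps)
    then show "nmem (den (LN ''rem'' (nv ''v'') (NRead ''S'' (nv ''v''))) (nwrite ''v'' 0 v s')) ''rem'' v = nmem s ''S'' v \<and>
        (\<forall>v'<v. nmem (den (LN ''rem'' (nv ''v'') (NRead ''S'' (nv ''v''))) (nwrite ''v'' 0 v s')) ''rem'' v' = nmem s ''S'' v')"
      using Q by simp
  qed simp
  have env3: "env n d l k P col ?s3"
    by (rule env_nwrite, rule env_den, rule env_den, rule env) simp_all
  have f3: "nmem ?s3 ''f'' = nmem ?s1 ''f''" "nmem ?s3 ''rem'' = nmem ?s2 ''rem''"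
    by (simp_all add: nmem_den del: den.simps)
  let ?I = "\<lambda>N s'. runs k ?S ?near (map ?p [0..<N]) (nmem ?s3 ''f'', nmem ?s3 ''rem'') (nmem s' ''f'', nmem s' ''rem'')"
  have R: "?I (2 * k) ?s4"
  proof (rule den_For[where I = ?I])
    fix t s' assume t: "t < 2 * k" and ag: "agree (insert ''t'' (nw ?c)) (rw ?c) ?s3 s'" and I: "?I t s'"
    let ?s' = "nwrite ''v'' 0 (?b (2 * t + 1)) (nwrite ''u'' 0 (?b (2 * t)) (nwrite ''t'' 0 t s'))"
    have bb: "nmem s' ''b'' = ?b" by (simp add: agree_nmem[OF ag] nmem_den del: den.simps)
    have e: "den ?c (nwrite ''t'' 0 t s') = den move_prog ?s'" by (simp add: bb mult_2)
    have env': "env n d l k P col ?s'"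
      by (intro env_nwrite env_agree[OF env3 ag]) simp_all
    have c': "nmem ?s' ''c'' 0 = nmem s ''c'' 0" "nmem ?s' ''near'' = ?near" "nmem ?s' ''k'' 0 = k"
      by (simp_all add: agree_nmem[OF ag] nmem_den del: den.simps)
    have c'': "nmem s' ''c'' 0 = nmem s ''c'' 0" "nmem s' ''near'' = ?near"
      by (simp_all add: agree_nmem[OF ag] nmem_den del: den.simps)
    have "moved k ?S ?near (?p t) (nmem s' ''f'', nmem s' ''rem'')
        (nmem (den ?c (nwrite ''t'' 0 t s')) ''f'', nmem (den ?c (nwrite ''t'' 0 t s')) ''rem'')"
      using den_move_prog[OF env' c'(3)] b[of "2 * t + 1"] t unfolding e by (simp add: c'')
    then show "?I (Suc t) (den ?c (nwrite ''t'' 0 t s'))"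
      using I by (auto simp: runs_append simp del: den.simps)
  qed auto
  have e: "den (greedy_prog k) s = ?s4" by (simp add: greedy_prog_def)
  show ?thesis unfolding e using f r R[unfolded f3] by blast
qed

section \<open>The search over centers, sizes and rules\<close>

definition comb_prog :: "objective \<Rightarrow> string \<Rightarrow> rexp \<Rightarrow> lp" where
  "comb_prog obj x e = (if obj = K_Center then LIf (RLess (rv x) e) (SR x e) LSkip else SR x (RPlus (rv x) e))"

lemma comb_prog_sets [simp]: "nw (comb_prog obj x e) = {}" "rw (comb_prog obj x e) = {x}"
  by (auto simp: comb_prog_def)

lemma den_comb_prog:
  "den (comb_prog obj x e) s =
    rwrite x 0 (if obj = K_Center then max (rmem s x 0) (rval e s) else rmem s x 0 + rval e s) s"
proof -
  have "rwrite x 0 (rmem s x 0) s = s" by (cases s) (simp add: rwrite.simps fun_upd_idem)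
  then show ?thesis by (auto simp: comb_prog_def max_def)
qed

text \<open>Whatever the rule produced is verified here, so the soundness of the search does not
  rest on the guesses. Comparing with the prescribed sizes \<open>''S''\<close> instead of other
  colors keeps the colors independent.\<close>

definition check_prog :: "objective \<Rightarrow> nat \<Rightarrow> lp" where
  "check_prog obj k = SN ''ok'' (NConst (Suc 0)) ;; SR ''val'' (RConst 0) ;;
     LFor ''v'' 0 (NConst k) (LN ''cnt'' (nv ''v'') (NConst 0)) ;;
     LFor ''a'' 0 (nv ''n'') (LIf (NEq (NRead ''color'' (nv ''a'')) (nv ''c''))
       (LIf (NLess (NRead ''f'' (nv ''a'')) (NConst k))
         (LN ''cnt'' (NRead ''f'' (nv ''a'')) (NPlus (NRead ''cnt'' (NRead ''f'' (nv ''a''))) (NConst (Suc 0))) ;;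
          comb_prog obj ''val'' (RRead ''D'' (NPlus (kmul k (nv ''a'')) (NRead ''f'' (nv ''a'')))))
         (SN ''ok'' (NConst 0))) LSkip) ;;
     LFor ''v'' 0 (NConst k) (LIf (NEq (NRead ''cnt'' (nv ''v'')) (NRead ''S'' (nv ''v''))) LSkip (SN ''ok'' (NConst 0)))"

lemma check_prog_sets [simp]:
  "nw (check_prog obj k) = {''ok'', ''v'', ''cnt'', ''a''}" "rw (check_prog obj k) = {''val''}"
  by (auto simp: check_prog_def)

definition color_class :: "nat \<Rightarrow> (nat \<Rightarrow> nat) \<Rightarrow> nat \<Rightarrow> nat set" where
  "color_class n col c = {a\<in>{..<n}. col a = c}"

definition feasible :: "nat \<Rightarrow> nat set \<Rightarrow> (nat \<Rightarrow> nat) \<Rightarrow> (nat \<Rightarrow> nat) \<Rightarrow> bool" where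
  "feasible k C S f \<longleftrightarrow> (\<forall>a\<in>C. f a < k) \<and> (\<forall>v<k. card {a\<in>C. f a = v} = S v)"

definition table_cost :: "objective \<Rightarrow> nat \<Rightarrow> (nat \<Rightarrow> real) \<Rightarrow> nat set \<Rightarrow> (nat \<Rightarrow> nat) \<Rightarrow> real" where
  "table_cost obj k D C f = agg obj C (\<lambda>a. D (k * a + f a))"

lemma color_class_Suc:
  "color_class (Suc M) col c = (if col M = c then insert M (color_class M col c) else color_class M col c)"
  by (auto simp: color_class_def less_Suc_eq)

lemma color_class_finite [simp]: "finite (color_class n col c)"
  and color_class_less [simp]: "n \<notin> color_class n col c"
  by (auto simp: color_class_def)

lemma card_color_class_Suc:
  "card {a\<in>color_class (Suc M) col c. f a = v} =
    card {a\<in>color_class M col c. f a = v} + (if col M = c \<and> f M = v then 1 else 0)"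
  using card_filter_Suc[of M "\<lambda>a. col a = c \<and> f a = v"] by (simp add: color_class_def conj_assoc)

lemma den_check_prog:
  assumes env: "env n d l k P col s"
  shows "nmem (den (check_prog obj k) s) ''ok'' 0 =
      (if feasible k (color_class n col (nmem s ''c'' 0)) (nmem s ''S'') (nmem s ''f'') then 1 else 0)"
    and "feasible k (color_class n col (nmem s ''c'' 0)) (nmem s ''S'') (nmem s ''f'') \<Longrightarrow>
      rmem (den (check_prog obj k) s) ''val'' 0 =
        table_cost obj k (rmem s ''D'') (color_class n col (nmem s ''c'' 0)) (nmem s ''f'')"
proof -
  let ?cc = "nmem s ''c'' 0" and ?f = "nmem s ''f''" and ?D = "rmem s ''D''"
  let ?C = "\<lambda>M. color_class M col ?cc"
  let ?s1 = "rwrite ''val'' 0 0 (nwrite ''ok'' 0 (Suc 0) s)"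
  let ?c1 = "LN ''cnt'' (nv ''v'') (NConst 0)"
  let ?s2 = "den (LFor ''v'' 0 (NConst k) ?c1) ?s1"
  let ?c2 = "LIf (NEq (NRead ''color'' (nv ''a'')) (nv ''c''))
       (LIf (NLess (NRead ''f'' (nv ''a'')) (NConst k))
         (LN ''cnt'' (NRead ''f'' (nv ''a'')) (NPlus (NRead ''cnt'' (NRead ''f'' (nv ''a''))) (NConst (Suc 0))) ;;
          comb_prog obj ''val'' (RRead ''D'' (NPlus (kmul k (nv ''a'')) (NRead ''f'' (nv ''a'')))))
         (SN ''ok'' (NConst 0))) LSkip"
  let ?s3 = "den (LFor ''a'' 0 (nv ''n'') ?c2) ?s2"
  let ?c3 = "LIf (NEq (NRead ''cnt'' (nv ''v'')) (NRead ''S'' (nv ''v''))) LSkip (SN ''ok'' (NConst 0))"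
  let ?s4 = "den (LFor ''v'' 0 (NConst k) ?c3) ?s3"
  have z: "\<forall>v<k. nmem ?s2 ''cnt'' v = 0" by (rule den_For_all) auto
  have v2: "nmem ?s2 ''ok'' 0 = 1" "rmem ?s2 ''val'' 0 = 0" "nmem ?s2 ''n'' 0 = n" "nmem ?s2 ''color'' = nmem s ''color''"
    "nmem ?s2 ''c'' 0 = ?cc" "nmem ?s2 ''f'' = ?f" "rmem ?s2 ''D'' = ?D" "nmem ?s2 ''S'' = nmem s ''S''"
    using envD(1)[OF env] by (simp_all add: nmem_den rmem_den del: den.simps)
  let ?J = "\<lambda>M s'. nmem s' ''ok'' 0 = 1 \<and> (\<forall>v<k. nmem s' ''cnt'' v = card {a\<in>?C M. ?f a = v}) \<and>
      rmem s' ''val'' 0 = table_cost obj k ?D (?C M) ?f"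
  \<comment> \<open>Once a label out of range has been met, only \<open>ok = 0\<close> is claimed;
    counts and cost have no meaning from then on.\<close>
  let ?I = "\<lambda>M s'. if \<forall>a\<in>?C M. ?f a < k then ?J M s' else nmem s' ''ok'' 0 = 0"
  have I: "?I n ?s3"
  proof (rule den_For[where I = ?I])
    have "?C 0 = {}" by (simp add: color_class_def)
    then show "?I 0 ?s2" using z v2 by (simp add: table_cost_def del: den.simps)
  next
    fix a s' assume a: "a < n" and ag: "agree (insert ''a'' (nw ?c2)) (rw ?c2) ?s2 s'" and I: "?I a s'"
    have vals: "nmem s' ''color'' a = col a" "nmem s' ''c'' 0 = ?cc" "nmem s' ''f'' = ?f" "rmem s' ''D'' = ?D"
      using envD(4)[OF env a] by (simp_all add: agree_nmem[OF ag] agree_rmem[OF ag] nmem_den rmem_den del: den.simps)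
    show "?I (Suc a) (den ?c2 (nwrite ''a'' 0 a s'))"
    proof (cases "col a = ?cc")
      case True
      show ?thesis
      proof (cases "?f a < k")
        case fk: True
        have e: "den ?c2 (nwrite ''a'' 0 a s') = den (comb_prog obj ''val'' (RRead ''D'' (NPlus (kmul k (nv ''a'')) (NRead ''f'' (nv ''a'')))))
            (nwrite ''cnt'' (?f a) (nmem s' ''cnt'' (?f a) + 1) (nwrite ''a'' 0 a s'))"
          using True fk by (simp add: vals)
        have "table_cost obj k ?D (?C (Suc a)) ?f = (if obj = K_Center then max (table_cost obj k ?D (?C a) ?f) (?D (k * a + ?f a))
            else table_cost obj k ?D (?C a) ?f + ?D (k * a + ?f a))"
          using True by (simp add: color_class_Suc table_cost_def agg_insert)
        then show ?thesis
          using I True fk unfolding e den_comb_prog card_color_class_Suc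
          by (auto simp: vals color_class_Suc)
      next
        case False
        then have e: "den ?c2 (nwrite ''a'' 0 a s') = nwrite ''ok'' 0 0 (nwrite ''a'' 0 a s')"
          using True by (simp add: vals)
        show ?thesis using True False unfolding e by (simp add: color_class_Suc)
      qed
    next
      case False
      then have e: "den ?c2 (nwrite ''a'' 0 a s') = nwrite ''a'' 0 a s'" by (simp add: vals)
      show ?thesis using I False unfolding e by (simp add: color_class_Suc)
    qed
  qed (use v2(3) in \<open>simp del: den.simps\<close>)
  have ok3: "nmem ?s3 ''ok'' 0 = (if \<forall>a\<in>?C n. ?f a < k then 1 else 0)"
    using I by (simp split: if_splits del: den.simps)
  have v3: "nmem ?s3 ''S'' = nmem s ''S''" by (simp add: nmem_den v2 del: den.simps)
  have I4: "nmem ?s4 ''ok'' 0 = (if nmem ?s3 ''ok'' 0 = 1 \<and> (\<forall>v<k. nmem ?s3 ''cnt'' v = nmem s ''S'' v) then 1 else 0)"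
  proof (rule den_For[where I = "\<lambda>M s'. nmem s' ''ok'' 0 = (if nmem ?s3 ''ok'' 0 = 1 \<and> (\<forall>v<M. nmem ?s3 ''cnt'' v = nmem s ''S'' v) then 1 else 0)"])
    show "nmem ?s3 ''ok'' 0 = (if nmem ?s3 ''ok'' 0 = 1 \<and> (\<forall>v<0. nmem ?s3 ''cnt'' v = nmem s ''S'' v) then 1 else 0)"
      unfolding ok3 by simp
  next
    fix v s' assume v: "v < k" and ag: "agree (insert ''v'' (nw ?c3)) (rw ?c3) ?s3 s'"
      and I: "nmem s' ''ok'' 0 = (if nmem ?s3 ''ok'' 0 = 1 \<and> (\<forall>v'<v. nmem ?s3 ''cnt'' v' = nmem s ''S'' v') then 1 else 0)"
    have vals: "nmem s' ''cnt'' = nmem ?s3 ''cnt''" "nmem s' ''S'' = nmem s ''S''"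
      by (simp_all add: agree_nmem[OF ag] v3 del: den.simps)
    have "nmem (den ?c3 (nwrite ''v'' 0 v s')) ''ok'' 0 = (if nmem s' ''cnt'' v = nmem s' ''S'' v then nmem s' ''ok'' 0 else 0)"
      by simp
    then show "nmem (den ?c3 (nwrite ''v'' 0 v s')) ''ok'' 0 = (if nmem ?s3 ''ok'' 0 = 1 \<and> (\<forall>v'<Suc v. nmem ?s3 ''cnt'' v' = nmem s ''S'' v') then 1 else 0)"
      using I unfolding vals less_Suc_eq by auto
  qed simp
  have e: "den (check_prog obj k) s = ?s4" by (simp add: check_prog_def)
  have cnt: "nmem ?s3 ''cnt'' v = card {a\<in>?C n. ?f a = v}" if "\<forall>a\<in>?C n. ?f a < k" "v < k" for v
    using I that by (simp del: den.simps)
  show "nmem (den (check_prog obj k) s) ''ok'' 0 = (if feasible k (?C n) (nmem s ''S'') ?f then 1 else 0)"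
    unfolding e I4 ok3 feasible_def using cnt by auto
  assume "feasible k (?C n) (nmem s ''S'') ?f"
  then have "\<forall>a\<in>?C n. ?f a < k" by (simp add: feasible_def)
  then have "rmem ?s3 ''val'' 0 = table_cost obj k ?D (?C n) ?f" using I by (simp del: den.simps)
  then show "rmem (den (check_prog obj k) s) ''val'' 0 = table_cost obj k ?D (?C n) ?f"
    unfolding e by (simp add: rmem_den del: den.simps)
qed

text \<open>The flag \<open>''cf''\<close> says whether an assignment of the current color has been
  found, as there is no infinite value to start a minimum with. Only entries of this color are
  written, so the results of other colors stay.\<close>

definition keep_prog :: lp where
  "keep_prog = LIf (BAnd (NEq (nv ''ok'') (NConst (Suc 0))) (BNot (BAnd (NEq (nv ''cf'') (NConst (Suc 0))) (BNot (RLess (rv ''val'') (rv ''cbest''))))))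
     (SN ''cf'' (NConst (Suc 0)) ;; SR ''cbest'' (rv ''val'') ;;
      LFor ''a'' 0 (nv ''n'') (LIf (NEq (NRead ''color'' (nv ''a'')) (nv ''c'')) (LN ''asg'' (nv ''a'') (NRead ''f'' (nv ''a''))) LSkip))
     LSkip"

lemma keep_prog_sets [simp]: "nw keep_prog = {''cf'', ''a'', ''asg''}" "rw keep_prog = {''cbest''}"
  by (auto simp: keep_prog_def)

lemma den_keep_prog:
  assumes env: "env n d l k P col s"
  shows "if nmem s ''ok'' 0 = 1 \<and> \<not> (nmem s ''cf'' 0 = 1 \<and> rmem s ''cbest'' 0 \<le> rmem s ''val'' 0)
    then nmem (den keep_prog s) ''cf'' 0 = 1 \<and> rmem (den keep_prog s) ''cbest'' 0 = rmem s ''val'' 0 \<and>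
      (\<forall>a. nmem (den keep_prog s) ''asg'' a =
        (if a \<in> color_class n col (nmem s ''c'' 0) then nmem s ''f'' a else nmem s ''asg'' a))
    else den keep_prog s = s"
proof -
  let ?c = "LIf (NEq (NRead ''color'' (nv ''a'')) (nv ''c'')) (LN ''asg'' (nv ''a'') (NRead ''f'' (nv ''a''))) LSkip"
  let ?s = "rwrite ''cbest'' 0 (rmem s ''val'' 0) (nwrite ''cf'' 0 (Suc 0) s)"
  let ?s1 = "den (LFor ''a'' 0 (nv ''n'') ?c) ?s"
  let ?I = "\<lambda>M s'. \<forall>a. nmem s' ''asg'' a = (if a \<in> color_class M col (nmem s ''c'' 0) then nmem s ''f'' a else nmem s ''asg'' a)"
  have I: "?I n ?s1"
  proof (rule den_For[where I = ?I])
    fix a s' assume a: "a < n" and ag: "agree (insert ''a'' (nw ?c)) (rw ?c) ?s s'" and I: "?I a s'"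
    have vals: "nmem s' ''color'' a = col a" "nmem s' ''c'' 0 = nmem s ''c'' 0" "nmem s' ''f'' = nmem s ''f''"
      using envD(4)[OF env a] by (simp_all add: agree_nmem[OF ag])
    show "?I (Suc a) (den ?c (nwrite ''a'' 0 a s'))"
      using I by (auto simp: vals color_class_Suc)
  qed (use envD(1)[OF env] in \<open>auto simp: color_class_def\<close>)
  have v: "nmem ?s1 ''cf'' 0 = 1" "rmem ?s1 ''cbest'' 0 = rmem s ''val'' 0"
    by (simp_all add: nmem_den rmem_den del: den.simps)
  let ?cond = "nmem s ''ok'' 0 = 1 \<and> \<not> (nmem s ''cf'' 0 = 1 \<and> rmem s ''cbest'' 0 \<le> rmem s ''val'' 0)"
  have "den keep_prog s = (if nmem s ''ok'' 0 = 1 \<and> \<not> (nmem s ''cf'' 0 = 1 \<and> rmem s ''cbest'' 0 \<le> rmem s ''val'' 0) then ?s1 else s)"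
    by (auto simp: keep_prog_def not_less simp del: den.simps(6))
  then have e: "den keep_prog s = (if ?cond then ?s1 else s)" .
  show ?thesis
  proof (cases ?cond)
    case True
    have "den keep_prog s = ?s1" unfolding e if_P[OF True] ..
    then show ?thesis unfolding if_P[OF True] using I v by (simp only: simp_thms)
  next
    case False
    show ?thesis unfolding if_not_P[OF False] e ..
  qed
qed

text \<open>The search common to both algorithms. \<open>sp\<close> derives sizes from
  \<open>K2\<close> digits, and \<open>rp\<close> derives the assignment of one color from
  \<open>K3\<close> digits; all that is known of their results is expressed by \<open>szrel\<close>
  and \<open>rprel\<close>. \<open>N2\<close> and \<open>N3\<close> are the radices, computed by
  \<open>R2\<close> and \<open>R3\<close>.\<close>

locale search =
  fixes obj :: objective and k n d l :: nat and P :: "nat \<Rightarrow> point" and col :: "nat \<Rightarrow> nat"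
    and rp sp :: lp and K2 K3 N2 N3 :: nat and R2 R3 :: nexp
    and szrel :: "(nat \<Rightarrow> real) \<Rightarrow> (nat \<Rightarrow> nat) \<Rightarrow> (nat \<Rightarrow> nat) \<Rightarrow> (nat \<Rightarrow> nat) \<Rightarrow> bool"
    and rprel :: "(nat \<Rightarrow> real) \<Rightarrow> (nat \<Rightarrow> nat) \<Rightarrow> (nat \<Rightarrow> nat) \<Rightarrow> nat \<Rightarrow> (nat \<Rightarrow> nat) \<Rightarrow> (nat \<Rightarrow> nat) \<Rightarrow> bool"
  assumes rp_nw: "nw rp \<subseteq> {''t'', ''a'', ''u'', ''v'', ''ok1'', ''f'', ''rem'', ''k''}" and rp_rw: "rw rp \<subseteq> {''th'', ''W''}"
    and sp_nw: "nw sp \<subseteq> {''a'', ''v'', ''near'', ''S''}" and sp_rw: "rw sp \<subseteq> {}"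
    and col_less: "\<And>a. a < n \<Longrightarrow> col a < l"
    and rp_spec: "\<And>s. env n d l k P col s \<Longrightarrow> rprel (rmem s ''D'') (nmem s ''S'') (nmem s ''near'') (nmem s ''c'' 0)
      (nmem s ''b'') (nmem (den rp s) ''f'')"
    and sp_spec: "\<And>s. env n d l k P col s \<Longrightarrow> szrel (rmem s ''D'') (nmem s ''s'') (nmem (den sp s) ''S'') (nmem (den sp s) ''near'')"
    and R2: "\<And>s. env n d l k P col s \<Longrightarrow> nval R2 s = N2"
    and R3: "\<And>s. env n d l k P col s \<Longrightarrow> nval R3 s = N3"
begin

abbreviation "ENV \<equiv> env n d l k P col"
abbreviation "CC \<equiv> color_class n col"

lemma rp_agree: "agree {''t'', ''a'', ''u'', ''v'', ''ok1'', ''f'', ''rem'', ''k''} {''th'', ''W''} s (den rp s)"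
  using rp_nw rp_rw by (rule agree_mono[OF den_agree])

lemma sp_agree: "agree {''a'', ''v'', ''near'', ''S''} {} s (den sp s)"
  using sp_nw sp_rw by (rule agree_mono[OF den_agree])

definition rule_body :: lp where
  "rule_body = rp ;; check_prog obj k ;; keep_prog"

text \<open>Explicit lists of names for the frame conditions, since the write sets of
  \<open>rp\<close> and \<open>sp\<close> are known only up to upper bounds.\<close>

abbreviation "AW \<equiv> {''t'', ''a'', ''u'', ''v'', ''ok1'', ''f'', ''rem'', ''k'', ''ok'', ''cnt'', ''cf'', ''asg''}"
abbreviation "AB \<equiv> insert ''b'' AW"
abbreviation "RW \<equiv> {''th'', ''W'', ''val'', ''cbest''}"

lemma rule_body_sets: "nw rule_body \<subseteq> AW" "rw rule_body \<subseteq> RW"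
  unfolding rule_body_def nw.simps rw.simps check_prog_sets keep_prog_sets
  by (intro Un_least order_trans[OF rp_nw] order_trans[OF rp_rw]; simp)+

definition kept :: "state \<Rightarrow> bool" where
  "kept s \<longleftrightarrow> (nmem s ''cf'' 0 = 1 \<longrightarrow> feasible k (CC (nmem s ''c'' 0)) (nmem s ''S'') (nmem s ''asg'') \<and>
     rmem s ''cbest'' 0 = table_cost obj k (rmem s ''D'') (CC (nmem s ''c'' 0)) (nmem s ''asg''))"

lemma feasible_cong: "(\<And>a. a \<in> C \<Longrightarrow> f a = g a) \<Longrightarrow> feasible k C S f \<longleftrightarrow> feasible k C S g"
  by (auto simp: feasible_def cong: conj_cong)

lemma table_cost_cong: "(\<And>a. a \<in> C \<Longrightarrow> f a = g a) \<Longrightarrow> table_cost obj k D C f = table_cost obj k D C g"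
  by (auto simp: table_cost_def intro: agg_cong)

lemma den_rule_body:
  assumes env: "ENV s" and kept: "kept s"
  shows "kept (den rule_body s)"
    and "\<exists>f. rprel (rmem s ''D'') (nmem s ''S'') (nmem s ''near'') (nmem s ''c'' 0) (nmem s ''b'') f \<and>
      (feasible k (CC (nmem s ''c'' 0)) (nmem s ''S'') f \<longrightarrow> nmem (den rule_body s) ''cf'' 0 = 1 \<and>
        rmem (den rule_body s) ''cbest'' 0 \<le> table_cost obj k (rmem s ''D'') (CC (nmem s ''c'' 0)) f)"
    and "nmem s ''cf'' 0 = 1 \<Longrightarrow> nmem (den rule_body s) ''cf'' 0 = 1 \<and> rmem (den rule_body s) ''cbest'' 0 \<le> rmem s ''cbest'' 0"
    and "a \<notin> CC (nmem s ''c'' 0) \<Longrightarrow> nmem (den rule_body s) ''asg'' a = nmem s ''asg'' a"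
proof -
  let ?s1 = "den rp s"
  let ?s2 = "den (check_prog obj k) ?s1"
  let ?s3 = "den keep_prog ?s2"
  let ?C = "CC (nmem s ''c'' 0)" and ?D = "rmem s ''D''" and ?S = "nmem s ''S''" and ?f = "nmem ?s1 ''f''"
  have e: "den rule_body s = ?s3" by (simp add: rule_body_def)
  have env1: "ENV ?s1" using env rp_agree by (rule env_agree) simp_all
  have env2: "ENV ?s2" using env1 by (rule env_den) simp_all
  note ag = agree_nmem[OF rp_agree] agree_rmem[OF rp_agree]
  have v1: "nmem ?s1 ''c'' = nmem s ''c''" "nmem ?s1 ''S'' = ?S" "rmem ?s1 ''D'' = ?D" by (simp_all add: ag)
  have v2: "nmem ?s2 ''c'' = nmem s ''c''" "nmem ?s2 ''S'' = ?S" "rmem ?s2 ''D'' = ?D" "nmem ?s2 ''f'' = ?f"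
    "nmem ?s2 ''cf'' = nmem s ''cf''" "rmem ?s2 ''cbest'' = rmem s ''cbest''" "nmem ?s2 ''asg'' = nmem s ''asg''"
    by (simp_all add: nmem_den rmem_den ag v1)
  have v3: "nmem ?s3 ''c'' = nmem s ''c''" "nmem ?s3 ''S'' = ?S" "rmem ?s3 ''D'' = ?D"
    by (simp_all add: nmem_den rmem_den v2)
  have ok: "nmem ?s2 ''ok'' 0 = (if feasible k ?C ?S ?f then 1 else 0)"
    and val: "feasible k ?C ?S ?f \<Longrightarrow> rmem ?s2 ''val'' 0 = table_cost obj k ?D ?C ?f"
    using den_check_prog[OF env1, of obj] unfolding v1 by auto
  have rel: "rprel ?D ?S (nmem s ''near'') (nmem s ''c'' 0) (nmem s ''b'') ?f" using env by (rule rp_spec)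
  let ?cond = "feasible k ?C ?S ?f \<and> \<not> (nmem s ''cf'' 0 = 1 \<and> rmem s ''cbest'' 0 \<le> table_cost obj k ?D ?C ?f)"
  have K: "if ?cond then nmem ?s3 ''cf'' 0 = 1 \<and> rmem ?s3 ''cbest'' 0 = table_cost obj k ?D ?C ?f \<and>
      (\<forall>a. nmem ?s3 ''asg'' a = (if a \<in> ?C then ?f a else nmem s ''asg'' a)) else ?s3 = ?s2"
    using den_keep_prog[OF env2] ok val unfolding v2 by (auto split: if_splits)
  have "kept ?s3 \<and> (feasible k ?C ?S ?f \<longrightarrow> nmem ?s3 ''cf'' 0 = 1 \<and> rmem ?s3 ''cbest'' 0 \<le> table_cost obj k ?D ?C ?f) \<and>
    (nmem s ''cf'' 0 = 1 \<longrightarrow> nmem ?s3 ''cf'' 0 = 1 \<and> rmem ?s3 ''cbest'' 0 \<le> rmem s ''cbest'' 0) \<and>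
    (\<forall>a. a \<notin> ?C \<longrightarrow> nmem ?s3 ''asg'' a = nmem s ''asg'' a)"
  proof (cases ?cond)
    case True
    then have k3: "nmem ?s3 ''cf'' 0 = 1" "rmem ?s3 ''cbest'' 0 = table_cost obj k ?D ?C ?f"
      "\<And>a. nmem ?s3 ''asg'' a = (if a \<in> ?C then ?f a else nmem s ''asg'' a)" using K by auto
    have "feasible k ?C ?S (nmem ?s3 ''asg'') \<longleftrightarrow> feasible k ?C ?S ?f"
      "table_cost obj k ?D ?C (nmem ?s3 ''asg'') = table_cost obj k ?D ?C ?f"
      by (rule feasible_cong table_cost_cong; simp add: k3)+
    then have "kept ?s3" unfolding kept_def v3 using True k3 by simp
    then show ?thesis using True k3 by auto
  next
    case False
    then have k3: "?s3 = ?s2" using K by argo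
    have "kept ?s2" using kept unfolding kept_def v2 .
    then show ?thesis using False unfolding k3 v2 by auto
  qed
  then show "kept (den rule_body s)"
    "\<exists>f. rprel (rmem s ''D'') (nmem s ''S'') (nmem s ''near'') (nmem s ''c'' 0) (nmem s ''b'') f \<and>
      (feasible k (CC (nmem s ''c'' 0)) (nmem s ''S'') f \<longrightarrow> nmem (den rule_body s) ''cf'' 0 = 1 \<and>
        rmem (den rule_body s) ''cbest'' 0 \<le> table_cost obj k (rmem s ''D'') (CC (nmem s ''c'' 0)) f)"
    "nmem s ''cf'' 0 = 1 \<Longrightarrow> nmem (den rule_body s) ''cf'' 0 = 1 \<and> rmem (den rule_body s) ''cbest'' 0 \<le> rmem s ''cbest'' 0"
    "a \<notin> CC (nmem s ''c'' 0) \<Longrightarrow> nmem (den rule_body s) ''asg'' a = nmem s ''asg'' a"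
    unfolding e using rel by blast+
qed

definition color_prog :: lp where
  "color_prog = SN ''cf'' (NConst 0) ;; nest K3 ''b'' R3 rule_body ;;
     LIf (NEq (nv ''cf'') (NConst (Suc 0))) LSkip (SN ''all'' (NConst 0))"

lemma color_prog_sets: "nw color_prog \<subseteq> insert ''all'' AB" "rw color_prog \<subseteq> RW"
proof -
  have "nw rule_body \<subseteq> insert ''all'' AB" using rule_body_sets(1) by (rule order_trans) (intro subset_insertI2 order_refl)
  then show "nw color_prog \<subseteq> insert ''all'' AB"
    unfolding color_prog_def nw.simps nw_nest by (cases "K3 = 0") simp_all
  show "rw color_prog \<subseteq> RW" unfolding color_prog_def rw.simps rw_nest using rule_body_sets(2) by simp
qed

text \<open>The universal quantifiers absorb what is not controlled: cells of \<open>''b''\<close>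
  beyond the enumerated digits, and the freedom that \<open>rprel\<close> leaves in the
  result.\<close>

definition rule_good :: "(nat \<Rightarrow> real) \<Rightarrow> (nat \<Rightarrow> nat) \<Rightarrow> (nat \<Rightarrow> nat) \<Rightarrow> nat \<Rightarrow> real \<Rightarrow> bool" where
  "rule_good D S near c X \<longleftrightarrow> (\<exists>b. (\<forall>i<K3. b i < N3) \<and> (\<forall>b' f. (\<forall>i<K3. b' i = b i) \<longrightarrow> rprel D S near c b' f \<longrightarrow>
     feasible k (CC c) S f \<and> table_cost obj k D (CC c) f \<le> X))"

lemma den_color_prog:
  assumes env: "ENV s"
  shows "\<exists>ok. nmem (den color_prog s) ''all'' 0 = (if ok then nmem s ''all'' 0 else 0) \<and>
     (ok \<longrightarrow> feasible k (CC (nmem s ''c'' 0)) (nmem s ''S'') (nmem (den color_prog s) ''asg'')) \<and>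
     (\<forall>X. rule_good (rmem s ''D'') (nmem s ''S'') (nmem s ''near'') (nmem s ''c'' 0) X \<longrightarrow> ok \<and>
        table_cost obj k (rmem s ''D'') (CC (nmem s ''c'' 0)) (nmem (den color_prog s) ''asg'') \<le> X) \<and>
     (\<forall>a. a \<notin> CC (nmem s ''c'' 0) \<longrightarrow> nmem (den color_prog s) ''asg'' a = nmem s ''asg'' a)"
proof -
  let ?C = "CC (nmem s ''c'' 0)" and ?D = "rmem s ''D''" and ?S = "nmem s ''S''"
  let ?s1 = "nwrite ''cf'' 0 0 s"
  let ?s2 = "den (nest K3 ''b'' R3 rule_body) ?s1"
  let ?Inv = "\<lambda>s'. agree AB RW s s' \<and> kept s' \<and> (\<forall>a. a \<notin> ?C \<longrightarrow> nmem s' ''asg'' a = nmem s ''asg'' a)"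
  \<comment> \<open>The visit of \<open>g\<close> is recorded as follows: every bound
    \<open>X\<close> that \<open>g\<close> guarantees is met by the assignment kept.\<close>
  let ?G = "\<lambda>g s'. \<forall>X. (\<forall>b' f. (\<forall>i<K3. b' i = g i) \<longrightarrow> rprel ?D ?S (nmem s ''near'') (nmem s ''c'' 0) b' f \<longrightarrow>
     feasible k ?C ?S f \<and> table_cost obj k ?D ?C f \<le> X) \<longrightarrow> nmem s' ''cf'' 0 = 1 \<and> rmem s' ''cbest'' 0 \<le> X"
  have E: "ENV s'" if "?Inv s'" for s' using env conjunct1[OF that] by (rule env_agree) simp_all
  have V: "nmem s' ''c'' 0 = nmem s ''c'' 0" "nmem s' ''S'' = ?S" "rmem s' ''D'' = ?D" "nmem s' ''near'' = nmem s ''near''"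
    if "?Inv s'" for s' using agree_nmem[OF conjunct1[OF that]] agree_rmem[OF conjunct1[OF that]] by simp_all
  have "?Inv ?s2 \<and> (\<forall>g. (\<forall>i<K3. g i < N3) \<longrightarrow> ?G g ?s2)"
  proof (rule nest_search[where Inv = ?Inv and G = ?G])
    show "?Inv ?s1" by (auto simp: agree_def kept_def)
    show "nval R3 s' = N3" if "?Inv s'" for s' using E[OF that] by (rule R3)
    show "?Inv (nwrite ''b'' i v s')" if "?Inv s'" for s' i v
    proof (intro conjI)
      have "agree AB RW s' (nwrite ''b'' i v s')" by (simp add: agree_def)
      then show "agree AB RW s (nwrite ''b'' i v s')" by (rule agree_trans[OF conjunct1[OF that]])
      show "kept (nwrite ''b'' i v s')" using conjunct1[OF conjunct2[OF that]] by (simp add: kept_def)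
      show "\<forall>a. a \<notin> ?C \<longrightarrow> nmem (nwrite ''b'' i v s') ''asg'' a = nmem s ''asg'' a" using that by simp
    qed
    show "?Inv (den rule_body s')" if I: "?Inv s'" for s'
    proof (intro conjI allI impI)
      have "agree AB RW s' (den rule_body s')" 
        by (rule agree_mono[OF den_agree _ rule_body_sets(2)])
          (rule order_trans[OF rule_body_sets(1)], rule subset_insertI)
      then show "agree AB RW s (den rule_body s')" by (rule agree_trans[OF conjunct1[OF I]])
      show "kept (den rule_body s')" by (rule den_rule_body(1)[OF E[OF I] conjunct1[OF conjunct2[OF I]]])
      fix a assume "a \<notin> ?C"
      then show "nmem (den rule_body s') ''asg'' a = nmem s ''asg'' a"
        using I den_rule_body(4)[of s' a] E[OF I] V[OF I] by simp
    qed
    show "?G g (nwrite ''b'' i v s')" if "?Inv s'" "?G g s'" for s' i v g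
    proof -
      have e: "nmem (nwrite ''b'' i v s') ''cf'' = nmem s' ''cf''" by simp
      show ?thesis unfolding e rmem_nwrite by (rule that(2))
    qed
    show "?G g (den rule_body s')" if I: "?Inv s'" and G: "?G g s'" for s' g
    proof (intro allI impI)
      fix X assume "\<forall>b' f. (\<forall>i<K3. b' i = g i) \<longrightarrow> rprel ?D ?S (nmem s ''near'') (nmem s ''c'' 0) b' f \<longrightarrow>
         feasible k ?C ?S f \<and> table_cost obj k ?D ?C f \<le> X"
      then have "nmem s' ''cf'' 0 = 1 \<and> rmem s' ''cbest'' 0 \<le> X" using G by blast
      then show "nmem (den rule_body s') ''cf'' 0 = 1 \<and> rmem (den rule_body s') ''cbest'' 0 \<le> X"
        using den_rule_body(3)[OF E[OF I] conjunct1[OF conjunct2[OF I]]] by linarith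
    qed
    show "?G g (den rule_body s')" if I: "?Inv s'" and g: "\<And>i. i < K3 \<Longrightarrow> nmem s' ''b'' i = g i" for s' g
    proof (intro allI impI)
      fix X assume X: "\<forall>b' f. (\<forall>i<K3. b' i = g i) \<longrightarrow> rprel ?D ?S (nmem s ''near'') (nmem s ''c'' 0) b' f \<longrightarrow>
         feasible k ?C ?S f \<and> table_cost obj k ?D ?C f \<le> X"
      have kp: "kept s'" using I by blast
      obtain f where f: "rprel ?D ?S (nmem s ''near'') (nmem s ''c'' 0) (nmem s' ''b'') f"
        "feasible k ?C ?S f \<longrightarrow> nmem (den rule_body s') ''cf'' 0 = 1 \<and>
          rmem (den rule_body s') ''cbest'' 0 \<le> table_cost obj k ?D ?C f"
        using den_rule_body(2)[OF E[OF I] kp] unfolding V[OF I] by blast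
      have "feasible k ?C ?S f \<and> table_cost obj k ?D ?C f \<le> X" using X g f(1) by blast
      then show "nmem (den rule_body s') ''cf'' 0 = 1 \<and> rmem (den rule_body s') ''cbest'' 0 \<le> X"
        using f(2) by auto
    qed
    show "''b'' \<notin> nw rule_body" using rule_body_sets by blast
  qed
  then have I: "?Inv ?s2" and G: "\<And>g. (\<forall>i<K3. g i < N3) \<Longrightarrow> ?G g ?s2" by blast+
  let ?ok = "nmem ?s2 ''cf'' 0 = 1"
  have all2: "nmem ?s2 ''all'' = nmem s ''all''" using agree_nmem[OF conjunct1[OF I]] by simp
  have e: "den color_prog s = (if ?ok then ?s2 else nwrite ''all'' 0 0 ?s2)" by (simp add: color_prog_def)
  have asg: "nmem (den color_prog s) ''asg'' = nmem ?s2 ''asg''" unfolding e by simp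
  have kp: "kept ?s2" using I by blast
  have 1: "nmem (den color_prog s) ''all'' 0 = (if ?ok then nmem s ''all'' 0 else 0)" unfolding e using all2 by simp
  have 2: "?ok \<longrightarrow> feasible k ?C ?S (nmem ?s2 ''asg'')" using kp unfolding kept_def V[OF I] by blast
  have 3: "?ok \<and> table_cost obj k ?D ?C (nmem ?s2 ''asg'') \<le> X"
    if "rule_good ?D ?S (nmem s ''near'') (nmem s ''c'' 0) X" for X
  proof -
    obtain b where b: "\<forall>i<K3. b i < N3" "\<forall>b' f. (\<forall>i<K3. b' i = b i) \<longrightarrow> rprel ?D ?S (nmem s ''near'') (nmem s ''c'' 0) b' f \<longrightarrow>
     feasible k ?C ?S f \<and> table_cost obj k ?D ?C f \<le> X" using \<open>rule_good _ _ _ _ _\<close> unfolding rule_good_def by blast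
    have "nmem ?s2 ''cf'' 0 = 1 \<and> rmem ?s2 ''cbest'' 0 \<le> X" using G[OF b(1)] b(2) by blast
    then show ?thesis using kp unfolding kept_def V[OF I] by simp
  qed
  show ?thesis unfolding asg using 1 2 3 I by blast
qed

end

section \<open>Evaluating and storing complete solutions\<close>

definition total_prog :: "objective \<Rightarrow> nat \<Rightarrow> lp" where
  "total_prog obj k = SR ''tot'' (RConst 0) ;;
     LFor ''a'' 0 (nv ''n'') (comb_prog obj ''tot'' (RRead ''D'' (NPlus (kmul k (nv ''a'')) (NRead ''asg'' (nv ''a'')))))"

lemma total_prog_sets [simp]: "nw (total_prog obj k) = {''a''}" "rw (total_prog obj k) = {''tot''}"
  by (auto simp: total_prog_def)

lemma den_total_prog:
  assumes "nmem s ''n'' 0 = n"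
  shows "rmem (den (total_prog obj k) s) ''tot'' 0 = table_cost obj k (rmem s ''D'') {..<n} (nmem s ''asg'')"
proof -
  let ?c = "comb_prog obj ''tot'' (RRead ''D'' (NPlus (kmul k (nv ''a'')) (NRead ''asg'' (nv ''a''))))"
  let ?s = "rwrite ''tot'' 0 0 s"
  have "rmem (den (LFor ''a'' 0 (nv ''n'') ?c) ?s) ''tot'' 0 = table_cost obj k (rmem s ''D'') {..<n} (nmem s ''asg'')"
  proof (rule den_For[where I = "\<lambda>M s'. rmem s' ''tot'' 0 = table_cost obj k (rmem s ''D'') {..<M} (nmem s ''asg'')"])
    fix a s' assume ag: "agree (insert ''a'' (nw ?c)) (rw ?c) ?s s'"
      and I: "rmem s' ''tot'' 0 = table_cost obj k (rmem s ''D'') {..<a} (nmem s ''asg'')"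
    have vals: "nmem s' ''asg'' = nmem s ''asg''" "rmem s' ''D'' = rmem s ''D''"
      by (simp_all add: agree_nmem[OF ag] agree_rmem[OF ag])
    show "rmem (den ?c (nwrite ''a'' 0 a s')) ''tot'' 0 = table_cost obj k (rmem s ''D'') {..<Suc a} (nmem s ''asg'')"
      unfolding den_comb_prog using I by (simp add: vals table_cost_def lessThan_Suc agg_insert)
  qed (use assms in \<open>auto simp: table_cost_def\<close>)
  then show ?thesis by (simp add: total_prog_def)
qed

definition copy_prog :: "nat \<Rightarrow> lp" where
  "copy_prog k = LFor ''a'' 0 (nv ''n'') (LN ''cluster'' (nv ''a'') (NRead ''asg'' (nv ''a''))) ;;
     LFor ''j'' 0 (NConst k) (LFor ''i'' 0 (nv ''d'')
       (LR ''center'' (NPlus (NRead ''md'' (nv ''j'')) (nv ''i'')) (RRead ''cen'' (NPlus (NRead ''md'' (nv ''j'')) (nv ''i'')))))"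

lemma copy_prog_sets [simp]: "nw (copy_prog k) = {''a'', ''cluster'', ''j'', ''i''}" "rw (copy_prog k) = {''center''}"
  by (auto simp: copy_prog_def)

lemma den_copy_prog:
  assumes env: "env n d l k P col s"
  shows "\<forall>a<n. nmem (den (copy_prog k) s) ''cluster'' a = nmem s ''asg'' a"
    and "\<forall>j<k. \<forall>i<d. rmem (den (copy_prog k) s) ''center'' (j * d + i) = rmem s ''cen'' (j * d + i)"
proof -
  let ?c1 = "LN ''cluster'' (nv ''a'') (NRead ''asg'' (nv ''a''))"
  let ?s1 = "den (LFor ''a'' 0 (nv ''n'') ?c1) s"
  let ?c = "LR ''center'' (NPlus (NRead ''md'' (nv ''j'')) (nv ''i'')) (RRead ''cen'' (NPlus (NRead ''md'' (nv ''j'')) (nv ''i'')))"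
  let ?L = "LFor ''i'' 0 (nv ''d'') ?c"
  let ?s2 = "den (LFor ''j'' 0 (NConst k) ?L) ?s1"
  have 1: "\<forall>a<n. nmem ?s1 ''cluster'' a = nmem s ''asg'' a"
  proof (rule den_For_all)
    fix a s' assume ag: "agree (insert ''a'' (nw ?c1)) (rw ?c1) s s'" and Q: "\<forall>a'<a. nmem s' ''cluster'' a' = nmem s ''asg'' a'"
    have "nmem s' ''asg'' = nmem s ''asg''" by (simp add: agree_nmem[OF ag])
    then show "nmem (den ?c1 (nwrite ''a'' 0 a s')) ''cluster'' a = nmem s ''asg'' a \<and>
        (\<forall>a'<a. nmem (den ?c1 (nwrite ''a'' 0 a s')) ''cluster'' a' = nmem s ''asg'' a')" using Q by simp
  qed (use envD(1)[OF env] in simp)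
  have env1: "env n d l k P col ?s1" by (rule env_den[OF env]) simp_all
  let ?Q = "\<lambda>j i s'. rmem s' ''center'' (j * d + i) = rmem s ''cen'' (j * d + i)"
  have 2: "\<forall>j<k. \<forall>i<d. ?Q j i ?s2"
  proof (rule den_For_all)
    fix j s' assume j: "j < k" and ag: "agree (insert ''j'' (nw ?L)) (rw ?L) ?s1 s'" and Q: "\<forall>j'<j. \<forall>i<d. ?Q j' i s'"
    let ?s = "nwrite ''j'' 0 j s'"
    have env': "env n d l k P col ?s" by (intro env_nwrite env_agree[OF env1 ag]) simp_all
    have cen': "rmem s' ''cen'' = rmem s ''cen''" by (simp add: agree_rmem[OF ag] rmem_den del: den.simps)
    let ?I = "\<lambda>M s1. (\<forall>i<M. ?Q j i s1) \<and> (\<forall>j'<j. \<forall>i<d. ?Q j' i s1)"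
    have "?I d (den ?L ?s)"
    proof (rule den_For[where I = ?I])
      fix i and s1 :: state assume i: "i < d" and ag1: "agree (insert ''i'' (nw ?c)) (rw ?c) ?s s1" and I: "?I i s1"
      have vals: "nmem s1 ''md'' j = j * d" "nmem s1 ''j'' 0 = j" "rmem s1 ''cen'' = rmem s ''cen''"
        using envD(6)[OF env', of j] j by (simp_all add: agree_nmem[OF ag1] agree_rmem[OF ag1] cen')
      show "?I (Suc i) (den ?c (nwrite ''i'' 0 i s1))"
        using I i by (auto simp: vals less_Suc_eq row_index_inj)
    qed (use Q envD(2)[OF env'] in simp_all)
    then show "(\<forall>i<d. ?Q j i (den ?L ?s)) \<and> (\<forall>j'<j. \<forall>i<d. ?Q j' i (den ?L ?s))" .
  qed simp
  have e: "den (copy_prog k) s = ?s2" by (simp add: copy_prog_def)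
  have 3: "nmem ?s2 ''cluster'' = nmem ?s1 ''cluster''" by (rule nmem_den) simp
  show "\<forall>a<n. nmem (den (copy_prog k) s) ''cluster'' a = nmem s ''asg'' a" unfolding e 3 by (rule 1)
  show "\<forall>j<k. \<forall>i<d. rmem (den (copy_prog k) s) ''center'' (j * d + i) = rmem s ''cen'' (j * d + i)"
    unfolding e by (rule 2)
qed

definition store_prog :: "nat \<Rightarrow> lp" where
  "store_prog k = LIf (BAnd (NEq (nv ''all'') (NConst (Suc 0))) (BNot (BAnd (NEq (nv ''bf'') (NConst (Suc 0))) (BNot (RLess (rv ''tot'') (rv ''best''))))))
     (SN ''bf'' (NConst (Suc 0)) ;; SR ''best'' (rv ''tot'') ;; copy_prog k) LSkip"

lemma store_prog_sets [simp]:
  "nw (store_prog k) = {''bf'', ''a'', ''cluster'', ''j'', ''i''}" "rw (store_prog k) = {''best'', ''center''}"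
  by (auto simp: store_prog_def)

context search
begin

text \<open>For fixed sizes the colors do not interact, so their searches run one after the other.
  The number of colors thus enters the time as a factor and not in the exponent.\<close>

definition colors_prog :: lp where
  "colors_prog = SN ''all'' (NConst (Suc 0)) ;; LFor ''c'' 0 (nv ''l'') color_prog"

lemma colors_prog_sets: "nw colors_prog \<subseteq> insert ''c'' (insert ''all'' AB)" "rw colors_prog \<subseteq> RW"
proof -
  have "nw color_prog \<subseteq> insert ''c'' (insert ''all'' AB)"
    using color_prog_sets(1) by (rule order_trans) (rule subset_insertI)
  then show "nw colors_prog \<subseteq> insert ''c'' (insert ''all'' AB)" by (simp add: colors_prog_def)
  show "rw colors_prog \<subseteq> RW" using color_prog_sets(2) by (simp add: colors_prog_def)
qed

lemma den_colors_prog: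
  assumes env: "ENV s"
  shows "(nmem (den colors_prog s) ''all'' 0 = 1 \<longrightarrow> (\<forall>c<l. feasible k (CC c) (nmem s ''S'') (nmem (den colors_prog s) ''asg''))) \<and>
    (\<forall>X. (\<forall>c<l. rule_good (rmem s ''D'') (nmem s ''S'') (nmem s ''near'') c (X c)) \<longrightarrow> nmem (den colors_prog s) ''all'' 0 = 1 \<and>
      (\<forall>c<l. table_cost obj k (rmem s ''D'') (CC c) (nmem (den colors_prog s) ''asg'') \<le> X c))"
proof -
  let ?D = "rmem s ''D''" and ?S = "nmem s ''S''" and ?near = "nmem s ''near''"
  let ?s = "nwrite ''all'' 0 (Suc 0) s"
  let ?I = "\<lambda>M s'. (nmem s' ''all'' 0 = 1 \<longrightarrow> (\<forall>c<M. feasible k (CC c) ?S (nmem s' ''asg''))) \<and>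
    (\<forall>X. (\<forall>c<M. rule_good ?D ?S ?near c (X c)) \<longrightarrow> nmem s' ''all'' 0 = 1 \<and> (\<forall>c<M. table_cost obj k ?D (CC c) (nmem s' ''asg'') \<le> X c))"
  have "?I l (den (LFor ''c'' 0 (nv ''l'') color_prog) ?s)"
  proof (rule den_For[where I = ?I])
    show "?I 0 ?s" by simp
    show "nval (nv ''l'') ?s = l" using envD(3)[OF env] by simp
  next
    fix c s' assume c: "c < l" and ag0: "agree (insert ''c'' (nw color_prog)) (rw color_prog) ?s s'" and I: "?I c s'"
    let ?s1 = "nwrite ''c'' 0 c s'"
    let ?s2 = "den color_prog ?s1"
    have ag: "agree (insert ''c'' (insert ''all'' AB)) RW ?s s'"
      using ag0 by (rule agree_mono) (rule insert_mono[OF color_prog_sets(1)], rule color_prog_sets(2))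
    have env1: "ENV ?s1" by (intro env_nwrite env_agree[OF env_nwrite[OF env] ag]) simp_all
    have v: "nmem ?s1 ''S'' = ?S" "rmem ?s1 ''D'' = ?D" "nmem ?s1 ''near'' = ?near" "nmem ?s1 ''c'' 0 = c"
      "nmem ?s1 ''all'' = nmem s' ''all''" "nmem ?s1 ''asg'' = nmem s' ''asg''"
      by (simp_all add: agree_nmem[OF ag] agree_rmem[OF ag])
    obtain ok where ok: "nmem ?s2 ''all'' 0 = (if ok then nmem s' ''all'' 0 else 0)"
      "ok \<longrightarrow> feasible k (CC c) ?S (nmem ?s2 ''asg'')"
      "\<forall>X. rule_good ?D ?S ?near c X \<longrightarrow> ok \<and> table_cost obj k ?D (CC c) (nmem ?s2 ''asg'') \<le> X"
      "\<forall>a. a \<notin> CC c \<longrightarrow> nmem ?s2 ''asg'' a = nmem s' ''asg'' a"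
      using den_color_prog[OF env1] unfolding v by blast
    \<comment> \<open>Color classes are disjoint, hence the search for color \<open>c\<close> does
      not disturb what earlier colors have obtained.\<close>
    have same: "nmem ?s2 ''asg'' a = nmem s' ''asg'' a" if "c' < c" "a \<in> CC c'" for c' a
    proof -
      have "a \<notin> CC c" using that by (auto simp: color_class_def)
      then show ?thesis using ok(4) by blast
    qed
    have F: "feasible k (CC c') ?S (nmem ?s2 ''asg'') \<longleftrightarrow> feasible k (CC c') ?S (nmem s' ''asg'')"
      "table_cost obj k ?D (CC c') (nmem ?s2 ''asg'') = table_cost obj k ?D (CC c') (nmem s' ''asg'')" if "c' < c" for c'
      by (rule feasible_cong table_cost_cong; rule same[OF that]; assumption)+
    show "?I (Suc c) ?s2"
    proof (intro conjI allI impI)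
      fix c' assume a: "nmem ?s2 ''all'' 0 = 1" and c': "c' < Suc c"
      have ok': ok "nmem s' ''all'' 0 = 1" using a ok(1) by (auto split: if_splits)
      show "feasible k (CC c') ?S (nmem ?s2 ''asg'')"
      proof (cases "c' = c")
        case True
        then show ?thesis using ok(2) ok'(1) by blast
      next
        case False
        then have "c' < c" using c' by simp
        then show ?thesis using I ok'(2) F(1) by blast
      qed
    next
      fix X assume X: "\<forall>c'<Suc c. rule_good ?D ?S ?near c' (X c')"
      then have 1: "nmem s' ''all'' 0 = 1" "\<forall>c'<c. table_cost obj k ?D (CC c') (nmem s' ''asg'') \<le> X c'"
        and 2: ok "table_cost obj k ?D (CC c) (nmem ?s2 ''asg'') \<le> X c" using I ok(3) less_Suc_eq by blast+
      show "nmem ?s2 ''all'' 0 = 1" using ok(1) 1 2 by simp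
      fix c' assume c': "c' < Suc c"
      show "table_cost obj k ?D (CC c') (nmem ?s2 ''asg'') \<le> X c'"
      proof (cases "c' = c")
        case False
        then have "c' < c" using c' by simp
        then show ?thesis using 1(2) F(2) by simp
      qed (use 2 in simp)
    qed
  qed
  moreover have "den colors_prog s = den (LFor ''c'' 0 (nv ''l'') color_prog) ?s" by (simp add: colors_prog_def)
  ultimately show ?thesis by (simp only:)
qed

definition inner_prog :: lp where
  "inner_prog = sp ;; colors_prog ;; total_prog obj k ;; store_prog k"

abbreviation "AI \<equiv> insert ''near'' (insert ''S'' (insert ''bf'' (insert ''cluster'' (insert ''i'' (insert ''j'' (insert ''c'' (insert ''all'' AB)))))))"
abbreviation "RI \<equiv> insert ''tot'' (insert ''best'' (insert ''center'' RW))"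

lemma inner_prog_sets: "nw inner_prog \<subseteq> AI" "rw inner_prog \<subseteq> RI"
proof -
  have "nw sp \<subseteq> AI" by (rule order_trans[OF sp_nw]) simp
  moreover have "nw colors_prog \<subseteq> AI"
    by (rule order_trans[OF colors_prog_sets(1)]) (intro subset_insertI2 order_refl)
  ultimately show "nw inner_prog \<subseteq> AI" unfolding inner_prog_def nw.simps total_prog_sets store_prog_sets by simp
  have "rw sp \<subseteq> RI" by (rule order_trans[OF sp_rw]) simp
  moreover have "rw colors_prog \<subseteq> RI"
    by (rule order_trans[OF colors_prog_sets(2)]) (intro subset_insertI2 order_refl)
  ultimately show "rw inner_prog \<subseteq> RI" unfolding inner_prog_def rw.simps total_prog_sets store_prog_sets by simp
qed

lemma inner_prog_agree: "agree AI RI s (den inner_prog s)"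
  using inner_prog_sets by (rule agree_mono[OF den_agree])

definition fair_assignment :: "(nat \<Rightarrow> nat) \<Rightarrow> bool" where
  "fair_assignment f \<longleftrightarrow> (\<forall>a<n. f a < k) \<and> (\<exists>\<sigma>. \<forall>c<l. \<forall>v<k. card {a\<in>CC c. f a = v} = \<sigma> v)"

definition stored :: "state \<Rightarrow> bool" where
  "stored s \<longleftrightarrow> (nmem s ''bf'' 0 = 1 \<longrightarrow> fair_assignment (nmem s ''cluster'') \<and>
     rmem s ''best'' 0 = agg obj {..<n} (\<lambda>a. zc obj d (P a) (\<lambda>i. rmem s ''center'' (nmem s ''cluster'' a * d + i))))"

definition best_le :: "state \<Rightarrow> real \<Rightarrow> bool" where
  "best_le s X \<longleftrightarrow> nmem s ''bf'' 0 = 1 \<and> rmem s ''best'' 0 \<le> X"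

text \<open>The two bounding functions \<open>p\<close> and \<open>q\<close> may depend on the sizes
  and on the table; the shape of the bound on each color is the one that
  \<open>agg_parts_add\<close> can combine.\<close>

definition candidate :: "(nat \<Rightarrow> real) \<Rightarrow> (nat \<Rightarrow> nat) \<Rightarrow> real \<Rightarrow> bool" where
  "candidate D gs X \<longleftrightarrow> (\<forall>S near. szrel D gs S near \<longrightarrow> (\<exists>p q. (\<forall>a. 0 \<le> p a) \<and> (\<forall>a. 0 \<le> q a) \<and>
     agg obj {..<n} p + agg obj {..<n} q \<le> X \<and>
     (\<forall>c<l. rule_good D S near c (agg obj (CC c) p + agg obj (CC c) q))))"

lemma zc_cong: "(\<And>i. i < d \<Longrightarrow> y i = y' i) \<Longrightarrow> zc obj d x y = zc obj d x y'"
  by (simp add: zc_def sqdist_def)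

text \<open>Only the third claim depends on a good guess. The first two hold for every guess: the
  stored solution is fair with its true cost on record, and it never gets worse.\<close>

lemma den_inner_prog:
  assumes env: "ENV s" and stored: "stored s"
    and table: "\<And>a j. a < n \<Longrightarrow> j < k \<Longrightarrow> rmem s ''D'' (k * a + j) = zc obj d (P a) (\<lambda>i. rmem s ''cen'' (j * d + i))"
  shows "stored (den inner_prog s)" and "best_le s X \<Longrightarrow> best_le (den inner_prog s) X"
    and "candidate (rmem s ''D'') (nmem s ''s'') X \<Longrightarrow> best_le (den inner_prog s) X"
proof -
  let ?s1 = "den sp s"
  let ?s2 = "den colors_prog ?s1"
  let ?s3 = "den (total_prog obj k) ?s2"
  let ?s4 = "den (store_prog k) ?s3"
  let ?D = "rmem s ''D''" and ?S = "nmem ?s1 ''S''" and ?near = "nmem ?s1 ''near''" and ?asg = "nmem ?s2 ''asg''"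
  have e: "den inner_prog s = ?s4" by (simp add: inner_prog_def)
  have ag2: "agree (insert ''c'' (insert ''all'' AB)) RW ?s1 ?s2"
    using colors_prog_sets by (rule agree_mono[OF den_agree])
  have env1: "ENV ?s1" by (rule env_agree[OF env sp_agree]) simp_all
  have env2: "ENV ?s2" by (rule env_agree[OF env1 ag2]) simp_all
  have env3: "ENV ?s3" by (rule env_den[OF env2]) simp_all
  have D1: "rmem ?s1 ''D'' = ?D" by (simp add: agree_rmem[OF sp_agree])
  have v2: "rmem ?s2 ''D'' = ?D" by (simp add: agree_rmem[OF ag2] D1)
  have v3: "nmem ?s3 ''asg'' = ?asg" "nmem ?s3 ''all'' = nmem ?s2 ''all''" by (simp_all add: nmem_den)
  have s3: "nmem ?s3 ''bf'' = nmem s ''bf''" "nmem ?s3 ''cluster'' = nmem s ''cluster''" "rmem ?s3 ''best'' = rmem s ''best''"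
    "rmem ?s3 ''center'' = rmem s ''center''" "rmem ?s3 ''cen'' = rmem s ''cen''"
    by (simp_all add: nmem_den[of _ "total_prog obj k"] rmem_den[of _ "total_prog obj k"] agree_nmem[OF ag2] agree_rmem[OF ag2]
      agree_nmem[OF sp_agree] agree_rmem[OF sp_agree])
  have st3: "stored ?s3" using stored unfolding stored_def s3 .
  have tot: "rmem ?s3 ''tot'' 0 = table_cost obj k ?D {..<n} ?asg"
    using den_total_prog[OF envD(1)[OF env2], of obj k] unfolding v2 .
  have C: "nmem ?s2 ''all'' 0 = 1 \<longrightarrow> (\<forall>c<l. feasible k (CC c) ?S ?asg)"
    "\<forall>X. (\<forall>c<l. rule_good ?D ?S ?near c (X c)) \<longrightarrow> nmem ?s2 ''all'' 0 = 1 \<and> (\<forall>c<l. table_cost obj k ?D (CC c) ?asg \<le> X c)"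
    using den_colors_prog[OF env1] unfolding D1 by blast+
  let ?cond = "nmem ?s2 ''all'' 0 = 1 \<and> \<not> (nmem s ''bf'' 0 = 1 \<and> rmem s ''best'' 0 \<le> rmem ?s3 ''tot'' 0)"
  let ?s5 = "rwrite ''best'' 0 (rmem ?s3 ''tot'' 0) (nwrite ''bf'' 0 (Suc 0) ?s3)"
  have s4: "?s4 = (if ?cond then den (copy_prog k) ?s5 else ?s3)"
    by (auto simp: store_prog_def not_less v3 s3)
  have env5: "ENV ?s5" by (intro env_nwrite env_rwrite env3) simp_all
  have yes: "stored ?s4 \<and> nmem ?s4 ''bf'' 0 = 1 \<and> rmem ?s4 ''best'' 0 = rmem ?s3 ''tot'' 0" if cond: ?cond
  proof -
    have e4: "?s4 = den (copy_prog k) ?s5" unfolding s4 if_P[OF cond] ..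
    have "\<forall>a<n. nmem ?s4 ''cluster'' a = nmem ?s5 ''asg'' a" unfolding e4 by (rule den_copy_prog(1)[OF env5])
    then have cl: "\<And>a. a < n \<Longrightarrow> nmem ?s4 ''cluster'' a = ?asg a" using v3 by simp
    have "\<forall>j<k. \<forall>i<d. rmem ?s4 ''center'' (j * d + i) = rmem ?s5 ''cen'' (j * d + i)"
      unfolding e4 by (rule den_copy_prog(2)[OF env5])
    then have ce: "\<And>i j. j < k \<Longrightarrow> i < d \<Longrightarrow> rmem ?s4 ''center'' (j * d + i) = rmem s ''cen'' (j * d + i)" using s3 by simp
    have b4: "nmem ?s4 ''bf'' 0 = 1" "rmem ?s4 ''best'' 0 = rmem ?s3 ''tot'' 0"
      unfolding e4 by (simp_all add: nmem_den rmem_den)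
    have fe: "feasible k (CC c) ?S ?asg" if "c < l" for c using C(1) cond that by blast
    have asgk: "?asg a < k" if "a < n" for a
      using fe[OF col_less[OF that]] that by (simp add: feasible_def color_class_def)
    have "fair_assignment (nmem ?s4 ''cluster'')"
      unfolding fair_assignment_def
    proof (intro conjI exI[of _ ?S] allI impI)
      show "nmem ?s4 ''cluster'' a < k" if "a < n" for a using cl asgk that by simp
      fix c v assume cv: "c < l" "v < k"
      have "{a\<in>CC c. nmem ?s4 ''cluster'' a = v} = {a\<in>CC c. ?asg a = v}" using cl by (auto simp: color_class_def)
      then show "card {a\<in>CC c. nmem ?s4 ''cluster'' a = v} = ?S v" using fe[OF cv(1)] cv(2) by (simp add: feasible_def)
    qed
    moreover have "rmem ?s3 ''tot'' 0 = agg obj {..<n} (\<lambda>a. zc obj d (P a) (\<lambda>i. rmem ?s4 ''center'' (nmem ?s4 ''cluster'' a * d + i)))"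
      unfolding tot table_cost_def
    proof (rule agg_cong)
      fix a assume "a \<in> {..<n}"
      then have a: "a < n" by simp
      show "?D (k * a + ?asg a) = zc obj d (P a) (\<lambda>i. rmem ?s4 ''center'' (nmem ?s4 ''cluster'' a * d + i))"
        unfolding cl[OF a] table[OF a asgk[OF a]] by (rule zc_cong) (rule ce[OF asgk[OF a], symmetric])
    qed simp
    ultimately show ?thesis using b4 unfolding stored_def by simp
  qed
  have no: "?s4 = ?s3" if "\<not> ?cond" unfolding s4 if_not_P[OF that] ..
  show "stored (den inner_prog s)" unfolding e using yes no st3 by (cases ?cond) simp_all
  show "best_le (den inner_prog s) X" if "best_le s X"
  proof (cases ?cond)
    case True
    then show ?thesis using yes that unfolding e best_le_def by auto
  next
    case False
    then show ?thesis using that unfolding e no[OF False] best_le_def s3 by simp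
  qed
  show "best_le (den inner_prog s) X" if cand: "candidate ?D (nmem s ''s'') X"
  proof -
    have "szrel ?D (nmem s ''s'') ?S ?near" by (rule sp_spec[OF env])
    then obtain p q where pq: "\<And>a. 0 \<le> p a" "\<And>a. 0 \<le> q a" "agg obj {..<n} p + agg obj {..<n} q \<le> X"
      "\<forall>c<l. rule_good ?D ?S ?near c (agg obj (CC c) p + agg obj (CC c) q)" using cand unfolding candidate_def by blast
    have all: "nmem ?s2 ''all'' 0 = 1"
      and le: "\<And>c. c < l \<Longrightarrow> table_cost obj k ?D (CC c) ?asg \<le> agg obj (CC c) p + agg obj (CC c) q"
      using C(2)[rule_format, of "\<lambda>c. agg obj (CC c) p + agg obj (CC c) q"] pq(4) by blast+
    have "table_cost obj k ?D {..<n} ?asg \<le> agg obj {..<n} p + agg obj {..<n} q"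
      unfolding table_cost_def
      by (rule agg_parts_add[where part = col and l = l])
        (use col_less pq(1,2) le in \<open>auto simp: table_cost_def color_class_def\<close>)
    then have t: "rmem ?s3 ''tot'' 0 \<le> X" using pq(3) tot by simp
    show ?thesis
    proof (cases ?cond)
      case True
      then show ?thesis using yes t unfolding e best_le_def by simp
    next
      case False
      then have "nmem s ''bf'' 0 = 1 \<and> rmem s ''best'' 0 \<le> X" using all t by auto
      then show ?thesis unfolding e no[OF False] best_le_def s3 .
    qed
  qed
qed

definition outer_body :: "nat \<Rightarrow> lp" where
  "outer_body m = center_prog k m ;; table_prog obj k ;; nest K2 ''s'' R2 inner_prog"

abbreviation "AO \<equiv> insert ''s'' AI"
abbreviation "RO \<equiv> insert ''z'' (insert ''w'' (insert ''cen'' (insert ''D'' RI)))"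

lemma outer_body_sets: "nw (outer_body m) \<subseteq> AO" "rw (outer_body m) \<subseteq> RO"
proof -
  have "nw inner_prog \<subseteq> AO" by (rule order_trans[OF inner_prog_sets(1)]) (rule subset_insertI)
  then show "nw (outer_body m) \<subseteq> AO"
    unfolding outer_body_def nw.simps nw_nest center_prog_sets table_prog_sets by (cases "K2 = 0") simp_all
  have "rw inner_prog \<subseteq> RO" by (rule order_trans[OF inner_prog_sets(2)]) (intro subset_insertI2 order_refl)
  then show "rw (outer_body m) \<subseteq> RO"
    unfolding outer_body_def rw.simps rw_nest center_prog_sets table_prog_sets by simp
qed

lemma outer_body_agree: "agree AO RO s (den (outer_body m) s)"
  using outer_body_sets by (rule agree_mono[OF den_agree])

definition sizes_good :: "(nat \<Rightarrow> real) \<Rightarrow> real \<Rightarrow> bool" where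
  "sizes_good D X \<longleftrightarrow> (\<exists>gs. (\<forall>i<K2. gs i < N2) \<and> (\<forall>gs'. (\<forall>i<K2. gs' i = gs i) \<longrightarrow> candidate D gs' X))"

lemma stored_nwrite: "x \<noteq> ''bf'' \<Longrightarrow> x \<noteq> ''cluster'' \<Longrightarrow> stored s \<Longrightarrow> stored (nwrite x i v s)"
  and best_le_nwrite: "x \<noteq> ''bf'' \<Longrightarrow> best_le s X \<Longrightarrow> best_le (nwrite x i v s) X"
  by (simp_all add: stored_def best_le_def)

lemma den_outer_body:
  assumes env: "ENV s" and stored: "stored s" and np: "nmem s ''np'' 0 = np"
    and pool: "\<And>x. x < np \<Longrightarrow> nmem s ''pool'' x < n"
  shows "stored (den (outer_body m) s)" and "best_le s X \<Longrightarrow> best_le (den (outer_body m) s) X"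
    and "(\<And>D. (\<And>a j. a < n \<Longrightarrow> j < k \<Longrightarrow> D (k * a + j) =
        zc obj d (P a) (digit_center np m (\<lambda>x. P (nmem s ''pool'' x)) (nmem s ''g'') j)) \<Longrightarrow> sizes_good D X) \<Longrightarrow>
      best_le (den (outer_body m) s) X"
proof -
  let ?s1 = "den (center_prog k m) s"
  let ?s2 = "den (table_prog obj k) ?s1"
  let ?s3 = "den (nest K2 ''s'' R2 inner_prog) ?s2"
  have e: "den (outer_body m) s = ?s3" by (simp add: outer_body_def)
  have env1: "ENV ?s1" by (rule env_den[OF env]) simp_all
  have env2: "ENV ?s2" by (rule env_den[OF env1]) simp_all
  let ?dc = "digit_center np m (\<lambda>x. P (nmem s ''pool'' x)) (nmem s ''g'')"
  have cen1: "\<forall>j<k. \<forall>i<d. rmem ?s1 ''cen'' (j * d + i) = ?dc j i" using env np pool by (rule den_center_prog)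
  have cen2: "rmem ?s2 ''cen'' = rmem ?s1 ''cen''" by (simp add: rmem_den)
  have D2: "rmem ?s2 ''D'' (k * a + j) = zc obj d (P a) (?dc j)" if "a < n" "j < k" for a j
    using den_table_prog[OF env1, of ?dc obj] cen1 that by blast
  have D2': "rmem ?s2 ''D'' (k * a + j) = zc obj d (P a) (\<lambda>i. rmem ?s2 ''cen'' (j * d + i))" if "a < n" "j < k" for a j
    unfolding D2[OF that] cen2 by (rule zc_cong) (use cen1 that in simp)
  have s2: "nmem ?s2 ''bf'' = nmem s ''bf''" "nmem ?s2 ''cluster'' = nmem s ''cluster''" "rmem ?s2 ''best'' = rmem s ''best''"
    "rmem ?s2 ''center'' = rmem s ''center''" by (simp_all add: nmem_den rmem_den)
  have st2: "stored ?s2" using stored unfolding stored_def s2 .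
  let ?D = "rmem ?s2 ''D''"
  let ?Inv = "\<lambda>s'. agree AO RI ?s2 s' \<and> stored s' \<and> (\<forall>X. best_le ?s2 X \<longrightarrow> best_le s' X)"
  \<comment> \<open>Cells of \<open>''s''\<close> beyond the first \<open>K2\<close> are arbitrary,
    which is why all \<open>gs'\<close> agreeing with \<open>gs\<close> there are
    considered.\<close>
  let ?G = "\<lambda>gs s'. \<forall>X. (\<forall>gs'. (\<forall>i<K2. gs' i = gs i) \<longrightarrow> candidate ?D gs' X) \<longrightarrow> best_le s' X"
  have E: "ENV s'" if "?Inv s'" for s' by (rule env_agree[OF env2 conjunct1[OF that]]) simp_all
  have V: "rmem s' ''D'' = ?D" "rmem s' ''cen'' = rmem ?s2 ''cen''" if "?Inv s'" for s'
    using agree_rmem[OF conjunct1[OF that]] by simp_all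
  have St: "stored s'" if "?Inv s'" for s' using that by blast
  have T: "rmem s' ''D'' (k * a + j) = zc obj d (P a) (\<lambda>i. rmem s' ''cen'' (j * d + i))" if "?Inv s'" "a < n" "j < k" for s' a j
    unfolding V[OF that(1)] by (rule D2'[OF that(2,3)])
  have "?Inv ?s3 \<and> (\<forall>g. (\<forall>i<K2. g i < N2) \<longrightarrow> ?G g ?s3)"
  proof (rule nest_search[where Inv = ?Inv and G = ?G])
    show "?Inv ?s2" using st2 by simp
    show "nval R2 s' = N2" if "?Inv s'" for s' by (rule R2[OF E[OF that]])
    show "?Inv (nwrite ''s'' i v s')" if I: "?Inv s'" for s' i v
    proof (intro conjI allI impI)
      have "agree AO RI s' (nwrite ''s'' i v s')" by (simp add: agree_def)
      then show "agree AO RI ?s2 (nwrite ''s'' i v s')" by (rule agree_trans[OF conjunct1[OF I]])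
      show "stored (nwrite ''s'' i v s')" by (rule stored_nwrite[OF _ _ St[OF I]]) simp_all
      show "best_le (nwrite ''s'' i v s') X" if "best_le ?s2 X" for X
        by (rule best_le_nwrite) (use I that in simp_all)
    qed
    show "?Inv (den inner_prog s')" if I: "?Inv s'" for s'
    proof (intro conjI allI impI)
      have "agree AO RI s' (den inner_prog s')"
        by (rule agree_mono[OF inner_prog_agree]) (rule subset_insertI, rule order_refl)
      then show "agree AO RI ?s2 (den inner_prog s')" by (rule agree_trans[OF conjunct1[OF I]])
      show "stored (den inner_prog s')" by (rule den_inner_prog(1)[OF E[OF I] St[OF I] T[OF I]])
      show "best_le (den inner_prog s') X" if "best_le ?s2 X" for X
        by (rule den_inner_prog(2)[OF E[OF I] St[OF I] T[OF I]]) (use I that in blast)+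
    qed
    show "?G g (nwrite ''s'' i v s')" if "?Inv s'" "?G g s'" for s' i v g
      using that(2) by (intro allI impI best_le_nwrite) simp_all
    show "?G g (den inner_prog s')" if I: "?Inv s'" and G: "?G g s'" for s' g
      by (intro allI impI, rule den_inner_prog(2)[OF E[OF I] St[OF I] T[OF I]]) (use G in blast)+
    show "?G g (den inner_prog s')" if I: "?Inv s'" and g: "\<And>i. i < K2 \<Longrightarrow> nmem s' ''s'' i = g i" for s' g
      by (intro allI impI, rule den_inner_prog(3)[OF E[OF I] St[OF I] T[OF I]]) (use g V[OF I] in simp_all)
    show "''s'' \<notin> nw inner_prog"
    proof
      assume "''s'' \<in> nw inner_prog"
      from subsetD[OF inner_prog_sets(1) this] show False by simp
    qed
  qed
  then have I: "?Inv ?s3" and G: "\<And>g. (\<forall>i<K2. g i < N2) \<Longrightarrow> ?G g ?s3" by blast+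
  show "stored (den (outer_body m) s)" unfolding e by (rule St[OF I])
  show "best_le (den (outer_body m) s) X" if "best_le s X"
  proof -
    have "best_le ?s2 X" using that unfolding best_le_def s2 .
    then show ?thesis unfolding e using I by blast
  qed
  show "best_le (den (outer_body m) s) X"
    if "\<And>D. (\<And>a j. a < n \<Longrightarrow> j < k \<Longrightarrow> D (k * a + j) = zc obj d (P a) (?dc j)) \<Longrightarrow> sizes_good D X"
  proof -
    have "sizes_good ?D X" by (rule that[OF D2])
    then show ?thesis unfolding sizes_good_def e using G by blast
  qed
qed

definition search_prog :: "nat \<Rightarrow> nat \<Rightarrow> nexp \<Rightarrow> lp" where
  "search_prog m K1 R1 = SN ''bf'' (NConst 0) ;; nest K1 ''g'' R1 (outer_body m)"

lemma search_prog_sets: "nw (search_prog m K1 R1) \<subseteq> insert ''g'' AO" "rw (search_prog m K1 R1) \<subseteq> RO"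
proof -
  have "nw (outer_body m) \<subseteq> insert ''g'' AO" by (rule order_trans[OF outer_body_sets(1)]) (rule subset_insertI)
  then show "nw (search_prog m K1 R1) \<subseteq> insert ''g'' AO"
    unfolding search_prog_def nw.simps nw_nest by (cases "K1 = 0") simp_all
  show "rw (search_prog m K1 R1) \<subseteq> RO" unfolding search_prog_def using outer_body_sets(2) by simp
qed

text \<open>A single digit vector \<open>g\<close> of centers suffices for completeness. It has to
  work for all \<open>g'\<close> and \<open>D\<close> that agree with the intended digits and
  distances, because the arrays contain further cells with unknown content.\<close>

lemma den_search_prog:
  assumes env: "ENV s" and np: "nmem s ''np'' 0 = np" and pool: "\<And>x. x < np \<Longrightarrow> nmem s ''pool'' x < n"
    and R1: "\<And>s'. ENV s' \<Longrightarrow> nmem s' ''np'' 0 = np \<Longrightarrow> nval R1 s' = N1"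
  shows "stored (den (search_prog m K1 R1) s)"
    and "\<lbrakk>\<And>i. i < K1 \<Longrightarrow> g i < N1; \<And>g' D. (\<And>i. i < K1 \<Longrightarrow> g' i = g i) \<Longrightarrow>
        (\<And>a j. a < n \<Longrightarrow> j < k \<Longrightarrow> D (k * a + j) = zc obj d (P a) (digit_center np m (\<lambda>x. P (nmem s ''pool'' x)) g' j)) \<Longrightarrow>
        sizes_good D X\<rbrakk> \<Longrightarrow> best_le (den (search_prog m K1 R1) s) X"
proof -
  let ?s1 = "nwrite ''bf'' 0 0 s"
  let ?s2 = "den (nest K1 ''g'' R1 (outer_body m)) ?s1"
  have e: "den (search_prog m K1 R1) s = ?s2" by (simp add: search_prog_def)
  have env1: "ENV ?s1" by (rule env_nwrite[OF env]) simp
  let ?Inv = "\<lambda>s'. agree (insert ''g'' AO) RO ?s1 s' \<and> stored s'"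
  let ?dc = "\<lambda>g. digit_center np m (\<lambda>x. P (nmem s ''pool'' x)) g"
  let ?G = "\<lambda>g s'. \<forall>X. (\<forall>g' D. (\<forall>i<K1. g' i = g i) \<longrightarrow> (\<forall>a<n. \<forall>j<k. D (k * a + j) = zc obj d (P a) (?dc g' j)) \<longrightarrow> sizes_good D X) \<longrightarrow> best_le s' X"
  have E: "ENV s'" if "?Inv s'" for s' by (rule env_agree[OF env1 conjunct1[OF that]]) simp_all
  have V: "nmem s' ''np'' 0 = np" "nmem s' ''pool'' = nmem s ''pool''" if "?Inv s'" for s'
    using agree_nmem[OF conjunct1[OF that]] np by simp_all
  have Pl: "x < np \<Longrightarrow> nmem s' ''pool'' x < n" if "?Inv s'" for s' x unfolding V(2)[OF that] by (rule pool)
  have "?Inv ?s2 \<and> (\<forall>g. (\<forall>i<K1. g i < N1) \<longrightarrow> ?G g ?s2)"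
  proof (rule nest_search[where Inv = ?Inv and G = ?G])
    show "?Inv ?s1" by (simp add: stored_def)
    show "nval R1 s' = N1" if "?Inv s'" for s' by (rule R1[OF E[OF that] V(1)[OF that]])
    show "?Inv (nwrite ''g'' i v s')" if I: "?Inv s'" for s' i v
    proof (intro conjI)
      have "agree (insert ''g'' AO) RO s' (nwrite ''g'' i v s')" by (simp add: agree_def)
      then show "agree (insert ''g'' AO) RO ?s1 (nwrite ''g'' i v s')" by (rule agree_trans[OF conjunct1[OF I]])
      show "stored (nwrite ''g'' i v s')" by (rule stored_nwrite[OF _ _ conjunct2[OF I]]) simp_all
    qed
    show "?Inv (den (outer_body m) s')" if I: "?Inv s'" for s'
    proof (intro conjI)
      have "agree (insert ''g'' AO) RO s' (den (outer_body m) s')"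
        by (rule agree_mono[OF outer_body_agree]) (rule subset_insertI, rule order_refl)
      then show "agree (insert ''g'' AO) RO ?s1 (den (outer_body m) s')" by (rule agree_trans[OF conjunct1[OF I]])
      show "stored (den (outer_body m) s')" by (rule den_outer_body(1)[OF E[OF I] conjunct2[OF I] V(1)[OF I] Pl[OF I]])
    qed
    show "?G g (nwrite ''g'' i v s')" if "?Inv s'" "?G g s'" for s' i v g
      using that(2) by (intro allI impI best_le_nwrite) simp_all
    show "?G g (den (outer_body m) s')" if I: "?Inv s'" and G: "?G g s'" for s' g
      by (intro allI impI, rule den_outer_body(2)[OF E[OF I] conjunct2[OF I] V(1)[OF I] Pl[OF I]]) (use G in blast)+
    show "?G g (den (outer_body m) s')" if I: "?Inv s'" and g: "\<And>i. i < K1 \<Longrightarrow> nmem s' ''g'' i = g i" for s' g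
    proof (intro allI impI)
      fix X assume X: "\<forall>g' D. (\<forall>i<K1. g' i = g i) \<longrightarrow> (\<forall>a<n. \<forall>j<k. D (k * a + j) = zc obj d (P a) (?dc g' j)) \<longrightarrow> sizes_good D X"
      show "best_le (den (outer_body m) s') X"
      proof (rule den_outer_body(3)[OF E[OF I] conjunct2[OF I] V(1)[OF I] Pl[OF I]])
        fix D assume "\<And>a j. a < n \<Longrightarrow> j < k \<Longrightarrow> D (k * a + j) = zc obj d (P a) (digit_center np m (\<lambda>x. P (nmem s' ''pool'' x)) (nmem s' ''g'') j)"
        then have "\<forall>a<n. \<forall>j<k. D (k * a + j) = zc obj d (P a) (?dc (nmem s' ''g'') j)" unfolding V(2)[OF I] by blast
        then show "sizes_good D X" using X g by blast
      qed
    qed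
    show "''g'' \<notin> nw (outer_body m)"
    proof
      assume "''g'' \<in> nw (outer_body m)"
      from subsetD[OF outer_body_sets(1) this] show False by simp
    qed
  qed
  then have I: "?Inv ?s2" and G: "\<And>g. (\<forall>i<K1. g i < N1) \<Longrightarrow> ?G g ?s2" by blast+
  show "stored (den (search_prog m K1 R1) s)" unfolding e by (rule conjunct2[OF I])
  assume g: "\<And>i. i < K1 \<Longrightarrow> g i < N1" and gD: "\<And>g' D. (\<And>i. i < K1 \<Longrightarrow> g' i = g i) \<Longrightarrow>
        (\<And>a j. a < n \<Longrightarrow> j < k \<Longrightarrow> D (k * a + j) = zc obj d (P a) (?dc g' j)) \<Longrightarrow> sizes_good D X"
  have "?G g ?s2" by (rule G) (use g in blast)
  then show "best_le (den (search_prog m K1 R1) s) X" unfolding e using gD by blast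
qed

end

section \<open>Computing the pool\<close>

definition identity_pool_prog :: lp where
  "identity_pool_prog = LFor ''a'' 0 (nv ''n'') (LN ''pool'' (nv ''a'') (nv ''a'')) ;; SN ''np'' (nv ''n'')"

lemma identity_pool_prog_sets [simp]: "nw identity_pool_prog = {''a'', ''pool'', ''np''}" "rw identity_pool_prog = {}"
  by (auto simp: identity_pool_prog_def)

lemma den_identity_pool_prog:
  assumes "nmem s ''n'' 0 = n"
  shows "nmem (den identity_pool_prog s) ''np'' 0 = n" "\<forall>a<n. nmem (den identity_pool_prog s) ''pool'' a = a"
proof -
  let ?s = "den (LFor ''a'' 0 (nv ''n'') (LN ''pool'' (nv ''a'') (nv ''a''))) s"
  have "\<forall>a<n. nmem ?s ''pool'' a = a" by (rule den_For_all) (use assms in auto)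
  moreover have "nmem ?s ''n'' 0 = n" using assms by (simp add: nmem_den del: den.simps)
  ultimately show "nmem (den identity_pool_prog s) ''np'' 0 = n" "\<forall>a<n. nmem (den identity_pool_prog s) ''pool'' a = a"
    by (simp_all add: identity_pool_prog_def del: den.simps(6))
qed

text \<open>Doubling \<open>''x''\<close> computes \<open>k + k * L\<close> with 2^L between
  \<open>4 * n\<close> and \<open>8 * n\<close>, without logarithm or product. The limit
  \<open>4 * n\<close> is generous: that many doublings always exceed \<open>4 * n\<close>, and the
  last doubling starts below it.\<close>

definition count_prog :: "nat \<Rightarrow> lp" where
  "count_prog k = SN ''x'' (NConst (Suc 0)) ;; SN ''N'' (NConst k) ;;
     LFor ''t'' 0 (kmul 4 (nv ''n'')) (LIf (NLess (nv ''x'') (kmul 4 (nv ''n'')))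
       (SN ''x'' (NPlus (nv ''x'') (nv ''x'')) ;; SN ''N'' (NPlus (nv ''N'') (NConst k))) LSkip)"

lemma count_prog_sets [simp]: "nw (count_prog k) = {''x'', ''N'', ''t''}" "rw (count_prog k) = {}"
  by (auto simp: count_prog_def)

lemma den_count_prog:
  assumes n: "nmem s ''n'' 0 = n" "n \<ge> 1"
  shows "\<exists>L. nmem (den (count_prog k) s) ''N'' 0 = k + k * L \<and> 4 * n \<le> 2 ^ L \<and> 2 ^ L \<le> 8 * n"
proof -
  let ?c = "LIf (NLess (nv ''x'') (kmul 4 (nv ''n'')))
       (SN ''x'' (NPlus (nv ''x'') (nv ''x'')) ;; SN ''N'' (NPlus (nv ''N'') (NConst k))) LSkip"
  let ?s = "nwrite ''N'' 0 k (nwrite ''x'' 0 (Suc 0) s)"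
  let ?I = "\<lambda>t s'. \<exists>L. nmem s' ''N'' 0 = k + k * L \<and> nmem s' ''x'' 0 = 2 ^ L \<and> 2 ^ L \<le> 8 * n \<and> (4 * n \<le> 2 ^ L \<or> L = t)"
  let ?s1 = "den (LFor ''t'' 0 (kmul 4 (nv ''n'')) ?c) ?s"
  have "?I (4 * n) ?s1"
  proof (rule den_For[where I = ?I])
    show "?I 0 ?s" using n by (intro exI[of _ 0]) auto
  next
    fix t and s' :: state assume ag: "agree (insert ''t'' (nw ?c)) (rw ?c) ?s s'" and "?I t s'"
    then obtain L where L: "nmem s' ''N'' 0 = k + k * L" "nmem s' ''x'' 0 = 2 ^ L" "2 ^ L \<le> 8 * n" "4 * n \<le> 2 ^ L \<or> L = t"
      by blast
    have n': "nmem s' ''n'' 0 = n" using n by (simp add: agree_nmem[OF ag])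
    show "?I (Suc t) (den ?c (nwrite ''t'' 0 t s'))"
    proof (cases "4 * n \<le> 2 ^ L")
      case True
      then show ?thesis using L by (intro exI[of _ L]) (simp add: n')
    next
      case False
      then show ?thesis using L by (intro exI[of _ "Suc L"]) (simp add: n')
    qed
  qed (use n in simp)
  then obtain L where L: "nmem ?s1 ''N'' 0 = k + k * L" "2 ^ L \<le> 8 * n" "4 * n \<le> 2 ^ L \<or> L = 4 * n" by blast
  have "4 * n \<le> 2 ^ L" using L(3) less_exp[of L] by (auto intro: less_imp_le)
  moreover have "den (count_prog k) s = ?s1" by (simp add: count_prog_def)
  ultimately show ?thesis using L by auto
qed

definition point_dist_prog :: "objective \<Rightarrow> string \<Rightarrow> lp" where
  "point_dist_prog obj x = zdist obj ''point'' (NRead ''md'' (nv ''a'')) ''point'' (NRead ''md'' (nv x))"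

lemma point_dist_prog_sets [simp]: "nw (point_dist_prog obj x) = {''i''}" "rw (point_dist_prog obj x) = {''z''}"
  by (simp_all add: point_dist_prog_def)

lemma den_point_dist_prog:
  assumes env: "env n d l k P col s" and a: "nmem s ''a'' 0 = a" "a < n" and t: "nmem s x 0 = t" "t < n" and x: "x \<noteq> ''i''"
  shows "rmem (den (point_dist_prog obj x) s) ''z'' 0 = zc obj d (P a) (P t)"
  unfolding point_dist_prog_def by (rule den_zdist[OF envD(2)[OF env]]) (use envD(5,6)[OF env] a t x in auto)

text \<open>The array may list a point repeatedly, so the set of its entries is what is tracked.
  \<open>''dT''\<close> caches the distances to the pool, which makes a trial insertion
  cheap.\<close>

definition pooled :: "objective \<Rightarrow> nat \<Rightarrow> nat \<Rightarrow> (nat \<Rightarrow> point) \<Rightarrow> nat set \<Rightarrow> state \<Rightarrow> bool" where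
  "pooled obj n d P T s \<longleftrightarrow> T = nmem s ''pool'' ` {..<nmem s ''np'' 0} \<and> T \<subseteq> {..<n} \<and> T \<noteq> {} \<and>
     (\<forall>a<n. rmem s ''dT'' a = pool_dist obj d P T a)"

lemma pooled_cong:
  assumes "nmem s' ''pool'' = nmem s ''pool''" "nmem s' ''np'' = nmem s ''np''" "rmem s' ''dT'' = rmem s ''dT''"
  shows "pooled obj n d P T s' \<longleftrightarrow> pooled obj n d P T s"
  unfolding pooled_def assms ..

lemma pooledD:
  assumes "pooled obj n d P T s"
  shows "T = nmem s ''pool'' ` {..<nmem s ''np'' 0}" "T \<subseteq> {..<n}" "T \<noteq> {}" "a < n \<Longrightarrow> rmem s ''dT'' a = pool_dist obj d P T a"
  using assms unfolding pooled_def by blast+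

lemma pooled_agree:
  "pooled obj n d P T s \<Longrightarrow> agree A B s s' \<Longrightarrow> ''pool'' \<notin> A \<Longrightarrow> ''np'' \<notin> A \<Longrightarrow> ''dT'' \<notin> B \<Longrightarrow> pooled obj n d P T s'"
  using pooled_cong[of s' s] by (simp add: agree_def)

definition insert_prog :: "objective \<Rightarrow> string \<Rightarrow> lp" where
  "insert_prog obj x = LN ''pool'' (nv ''np'') (nv x) ;; SN ''np'' (NPlus (nv ''np'') (NConst (Suc 0))) ;;
     LFor ''a'' 0 (nv ''n'') (point_dist_prog obj x ;;
       LIf (RLess (rv ''z'') (RRead ''dT'' (nv ''a''))) (LR ''dT'' (nv ''a'') (rv ''z'')) LSkip)"

lemma insert_prog_sets [simp]: "nw (insert_prog obj x) = {''pool'', ''np'', ''a'', ''i''}" "rw (insert_prog obj x) = {''z'', ''dT''}"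
  by (auto simp: insert_prog_def)

lemma den_insert_prog:
  assumes env: "env n d l k P col s" and T: "pooled obj n d P T s" and t: "nmem s x 0 = t" "t < n"
    and x: "x \<notin> {''pool'', ''np'', ''a'', ''i''}"
  shows "pooled obj n d P (insert t T) (den (insert_prog obj x) s)"
    and "nmem (den (insert_prog obj x) s) ''np'' 0 = nmem s ''np'' 0 + 1"
proof -
  let ?c = "point_dist_prog obj x ;;
       LIf (RLess (rv ''z'') (RRead ''dT'' (nv ''a''))) (LR ''dT'' (nv ''a'') (rv ''z'')) LSkip"
  let ?np = "nmem s ''np'' 0"
  let ?s1 = "nwrite ''np'' 0 (Suc ?np) (nwrite ''pool'' ?np t s)"
  let ?s2 = "den (LFor ''a'' 0 (nv ''n'') ?c) ?s1"
  have e: "den (insert_prog obj x) s = ?s2" using t x by (simp add: insert_prog_def)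
  have env1: "env n d l k P col ?s1" by (intro env_nwrite env) simp_all
  have finT: "finite T" using pooledD(2)[OF T] by (rule finite_subset) simp
  let ?I = "\<lambda>M s'. \<forall>a<n. rmem s' ''dT'' a = (if a < M then pool_dist obj d P (insert t T) a else pool_dist obj d P T a)"
  have I: "?I n ?s2"
  proof (rule den_For[where I = ?I])
    show "?I 0 ?s1" using pooledD(4)[OF T] by simp
    show "nval (nv ''n'') ?s1 = n" using envD(1)[OF env] by simp
  next
    fix a and s' :: state assume a: "a < n" and ag: "agree (insert ''a'' (nw ?c)) (rw ?c) ?s1 s'" and I: "?I a s'"
    let ?s' = "nwrite ''a'' 0 a s'"
    have env': "env n d l k P col ?s'" by (intro env_nwrite env_agree[OF env1 ag]) simp_all
    have x': "nmem ?s' x 0 = t" using x t by (simp add: agree_nmem[OF ag])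
    have z: "rmem (den (point_dist_prog obj x) ?s') ''z'' 0 = zc obj d (P a) (P t)"
      by (rule den_point_dist_prog[OF env' _ a x' t(2)]) (use x in simp_all)
    have fr: "rmem (den (point_dist_prog obj x) ?s') ''dT'' = rmem s' ''dT''" "nmem (den (point_dist_prog obj x) ?s') ''a'' 0 = a"
      by (simp_all add: nmem_den rmem_den)
    have "T \<noteq> {}" by (rule pooledD(3)[OF T])
    then show "?I (Suc a) (den ?c ?s')"
      using I a by (auto simp: z fr pool_dist_insert[OF finT] less_Suc_eq min_def)
  qed
  have v: "nmem ?s2 ''np'' 0 = Suc ?np" "nmem ?s2 ''pool'' = (nmem s ''pool'')(?np := t)"
    by (simp_all add: nmem_den del: den.simps)
  then show "nmem (den (insert_prog obj x) s) ''np'' 0 = ?np + 1" unfolding e by simp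
  have eT: "insert t T = (nmem s ''pool'')(?np := t) ` {..<Suc ?np}"
    using pooledD(1)[OF T] by (auto simp: lessThan_Suc)
  have sub: "insert t T \<subseteq> {..<n}" using pooledD(2)[OF T] t(2) by simp
  have dT: "\<forall>a<n. rmem ?s2 ''dT'' a = pool_dist obj d P (insert t T) a" using I by presburger
  show "pooled obj n d P (insert t T) (den (insert_prog obj x) s)"
    unfolding e pooled_def v by (intro conjI eT sub dT insert_not_empty)
qed

definition farthest_prog :: lp where
  "farthest_prog = SN ''far'' (NConst 0) ;; LFor ''a'' 0 (nv ''n'')
     (LIf (RLess (RRead ''dT'' (nv ''far'')) (RRead ''dT'' (nv ''a''))) (SN ''far'' (nv ''a'')) LSkip)"

lemma farthest_prog_sets [simp]: "nw farthest_prog = {''far'', ''a''}" "rw farthest_prog = {}"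
  by (auto simp: farthest_prog_def)

lemma den_farthest_prog:
  assumes n: "nmem s ''n'' 0 = n" "n \<ge> 1"
  shows "nmem (den farthest_prog s) ''far'' 0 < n"
    "\<forall>a<n. rmem s ''dT'' a \<le> rmem s ''dT'' (nmem (den farthest_prog s) ''far'' 0)"
proof -
  let ?c = "LIf (RLess (RRead ''dT'' (nv ''far'')) (RRead ''dT'' (nv ''a''))) (SN ''far'' (nv ''a'')) LSkip"
  let ?s = "nwrite ''far'' 0 0 s"
  let ?I = "\<lambda>M s'. nmem s' ''far'' 0 < n \<and> (\<forall>a<M. rmem s ''dT'' a \<le> rmem s ''dT'' (nmem s' ''far'' 0))"
  have "?I n (den (LFor ''a'' 0 (nv ''n'') ?c) ?s)"
  proof (rule den_For[where I = ?I])
    fix a and s' :: state assume a: "a < n" and ag: "agree (insert ''a'' (nw ?c)) (rw ?c) ?s s'" and I: "?I a s'"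
    have d: "rmem s' ''dT'' = rmem s ''dT''" by (simp add: agree_rmem[OF ag])
    show "?I (Suc a) (den ?c (nwrite ''a'' 0 a s'))"
      using I a by (auto simp: d less_Suc_eq not_less intro: less_imp_le order_trans)
  qed (use n in auto)
  then show "nmem (den farthest_prog s) ''far'' 0 < n"
    "\<forall>a<n. rmem s ''dT'' a \<le> rmem s ''dT'' (nmem (den farthest_prog s) ''far'' 0)"
    by (simp_all add: farthest_prog_def del: den.simps(6))
qed

definition gain_prog :: "objective \<Rightarrow> lp" where
  "gain_prog obj = SR ''F'' (RConst 0) ;; LFor ''a'' 0 (nv ''n'') (point_dist_prog obj ''t'' ;;
     LIf (RLess (rv ''z'') (RRead ''dT'' (nv ''a''))) (SR ''F'' (RPlus (rv ''F'') (rv ''z'')))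
       (SR ''F'' (RPlus (rv ''F'') (RRead ''dT'' (nv ''a'')))))"

lemma gain_prog_sets [simp]: "nw (gain_prog obj) = {''a'', ''i''}" "rw (gain_prog obj) = {''F'', ''z''}"
  by (auto simp: gain_prog_def)

lemma den_gain_prog:
  assumes env: "env n d l k P col s" and T: "pooled obj n d P T s" and t: "nmem s ''t'' 0 = t" "t < n"
  shows "rmem (den (gain_prog obj) s) ''F'' 0 = (\<Sum>a<n. pool_dist obj d P (insert t T) a)"
proof -
  let ?c = "point_dist_prog obj ''t'' ;;
     LIf (RLess (rv ''z'') (RRead ''dT'' (nv ''a''))) (SR ''F'' (RPlus (rv ''F'') (rv ''z'')))
       (SR ''F'' (RPlus (rv ''F'') (RRead ''dT'' (nv ''a''))))"
  let ?s = "rwrite ''F'' 0 0 s"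
  have finT: "finite T" "T \<noteq> {}" using pooledD(2)[OF T] by (rule finite_subset, simp) (rule pooledD(3)[OF T])
  have env1: "env n d l k P col ?s" by (intro env_rwrite env) simp
  let ?I = "\<lambda>M s'. rmem s' ''F'' 0 = (\<Sum>a<M. pool_dist obj d P (insert t T) a)"
  have "?I n (den (LFor ''a'' 0 (nv ''n'') ?c) ?s)"
  proof (rule den_For[where I = ?I])
    fix a and s' :: state assume a: "a < n" and ag: "agree (insert ''a'' (nw ?c)) (rw ?c) ?s s'" and I: "?I a s'"
    let ?s' = "nwrite ''a'' 0 a s'"
    have env': "env n d l k P col ?s'" by (intro env_nwrite env_agree[OF env1 ag]) simp_all
    have t': "nmem ?s' ''t'' 0 = t" using t by (simp add: agree_nmem[OF ag])
    have z: "rmem (den (point_dist_prog obj ''t'') ?s') ''z'' 0 = zc obj d (P a) (P t)"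
      by (rule den_point_dist_prog[OF env' _ a t' t(2)]) simp_all
    have "rmem s' ''dT'' a = pool_dist obj d P T a" using pooledD(4)[OF T a] by (simp add: agree_rmem[OF ag])
    then have fr: "rmem (den (point_dist_prog obj ''t'') ?s') ''dT'' a = pool_dist obj d P T a"
      "nmem (den (point_dist_prog obj ''t'') ?s') ''a'' 0 = a" "rmem (den (point_dist_prog obj ''t'') ?s') ''F'' = rmem s' ''F''"
      by (simp_all add: nmem_den rmem_den)
    show "?I (Suc a) (den ?c ?s')" using I by (auto simp: z fr pool_dist_insert[OF finT] min_def)
  qed (use envD(1)[OF env] in auto)
  then show ?thesis by (simp add: gain_prog_def del: den.simps(6))
qed

text \<open>The flag \<open>''gb''\<close> again takes the place of an infinite initial
  minimum.\<close>

definition greedy_choice_prog :: "objective \<Rightarrow> lp" where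
  "greedy_choice_prog obj = SN ''gb'' (NConst 0) ;; LFor ''t'' 0 (nv ''n'') (gain_prog obj ;;
     LIf (BAnd (NEq (nv ''gb'') (NConst (Suc 0))) (BNot (RLess (rv ''F'') (rv ''Fb'')))) LSkip
       (SN ''gb'' (NConst (Suc 0)) ;; SR ''Fb'' (rv ''F'') ;; SN ''gt'' (nv ''t'')))"

lemma greedy_choice_prog_sets [simp]:
  "nw (greedy_choice_prog obj) = {''gb'', ''t'', ''gt'', ''a'', ''i''}" "rw (greedy_choice_prog obj) = {''F'', ''z'', ''Fb''}"
  by (auto simp: greedy_choice_prog_def)

lemma den_greedy_choice_prog:
  assumes env: "env n d l k P col s" and T: "pooled obj n d P T s" and n: "n \<ge> 1"
  shows "nmem (den (greedy_choice_prog obj) s) ''gt'' 0 < n"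
    and "\<forall>t<n. (\<Sum>a<n. pool_dist obj d P (insert (nmem (den (greedy_choice_prog obj) s) ''gt'' 0) T) a) \<le>
      (\<Sum>a<n. pool_dist obj d P (insert t T) a)"
proof -
  let ?F = "\<lambda>t. \<Sum>a<n. pool_dist obj d P (insert t T) a"
  let ?c = "gain_prog obj ;;
     LIf (BAnd (NEq (nv ''gb'') (NConst (Suc 0))) (BNot (RLess (rv ''F'') (rv ''Fb'')))) LSkip
       (SN ''gb'' (NConst (Suc 0)) ;; SR ''Fb'' (rv ''F'') ;; SN ''gt'' (nv ''t''))"
  let ?s = "nwrite ''gb'' 0 0 s"
  have env1: "env n d l k P col ?s" by (intro env_nwrite env) simp
  let ?I = "\<lambda>M s'. (M = 0 \<and> nmem s' ''gb'' 0 = 0) \<or> (nmem s' ''gb'' 0 = 1 \<and> nmem s' ''gt'' 0 < n \<and>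
    rmem s' ''Fb'' 0 = ?F (nmem s' ''gt'' 0) \<and> (\<forall>t<M. ?F (nmem s' ''gt'' 0) \<le> ?F t))"
  have "?I n (den (LFor ''t'' 0 (nv ''n'') ?c) ?s)"
  proof (rule den_For[where I = ?I])
    show "?I 0 ?s" by simp
    show "nval (nv ''n'') ?s = n" using envD(1)[OF env] by simp
  next
    fix t and s' :: state assume t: "t < n" and ag: "agree (insert ''t'' (nw ?c)) (rw ?c) ?s s'" and I: "?I t s'"
    let ?s' = "nwrite ''t'' 0 t s'"
    have env': "env n d l k P col ?s'" by (intro env_nwrite env_agree[OF env1 ag]) simp_all
    have "pooled obj n d P T s'"
      by (rule pooled_agree[OF pooled_agree[OF T, of "{''gb''}" "{}"] ag]) (simp_all add: agree_def)
    then have T': "pooled obj n d P T ?s'" by (rule pooled_cong[THEN iffD2, rotated -1]) simp_all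
    have F: "rmem (den (gain_prog obj) ?s') ''F'' 0 = ?F t" by (rule den_gain_prog[OF env' T' _ t]) simp
    have fr: "nmem (den (gain_prog obj) ?s') ''gb'' = nmem s' ''gb''" "nmem (den (gain_prog obj) ?s') ''gt'' = nmem s' ''gt''"
      "rmem (den (gain_prog obj) ?s') ''Fb'' = rmem s' ''Fb''" "nmem (den (gain_prog obj) ?s') ''t'' 0 = t"
      by (simp_all add: nmem_den rmem_den)
    show "?I (Suc t) (den ?c ?s')"
    proof (cases "nmem s' ''gb'' 0 = 1 \<and> \<not> ?F t < rmem s' ''Fb'' 0")
      case True
      then have "den ?c ?s' = den (gain_prog obj) ?s'" by (simp add: F fr)
      then show ?thesis using I True unfolding less_Suc_eq by (auto simp: fr not_less)
    next
      case False
      then have e: "den ?c ?s' = nwrite ''gt'' 0 t (rwrite ''Fb'' 0 (?F t) (nwrite ''gb'' 0 (Suc 0) (den (gain_prog obj) ?s')))"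
        by (auto simp: F fr)
      have "?F t \<le> ?F t'" if "t' < t" for t'
        using I False that by (auto simp: not_less intro: less_imp_le less_le_trans)
      then show ?thesis unfolding e using t by (auto simp: less_Suc_eq)
    qed
  qed
  then have R: "?I n (den (greedy_choice_prog obj) s)" by (simp add: greedy_choice_prog_def del: den.simps(6))
  then show "nmem (den (greedy_choice_prog obj) s) ''gt'' 0 < n"
    "\<forall>t<n. ?F (nmem (den (greedy_choice_prog obj) s) ''gt'' 0) \<le> ?F t" using n by auto
qed

definition pool_step_prog :: "objective \<Rightarrow> lp" where
  "pool_step_prog obj = farthest_prog ;; insert_prog obj ''far'' ;; greedy_choice_prog obj ;; insert_prog obj ''gt''"

lemma pool_step_prog_sets [simp]:
  "nw (pool_step_prog obj) = {''far'', ''a'', ''pool'', ''np'', ''i'', ''gb'', ''t'', ''gt''}"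
  "rw (pool_step_prog obj) = {''z'', ''dT'', ''F'', ''Fb''}"
  by (auto simp: pool_step_prog_def)

lemma den_pool_step_prog:
  assumes env: "env n d l k P col s" and T: "pooled obj n d P T s" and n: "n \<ge> 1"
  shows "\<exists>T'. pool_step obj d P n T T' \<and> pooled obj n d P T' (den (pool_step_prog obj) s)"
    and "nmem (den (pool_step_prog obj) s) ''np'' 0 = nmem s ''np'' 0 + 2"
proof -
  let ?s1 = "den farthest_prog s"
  let ?s2 = "den (insert_prog obj ''far'') ?s1"
  let ?s3 = "den (greedy_choice_prog obj) ?s2"
  let ?s4 = "den (insert_prog obj ''gt'') ?s3"
  let ?f = "nmem ?s1 ''far'' 0" and ?t = "nmem ?s3 ''gt'' 0"
  have e: "den (pool_step_prog obj) s = ?s4" by (simp add: pool_step_prog_def)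
  have env1: "env n d l k P col ?s1" by (rule env_den[OF env]) simp_all
  have env2: "env n d l k P col ?s2" by (rule env_den[OF env1]) simp_all
  have env3: "env n d l k P col ?s3" by (rule env_den[OF env2]) simp_all
  have T1: "pooled obj n d P T ?s1" by (rule pooled_agree[OF T den_agree]) simp_all
  have f: "?f < n" "\<forall>a<n. rmem s ''dT'' a \<le> rmem s ''dT'' ?f" using den_farthest_prog[OF envD(1)[OF env] n] by blast+
  have far: "\<forall>a<n. pool_dist obj d P T a \<le> pool_dist obj d P T ?f" using f pooledD(4)[OF T] by simp
  have T2: "pooled obj n d P (insert ?f T) ?s2" by (rule den_insert_prog(1)[OF env1 T1 refl f(1)]) simp
  have np2: "nmem ?s2 ''np'' 0 = nmem s ''np'' 0 + 1"
    using den_insert_prog(2)[OF env1 T1 refl f(1)] by (simp add: nmem_den[of _ farthest_prog])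
  have t: "?t < n" "\<forall>t<n. (\<Sum>a<n. pool_dist obj d P (insert ?t (insert ?f T)) a) \<le> (\<Sum>a<n. pool_dist obj d P (insert t (insert ?f T)) a)"
    using den_greedy_choice_prog[OF env2 T2 n] by blast+
  have T3: "pooled obj n d P (insert ?f T) ?s3" by (rule pooled_agree[OF T2 den_agree]) simp_all
  have T4: "pooled obj n d P (insert ?t (insert ?f T)) ?s4" by (rule den_insert_prog(1)[OF env3 T3 refl t(1)]) simp
  have np4: "nmem ?s4 ''np'' 0 = nmem ?s2 ''np'' 0 + 1"
    using den_insert_prog(2)[OF env3 T3 refl t(1)] by (simp add: nmem_den[of _ "greedy_choice_prog obj"])
  show "nmem (den (pool_step_prog obj) s) ''np'' 0 = nmem s ''np'' 0 + 2" unfolding e using np2 np4 by simp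
  have "pool_step obj d P n T (insert ?t (insert ?f T))" unfolding pool_step_def using f(1) t far by blast
  then show "\<exists>T'. pool_step obj d P n T T' \<and> pooled obj n d P T' (den (pool_step_prog obj) s)" unfolding e using T4 by blast
qed

definition pool_init_prog :: "objective \<Rightarrow> lp" where
  "pool_init_prog obj = SN ''far'' (NConst 0) ;; LN ''pool'' (NConst 0) (NConst 0) ;; SN ''np'' (NConst (Suc 0)) ;;
     LFor ''a'' 0 (nv ''n'') (point_dist_prog obj ''far'' ;; LR ''dT'' (nv ''a'') (rv ''z''))"

lemma pool_init_prog_sets [simp]:
  "nw (pool_init_prog obj) = {''far'', ''pool'', ''np'', ''a'', ''i''}" "rw (pool_init_prog obj) = {''z'', ''dT''}"
  by (auto simp: pool_init_prog_def)

lemma den_pool_init_prog: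
  assumes env: "env n d l k P col s" and n: "n \<ge> 1"
  shows "pooled obj n d P {0} (den (pool_init_prog obj) s)" "nmem (den (pool_init_prog obj) s) ''np'' 0 = 1"
proof -
  let ?c = "point_dist_prog obj ''far'' ;; LR ''dT'' (nv ''a'') (rv ''z'')"
  let ?s = "nwrite ''np'' 0 (Suc 0) (nwrite ''pool'' 0 0 (nwrite ''far'' 0 0 s))"
  let ?s1 = "den (LFor ''a'' 0 (nv ''n'') ?c) ?s"
  have env1: "env n d l k P col ?s" by (intro env_nwrite env) simp_all
  have I: "\<forall>a<n. rmem ?s1 ''dT'' a = pool_dist obj d P {0} a"
  proof (rule den_For_all)
    fix a and s' :: state assume a: "a < n" and ag: "agree (insert ''a'' (nw ?c)) (rw ?c) ?s s'"
      and Q: "\<forall>a'<a. rmem s' ''dT'' a' = pool_dist obj d P {0} a'"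
    let ?s' = "nwrite ''a'' 0 a s'"
    have env': "env n d l k P col ?s'" by (intro env_nwrite env_agree[OF env1 ag]) simp_all
    have t': "nmem ?s' ''far'' 0 = 0" by (simp add: agree_nmem[OF ag])
    have z: "rmem (den (point_dist_prog obj ''far'') ?s') ''z'' 0 = zc obj d (P a) (P 0)"
      by (rule den_point_dist_prog[OF env' _ a t']) (use n in simp_all)
    have fr: "rmem (den (point_dist_prog obj ''far'') ?s') ''dT'' = rmem s' ''dT''"
      "nmem (den (point_dist_prog obj ''far'') ?s') ''a'' 0 = a" by (simp_all add: nmem_den rmem_den)
    show "rmem (den ?c ?s') ''dT'' a = pool_dist obj d P {0} a \<and> (\<forall>a'<a. rmem (den ?c ?s') ''dT'' a' = pool_dist obj d P {0} a')"
      using Q by (simp add: z fr pool_dist_def)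
  qed (use envD(1)[OF env] in simp)
  have e: "den (pool_init_prog obj) s = ?s1" by (simp add: pool_init_prog_def)
  have v: "nmem ?s1 ''np'' 0 = Suc 0" "nmem ?s1 ''pool'' 0 = 0" by (simp_all add: nmem_den del: den.simps)
  show "nmem (den (pool_init_prog obj) s) ''np'' 0 = 1" unfolding e using v by simp
  have "{0} = nmem ?s1 ''pool'' ` {..<nmem ?s1 ''np'' 0}" unfolding v(1) lessThan_Suc using v(2) by simp
  moreover have "{0} \<subseteq> {..<n}" "{0::nat} \<noteq> {}" using n by simp_all
  ultimately show "pooled obj n d P {0} (den (pool_init_prog obj) s)" unfolding e pooled_def using I by (intro conjI)
qed

definition pool_loop_prog :: "objective \<Rightarrow> lp" where
  "pool_loop_prog obj = LFor ''r'' 0 (nv ''N'') (pool_step_prog obj)"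

lemma pool_loop_prog_sets [simp]:
  "nw (pool_loop_prog obj) = {''r'', ''far'', ''a'', ''pool'', ''np'', ''i'', ''gb'', ''t'', ''gt''}"
  "rw (pool_loop_prog obj) = {''z'', ''dT'', ''F'', ''Fb''}"
  by (auto simp: pool_loop_prog_def)

lemma den_pool_loop_prog:
  assumes env: "env n d l k P col s" and T: "pooled obj n d P {0} s" "nmem s ''np'' 0 = 1" and n: "n \<ge> 1"
    and N: "nmem s ''N'' 0 = N"
  shows "\<exists>T. T 0 = {0} \<and> (\<forall>i<N. pool_step obj d P n (T i) (T (Suc i))) \<and>
      pooled obj n d P (T N) (den (pool_loop_prog obj) s)"
    and "nmem (den (pool_loop_prog obj) s) ''np'' 0 = 2 * N + 1"
proof -
  let ?I = "\<lambda>M s'. (\<exists>T. T 0 = {0} \<and> (\<forall>i<M. pool_step obj d P n (T i) (T (Suc i))) \<and> pooled obj n d P (T M) s') \<and>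
    nmem s' ''np'' 0 = 2 * M + 1"
  have "?I N (den (LFor ''r'' 0 (nv ''N'') (pool_step_prog obj)) s)"
  proof (rule den_For[where I = ?I])
    show "?I 0 s" using T by auto
    show "nval (nv ''N'') s = N" using N by simp
  next
    fix i and s' :: state assume ag: "agree (insert ''r'' (nw (pool_step_prog obj))) (rw (pool_step_prog obj)) s s'" and I: "?I i s'"
    then obtain T where T: "T 0 = {0}" "\<forall>i'<i. pool_step obj d P n (T i') (T (Suc i'))" "pooled obj n d P (T i) s'" by blast
    let ?s' = "nwrite ''r'' 0 i s'"
    have env': "env n d l k P col ?s'" by (intro env_nwrite env_agree[OF env ag]) simp_all
    have T': "pooled obj n d P (T i) ?s'" using T(3) by (rule pooled_cong[THEN iffD2, rotated -1]) simp_all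
    obtain T2 where T2: "pool_step obj d P n (T i) T2" "pooled obj n d P T2 (den (pool_step_prog obj) ?s')"
      using den_pool_step_prog(1)[OF env' T' n] by blast
    have np: "nmem (den (pool_step_prog obj) ?s') ''np'' 0 = 2 * Suc i + 1"
      using den_pool_step_prog(2)[OF env' T' n] I by simp
    have "pool_step obj d P n ((T(Suc i := T2)) i') ((T(Suc i := T2)) (Suc i'))" if "i' < Suc i" for i'
      using T(2) T2(1) that by (cases "i' = i") simp_all
    then have c: "(T(Suc i := T2)) 0 = {0} \<and> (\<forall>i'<Suc i. pool_step obj d P n ((T(Suc i := T2)) i') ((T(Suc i := T2)) (Suc i'))) \<and>
        pooled obj n d P ((T(Suc i := T2)) (Suc i)) (den (pool_step_prog obj) ?s')"
      using T(1) T2(2) by simp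
    show "?I (Suc i) (den (pool_step_prog obj) ?s')" by (rule conjI[OF exI[of _ "T(Suc i := T2)"] np]) (rule c)
  qed
  then have R: "?I N (den (pool_loop_prog obj) s)" unfolding pool_loop_prog_def .
  show "\<exists>T. T 0 = {0} \<and> (\<forall>i<N. pool_step obj d P n (T i) (T (Suc i))) \<and>
      pooled obj n d P (T N) (den (pool_loop_prog obj) s)" by (rule conjunct1[OF R])
  show "nmem (den (pool_loop_prog obj) s) ''np'' 0 = 2 * N + 1" by (rule conjunct2[OF R])
qed

section \<open>The two search programs\<close>

definition solution :: "objective \<Rightarrow> nat \<Rightarrow> nat \<Rightarrow> nat \<Rightarrow> nat \<Rightarrow> (nat \<Rightarrow> point) \<Rightarrow> (nat \<Rightarrow> nat) \<Rightarrow> state \<Rightarrow> real \<Rightarrow> bool" where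
  "solution obj k n d l P col s X \<longleftrightarrow> (\<forall>a<n. nmem s ''cluster'' a < k) \<and>
     (\<exists>\<sigma>. \<forall>c<l. \<forall>v<k. card {a\<in>color_class n col c. nmem s ''cluster'' a = v} = \<sigma> v) \<and>
     agg obj {..<n} (\<lambda>a. zc obj d (P a) (\<lambda>i. rmem s ''center'' (nmem s ''cluster'' a * d + i))) \<le> X"

lemma (in search) solutionI: "stored s \<Longrightarrow> best_le s X \<Longrightarrow> solution obj k n d l P col s X"
  unfolding stored_def best_le_def solution_def fair_assignment_def by simp

lemma digit_center_cong:
  assumes "j < k" "\<And>i. i < k * m \<Longrightarrow> g i = g' i" "\<And>x. x < n \<Longrightarrow> P x = P' x"
  shows "digit_center n m P g j = digit_center n m P' g' j"
proof -
  have "m * j + t < k * m" if "t < m" for t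
  proof -
    have "m * j + t < m * Suc j" using that by simp
    also have "\<dots> \<le> m * k" using assms(1) by (intro mult_le_mono2) simp
    finally show ?thesis by (simp add: mult.commute)
  qed
  then have "g (m * j + t) = g' (m * j + t)" if "t < m" for t using assms(2) that by blast
  then show ?thesis using assms(3) unfolding digit_center_def
    by (intro ext arg_cong2[of _ _ _ _ "(/)"] arg_cong[of _ _ real] sum.cong) auto
qed

section \<open>The search with guessed sizes and thresholds\<close>

definition size_copy_prog :: "nat \<Rightarrow> lp" where
  "size_copy_prog k = LFor ''v'' 0 (NConst k) (LN ''S'' (nv ''v'') (NRead ''s'' (nv ''v'')))"

lemma size_copy_prog_sets [simp]: "nw (size_copy_prog k) = {''v'', ''S''}" "rw (size_copy_prog k) = {}"
  by (auto simp: size_copy_prog_def)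

lemma den_size_copy_prog: "\<forall>v<k. nmem (den (size_copy_prog k) s) ''S'' v = nmem s ''s'' v"
  unfolding size_copy_prog_def
proof (rule den_For_all)
  let ?c = "LN ''S'' (nv ''v'') (NRead ''s'' (nv ''v''))"
  fix v and s' :: state assume ag: "agree (insert ''v'' (nw ?c)) (rw ?c) s s'" and Q: "\<forall>v'<v. nmem s' ''S'' v' = nmem s ''s'' v'"
  have "nmem s' ''s'' = nmem s ''s''" by (simp add: agree_nmem[OF ag])
  then show "nmem (den ?c (nwrite ''v'' 0 v s')) ''S'' v = nmem s ''s'' v \<and>
      (\<forall>v'<v. nmem (den ?c (nwrite ''v'' 0 v s')) ''S'' v' = nmem s ''s'' v')" using Q by simp
qed simp

text \<open>One radix for all guesses: input points and thresholds with the special value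
  \<open>n\<close>, cluster sizes up to \<open>n\<close>, and flat indices of a table with
  \<open>k * n\<close> entries.\<close>

definition radix :: "nat \<Rightarrow> nexp" where
  "radix k = kmul k (NPlus (nv ''n'') (NConst 1))"

definition threshold_rel :: "objective \<Rightarrow> nat \<Rightarrow> nat \<Rightarrow> (nat \<Rightarrow> real) \<Rightarrow> (nat \<Rightarrow> nat) \<Rightarrow> (nat \<Rightarrow> nat) \<Rightarrow> nat \<Rightarrow>
    (nat \<Rightarrow> nat) \<Rightarrow> (nat \<Rightarrow> nat) \<Rightarrow> bool" where
  "threshold_rel obj k n D S near c b f \<longleftrightarrow> (\<forall>a<n. \<forall>h<k.
     (\<forall>u<k. selects n k (rule_weight obj (\<lambda>a v. D (k * a + v)) (D (b (k * k)))) b u a \<longleftrightarrow> u = h) \<longrightarrow> f a = h)"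

lemma digit_less: "u < k \<Longrightarrow> v < k \<Longrightarrow> k * u + v < k * (k::nat)"
proof -
  assume "u < k" "v < k"
  then have "k * u + v < k * Suc u" by simp
  also have "\<dots> \<le> k * k" using \<open>u < k\<close> by (intro mult_le_mono2) simp
  finally show ?thesis .
qed

lemma selects_cong:
  assumes "u < k" "\<And>i. i < k * k \<Longrightarrow> b i = b' i"
  shows "selects n k W b u a \<longleftrightarrow> selects n k W b' u a"
  unfolding selects_def using assms digit_less[OF assms(1)] by simp

text \<open>There are \<open>k\<close> digits for the sizes, \<open>k * k\<close> thresholds with
  one further digit for the radius, and \<open>k * m\<close> sample points.\<close>

abbreviation "threshold_search_prog obj k m \<equiv>
  search.search_prog obj k (threshold_prog obj k) (size_copy_prog k) k (k * k + 1) (radix k) (radix k) m (k * m) (radix k)"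

lemma search_threshold:
  assumes col: "\<And>a. a < n \<Longrightarrow> col a < l"
  shows "search k n d l P col (threshold_prog obj k) (size_copy_prog k) (k * (n + 1)) (k * (n + 1)) (radix k) (radix k)
    (\<lambda>D gs S near. \<forall>v<k. S v = gs v) (threshold_rel obj k n)"
proof
  fix s assume env: "env n d l k P col s"
  show "threshold_rel obj k n (rmem s ''D'') (nmem s ''S'') (nmem s ''near'') (nmem s ''c'' 0) (nmem s ''b'') (nmem (den (threshold_prog obj k) s) ''f'')"
    unfolding threshold_rel_def
  proof (intro allI impI)
    fix a h assume a: "a < n" and h: "h < k" "\<forall>u<k. selects n k (rule_weight obj (\<lambda>a v. rmem s ''D'' (k * a + v)) (rmem s ''D'' (nmem s ''b'' (k * k)))) (nmem s ''b'') u a \<longleftrightarrow> u = h"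
    show "nmem (den (threshold_prog obj k) s) ''f'' a = h"
      using den_threshold_prog[of s n a "\<lambda>_. h" k obj] envD(1)[OF env] a h by simp
  qed
  show "\<forall>v<k. nmem (den (size_copy_prog k) s) ''S'' v = nmem s ''s'' v" by (rule den_size_copy_prog)
  show "nval (radix k) s = k * (n + 1)" using envD(1)[OF env] by (simp add: radix_def)
qed (use col in simp_all)

lemma threshold_search:
  fixes col cl \<sigma> :: "nat \<Rightarrow> nat"
  assumes env: "env n d l k P col s" and np: "nmem s ''np'' 0 = n" and pool: "\<forall>a<n. nmem s ''pool'' a = a"
    and n: "n \<ge> 1" and k: "k \<ge> 1" and E: "E \<ge> 1" and m: "m = 4 * E\<^sup>2"
    and col: "\<And>a. a < n \<Longrightarrow> col a < l" and cl: "\<And>a. a < n \<Longrightarrow> cl a < k"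
    and sizes: "\<And>c j. c < l \<Longrightarrow> j < k \<Longrightarrow> card {a\<in>color_class n col c. cl a = j} = \<sigma> j"
  shows "solution obj k n d l P col (den (threshold_search_prog obj k m) s)
    ((1 + 1 / real E) * agg obj {..<n} (\<lambda>a. zc obj d (P a) (\<nu> (cl a))))"
proof -
  interpret search obj k n d l P col "threshold_prog obj k" "size_copy_prog k" k "k * k + 1" "k * (n + 1)" "k * (n + 1)"
    "radix k" "radix k" "\<lambda>D gs S near. \<forall>v<k. S v = gs v" "threshold_rel obj k n"
    using col by (rule search_threshold)
  let ?X = "(1 + 1 / real E) * agg obj {..<n} (\<lambda>a. zc obj d (P a) (\<nu> (cl a)))"
  have ndig: "x < k * (n + 1)" if "x \<le> n" for x
  proof -
    have "x < 1 * (n + 1)" using that by simp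
    also have "\<dots> \<le> k * (n + 1)" using k by (rule mult_le_mono1)
    finally show ?thesis .
  qed
  \<comment> \<open>All color classes have the size obtained by summing \<open>\<sigma>\<close>, and
    one of them contains the point 0. The choice of a radius needs a nonempty class.\<close>
  have CCne: "CC c \<noteq> {}" if c: "c < l" for c
  proof -
    have card: "card (CC c) = (\<Sum>j<k. \<sigma> j)" if "c < l" for c
      using sum_card_fibres[of "CC c" cl k "\<lambda>_. True"] cl sizes[OF that] by (auto simp: color_class_def)
    have "0 \<in> CC (col 0)" using n by (simp add: color_class_def)
    then have "card (CC (col 0)) > 0" by (auto simp: card_gt_0_iff)
    then have "card (CC c) > 0" using card[OF c] card[OF col[of 0]] n by simp
    then show ?thesis by auto
  qed
  have \<sigma>n: "\<sigma> v \<le> n" if "v < k" for v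
  proof -
    have "\<sigma> v = card {a\<in>CC (col 0). cl a = v}" using sizes[OF col[of 0] that] n by simp
    also have "\<dots> \<le> card {..<n}" by (intro card_mono) (auto simp: color_class_def)
    finally show ?thesis by simp
  qed
  obtain g where g: "\<forall>i. g i \<le> n" "agg obj {..<n} (\<lambda>a. zc obj d (P a) (digit_center n m P g (cl a))) \<le> ?X"
    using digit_centers_complete[OF E m, of n cl k obj d P \<nu>] cl by blast
  have pooln: "nmem s ''pool'' x < n" if "x < n" for x using pool that by simp
  have R1: "nval (radix k) s' = k * (n + 1)" if "ENV s'" "nmem s' ''np'' 0 = n" for s' by (rule R2[OF that(1)])
  have "best_le (den (search_prog m (k * m) (radix k)) s) ?X"
  proof (rule den_search_prog(2)[OF env np pooln R1])
    show "g i < k * (n + 1)" for i using g(1) ndig by blast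
    fix g' D assume g': "\<And>i. i < k * m \<Longrightarrow> g' i = g i"
      and D: "\<And>a j. a < n \<Longrightarrow> j < k \<Longrightarrow> D (k * a + j) = zc obj d (P a) (digit_center n m (\<lambda>x. P (nmem s ''pool'' x)) g' j)"
    let ?dc = "digit_center n m P g"
    have D': "D (k * a + j) = zc obj d (P a) (?dc j)" if "a < n" "j < k" for a j
      unfolding D[OF that] using that(2) g' pool by (intro arg_cong[of _ _ "zc obj d (P a)"] digit_center_cong) auto
    \<comment> \<open>The reference assignment with the sampled centers; here a single bounding
      function is enough, and the other is 0.\<close>
    let ?p = "\<lambda>a. zc obj d (P a) (?dc (cl a))"
    have good: "rule_good D S near c (agg obj (CC c) ?p + agg obj (CC c) (\<lambda>_. 0))"
      if S: "\<forall>v<k. S v = \<sigma> v" and c: "c < l" for S near c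
    proof -
      have CCn: "CC c \<subseteq> {..<n}" by (auto simp: color_class_def)
      have "\<exists>a0<n. \<exists>v0<k. \<exists>b h. (\<forall>i. b i \<le> n) \<and>
        (\<forall>a\<in>CC c. h a < k \<and> (\<forall>u<k. selects n k (rule_weight obj (\<lambda>a v. D (k * a + v)) (D (k * a0 + v0))) b u a \<longleftrightarrow> u = h a)) \<and>
        (\<forall>v<k. card {a\<in>CC c. h a = v} = card {a\<in>CC c. cl a = v}) \<and>
        agg obj (CC c) (\<lambda>a. D (k * a + h a)) \<le> agg obj (CC c) (\<lambda>a. D (k * a + cl a))"
      proof (rule threshold_assignment[OF CCn CCne[OF c]])
        show "cl a < k" if "a \<in> CC c" for a using that cl by (simp add: color_class_def)
        show "0 \<le> D (k * a + v)" if "a \<in> CC c" "v < k" for a v using D'[of a v] that by (simp add: color_class_def)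
      qed
      then obtain a0 v0 b h where H: "a0 < n" "v0 < k" "\<forall>i. b i \<le> n"
        "\<forall>a\<in>CC c. h a < k \<and> (\<forall>u<k. selects n k (rule_weight obj (\<lambda>a v. D (k * a + v)) (D (k * a0 + v0))) b u a \<longleftrightarrow> u = h a)"
        "\<forall>v<k. card {a\<in>CC c. h a = v} = card {a\<in>CC c. cl a = v}"
        "agg obj (CC c) (\<lambda>a. D (k * a + h a)) \<le> agg obj (CC c) (\<lambda>a. D (k * a + cl a))"
        by (elim exE conjE) (rule that; assumption)
      \<comment> \<open>The table index of the radius is stored right after the thresholds; it is
        below the radix since \<open>a0 < n\<close>.\<close>
      let ?b = "b(k * k := k * a0 + v0)"
      show ?thesis
        unfolding rule_good_def
      proof (intro exI[of _ ?b] conjI allI impI)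
        have "k * a0 + v0 < k * Suc a0" using H(2) by simp
        also have "\<dots> \<le> k * (n + 1)" using H(1) by (intro mult_le_mono2) simp
        finally show "?b i < k * (n + 1)" if "i < k * k + 1" for i using H(3) ndig by simp
        fix b' f assume b': "\<forall>i<k * k + 1. b' i = ?b i" and rel: "threshold_rel obj k n D S near c b' f"
        have bkk: "b' (k * k) = k * a0 + v0" using b' by simp
        have f: "f a = h a" if a: "a \<in> CC c" for a
        proof -
          have an: "a < n" using a by (simp add: color_class_def)
          have "\<forall>u<k. selects n k (rule_weight obj (\<lambda>a v. D (k * a + v)) (D (k * a0 + v0))) b' u a \<longleftrightarrow> u = h a"
          proof (intro allI impI)
            fix u assume u: "u < k"
            have "selects n k W b' u a \<longleftrightarrow> selects n k W b u a" for W using b' by (intro selects_cong[OF u]) auto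
            then show "selects n k (rule_weight obj (\<lambda>a v. D (k * a + v)) (D (k * a0 + v0))) b' u a \<longleftrightarrow> u = h a"
              using H(4) a u by blast
          qed
          then show ?thesis using rel[unfolded threshold_rel_def bkk] an H(4) a by blast
        qed
        have "{a\<in>CC c. f a = v} = {a\<in>CC c. h a = v}" for v using f by auto
        then show "feasible k (CC c) S f"
          unfolding feasible_def using f H(4,5) S sizes[OF c] by simp
        have "table_cost obj k D (CC c) f = agg obj (CC c) (\<lambda>a. D (k * a + h a))"
          unfolding table_cost_def by (rule agg_cong) (simp_all add: f)
        also have "\<dots> \<le> agg obj (CC c) (\<lambda>a. D (k * a + cl a))" by (rule H(6))
        also have "\<dots> = agg obj (CC c) ?p"
          by (rule agg_cong) (use D' cl in \<open>auto simp: color_class_def\<close>)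
        also have "\<dots> \<le> agg obj (CC c) ?p + agg obj (CC c) (\<lambda>_. 0)" by (simp add: agg_nonneg)
        finally show "table_cost obj k D (CC c) f \<le> agg obj (CC c) ?p + agg obj (CC c) (\<lambda>_. 0)" .
      qed
    qed
    have z: "agg obj {..<n} (\<lambda>_. 0 :: real) \<le> 0" using agg_cmult[of "{..<n}" 0 obj "\<lambda>_. 0"] by simp
    show "sizes_good D ?X"
      unfolding sizes_good_def candidate_def
    proof (intro exI[of _ \<sigma>] conjI allI impI)
      show "\<sigma> v < k * (n + 1)" if "v < k" for v using ndig \<sigma>n that by blast
      fix gs' :: "nat \<Rightarrow> nat" and S near :: "nat \<Rightarrow> nat" assume "\<forall>i<k. gs' i = \<sigma> i" "\<forall>v<k. S v = gs' v"
      then have S: "\<forall>v<k. S v = \<sigma> v" by simp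
      show "\<exists>p q. (\<forall>a. 0 \<le> p a) \<and> (\<forall>a. 0 \<le> q a) \<and> agg obj {..<n} p + agg obj {..<n} q \<le> ?X \<and>
        (\<forall>c<l. rule_good D S near c (agg obj (CC c) p + agg obj (CC c) q))"
        using good[OF S] g(2) z by (intro exI[of _ ?p] exI[of _ "\<lambda>_. 0"]) auto
    qed
  qed
  moreover have "stored (den (search_prog m (k * m) (radix k)) s)"
    by (rule den_search_prog(1)[OF env np]) (rule pooln R1; assumption)+
  ultimately show ?thesis by (intro solutionI)
qed

section \<open>The search with a greedy pool and greedy moves\<close>

definition base_size_rel :: "nat \<Rightarrow> nat \<Rightarrow> (nat \<Rightarrow> nat) \<Rightarrow> (nat \<Rightarrow> real) \<Rightarrow> (nat \<Rightarrow> nat) \<Rightarrow> (nat \<Rightarrow> nat) \<Rightarrow> (nat \<Rightarrow> nat) \<Rightarrow> bool" where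
  "base_size_rel k n col D gs S near \<longleftrightarrow> (\<forall>a<n. near a = nearest k D a) \<and>
     (\<forall>v<k. S v = card {a\<in>{..<n}. col a = gs 0 \<and> nearest k D a = v})"

definition greedy_rel :: "nat \<Rightarrow> nat \<Rightarrow> (nat \<Rightarrow> nat) \<Rightarrow> (nat \<Rightarrow> real) \<Rightarrow> (nat \<Rightarrow> nat) \<Rightarrow> (nat \<Rightarrow> nat) \<Rightarrow> nat \<Rightarrow>
    (nat \<Rightarrow> nat) \<Rightarrow> (nat \<Rightarrow> nat) \<Rightarrow> bool" where
  "greedy_rel k n col D S near c b f \<longleftrightarrow> ((\<forall>i<4 * k. b i < k) \<longrightarrow> (\<exists>f0 rem rem'. (\<forall>a<n. f0 a = k) \<and> (\<forall>v<k. rem v = S v) \<and>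
     runs k (color_class n col c) near (map (\<lambda>t. (b (2 * t), b (2 * t + 1))) [0..<2 * k]) (f0, rem) (f, rem')))"

lemma moved_cong:
  assumes "\<And>a. a \<in> S \<Longrightarrow> near a = near' a"
  shows "moved k S near = moved k S near'"
proof -
  have "{a\<in>S. f a = k \<and> near a = u} = {a\<in>S. f a = k \<and> near' a = u}" for f u using assms by auto
  then show ?thesis unfolding moved_def by presburger
qed

lemma runs_cong:
  assumes "\<And>a. a \<in> S \<Longrightarrow> near a = near' a"
  shows "runs k S near ps s s' \<longleftrightarrow> runs k S near' ps s s'"
  by (induction ps arbitrary: s) (simp_all add: moved_cong[of S near near' k, OF assms])

text \<open>One digit names the color that dictates the sizes, \<open>4 * k\<close> digits below
  \<open>k\<close> spell out the moves, and \<open>k\<close> digits choose centers from the pool.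
  With \<open>m = 1\<close>, averages become single points.\<close>

abbreviation "greedy_search_prog obj k \<equiv>
  search.search_prog obj k (greedy_prog k) (base_size_prog k) 1 (4 * k) (nv ''l'') (NConst k) 1 k (nv ''np'')"

lemma search_greedy:
  assumes col: "\<And>a. a < n \<Longrightarrow> col a < l" and k: "k \<ge> 1"
  shows "search k n d l P col (greedy_prog k) (base_size_prog k) l k (nv ''l'') (NConst k)
    (base_size_rel k n col) (greedy_rel k n col)"
proof
  fix s assume env: "env n d l k P col s"
  show "greedy_rel k n col (rmem s ''D'') (nmem s ''S'') (nmem s ''near'') (nmem s ''c'' 0) (nmem s ''b'') (nmem (den (greedy_prog k) s) ''f'')"
    unfolding greedy_rel_def color_class_def using den_greedy_prog[OF env] by blast
  have nr: "\<forall>a<n. nmem (den (near_prog k) s) ''near'' a = nearest k (rmem s ''D'') a"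
    by (rule den_near_prog[OF envD(1)[OF env] k])
  have S: "nmem (den (base_size_prog k) s) ''S'' v = card {a\<in>{..<n}. col a = nmem s ''s'' 0 \<and> nearest k (rmem s ''D'') a = v}" if "v < k" for v
  proof -
    have "{a\<in>{..<n}. col a = nmem s ''s'' 0 \<and> nmem (den (near_prog k) s) ''near'' a = v} =
        {a\<in>{..<n}. col a = nmem s ''s'' 0 \<and> nearest k (rmem s ''D'') a = v}" using nr by auto
    then show ?thesis using den_base_size_prog(1)[OF env] that unfolding den_base_size_prog(2)[OF env] by simp
  qed
  show "base_size_rel k n col (rmem s ''D'') (nmem s ''s'') (nmem (den (base_size_prog k) s) ''S'') (nmem (den (base_size_prog k) s) ''near'')"
    unfolding base_size_rel_def den_base_size_prog(2)[OF env] using nr S by blast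
  show "nval (nv ''l'') s = l" using envD(3)[OF env] by simp
qed (use col in simp_all)

lemma greedy_search:
  fixes col cl \<sigma> :: "nat \<Rightarrow> nat"
  assumes env: "env n d l k P col s" and np: "nmem s ''np'' 0 = np" and T: "T = nmem s ''pool'' ` {..<np}" "T \<subseteq> {..<n}" "T \<noteq> {}"
    and pd: "agg obj {..<n} (pool_dist obj d P T) \<le> 5 * agg obj {..<n} (\<lambda>a. zc obj d (P a) (\<nu> (cl a)))"
    and n: "n \<ge> 1" and k: "k \<ge> 1"
    and col: "\<And>a. a < n \<Longrightarrow> col a < l" and cl: "\<And>a. a < n \<Longrightarrow> cl a < k"
    and sizes: "\<And>c j. c < l \<Longrightarrow> j < k \<Longrightarrow> card {a\<in>color_class n col c. cl a = j} = \<sigma> j"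
  shows "solution obj k n d l P col (den (greedy_search_prog obj k) s)
    (884 * agg obj {..<n} (\<lambda>a. zc obj d (P a) (\<nu> (cl a))))"
proof -
  interpret search obj k n d l P col "greedy_prog k" "base_size_prog k" 1 "4 * k" l k
    "nv ''l''" "NConst k" "base_size_rel k n col" "greedy_rel k n col"
    using col k by (rule search_greedy)
  let ?X = "884 * agg obj {..<n} (\<lambda>a. zc obj d (P a) (\<nu> (cl a)))"
  have finT: "finite T" using T(2) by (rule finite_subset) simp
  obtain \<tau> where \<tau>: "\<forall>j. \<tau> j \<in> T" "agg obj {..<n} (\<lambda>a. zc obj d (P a) (P (\<tau> (cl a)))) \<le>
    26 * agg obj {..<n} (\<lambda>a. zc obj d (P a) (\<nu> (cl a)))"
    using pool_centers[where \<nu> = \<nu> and cl = cl, OF finT T(3) pd] by blast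
  have "\<exists>x<np. nmem s ''pool'' x = \<tau> j" for j
  proof -
    have "\<tau> j \<in> nmem s ''pool'' ` {..<np}" using \<tau>(1) T(1) by simp
    then show ?thesis by auto
  qed
  then obtain g where g: "\<And>j. g j < np" "\<And>j. nmem s ''pool'' (g j) = \<tau> j" by metis
  have pooln: "nmem s ''pool'' x < n" if "x < np" for x using T(1,2) that by auto
  have R1: "nval (nv ''np'') s' = np" if "ENV s'" "nmem s' ''np'' 0 = np" for s' using that by simp
  have "best_le (den (search_prog 1 k (nv ''np'')) s) ?X"
  proof (rule den_search_prog(2)[OF env np pooln R1])
    show "g i < np" for i by (rule g(1))
    fix g' D assume g': "\<And>i. i < k \<Longrightarrow> g' i = g i"
      and D: "\<And>a j. a < n \<Longrightarrow> j < k \<Longrightarrow> D (k * a + j) = zc obj d (P a) (digit_center np 1 (\<lambda>x. P (nmem s ''pool'' x)) g' j)"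
    let ?cen = "\<lambda>j. P (\<tau> j)"
    have D': "D (k * a + j) = zc obj d (P a) (?cen j)" if "a < n" "j < k" for a j
      unfolding D[OF that] digit_center_def using g g'[OF that(2)] by simp
    have nearA: "nearest k D a < k" "\<And>v. v < k \<Longrightarrow> zc obj d (P a) (?cen (nearest k D a)) \<le> zc obj d (P a) (?cen v)" if "a < n" for a
      using nearest[OF k, of D a] D'[OF that] by auto
    have sizes': "card {a\<in>{..<n}. col a = c \<and> cl a = j} = \<sigma> j" if "c < l" "j < k" for c j
      using sizes[OF that] by (simp add: color_class_def)
    have "\<exists>b<l. \<exists>p q. (\<forall>a. 0 \<le> p a \<and> 0 \<le> q a) \<and>
      agg obj {..<n} p + agg obj {..<n} q \<le> 34 * agg obj {..<n} (\<lambda>a. zc obj d (P a) (?cen (cl a))) \<and>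
      (\<forall>c<l. \<exists>ps. length ps = 2 * k \<and> set ps \<subseteq> {..<k} \<times> {..<k} \<and>
      (\<forall>f rem f' rem'. (\<forall>a\<in>{a\<in>{..<n}. col a = c}. f a = k) \<longrightarrow>
        (\<forall>v<k. rem v = card {a\<in>{..<n}. col a = b \<and> nearest k D a = v}) \<longrightarrow>
        runs k {a\<in>{..<n}. col a = c} (nearest k D) ps (f, rem) (f', rem') \<longrightarrow>
        (\<forall>a\<in>{a\<in>{..<n}. col a = c}. f' a < k) \<and>
        (\<forall>v<k. card {a\<in>{a\<in>{..<n}. col a = c}. f' a = v} = card {a\<in>{..<n}. col a = b \<and> nearest k D a = v}) \<and>
        agg obj {a\<in>{..<n}. col a = c} (\<lambda>a. zc obj d (P a) (?cen (f' a))) \<le>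
          agg obj {a\<in>{..<n}. col a = c} p + agg obj {a\<in>{..<n}. col a = c} q))"
    proof (rule greedy_assignment[OF n k])
      show "col a < l" "cl a < k" "nearest k D a < k" if "a < n" for a using col cl nearA that by blast+
      show "card {a\<in>{..<n}. col a = c \<and> cl a = j} = \<sigma> j" if "c < l" "j < k" for c j by (rule sizes'[OF that])
      show "zc obj d (P a) (?cen (nearest k D a)) \<le> zc obj d (P a) (?cen v)" if "a < n" "v < k" for a v
        by (rule nearA(2)[OF that])
    qed
    then obtain b p q where b: "b < l" and pq: "\<forall>a. 0 \<le> p a \<and> 0 \<le> q a"
      "agg obj {..<n} p + agg obj {..<n} q \<le> 34 * agg obj {..<n} (\<lambda>a. zc obj d (P a) (?cen (cl a)))"
      and steps: "(\<forall>c<l. \<exists>ps. length ps = 2 * k \<and> set ps \<subseteq> {..<k} \<times> {..<k} \<and>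
      (\<forall>f rem f' rem'. (\<forall>a\<in>{a\<in>{..<n}. col a = c}. f a = k) \<longrightarrow>
        (\<forall>v<k. rem v = card {a\<in>{..<n}. col a = b \<and> nearest k D a = v}) \<longrightarrow>
        runs k {a\<in>{..<n}. col a = c} (nearest k D) ps (f, rem) (f', rem') \<longrightarrow>
        (\<forall>a\<in>{a\<in>{..<n}. col a = c}. f' a < k) \<and>
        (\<forall>v<k. card {a\<in>{a\<in>{..<n}. col a = c}. f' a = v} = card {a\<in>{..<n}. col a = b \<and> nearest k D a = v}) \<and>
        agg obj {a\<in>{..<n}. col a = c} (\<lambda>a. zc obj d (P a) (?cen (f' a))) \<le>
          agg obj {a\<in>{..<n}. col a = c} p + agg obj {a\<in>{..<n}. col a = c} q))"
      by (elim exE conjE) (rule that; assumption)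
    have good: "rule_good D S near c (agg obj (CC c) p + agg obj (CC c) q)"
      if S: "\<forall>v<k. S v = card {a\<in>{..<n}. col a = b \<and> nearest k D a = v}" and near: "\<forall>a<n. near a = nearest k D a" and c: "c < l"
      for S near c
    proof -
      obtain ps where ps: "length ps = 2 * k" "set ps \<subseteq> {..<k} \<times> {..<k}" and
        run: "\<forall>f rem f' rem'. (\<forall>a\<in>CC c. f a = k) \<longrightarrow>
        (\<forall>v<k. rem v = card {a\<in>{..<n}. col a = b \<and> nearest k D a = v}) \<longrightarrow>
        runs k (CC c) (nearest k D) ps (f, rem) (f', rem') \<longrightarrow>
        (\<forall>a\<in>CC c. f' a < k) \<and>
        (\<forall>v<k. card {a\<in>CC c. f' a = v} = card {a\<in>{..<n}. col a = b \<and> nearest k D a = v}) \<and>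
        agg obj (CC c) (\<lambda>a. zc obj d (P a) (?cen (f' a))) \<le> agg obj (CC c) p + agg obj (CC c) q"
        using steps[THEN spec, THEN mp, OF c, folded color_class_def] by (elim exE conjE) (rule that; assumption)
      \<comment> \<open>The list of moves flattened into digits: sources at even positions, targets
        at odd ones.\<close>
      let ?b = "\<lambda>i. if even i then fst (ps ! (i div 2)) else snd (ps ! (i div 2))"
      have bk: "?b i < k" if "i < 4 * k" for i
      proof -
        have "ps ! (i div 2) \<in> set ps" using that ps(1) by (intro nth_mem) simp
        then have "ps ! (i div 2) \<in> {..<k} \<times> {..<k}" using ps(2) by blast
        then show ?thesis by auto
      qed
      show ?thesis
        unfolding rule_good_def
      proof (intro exI[of _ ?b] conjI allI impI)
        show "?b i < k" if "i < 4 * k" for i by (rule bk[OF that])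
        fix b' f assume b': "\<forall>i<4 * k. b' i = ?b i" and rel: "greedy_rel k n col D S near c b' f"
        have "map (\<lambda>t. (b' (2 * t), b' (2 * t + 1))) [0..<2 * k] = ps"
          by (rule nth_equalityI) (use ps(1) b' in auto)
        moreover have "\<forall>i<4 * k. b' i < k" using b' bk by simp
        ultimately obtain f0 rem rem' where r: "\<forall>a<n. f0 a = k" "\<forall>v<k. rem v = S v" "runs k (CC c) near ps (f0, rem) (f, rem')"
          using rel unfolding greedy_rel_def by auto
        have r': "runs k (CC c) (nearest k D) ps (f0, rem) (f, rem')"
          using r(3) runs_cong[of "CC c" near "nearest k D" k ps] near by (simp add: color_class_def)
        have f0: "\<forall>a\<in>CC c. f0 a = k" using r(1) by (simp add: color_class_def)
        have rem: "\<forall>v<k. rem v = card {a\<in>{..<n}. col a = b \<and> nearest k D a = v}" using r(2) S by simp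
        note F = run[THEN spec, THEN spec, THEN spec, THEN spec, THEN mp, THEN mp, THEN mp, OF f0 rem r']
        show "feasible k (CC c) S f" unfolding feasible_def using F S by simp
        have "table_cost obj k D (CC c) f = agg obj (CC c) (\<lambda>a. zc obj d (P a) (?cen (f a)))"
          unfolding table_cost_def using F D' by (intro agg_cong) (auto simp: color_class_def)
        then show "table_cost obj k D (CC c) f \<le> agg obj (CC c) p + agg obj (CC c) q" using F by simp
      qed
    qed
    show "sizes_good D ?X"
      unfolding sizes_good_def candidate_def
    proof (intro exI[of _ "\<lambda>_. b"] conjI allI impI)
      show "b < l" by (rule b)
      fix gs' S near :: "nat \<Rightarrow> nat" assume "\<forall>i<1. gs' i = b" "base_size_rel k n col D gs' S near"
      then have SN: "\<forall>v<k. S v = card {a\<in>{..<n}. col a = b \<and> nearest k D a = v}" "\<forall>a<n. near a = nearest k D a"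
        unfolding base_size_rel_def by simp_all
      show "\<exists>p q. (\<forall>a. 0 \<le> p a) \<and> (\<forall>a. 0 \<le> q a) \<and> agg obj {..<n} p + agg obj {..<n} q \<le> ?X \<and>
        (\<forall>c<l. rule_good D S near c (agg obj (CC c) p + agg obj (CC c) q))"
        using good[OF SN] pq \<tau>(2) by (intro exI[of _ p] exI[of _ q]) simp
    qed
  qed
  moreover have "stored (den (search_prog 1 (k) (nv ''np'')) s)"
    by (rule den_search_prog(1)[OF env np]) (rule pooln R1; assumption)+
  ultimately show ?thesis by (intro solutionI)
qed

section \<open>From programs to fair clusterings\<close>

lemma env_input:
  "env n d l k P (\<lambda>a. col (P a)) (den (row_table k) (input n d l P col))"
proof -
  let ?s = "input n d l P col"
  have md: "\<forall>a<n+k. nmem (den (row_table k) ?s) ''md'' a = a * d" by (rule den_row_table) (simp_all add: input_def)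
  have "rmem ?s ''point'' (a * d + i) = P a i" if "a < n" "i < d" for a i
  proof -
    have "a * d + i < Suc a * d" using that(2) by simp
    also have "\<dots> \<le> n * d" using that(1) by (intro mult_le_mono1) simp
    finally show ?thesis using that(2) by (simp add: input_def)
  qed
  then show ?thesis unfolding env_def using md by (simp add: nmem_den rmem_den) (simp add: input_def)
qed

text \<open>Every point lies in exactly one cluster, so pairs of a cluster and a member correspond
  to point indices. This links the costs of clusterings with the labelings on which the programs
  work.\<close>

lemma cost_indexed:
  fixes P :: "nat \<Rightarrow> point"
  assumes part: "partition_on A \<C>" and A: "finite A" "A \<noteq> {}" and P: "bij_betw P {..<n} A"
    and Cof: "\<And>a. a < n \<Longrightarrow> Cof a \<in> \<C> \<and> P a \<in> Cof a"
  shows "cost obj d \<C> \<mu> = agg obj {..<n} (\<lambda>a. zc obj d (P a) (\<mu> (Cof a)))"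
proof -
  have fin: "finite \<C>" "\<And>C. C \<in> \<C> \<Longrightarrow> finite C"
    using finite_elements[OF A(1) part] part A(1) by (auto simp: partition_on_def intro: finite_subset)
  have uniq: "C = Cof a" if "a < n" "C \<in> \<C>" "P a \<in> C" for C a
    using partition_onD2[OF part] Cof[OF that(1)] that(2,3) unfolding disjoint_def by blast
  have bij: "bij_betw (\<lambda>a. (Cof a, P a)) {..<n} (SIGMA C:\<C>. C)"
  proof (rule bij_betw_imageI)
    show "inj_on (\<lambda>a. (Cof a, P a)) {..<n}" using P by (auto simp: bij_betw_def inj_on_def)
    show "(\<lambda>a. (Cof a, P a)) ` {..<n} = (SIGMA C:\<C>. C)"
    proof
      show "(\<lambda>a. (Cof a, P a)) ` {..<n} \<subseteq> (SIGMA C:\<C>. C)" using Cof by auto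
      show "(SIGMA C:\<C>. C) \<subseteq> (\<lambda>a. (Cof a, P a)) ` {..<n}"
      proof
        fix y assume "y \<in> (SIGMA C:\<C>. C)"
        then obtain C x where y: "y = (C, x)" "C \<in> \<C>" "x \<in> C" by auto
        then have "x \<in> A" using part by (auto simp: partition_on_def)
        then obtain a where "a < n" "x = P a" using P by (auto simp: bij_betw_def)
        then show "y \<in> (\<lambda>a. (Cof a, P a)) ` {..<n}" using uniq y by auto
      qed
    qed
  qed
  have sum: "(\<Sum>C\<in>\<C>. \<Sum>x\<in>C. g C x) = (\<Sum>a<n. g (Cof a) (P a))" for g :: "point set \<Rightarrow> point \<Rightarrow> real"
  proof -
    have "(\<Sum>C\<in>\<C>. \<Sum>x\<in>C. g C x) = (\<Sum>y\<in>(SIGMA C:\<C>. C). g (fst y) (snd y))"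
      using sum.Sigma[of \<C> "\<lambda>C. C" g] fin by (simp add: case_prod_beta)
    also have "\<dots> = (\<Sum>a<n. g (Cof a) (P a))"
      using sum.reindex_bij_betw[OF bij, of "\<lambda>y. g (fst y) (snd y)"] by simp
    finally show ?thesis .
  qed
  show ?thesis
  proof (cases obj)
    case K_Median
    then show ?thesis by (simp add: agg_def zc_def edist_eq sum)
  next
    case K_Means
    then show ?thesis by (simp add: agg_def zc_def edist_eq sum)
  next
    case K_Center
    let ?f = "\<lambda>a. edist d (P a) (\<mu> (Cof a))"
    have eq: "(\<Union>C\<in>\<C>. (\<lambda>x. edist d x (\<mu> C)) ` C) = ?f ` {..<n}"
    proof
      show "(\<Union>C\<in>\<C>. (\<lambda>x. edist d x (\<mu> C)) ` C) \<subseteq> ?f ` {..<n}"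
      proof
        fix r assume "r \<in> (\<Union>C\<in>\<C>. (\<lambda>x. edist d x (\<mu> C)) ` C)"
        then obtain C x where "C \<in> \<C>" "x \<in> C" "r = edist d x (\<mu> C)" by blast
        moreover from this have "(C, x) \<in> (\<lambda>a. (Cof a, P a)) ` {..<n}" using bij by (simp add: bij_betw_def)
        ultimately show "r \<in> ?f ` {..<n}" by auto
      qed
      show "?f ` {..<n} \<subseteq> (\<Union>C\<in>\<C>. (\<lambda>x. edist d x (\<mu> C)) ` C)" using Cof by auto
    qed
    have n: "?f ` {..<n} \<noteq> {}" using P A(2) by (auto simp: bij_betw_def)
    have fin': "finite (?f ` {..<n})" by (rule finite_imageI) simp
    \<comment> \<open>A maximum of nonnegative numbers over a nonempty set is not changed by the 0
      that \<open>agg\<close> adjoins.\<close>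
    have "Max (?f ` {..<n}) \<in> ?f ` {..<n}" using fin' n by (rule Max_in)
    then obtain a where "Max (?f ` {..<n}) = ?f a" by blast
    then have "Max (?f ` {..<n}) \<ge> 0" by (simp add: edist_eq)
    then have "Max (insert 0 (?f ` {..<n})) = Max (?f ` {..<n})" using Max_insert[OF fin' n, of 0] by simp
    moreover have "agg K_Center {..<n} (\<lambda>a. zc K_Center d (P a) (\<mu> (Cof a))) = Max (insert 0 (?f ` {..<n}))"
      by (simp add: agg_def zc_def edist_eq)
    ultimately show ?thesis using K_Center eq by simp
  qed
qed

text \<open>In a fair clustering all colors have the same size within each cluster. It thus becomes
  a labeling with sizes \<open>\<sigma>\<close> independent of the color; the labels come from an
  injection of the clusters into the numbers below \<open>k\<close>.\<close>

lemma fair_reference: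
  assumes fair: "fair_clustering d k l col A \<C> \<mu>" and A: "finite A" "A \<noteq> {}" and P: "bij_betw P {..<n} A"
  shows "\<exists>cl \<nu> \<sigma>. (\<forall>a<n. cl a < k) \<and> (\<forall>c<l. \<forall>j<k. card {a\<in>color_class n (\<lambda>a. col (P a)) c. cl a = j} = \<sigma> j) \<and>
    cost obj d \<C> \<mu> = agg obj {..<n} (\<lambda>a. zc obj d (P a) (\<nu> (cl a)))"
proof -
  have part: "partition_on A \<C>" and card: "card \<C> \<le> k" and bal: "\<And>C. C \<in> \<C> \<Longrightarrow> balanced l col C"
    using fair by (auto simp: fair_clustering_def)
  have finC: "finite \<C>" using finite_elements[OF A(1) part] .
  obtain e where e: "e ` \<C> \<subseteq> {..<k}" "inj_on e \<C>" using card_le_inj[of \<C> "{..<k}"] finC card by auto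
  have PA: "P a \<in> \<Union>\<C>" if "a < n" for a
    using bij_betwE[OF P] that partition_onD1[OF part] by auto
  define Cof where "Cof a = (SOME C. C \<in> \<C> \<and> P a \<in> C)" for a
  have Cof: "Cof a \<in> \<C> \<and> P a \<in> Cof a" if "a < n" for a
  proof -
    have "\<exists>C. C \<in> \<C> \<and> P a \<in> C" using PA[OF that] by blast
    then show ?thesis unfolding Cof_def by (rule someI_ex)
  qed
  define cl where "cl a = e (Cof a)" for a
  define \<nu> where "\<nu> j = \<mu> (inv_into \<C> e j)" for j
  \<comment> \<open>Color 0 represents all colors, by balance.\<close>
  define \<sigma> where "\<sigma> j = card {a\<in>color_class n (\<lambda>a. col (P a)) 0. cl a = j}" for j
  have clk: "cl a < k" if "a < n" for a using Cof[OF that] e(1) by (auto simp: cl_def)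
  have cst: "cost obj d \<C> \<mu> = agg obj {..<n} (\<lambda>a. zc obj d (P a) (\<nu> (cl a)))"
  proof -
    have "agg obj {..<n} (\<lambda>a. zc obj d (P a) (\<mu> (Cof a))) = agg obj {..<n} (\<lambda>a. zc obj d (P a) (\<nu> (cl a)))"
      by (rule agg_cong) (simp_all add: \<nu>_def cl_def inv_into_f_f[OF e(2)] Cof)
    then show ?thesis using cost_indexed[OF part A P Cof] by simp
  qed
  have sz: "card {a\<in>color_class n (\<lambda>a. col (P a)) c. cl a = j} = \<sigma> j" if c: "c < l" for c j
  proof (cases "\<exists>C\<in>\<C>. e C = j")
    case True
    then obtain C where C: "C \<in> \<C>" "e C = j" by blast
    have cardC: "card {a\<in>color_class n (\<lambda>a. col (P a)) c. cl a = j} = card {x\<in>C. col x = c}" for c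
    proof (rule bij_betw_same_card)
      have inC: "cl a = j \<longleftrightarrow> P a \<in> C" if "a < n" for a
      proof
        assume "cl a = j"
        then have "Cof a = C" using C Cof[OF that] e(2) by (auto simp: cl_def inj_on_def)
        then show "P a \<in> C" using Cof[OF that] by simp
      next
        assume "P a \<in> C"
        then have "Cof a = C"
          using partition_onD2[OF part] Cof[OF that] C(1) unfolding disjoint_def by blast
        then show "cl a = j" using C(2) by (simp add: cl_def)
      qed
      have CA: "C \<subseteq> A" using part C(1) by (auto simp: partition_on_def)
      show "bij_betw P {a\<in>color_class n (\<lambda>a. col (P a)) c. cl a = j} {x\<in>C. col x = c}"
      proof (rule bij_betw_imageI)
        show "inj_on P {a\<in>color_class n (\<lambda>a. col (P a)) c. cl a = j}"
          using P by (auto simp: bij_betw_def inj_on_def color_class_def)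
        show "P ` {a\<in>color_class n (\<lambda>a. col (P a)) c. cl a = j} = {x\<in>C. col x = c}"
        proof
          show "P ` {a\<in>color_class n (\<lambda>a. col (P a)) c. cl a = j} \<subseteq> {x\<in>C. col x = c}"
            using inC by (auto simp: color_class_def)
          show "{x\<in>C. col x = c} \<subseteq> P ` {a\<in>color_class n (\<lambda>a. col (P a)) c. cl a = j}"
          proof
            fix x assume x: "x \<in> {x\<in>C. col x = c}"
            then have "x \<in> P ` {..<n}" using CA P by (auto simp: bij_betw_def)
            then obtain a where "a < n" "x = P a" by auto
            then show "x \<in> P ` {a\<in>color_class n (\<lambda>a. col (P a)) c. cl a = j}"
              using inC x by (auto simp: color_class_def)
          qed
        qed
      qed
    qed
    have "card {x\<in>C. col x = c} = card {x\<in>C. col x = 0}"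
      using bal[OF C(1), unfolded balanced_def, rule_format, of c 0] c by simp
    then show ?thesis unfolding \<sigma>_def cardC .
  next
    case False
    then have "{a\<in>color_class n (\<lambda>a. col (P a)) c. cl a = j} = {}" for c using Cof by (auto simp: cl_def color_class_def)
    then show ?thesis unfolding \<sigma>_def by presburger
  qed
  show ?thesis by (intro exI[of _ cl] exI[of _ \<nu>] exI[of _ \<sigma>] conjI allI impI clk sz cst)
qed

lemma solution_output:
  assumes sol: "solution obj k n d l P (\<lambda>a. col (P a)) s X" and A: "finite A" "A \<noteq> {}" and P: "bij_betw P {..<n} A"
  shows "\<exists>\<C> \<mu>. outputs s n d k P \<C> \<mu> \<and> fair_clustering d k l col A \<C> \<mu> \<and>
    cost obj d \<C> \<mu> = agg obj {..<n} (\<lambda>a. zc obj d (P a) (\<lambda>i. rmem s ''center'' (nmem s ''cluster'' a * d + i)))"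
proof -
  let ?O = "output_cluster s n P" and ?cl = "nmem s ''cluster''"
  define \<C> where "\<C> = ?O ` {..<k} - {{}}"
  \<comment> \<open>Centers are attached to clusters as sets, so the cluster number is recovered
    from an arbitrary member.\<close>
  define \<mu> where "\<mu> C = output_center s d (?cl (inv_into {..<n} P (SOME x. x \<in> C)))" for C
  have inj: "inj_on P {..<n}" and img: "P ` {..<n} = A" using P by (auto simp: bij_betw_def)
  have mem: "P a \<in> ?O j \<longleftrightarrow> ?cl a = j" if "a < n" for a j
    using inj that by (auto simp: output_cluster_def inj_on_def)
  have cl: "?cl a < k" if "a < n" for a using sol that by (simp add: solution_def)
  obtain \<sigma> where \<sigma>: "\<And>c v. c < l \<Longrightarrow> v < k \<Longrightarrow> card {a\<in>color_class n (\<lambda>a. col (P a)) c. ?cl a = v} = \<sigma> v"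
    using sol by (auto simp: solution_def)
  have \<mu>: "\<mu> (?O j) = output_center s d j" if "?O j \<noteq> {}" for j
  proof -
    have "(SOME x. x \<in> ?O j) \<in> ?O j" using that by (simp add: some_in_eq)
    then obtain a where a: "a < n" "(SOME x. x \<in> ?O j) = P a" "?cl a = j" by (auto simp: output_cluster_def)
    then show ?thesis using inv_into_f_f[OF inj, of a] by (simp add: \<mu>_def)
  qed
  have out: "outputs s n d k P \<C> \<mu>" unfolding outputs_def using \<mu> by (auto simp: \<C>_def)
  have Cof: "?O (?cl a) \<in> \<C> \<and> P a \<in> ?O (?cl a)" if "a < n" for a
    using mem[OF that] cl[OF that] by (auto simp: \<C>_def)
  have sub: "?O j \<subseteq> A" for j using img by (auto simp: output_cluster_def)
  have part: "partition_on A \<C>"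
  proof (rule partition_onI)
    show "\<Union>\<C> = A"
    proof
      show "\<Union>\<C> \<subseteq> A" using sub by (auto simp: \<C>_def)
      show "A \<subseteq> \<Union>\<C>"
      proof
        fix x assume "x \<in> A"
        then obtain a where "a < n" "x = P a" using img by auto
        then show "x \<in> \<Union>\<C>" using Cof by blast
      qed
    qed
    show "disjnt C C'" if "C \<in> \<C>" "C' \<in> \<C>" "C \<noteq> C'" for C C'
    proof -
      have "C \<in> ?O ` {..<k}" "C' \<in> ?O ` {..<k}" using that unfolding \<C>_def by blast+
      then obtain j j' where j: "C = ?O j" "C' = ?O j'" by blast
      show ?thesis unfolding disjnt_def
      proof (rule ccontr)
        assume "C \<inter> C' \<noteq> {}"
        then obtain x where x: "x \<in> C" "x \<in> C'" by blast
        then obtain a where "a < n" "x = P a" using sub img j by blast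
        then show False using mem x j that(3) by auto
      qed
    qed
    show "{} \<notin> \<C>" by (simp add: \<C>_def)
  qed
  have "card \<C> \<le> card (?O ` {..<k})" unfolding \<C>_def by (intro card_mono) auto
  also have "\<dots> \<le> k" using card_image_le[of "{..<k}" ?O] by simp
  finally have card: "card \<C> \<le> k" .
  have bal: "balanced l col C" if "C \<in> \<C>" for C
  proof -
    have "C \<in> ?O ` {..<k}" using that unfolding \<C>_def by blast
    then obtain j where j: "j < k" "C = ?O j" by blast
    have "card {x\<in>C. col x = c} = \<sigma> j" if c: "c < l" for c
    proof -
      have "{x\<in>C. col x = c} = P ` {a\<in>color_class n (\<lambda>a. col (P a)) c. ?cl a = j}"
        unfolding j(2) by (auto simp: output_cluster_def color_class_def)
      moreover have "inj_on P {a\<in>color_class n (\<lambda>a. col (P a)) c. ?cl a = j}"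
        using inj by (rule inj_on_subset) (auto simp: color_class_def)
      ultimately show ?thesis using \<sigma>[OF c j(1)] by (simp add: card_image)
    qed
    then show ?thesis by (simp add: balanced_def)
  qed
  have "\<mu> C \<in> euclid d" for C by (simp add: \<mu>_def output_center_def euclid_def)
  then have fair: "fair_clustering d k l col A \<C> \<mu>" using part card bal by (simp add: fair_clustering_def)
  have "cost obj d \<C> \<mu> = agg obj {..<n} (\<lambda>a. zc obj d (P a) (\<mu> (?O (?cl a))))"
    using part A P Cof by (rule cost_indexed)
  also have "\<dots> = agg obj {..<n} (\<lambda>a. zc obj d (P a) (\<lambda>i. rmem s ''center'' (?cl a * d + i)))"
  proof (rule agg_cong)
    fix a assume "a \<in> {..<n}"
    then have "?O (?cl a) \<noteq> {}" using Cof by blast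
    then show "zc obj d (P a) (\<mu> (?O (?cl a))) = zc obj d (P a) (\<lambda>i. rmem s ''center'' (?cl a * d + i))"
      by (simp add: \<mu> output_center_def zc_def sqdist_def)
  qed simp
  finally show ?thesis using out fair by blast
qed

text \<open>A bound against every fair clustering passes to the infimum. Stating the requirement
  with labels and sizes confines partitions and input sets to this place.\<close>

lemma solves_withinI:
  assumes \<alpha>: "\<alpha> > 0" and k: "k \<ge> 1"
    and prog: "\<And>d l n P col. d \<ge> 1 \<Longrightarrow> n \<ge> 1 \<Longrightarrow> l \<le> n \<Longrightarrow> (\<And>a. a < n \<Longrightarrow> col (P a) < l) \<Longrightarrow>
      \<exists>t s. exec prog (input n d l P col) t s \<and> real t \<le> T n d \<and>
        (\<forall>cl \<nu> \<sigma>. (\<forall>a<n. cl a < k) \<longrightarrow> (\<forall>c<l. \<forall>j<k. card {a\<in>color_class n (\<lambda>a. col (P a)) c. cl a = j} = \<sigma> j) \<longrightarrow>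
          solution obj k n d l P (\<lambda>a. col (P a)) s (\<alpha> * agg obj {..<n} (\<lambda>a. zc obj d (P a) (\<nu> (cl a)))))"
  shows "solves_within prog obj \<alpha> k T"
  unfolding solves_within_def
proof (intro allI impI)
  fix d l A col P
  assume d: "d \<ge> 1" and Ad: "A \<subseteq> euclid d" and A: "finite A" "A \<noteq> {}" and bc: "balanced_coloring l col A" and P: "bij_betw P {..<card A} A"
  let ?n = "card A"
  have n: "?n \<ge> 1" using A by (simp add: Suc_le_eq card_gt_0_iff)
  have PA: "P a \<in> A" if "a < ?n" for a using P that by (auto simp: bij_betw_def)
  have colA: "col x < l" if "x \<in> A" for x using bc that by (auto simp: balanced_coloring_def)
  have balA: "balanced l col A" using bc by (simp add: balanced_coloring_def)
  \<comment> \<open>All colors are equally frequent and some color occurs, hence each of them does.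
    So loops over the colors are bounded by the number of points.\<close>
  have ln: "l \<le> ?n"
  proof -
    have "{..<l} \<subseteq> col ` A"
    proof
      fix c assume c: "c \<in> {..<l}"
      obtain x where x: "x \<in> A" using A by blast
      then have "{y\<in>A. col y = col x} \<noteq> {}" by blast
      then have "card {y\<in>A. col y = col x} > 0" using A by (simp add: card_gt_0_iff)
      then have "card {y\<in>A. col y = c} > 0" 
        using balA[unfolded balanced_def, rule_format, of c "col x"] c colA[OF x] by simp
      then show "c \<in> col ` A" by (auto simp: card_gt_0_iff)
    qed
    then have "card {..<l} \<le> card (col ` A)" using A by (intro card_mono) auto
    also have "\<dots> \<le> ?n" using A by (intro card_image_le)
    finally show ?thesis by simp
  qed
  obtain t s where ts: "exec prog (input ?n d l P col) t s" "real t \<le> T ?n d"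
    and sol: "\<And>cl \<nu> \<sigma>. (\<forall>a<?n. cl a < k) \<Longrightarrow> (\<forall>c<l. \<forall>j<k. card {a\<in>color_class ?n (\<lambda>a. col (P a)) c. cl a = j} = \<sigma> j) \<Longrightarrow>
          solution obj k ?n d l P (\<lambda>a. col (P a)) s (\<alpha> * agg obj {..<?n} (\<lambda>a. zc obj d (P a) (\<nu> (cl a))))"
  proof -
    have c: "col (P a) < l" if "a < ?n" for a by (rule colA[OF PA[OF that]])
    have "\<exists>t s. exec prog (input ?n d l P col) t s \<and> real t \<le> T ?n d \<and>
        (\<forall>cl \<nu> \<sigma>. (\<forall>a<?n. cl a < k) \<longrightarrow> (\<forall>c<l. \<forall>j<k. card {a\<in>color_class ?n (\<lambda>a. col (P a)) c. cl a = j} = \<sigma> j) \<longrightarrow>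
          solution obj k ?n d l P (\<lambda>a. col (P a)) s (\<alpha> * agg obj {..<?n} (\<lambda>a. zc obj d (P a) (\<nu> (cl a)))))"
      by (rule prog[OF d n ln]) (rule c)
    then show ?thesis by (elim exE conjE) (rule that, assumption, assumption, blast)
  qed
  let ?B = "agg obj {..<?n} (\<lambda>a. zc obj d (P a) (\<lambda>i. rmem s ''center'' (nmem s ''cluster'' a * d + i)))"
  have ref: "\<exists>X. solution obj k ?n d l P (\<lambda>a. col (P a)) s X \<and> X = \<alpha> * cost obj d \<C> \<mu>"
    if fc: "fair_clustering d k l col A \<C> \<mu>" for \<C> \<mu>
  proof -
    obtain cl \<nu> \<sigma> where r: "\<forall>a<?n. cl a < k" "\<forall>c<l. \<forall>j<k. card {a\<in>color_class ?n (\<lambda>a. col (P a)) c. cl a = j} = \<sigma> j"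
      "cost obj d \<C> \<mu> = agg obj {..<?n} (\<lambda>a. zc obj d (P a) (\<nu> (cl a)))"
      using fair_reference[OF fc A P, of obj] by blast
    show ?thesis unfolding r(3) using sol[OF r(1,2)] by blast
  qed
  \<comment> \<open>The whole input as one cluster is fair because the coloring is balanced. It
    makes the infimum range over a nonempty set and gives one reference from which the output is
    known to be feasible.\<close>
  have triv: "fair_clustering d k l col A {A} (\<lambda>_ _. 0)"
    unfolding fair_clustering_def using A k balA by (auto simp: partition_on_space euclid_def)
  obtain X where "solution obj k ?n d l P (\<lambda>a. col (P a)) s X" using ref[OF triv] by blast
  then obtain \<C> \<mu> where out: "outputs s ?n d k P \<C> \<mu>" "fair_clustering d k l col A \<C> \<mu>" "cost obj d \<C> \<mu> = ?B"
    using solution_output[OF _ A P] by blast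
  have "?B / \<alpha> \<le> opt obj d k l col A"
    unfolding opt_def
  proof (rule cInf_greatest)
    show "{cost obj d \<C> \<mu> |\<C> \<mu>. fair_clustering d k l col A \<C> \<mu>} \<noteq> {}" using triv by blast
    fix x assume "x \<in> {cost obj d \<C> \<mu> |\<C> \<mu>. fair_clustering d k l col A \<C> \<mu>}"
    then obtain \<C>' \<mu>' where x: "x = cost obj d \<C>' \<mu>'" "fair_clustering d k l col A \<C>' \<mu>'" by blast
    have "?B \<le> \<alpha> * x" using ref[OF x(2)] x(1) by (auto simp: solution_def)
    then show "?B / \<alpha> \<le> x" using \<alpha> by (simp add: divide_le_eq mult.commute)
  qed
  then have "cost obj d \<C> \<mu> \<le> \<alpha> * opt obj d k l col A" using \<alpha> out(3) by (simp add: divide_le_eq mult.commute)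
  then show "\<exists>t s \<C> \<mu>. exec prog (input ?n d l P col) t s \<and> real t \<le> T ?n d \<and> outputs s ?n d k P \<C> \<mu> \<and>
      approximation obj \<alpha> d k l col A \<C> \<mu>"
    using ts out unfolding approximation_def by blast
qed

section \<open>Running times\<close>

definition stable :: "lp \<Rightarrow> bool" where
  "stable c \<longleftrightarrow> ''#'' \<notin> vars c \<and> (\<forall>e\<in>bounds c. nvars e \<inter> nw c = {})"

lemma exec_stable:
  assumes "stable c" "agree {''#''} {} s r"
  shows "\<exists>t r'. exec (compile 0 c) r t r' \<and> agree {''#''} {} (den c s) r' \<and> t \<le> tb c s"
  using exec_compile[of c s r "nw c" 0] assms unfolding stable_def by blast

lemma depth_zdist [simp]: "depth Q (zdist obj X xo Y yo) = (if Q (nv ''d'') then 1 else 0)"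
  and bounds_zdist [simp]: "bounds (zdist obj X xo Y yo) = {nv ''d''}"
  and depth_comb [simp]: "depth Q (comb_prog obj x e) = 0"
  and bounds_comb [simp]: "bounds (comb_prog obj x e) = {}"
  and vars_comb [simp]: "vars (comb_prog obj x e) = rvars e"
  by (auto simp: zdist_def comb_prog_def)

lemma vars_zdist: "vars (zdist obj X xo Y yo) \<subseteq> {''i'', ''d''} \<union> nvars xo \<union> nvars yo"
  by (auto simp: zdist_def)

lemma is_dim_simps [simp]: "is_dim (nv x) \<longleftrightarrow> x = ''d''" "\<not> is_dim (NConst c)" "\<not> is_dim (NPlus e f)"
  by (auto simp: is_dim_def)

lemma not_is_dim_kmul [simp]: "\<not> is_dim (kmul c e)"
  by (cases c) (auto simp: is_dim_def)

lemma depth_center_prog: "depth Q (center_prog k m) \<le> 3" "depth is_dim (center_prog k m) \<le> 1"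
  and depth_table_prog: "depth Q (table_prog obj k) \<le> 3" "depth is_dim (table_prog obj k) \<le> 1"
  and depth_check_prog: "depth Q (check_prog obj k) \<le> 1" "depth is_dim (check_prog obj k) = 0"
  and depth_keep_prog: "depth Q keep_prog \<le> 1" "depth is_dim keep_prog = 0"
  and depth_total_prog: "depth Q (total_prog obj k) \<le> 1" "depth is_dim (total_prog obj k) = 0"
  and depth_store_prog: "depth Q (store_prog k) \<le> 2" "depth is_dim (store_prog k) \<le> 1"
  by (simp_all add: center_prog_def table_prog_def check_prog_def keep_prog_def total_prog_def store_prog_def copy_prog_def)

context search
begin

text \<open>The three digit counts add up because the nests lie inside each other, whereas the loop
  over colors contributes a single level.\<close>

lemma depth_search_prog:
  "depth Q (search_prog m K1 R1) \<le> (if Q R1 then K1 else 0) + (if Q R2 then K2 else 0) + (if Q R3 then K3 else 0) +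
    depth Q rp + depth Q sp + 3"
proof -
  have "depth Q rule_body \<le> depth Q rp + 1"
    using depth_check_prog(1)[of Q obj k] depth_keep_prog(1)[of Q] by (simp add: rule_body_def)
  then have "depth Q color_prog \<le> (if Q R3 then K3 else 0) + depth Q rp + 1"
    by (simp add: color_prog_def depth_nest)
  then have "depth Q colors_prog \<le> (if Q R3 then K3 else 0) + depth Q rp + 2"
    by (simp add: colors_prog_def)
  then have "depth Q inner_prog \<le> depth Q sp + (if Q R3 then K3 else 0) + depth Q rp + 2"
    using depth_total_prog(1)[of Q obj k] depth_store_prog(1)[of Q k] by (simp add: inner_prog_def)
  then have "depth Q (outer_body m) \<le> (if Q R2 then K2 else 0) + depth Q sp + (if Q R3 then K3 else 0) + depth Q rp + 3"
    using depth_center_prog(1)[of Q k m] depth_table_prog(1)[of Q obj k] by (simp add: outer_body_def depth_nest)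
  then show ?thesis by (simp add: search_prog_def depth_nest)
qed

lemma depth_is_dim_search_prog:
  assumes "\<not> is_dim R1" "\<not> is_dim R2" "\<not> is_dim R3" "depth is_dim rp = 0" "depth is_dim sp = 0"
  shows "depth is_dim (search_prog m K1 R1) \<le> 1"
proof -
  have "depth is_dim rule_body = 0"
    using depth_check_prog(2)[of obj k] depth_keep_prog(2) assms by (simp add: rule_body_def)
  then have "depth is_dim colors_prog = 0" using assms by (simp add: colors_prog_def color_prog_def depth_nest)
  then have "depth is_dim inner_prog \<le> 1"
    using depth_total_prog(2)[of obj k] depth_store_prog(2)[of k] assms by (simp add: inner_prog_def)
  then have "depth is_dim (outer_body m) \<le> 1"
    using depth_center_prog(2)[of k m] depth_table_prog(2)[of obj k] assms by (simp add: outer_body_def depth_nest)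
  then show ?thesis using assms by (simp add: search_prog_def depth_nest)
qed

lemma bounds_search_prog:
  "bounds (search_prog m K1 R1) \<subseteq> {R1, R2, R3, nv ''n'', nv ''d'', nv ''l'', NConst k, NConst m} \<union> bounds rp \<union> bounds sp"
proof -
  have "bounds rule_body \<subseteq> {nv ''n'', NConst k} \<union> bounds rp"
    by (simp add: rule_body_def check_prog_def keep_prog_def)
  then have "bounds colors_prog \<subseteq> {R3, nv ''l'', nv ''n'', NConst k} \<union> bounds rp"
    unfolding colors_prog_def color_prog_def bounds.simps bounds_nest by (cases "K3 = 0") (simp_all, blast+)
  then have "bounds inner_prog \<subseteq> {R3, nv ''l'', nv ''n'', nv ''d'', NConst k} \<union> bounds rp \<union> bounds sp"
    unfolding inner_prog_def total_prog_def store_prog_def copy_prog_def bounds.simps bounds_comb by blast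
  then have "bounds (outer_body m) \<subseteq> {R2, R3, nv ''n'', nv ''d'', nv ''l'', NConst k, NConst m} \<union> bounds rp \<union> bounds sp"
    unfolding outer_body_def center_prog_def table_prog_def bounds.simps bounds_nest bounds_zdist by (cases "K2 = 0") (simp_all, blast+)
  then show ?thesis
    unfolding search_prog_def bounds.simps bounds_nest by (cases "K1 = 0") (simp_all, blast+)
qed

lemma stable_search_prog:
  assumes "''#'' \<notin> vars rp" "''#'' \<notin> vars sp"
    and R: "\<And>e. e \<in> {R1, R2, R3} \<union> bounds rp \<union> bounds sp \<Longrightarrow> nvars e \<subseteq> {''n'', ''l'', ''np''}"
  shows "stable (search_prog m K1 R1)"
proof -
  have h: "''#'' \<notin> nvars R1" "''#'' \<notin> nvars R2" "''#'' \<notin> nvars R3" using R by fastforce+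
  have z: "''#'' \<notin> vars (zdist obj ''point'' (NRead ''md'' (nv ''a'')) ''cen'' (NRead ''md'' (nv ''j'')))"
    using vars_zdist[of obj "''point''" "NRead ''md'' (nv ''a'')" "''cen''" "NRead ''md'' (nv ''j'')"] by auto
  have "''#'' \<notin> vars (search_prog m K1 R1)"
    using h z assms(1,2)
    by (simp add: search_prog_def outer_body_def center_prog_def table_prog_def inner_prog_def colors_prog_def color_prog_def
      rule_body_def check_prog_def keep_prog_def total_prog_def store_prog_def copy_prog_def vars_nest)
  moreover have "nvars e \<inter> nw (search_prog m K1 R1) = {}" if "e \<in> bounds (search_prog m K1 R1)" for e
  proof -
    have "nvars e \<subseteq> {''n'', ''d'', ''l'', ''np''}"
      using subsetD[OF bounds_search_prog that] R by fastforce
    moreover have "{''n'', ''d'', ''l'', ''np''} \<inter> insert ''g'' AO = {}" by simp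
    ultimately show ?thesis using search_prog_sets(1)[of m K1 R1] by blast
  qed
  ultimately show ?thesis unfolding stable_def by blast
qed

end

lemma solution_agree:
  assumes "solution obj k n d l P col s X" "agree {''#''} {} s s'"
  shows "solution obj k n d l P col s' X"
  using assms unfolding solution_def by (simp add: agree_nmem[OF assms(2)] agree_rmem[OF assms(2)])

section \<open>Time of the two complete algorithms\<close>

definition threshold_algorithm :: "objective \<Rightarrow> nat \<Rightarrow> nat \<Rightarrow> com" where
  "threshold_algorithm obj k m = Seq (compile 0 (row_table k ;; identity_pool_prog)) (compile 0 (threshold_search_prog obj k m))"

lemma threshold_prog_facts:
  "''#'' \<notin> vars (threshold_prog obj k)" "bounds (threshold_prog obj k) \<subseteq> {kmul k (nv ''n''), nv ''n'', NConst k}"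
  "depth Q (threshold_prog obj k) \<le> 3" "depth is_dim (threshold_prog obj k) = 0"
proof -
  have "''#'' \<notin> bvars (beats_test k)" using bvars_beats_test[of k] by auto
  then show "''#'' \<notin> vars (threshold_prog obj k)"
    by (simp add: threshold_prog_def weight_prog_def selects_prog_def)
qed (simp_all add: threshold_prog_def weight_prog_def selects_prog_def)

text \<open>All limits other than the dimension are at most \<open>(2 * k + m) * n\<close>. The 7 in
  the exponent is the fixed nesting: 3 levels in \<open>threshold_prog\<close>, 1 in
  \<open>size_copy_prog\<close> and 3 in the rest of the search.\<close>

lemma threshold_algorithm:
  fixes col :: "point \<Rightarrow> nat"
  assumes d: "d \<ge> 1" and n: "n \<ge> 1" and ln: "l \<le> n" and col: "\<And>a. a < n \<Longrightarrow> col (P a) < l"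
    and k: "k \<ge> 1" and E: "E \<ge> 1" and m: "m = 4 * E\<^sup>2"
  shows "\<exists>t s. exec (threshold_algorithm obj k m) (input n d l P col) t s \<and>
    t \<le> (cst (row_table k ;; identity_pool_prog) + cst (threshold_search_prog obj k m)) *
      (2 * k + m) ^ (k * m + k + (k * k + 1) + 7) * (d * n ^ (k * m + k + (k * k + 1) + 7)) \<and>
    (\<forall>cl \<nu> \<sigma>. (\<forall>a<n. cl a < k) \<longrightarrow> (\<forall>c<l. \<forall>j<k. card {a\<in>color_class n (\<lambda>a. col (P a)) c. cl a = j} = \<sigma> j) \<longrightarrow>
      solution obj k n d l P (\<lambda>a. col (P a)) s ((1 + 1 / real E) * agg obj {..<n} (\<lambda>a. zc obj d (P a) (\<nu> (cl a)))))"
proof -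
  let ?c1 = "row_table k ;; identity_pool_prog" and ?c2 = "threshold_search_prog obj k m"
  let ?s = "input n d l P col"
  let ?s1 = "den ?c1 ?s"
  let ?col = "\<lambda>a. col (P a)"
  let ?X = "(2 * k + m) * n"
  let ?e = "k * m + k + (k * k + 1) + 7"
  interpret search obj k n d l P ?col "threshold_prog obj k" "size_copy_prog k" k "k * k + 1" "k * (n + 1)" "k * (n + 1)"
    "radix k" "radix k" "\<lambda>D gs S near. \<forall>v<k. S v = gs v" "threshold_rel obj k n"
    using col by (rule search_threshold)
  have env0: "ENV (den (row_table k) ?s)" by (rule env_input)
  have env: "ENV ?s1" using env_den[OF env0, of identity_pool_prog] by simp
  have pool: "nmem ?s1 ''np'' 0 = n" "\<forall>a<n. nmem ?s1 ''pool'' a = a"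
    using den_identity_pool_prog[OF envD(1)[OF env0]] by simp_all
  have X1: "?X \<ge> 1" and nX: "n \<le> ?X" and kX: "k \<le> ?X" and mX: "m \<le> ?X" and knX: "k * (n + 1) \<le> ?X"
  proof -
    have "1 * 1 \<le> (2 * k + m) * n" using k n by (intro mult_le_mono) auto
    then show "?X \<ge> 1" by simp
    have "1 * n \<le> (2 * k + m) * n" using k by (intro mult_le_mono1) auto
    then show "n \<le> ?X" by simp
    have "k * 1 \<le> (2 * k + m) * n" "m * 1 \<le> (2 * k + m) * n" using n by (intro mult_le_mono; simp)+
    then show "k \<le> ?X" "m \<le> ?X" by simp_all
    have "k * (n + 1) \<le> k * (2 * n)" using n by (intro mult_le_mono2) simp
    also have "\<dots> \<le> (2 * k + m) * n" by (simp add: distrib_right)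
    finally show "k * (n + 1) \<le> ?X" .
  qed
  have st1: "stable ?c1"
    by (auto simp: stable_def row_table_def identity_pool_prog_def)
  have b2: "bounds ?c2 \<subseteq> {radix k, nv ''n'', nv ''d'', nv ''l'', NConst k, NConst m, kmul k (nv ''n'')}"
    using bounds_search_prog[of m "k * m" "radix k"] threshold_prog_facts(2)[of obj k] by (auto simp: size_copy_prog_def)
  have st2: "stable ?c2"
  proof (rule stable_search_prog)
    show "''#'' \<notin> vars (threshold_prog obj k)" by (rule threshold_prog_facts(1))
    show "''#'' \<notin> vars (size_copy_prog k)" by (simp add: size_copy_prog_def)
    fix e assume "e \<in> {radix k, radix k, radix k} \<union> bounds (threshold_prog obj k) \<union> bounds (size_copy_prog k)"
    then have "e \<in> {radix k, kmul k (nv ''n''), nv ''n'', NConst k}"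
      using threshold_prog_facts(2)[of obj k] by (auto simp: size_copy_prog_def)
    then show "nvars e \<subseteq> {''n'', ''l'', ''np''}" by (auto simp: radix_def split: if_splits)
  qed
  obtain t1 r1 where 1: "exec (compile 0 ?c1) ?s t1 r1" "agree {''#''} {} ?s1 r1" "t1 \<le> tb ?c1 ?s"
    using exec_stable[OF st1, of ?s ?s] by auto
  obtain t2 r2 where 2: "exec (compile 0 ?c2) r1 t2 r2" "agree {''#''} {} (den ?c2 ?s1) r2" "t2 \<le> tb ?c2 ?s1"
    using exec_stable[OF st2 1(2)] by auto
  have pw: "c * (d ^ i * ?X ^ j * 1 ^ j') \<le> c * (d * ?X ^ ?e)" if "i \<le> 1" "j \<le> ?e" for c i j j'
  proof -
    have "d ^ i \<le> d ^ 1" "?X ^ j \<le> ?X ^ ?e" using d X1 that by (intro power_increasing; simp)+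
    then show ?thesis by (simp add: mult_le_mono)
  qed
  have T1: "tb ?c1 ?s \<le> cst ?c1 * (d * ?X ^ ?e)"
  proof (rule order_trans[OF tb_le[where Q = "\<lambda>_. False" and D = d and X = ?X and Y = 1]])
    fix e assume e: "e \<in> bounds ?c1"
    then have "e = NPlus (nv ''n'') (NConst k) \<or> e = nv ''n''" by (auto simp: row_table_def identity_pool_prog_def)
    then show "nval e ?s \<le> d" if "is_dim e" using that by auto
    have "n + k \<le> ?X"
    proof -
      have "n + k \<le> k * n + k * n" using k n by (intro add_mono) simp_all
      then show ?thesis by (simp add: distrib_right)
    qed
    then show "nval e ?s \<le> ?X" if "\<not> False" "\<not> is_dim e"
      using \<open>e = _ \<or> _\<close> nX by (auto simp: input_def)
  next
    show "cst ?c1 * (d ^ depth is_dim ?c1 * ?X ^ depth (\<lambda>e. \<not> False \<and> \<not> is_dim e) ?c1 * 1 ^ depth (\<lambda>e. False \<and> \<not> is_dim e) ?c1) \<le>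
      cst ?c1 * (d * ?X ^ ?e)"
      by (rule pw) (simp_all add: row_table_def identity_pool_prog_def)
  qed (use d X1 in simp_all)
  have dep: "depth (\<lambda>e. \<not> False \<and> \<not> is_dim e) ?c2 \<le> ?e"
    using depth_search_prog[of "\<lambda>e. \<not> False \<and> \<not> is_dim e" m "k * m" "radix k"]
      threshold_prog_facts(3)[of "\<lambda>e. \<not> False \<and> \<not> is_dim e" obj k]
    by (simp add: size_copy_prog_def radix_def)
  have dd: "depth is_dim ?c2 \<le> 1"
    by (rule depth_is_dim_search_prog) (simp_all add: threshold_prog_facts size_copy_prog_def radix_def)
  have T2: "tb ?c2 ?s1 \<le> cst ?c2 * (d * ?X ^ ?e)"
  proof (rule order_trans[OF tb_le[where Q = "\<lambda>_. False" and D = d and X = ?X and Y = 1]])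
    fix e assume "e \<in> bounds ?c2"
    then have e: "e \<in> {radix k, nv ''n'', nv ''d'', nv ''l'', NConst k, NConst m, kmul k (nv ''n'')}" using b2 by blast
    show "nval e ?s1 \<le> d" if "is_dim e" using that envD(2)[OF env] unfolding is_dim_def by simp
    have knX': "k * n \<le> ?X" by (simp add: distrib_right)
    have lX: "l \<le> ?X" using ln nX by linarith
    show "nval e ?s1 \<le> ?X" if "\<not> False" "\<not> is_dim e"
      using e that envD(1,3)[OF env] lX nX kX mX knX knX' by (auto simp: radix_def simp del: den.simps)
  next
    show "cst ?c2 * (d ^ depth is_dim ?c2 * ?X ^ depth (\<lambda>e. \<not> False \<and> \<not> is_dim e) ?c2 * 1 ^ depth (\<lambda>e. False \<and> \<not> is_dim e) ?c2) \<le>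
      cst ?c2 * (d * ?X ^ ?e)"
      using dd dep by (rule pw)
  qed (use d X1 in simp_all)
  have "t1 + t2 \<le> (cst ?c1 + cst ?c2) * (d * ?X ^ ?e)"
    using 1(3) 2(3) T1 T2 unfolding distrib_right by linarith
  also have "\<dots> = (cst ?c1 + cst ?c2) * (2 * k + m) ^ ?e * (d * n ^ ?e)"
    by (simp only: power_mult_distrib mult_ac)
  finally have T: "t1 + t2 \<le> (cst ?c1 + cst ?c2) * (2 * k + m) ^ ?e * (d * n ^ ?e)" .
  have ex: "exec (threshold_algorithm obj k m) ?s (t1 + t2) r2"
    unfolding threshold_algorithm_def by (rule exec.Seq[OF 1(1) 2(1)])
  have sol: "solution obj k n d l P ?col r2 ((1 + 1 / real E) * agg obj {..<n} (\<lambda>a. zc obj d (P a) (\<nu> (cl a))))"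
    if "\<forall>a<n. cl a < k" "\<forall>c<l. \<forall>j<k. card {a\<in>color_class n ?col c. cl a = j} = \<sigma> j" for cl \<nu> \<sigma>
    by (rule solution_agree[OF threshold_search[OF env pool n k E m] 2(2)]) (use col that in auto)
  show ?thesis using ex T sol by blast
qed

text \<open>From 1 + x \<le> exp x with x = L/m and m = 2 (e + 1): the power e of exp (L/m) is at
  most exp (L/2), and exp (1/2) \<le> 2. With 2^L \<le> 8 n it turns powers of log n into a multiple
  of n.\<close>

lemma power_le_exponential: "\<exists>C\<ge>0. \<forall>L. (1 + real L) ^ e \<le> C * 2 ^ L"
proof (intro exI conjI allI)
  let ?m = "2 * (real e + 1)"
  show "?m ^ e \<ge> 0" by simp
  fix L
  have "1 + real L \<le> ?m * (1 + real L / ?m)" by (simp add: field_simps)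
  also have "\<dots> \<le> ?m * exp (real L / ?m)" by (intro mult_left_mono) (simp_all add: exp_ge_add_one_self)
  finally have "(1 + real L) ^ e \<le> (?m * exp (real L / ?m)) ^ e" by (intro power_mono) simp_all
  also have "\<dots> = ?m ^ e * exp (real e * (real L / ?m))" by (simp only: power_mult_distrib exp_of_nat_mult)
  also have "\<dots> \<le> ?m ^ e * exp (real L * (1 / 2))"
    by (intro mult_left_mono) (simp_all add: field_simps)
  also have "exp (real L * (1 / 2)) = exp (1 / 2) ^ L" by (rule exp_of_nat_mult)
  also have "?m ^ e * exp (1 / 2 :: real) ^ L \<le> ?m ^ e * 2 ^ L"
    by (intro mult_left_mono power_mono exp_half_le2) simp_all
  finally show "(1 + real L) ^ e \<le> ?m ^ e * 2 ^ L" .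
qed

text \<open>Separately compiled stages, because a stage must not write variables of its own loop
  limits: the number of rounds \<open>''N''\<close> and the pool size \<open>''np''\<close> are
  computed before the stage whose loops they limit.\<close>

definition greedy_algorithm :: "objective \<Rightarrow> nat \<Rightarrow> com" where
  "greedy_algorithm obj k = Seq (compile 0 (row_table k ;; count_prog k ;; pool_init_prog obj))
     (Seq (compile 0 (pool_loop_prog obj)) (compile 0 (greedy_search_prog obj k)))"

lemma greedy_prog_facts:
  "''#'' \<notin> vars (greedy_prog k)" "bounds (greedy_prog k) \<subseteq> {nv ''n'', NConst k, NConst (2 * k)}"
  "depth (\<lambda>e. \<not> (e = nv ''np'' \<or> (\<exists>c. e = NConst c)) \<and> \<not> is_dim e) (greedy_prog k) \<le> 1"
  "depth (\<lambda>e. (e = nv ''np'' \<or> (\<exists>c. e = NConst c)) \<and> \<not> is_dim e) (greedy_prog k) \<le> 1"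
  "depth is_dim (greedy_prog k) = 0"
  by (simp_all add: greedy_prog_def move_prog_def)

lemma base_size_prog_facts:
  "''#'' \<notin> vars (base_size_prog k)" "bounds (base_size_prog k) \<subseteq> {nv ''n'', NConst k}"
  "depth (\<lambda>e. \<not> (e = nv ''np'' \<or> (\<exists>c. e = NConst c)) \<and> \<not> is_dim e) (base_size_prog k) \<le> 1"
  "depth (\<lambda>e. (e = nv ''np'' \<or> (\<exists>c. e = NConst c)) \<and> \<not> is_dim e) (base_size_prog k) \<le> 1"
  "depth is_dim (base_size_prog k) = 0"
  by (simp_all add: base_size_prog_def near_prog_def)

lemma pool_init_prog_facts:
  "stable (row_table k ;; count_prog k ;; pool_init_prog obj)"
  "bounds (row_table k ;; count_prog k ;; pool_init_prog obj) \<subseteq>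
    {NPlus (nv ''n'') (NConst k), kmul 4 (nv ''n''), nv ''n'', nv ''d''}"
  "depth is_dim (row_table k ;; count_prog k ;; pool_init_prog obj) \<le> 1"
  "depth Q (row_table k ;; count_prog k ;; pool_init_prog obj) \<le> 3"
proof -
  have "''#'' \<notin> vars (point_dist_prog obj ''far'')"
    using vars_zdist by (fastforce simp: point_dist_prog_def)
  then show "stable (row_table k ;; count_prog k ;; pool_init_prog obj)"
    by (auto simp: stable_def row_table_def count_prog_def pool_init_prog_def point_dist_prog_def)
qed (simp_all add: row_table_def count_prog_def pool_init_prog_def point_dist_prog_def)

lemma pool_loop_prog_facts:
  "stable (pool_loop_prog obj)" "bounds (pool_loop_prog obj) \<subseteq> {nv ''N'', nv ''n'', nv ''d''}"
  "depth is_dim (pool_loop_prog obj) \<le> 1" "depth Q (pool_loop_prog obj) \<le> 4"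
proof -
  have v: "''#'' \<notin> vars (point_dist_prog obj x)" if "x \<noteq> ''#''" for x
    using vars_zdist that by (fastforce simp: point_dist_prog_def)
  show b: "bounds (pool_loop_prog obj) \<subseteq> {nv ''N'', nv ''n'', nv ''d''}"
    by (simp add: pool_loop_prog_def pool_step_prog_def farthest_prog_def insert_prog_def greedy_choice_prog_def
      gain_prog_def point_dist_prog_def)
  have "''#'' \<notin> vars (pool_loop_prog obj)"
    by (simp add: pool_loop_prog_def pool_step_prog_def farthest_prog_def insert_prog_def greedy_choice_prog_def
      gain_prog_def v)
  moreover have "nvars e \<inter> nw (pool_loop_prog obj) = {}" if "e \<in> bounds (pool_loop_prog obj)" for e
    using subsetD[OF b that] by auto
  ultimately show "stable (pool_loop_prog obj)" unfolding stable_def by blast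
qed (simp_all add: pool_loop_prog_def pool_step_prog_def farthest_prog_def insert_prog_def greedy_choice_prog_def
      gain_prog_def point_dist_prog_def)

text \<open>Only a fixed number of nested loops range over \<open>n\<close>. The
  \<open>5 * k\<close> digits for centers and moves range over at most
  \<open>2 * (k + k * L) + 1\<close> values, the size of the pool array, which is logarithmic in
  \<open>n\<close> for fixed \<open>k\<close>.\<close>

lemma greedy_algorithm:
  fixes col :: "point \<Rightarrow> nat"
  assumes d: "d \<ge> 1" and n: "n \<ge> 1" and ln: "l \<le> n" and col: "\<And>a. a < n \<Longrightarrow> col (P a) < l" and k: "k \<ge> 1"
  shows "\<exists>t s L. exec (greedy_algorithm obj k) (input n d l P col) t s \<and> 2 ^ L \<le> 8 * n \<and>
    t \<le> (cst (row_table k ;; count_prog k ;; pool_init_prog obj) + cst (pool_loop_prog obj) + cst (greedy_search_prog obj k)) *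
      (d * ((9 * k * n) ^ 7 * (2 * (k + k * L) + 1) ^ (5 * k + 7))) \<and>
    (\<forall>cl \<nu> \<sigma>. (\<forall>a<n. cl a < k) \<longrightarrow> (\<forall>c<l. \<forall>j<k. card {a\<in>color_class n (\<lambda>a. col (P a)) c. cl a = j} = \<sigma> j) \<longrightarrow>
      solution obj k n d l P (\<lambda>a. col (P a)) s (884 * agg obj {..<n} (\<lambda>a. zc obj d (P a) (\<nu> (cl a)))))"
proof -
  let ?c1 = "row_table k ;; count_prog k ;; pool_init_prog obj" and ?c2 = "pool_loop_prog obj" and ?c3 = "greedy_search_prog obj k"
  let ?s = "input n d l P col"
  let ?s1 = "den ?c1 ?s"
  let ?s2 = "den ?c2 ?s1"
  let ?col = "\<lambda>a. col (P a)"
  let ?X = "9 * k * n"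
  let ?sc = "den (count_prog k) (den (row_table k) ?s)"
  interpret search obj k n d l P ?col "greedy_prog k" "base_size_prog k" 1 "4 * k" l k "nv ''l''" "NConst k"
    "base_size_rel k n ?col" "greedy_rel k n ?col"
    using col k by (rule search_greedy)
  have env0: "ENV (den (row_table k) ?s)" by (rule env_input)
  have envc: "ENV ?sc" using env_den[OF env0, of "count_prog k"] by simp
  have s1: "?s1 = den (pool_init_prog obj) ?sc" by simp
  have env1: "ENV ?s1" unfolding s1 using env_den[OF envc, of "pool_init_prog obj"] by simp
  have env2: "ENV ?s2" using env_den[OF env1, of ?c2] by simp
  obtain L where L: "nmem ?sc ''N'' 0 = k + k * L" "4 * n \<le> 2 ^ L" "2 ^ L \<le> 8 * n"
    using den_count_prog[OF envD(1)[OF env0] n, of k] by (elim exE conjE) (rule that; assumption)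
  have N: "nmem ?s1 ''N'' 0 = k + k * L"
    unfolding s1 L(1)[symmetric] by (simp add: nmem_den del: den.simps)
  have pool1: "pooled obj n d P {0} ?s1" "nmem ?s1 ''np'' 0 = 1"
    unfolding s1 by (rule den_pool_init_prog[OF envc n])+
  obtain T where T: "T 0 = {0}" "\<forall>i<k + k * L. pool_step obj d P n (T i) (T (Suc i))" "pooled obj n d P (T (k + k * L)) ?s2"
    using den_pool_loop_prog(1)[OF env1 pool1 n N] by (elim exE conjE) (rule that; assumption)
  have np: "nmem ?s2 ''np'' 0 = 2 * (k + k * L) + 1"
    by (rule den_pool_loop_prog(2)[OF env1 pool1 n N])
  let ?Y = "2 * (k + k * L) + 1"
  let ?B = "d * (?X ^ 7 * ?Y ^ (5 * k + 7))"
  have kn: "k * 1 \<le> k * n" "1 * n \<le> k * n" using k n by (intro mult_le_mono; simp)+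
  have X1: "?X \<ge> 1" and nX: "n \<le> ?X" and n4X: "4 * n \<le> ?X" and nkX: "n + k \<le> ?X" and lX: "l \<le> ?X" using kn k n ln by linarith+
  have NX: "k + k * L \<le> ?X"
  proof -
    have "L < 2 ^ L" by simp
    then have "L \<le> 8 * n" using L(3) by linarith
    then have "k * L \<le> k * (8 * n)" by (rule mult_le_mono2)
    moreover have "k * (8 * n) = 8 * (k * n)" "9 * k * n = 9 * (k * n)" by simp_all
    ultimately show ?thesis using kn by linarith
  qed
  have pw: "c * (d ^ i * ?X ^ j * ?Y ^ j') \<le> c * ?B" if "i \<le> 1" "j \<le> 7" "j' \<le> 5 * k + 7" for c i j j'
  proof -
    have "d ^ i \<le> d ^ 1" "?X ^ j \<le> ?X ^ 7" "?Y ^ j' \<le> ?Y ^ (5 * k + 7)" using d X1 that by (intro power_increasing; simp)+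
    then have "d ^ i * (?X ^ j * ?Y ^ j') \<le> d * (?X ^ 7 * ?Y ^ (5 * k + 7))" by (intro mult_le_mono) simp_all
    then show ?thesis by (simp only: mult.assoc mult_le_mono2)
  qed
  \<comment> \<open>The limits counted with the small base \<open>?Y\<close>: the pool size and the
    constants of the program.\<close>
  let ?Q = "\<lambda>e. e = nv ''np'' \<or> (\<exists>c. e = NConst c)"
  have b3: "bounds ?c3 \<subseteq> {nv ''np'', nv ''l'', NConst k, nv ''n'', nv ''d'', NConst 1, NConst (2 * k)}"
    using bounds_search_prog[of 1 k "nv ''np''"] greedy_prog_facts(2)[of k] base_size_prog_facts(2)[of k] by blast
  have st3: "stable ?c3"
  proof (rule stable_search_prog)
    show "''#'' \<notin> vars (greedy_prog k)" by (rule greedy_prog_facts(1))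
    show "''#'' \<notin> vars (base_size_prog k)" by (rule base_size_prog_facts(1))
    fix e assume "e \<in> {nv ''np'', nv ''l'', NConst k} \<union> bounds (greedy_prog k) \<union> bounds (base_size_prog k)"
    then have "e \<in> {nv ''np'', nv ''l'', nv ''n'', NConst k, NConst (2 * k)}"
      using greedy_prog_facts(2)[of k] base_size_prog_facts(2)[of k] by blast
    then show "nvars e \<subseteq> {''n'', ''l'', ''np''}" by auto
  qed
  obtain t1 r1 where 1: "exec (compile 0 ?c1) ?s t1 r1" "agree {''#''} {} ?s1 r1" "t1 \<le> tb ?c1 ?s"
    using exec_stable[OF pool_init_prog_facts(1)[of k obj], of ?s ?s] by (auto simp del: den.simps)
  obtain t2 r2 where 2: "exec (compile 0 ?c2) r1 t2 r2" "agree {''#''} {} ?s2 r2" "t2 \<le> tb ?c2 ?s1"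
    using exec_stable[OF pool_loop_prog_facts(1) 1(2), of obj] by (elim exE conjE) (rule that; assumption)
  obtain t3 r3 where 3: "exec (compile 0 ?c3) r2 t3 r3" "agree {''#''} {} (den ?c3 ?s2) r3" "t3 \<le> tb ?c3 ?s2"
    using exec_stable[OF st3 2(2)] by (elim exE conjE) (rule that; assumption)
  have T1: "tb ?c1 ?s \<le> cst ?c1 * ?B"
  proof (rule order_trans[OF tb_le[where Q = "\<lambda>_. False" and D = d and X = ?X and Y = ?Y]])
    fix e assume "e \<in> bounds ?c1"
    then have e: "e \<in> {NPlus (nv ''n'') (NConst k), kmul 4 (nv ''n''), nv ''n'', nv ''d''}"
      using pool_init_prog_facts(2) by blast
    show "nval e ?s \<le> d" if "is_dim e" using that by (simp add: is_dim_def input_def)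
    show "nval e ?s \<le> ?X" if "\<not> False" "\<not> is_dim e"
      using e that nX n4X nkX by (auto simp: input_def)
  next
    show "cst ?c1 * (d ^ depth is_dim ?c1 * ?X ^ depth (\<lambda>e. \<not> False \<and> \<not> is_dim e) ?c1 * ?Y ^ depth (\<lambda>e. False \<and> \<not> is_dim e) ?c1) \<le> cst ?c1 * ?B"
      using pool_init_prog_facts(3)[of k obj] pool_init_prog_facts(4)[of "\<lambda>e. \<not> False \<and> \<not> is_dim e" k obj]
        pool_init_prog_facts(4)[of "\<lambda>e. False \<and> \<not> is_dim e" k obj] by (intro pw) linarith+
  qed (use d X1 in simp_all)
  have T2: "tb ?c2 ?s1 \<le> cst ?c2 * ?B"
  proof (rule order_trans[OF tb_le[where Q = "\<lambda>_. False" and D = d and X = ?X and Y = ?Y]])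
    fix e assume "e \<in> bounds ?c2"
    then have e: "e \<in> {nv ''N'', nv ''n'', nv ''d''}" using pool_loop_prog_facts(2) by blast
    show "nval e ?s1 \<le> d" if "is_dim e" using that envD(2)[OF env1] unfolding is_dim_def by simp
    show "nval e ?s1 \<le> ?X" if "\<not> False" "\<not> is_dim e"
      using e that envD(1)[OF env1] N nX NX by (auto simp del: den.simps)
  next
    show "cst ?c2 * (d ^ depth is_dim ?c2 * ?X ^ depth (\<lambda>e. \<not> False \<and> \<not> is_dim e) ?c2 * ?Y ^ depth (\<lambda>e. False \<and> \<not> is_dim e) ?c2) \<le> cst ?c2 * ?B"
      using pool_loop_prog_facts(3)[of obj] pool_loop_prog_facts(4)[of "\<lambda>e. \<not> False \<and> \<not> is_dim e" obj]
        pool_loop_prog_facts(4)[of "\<lambda>e. False \<and> \<not> is_dim e" obj] by (intro pw) linarith+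
  qed (use d X1 in simp_all)
  have dX: "depth (\<lambda>e. \<not> ?Q e \<and> \<not> is_dim e) ?c3 \<le> 7"
    using depth_search_prog[of "\<lambda>e. \<not> ?Q e \<and> \<not> is_dim e" 1 k "nv ''np''"] greedy_prog_facts(3)[of k] base_size_prog_facts(3)[of k]
    by simp
  have dY: "depth (\<lambda>e. ?Q e \<and> \<not> is_dim e) ?c3 \<le> 5 * k + 7"
    using depth_search_prog[of "\<lambda>e. ?Q e \<and> \<not> is_dim e" 1 k "nv ''np''"] greedy_prog_facts(4)[of k] base_size_prog_facts(4)[of k]
    by simp
  have dd: "depth is_dim ?c3 \<le> 1"
    by (rule depth_is_dim_search_prog) (simp_all add: greedy_prog_facts base_size_prog_facts)
  have T3: "tb ?c3 ?s2 \<le> cst ?c3 * ?B"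
  proof (rule order_trans[OF tb_le[where Q = ?Q and D = d and X = ?X and Y = ?Y]])
    fix e assume "e \<in> bounds ?c3"
    then have e: "e \<in> {nv ''np'', nv ''l'', NConst k, nv ''n'', nv ''d'', NConst 1, NConst (2 * k)}" using b3 by blast
    show "nval e ?s2 \<le> d" if "is_dim e" using that envD(2)[OF env2] unfolding is_dim_def by simp
    show "nval e ?s2 \<le> ?Y" if "?Q e" "\<not> is_dim e"
      using e that np by (auto simp del: den.simps)
    show "nval e ?s2 \<le> ?X" if "\<not> ?Q e" "\<not> is_dim e"
      using e that envD(1,3)[OF env2] nX lX by (auto simp del: den.simps)
  next
    show "cst ?c3 * (d ^ depth is_dim ?c3 * ?X ^ depth (\<lambda>e. \<not> ?Q e \<and> \<not> is_dim e) ?c3 * ?Y ^ depth (\<lambda>e. ?Q e \<and> \<not> is_dim e) ?c3) \<le> cst ?c3 * ?B"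
      using dd dX dY by (rule pw)
  qed (use d X1 in simp_all)
  have t: "t1 + (t2 + t3) \<le> (cst ?c1 + cst ?c2 + cst ?c3) * ?B"
    using 1(3) 2(3) 3(3) T1 T2 T3 unfolding distrib_right by linarith
  have ex: "exec (greedy_algorithm obj k) ?s (t1 + (t2 + t3)) r3"
    unfolding greedy_algorithm_def by (rule exec.Seq[OF 1(1) exec.Seq[OF 2(1) 3(1)]])
  have sol: "solution obj k n d l P ?col r3 (884 * agg obj {..<n} (\<lambda>a. zc obj d (P a) (\<nu> (cl a))))"
    if h: "\<forall>a<n. cl a < k" "\<forall>c<l. \<forall>j<k. card {a\<in>color_class n ?col c. cl a = j} = \<sigma> j" for cl \<nu> \<sigma>
  proof (rule solution_agree[OF greedy_search[OF env2 np] 3(2)])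
    show "T (k + k * L) = nmem ?s2 ''pool'' ` {..<2 * (k + k * L) + 1}" using pooledD(1)[OF T(3)] unfolding np .
    show "agg obj {..<n} (pool_dist obj d P (T (k + k * L))) \<le> 5 * agg obj {..<n} (\<lambda>a. zc obj d (P a) (\<nu> (cl a)))"
      by (rule greedy_pool[where T = T and k = k and L = L]) (use n k h(1) T(1,2) L(2) in auto)
  qed (use pooledD(2,3)[OF T(3)] n k col h in auto)
  show ?thesis using ex L(3) t sol by blast
qed

section \<open>The exponent as a polynomial in k/eps\<close>

lemma solution_mono: "solution obj k n d l P col s X \<Longrightarrow> X \<le> X' \<Longrightarrow> solution obj k n d l P col s X'"
  by (auto simp: solution_def)

lemma threshold_solves:
  assumes k: "k \<ge> 1" and E: "E \<ge> 1" "1 / real E \<le> \<epsilon>" and eps: "\<epsilon> > 0"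
    and q: "real (k * (4 * E\<^sup>2) + k + (k * k + 1) + 7) \<le> q"
  shows "\<exists>prog C. solves_within prog obj (1 + \<epsilon>) k (\<lambda>n d. C * real d * real n powr q)"
proof -
  let ?m = "4 * E\<^sup>2"
  let ?e = "k * ?m + k + (k * k + 1) + 7"
  let ?C = "(cst (row_table k ;; identity_pool_prog) + cst (threshold_search_prog obj k ?m)) * (2 * k + ?m) ^ ?e"
  have "solves_within (threshold_algorithm obj k ?m) obj (1 + \<epsilon>) k (\<lambda>n d. real ?C * real d * real n powr q)"
  proof (rule solves_withinI)
    fix d l n :: nat and P :: "nat \<Rightarrow> point" and col :: "point \<Rightarrow> nat"
    assume d: "d \<ge> 1" and n: "n \<ge> 1" and ln: "l \<le> n" and col: "\<And>a. a < n \<Longrightarrow> col (P a) < l"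
    obtain t s where ts: "exec (threshold_algorithm obj k ?m) (input n d l P col) t s" "t \<le> ?C * (d * n ^ ?e)"
      and sol: "\<forall>cl \<nu> \<sigma>. (\<forall>a<n. cl a < k) \<longrightarrow> (\<forall>c<l. \<forall>j<k. card {a\<in>color_class n (\<lambda>a. col (P a)) c. cl a = j} = \<sigma> j) \<longrightarrow>
        solution obj k n d l P (\<lambda>a. col (P a)) s ((1 + 1 / real E) * agg obj {..<n} (\<lambda>a. zc obj d (P a) (\<nu> (cl a))))"
      by (rule exE[OF threshold_algorithm[where P = P and col = col and obj = obj, OF d n ln _ k E(1) refl]],
          rule col, assumption, elim exE conjE) (rule that; assumption)
    have "real n ^ ?e = real n powr real ?e" using n by (simp only: powr_realpow of_nat_0_less_iff)
    also have "\<dots> \<le> real n powr q" using n q by (intro powr_mono) simp_all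
    finally have pow: "real n ^ ?e \<le> real n powr q" .
    have "real t \<le> real (?C * (d * n ^ ?e))" using ts(2) by (rule of_nat_mono)
    also have "\<dots> = real ?C * real d * real n ^ ?e" by (simp only: of_nat_mult of_nat_power mult.assoc)
    also have "\<dots> \<le> real ?C * real d * real n powr q" using pow by (rule mult_left_mono) (simp only: of_nat_0_le_iff zero_le_mult_iff simp_thms)
    finally have T: "real t \<le> real ?C * real d * real n powr q" .
    have le: "(1 + 1 / real E) * agg obj {..<n} f \<le> (1 + \<epsilon>) * agg obj {..<n} f"
      if "\<And>a. f a \<ge> 0" for f using E(2) that by (intro mult_right_mono agg_nonneg) simp_all
    show "\<exists>t s. exec (threshold_algorithm obj k ?m) (input n d l P col) t s \<and> real t \<le> real ?C * real d * real n powr q \<and>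
        (\<forall>cl \<nu> \<sigma>. (\<forall>a<n. cl a < k) \<longrightarrow> (\<forall>c<l. \<forall>j<k. card {a\<in>color_class n (\<lambda>a. col (P a)) c. cl a = j} = \<sigma> j) \<longrightarrow>
          solution obj k n d l P (\<lambda>a. col (P a)) s ((1 + \<epsilon>) * agg obj {..<n} (\<lambda>a. zc obj d (P a) (\<nu> (cl a)))))"
      by (intro exI[of _ t] exI[of _ s] conjI ts(1) T allI impI) (rule solution_mono[OF sol[rule_format] le], simp_all add: zc_nonneg)
  qed (use eps k in simp_all)
  then show ?thesis by blast
qed

text \<open>The number of enumerated configurations is \<open>(log n)^O(k)\<close>, which stays below a constant multiple of \<open>n\<close>.\<close>

lemma greedy_solves:
  assumes k: "k \<ge> 1" and eps: "\<epsilon> \<ge> 883" and q: "q \<ge> 8"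
  shows "\<exists>prog C. solves_within prog obj (1 + \<epsilon>) k (\<lambda>n d. C * real d * real n powr q)"
proof -
  let ?e = "5 * k + 7"
  let ?c = "cst (row_table k ;; count_prog k ;; pool_init_prog obj) + cst (pool_loop_prog obj) + cst (greedy_search_prog obj k)"
  obtain C where C: "C \<ge> 0" "\<forall>L. (1 + real L) ^ ?e \<le> C * 2 ^ L" using power_le_exponential by blast
  let ?C = "real ?c * (9 * real k) ^ 7 * ((3 * real k) ^ ?e * C * 8)"
  have "solves_within (greedy_algorithm obj k) obj (1 + \<epsilon>) k (\<lambda>n d. ?C * real d * real n powr q)"
  proof (rule solves_withinI)
    fix d l n :: nat and P :: "nat \<Rightarrow> point" and col :: "point \<Rightarrow> nat"
    assume d: "d \<ge> 1" and n: "n \<ge> 1" and ln: "l \<le> n" and col: "\<And>a. a < n \<Longrightarrow> col (P a) < l"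
    obtain t s L where ts: "exec (greedy_algorithm obj k) (input n d l P col) t s" and L: "2 ^ L \<le> 8 * n"
      and t: "t \<le> ?c * (d * ((9 * k * n) ^ 7 * (2 * (k + k * L) + 1) ^ ?e))"
      and sol: "\<forall>cl \<nu> \<sigma>. (\<forall>a<n. cl a < k) \<longrightarrow> (\<forall>c<l. \<forall>j<k. card {a\<in>color_class n (\<lambda>a. col (P a)) c. cl a = j} = \<sigma> j) \<longrightarrow>
        solution obj k n d l P (\<lambda>a. col (P a)) s (884 * agg obj {..<n} (\<lambda>a. zc obj d (P a) (\<nu> (cl a))))"
      by (rule exE[OF greedy_algorithm[where P = P and col = col and obj = obj, OF d n ln _ k]],
          rule col, assumption, elim exE conjE) (rule that; assumption)
    have "real (2 * (k + k * L) + 1) \<le> 3 * real k * (1 + real L)"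
    proof -
      have "2 * (k + k * L) + 1 \<le> 3 * k * (1 + L)" using k by (simp add: algebra_simps)
      then have "real (2 * (k + k * L) + 1) \<le> real (3 * k * (1 + L))" by (rule of_nat_mono)
      then show ?thesis by (simp add: algebra_simps)
    qed
    then have "real (2 * (k + k * L) + 1) ^ ?e \<le> (3 * real k * (1 + real L)) ^ ?e" by (intro power_mono) simp_all
    also have "\<dots> = (3 * real k) ^ ?e * (1 + real L) ^ ?e" by (rule power_mult_distrib)
    also have "\<dots> \<le> (3 * real k) ^ ?e * (C * 2 ^ L)" using C(2) by (intro mult_left_mono) simp_all
    also have "\<dots> \<le> (3 * real k) ^ ?e * (C * (8 * real n))"
    proof -
      have "real (2 ^ L) \<le> real (8 * n)" using L by (rule of_nat_mono)
      then show ?thesis using C(1) by (intro mult_left_mono) simp_all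
    qed
    finally have Y: "real (2 * (k + k * L) + 1) ^ ?e \<le> (3 * real k) ^ ?e * C * 8 * real n" by (simp only: mult.assoc)
    \<comment> \<open>Seven powers come from loops over the input and one from 2^L \<le> 8 n, after
      the powers of log n have been absorbed into 2^L.\<close>
    have "real n ^ 8 = real n powr real 8" using n by (simp only: powr_realpow of_nat_0_less_iff)
    also have "\<dots> \<le> real n powr q" using n q by (intro powr_mono) simp_all
    finally have pow: "real n ^ 8 \<le> real n powr q" .
    have "real t \<le> real (?c * (d * ((9 * k * n) ^ 7 * (2 * (k + k * L) + 1) ^ ?e)))" using t by (rule of_nat_mono)
    also have "\<dots> = real ?c * (9 * real k) ^ 7 * real d * real n ^ 7 * real (2 * (k + k * L) + 1) ^ ?e"
      by (simp only: of_nat_mult of_nat_power of_nat_numeral power_mult_distrib mult_ac)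
    also have "\<dots> \<le> real ?c * (9 * real k) ^ 7 * real d * real n ^ 7 * ((3 * real k) ^ ?e * C * 8 * real n)"
      by (intro mult_left_mono Y mult_nonneg_nonneg zero_le_power) simp_all
    also have "\<dots> = ?C * real d * (real n ^ 7 * real n)" by (simp only: mult_ac)
    also have "real n ^ 7 * real n = real n ^ 8" by (simp add: eval_nat_numeral)
    also have "?C * real d * real n ^ 8 \<le> ?C * real d * real n powr q"
      by (intro mult_left_mono pow mult_nonneg_nonneg zero_le_power C(1)) simp_all
    finally have T: "real t \<le> ?C * real d * real n powr q" .
    have le: "884 * agg obj {..<n} f \<le> (1 + \<epsilon>) * agg obj {..<n} f"
      if "\<And>a. f a \<ge> 0" for f using eps that by (intro mult_right_mono agg_nonneg) simp_all
    show "\<exists>t s. exec (greedy_algorithm obj k) (input n d l P col) t s \<and> real t \<le> ?C * real d * real n powr q \<and>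
        (\<forall>cl \<nu> \<sigma>. (\<forall>a<n. cl a < k) \<longrightarrow> (\<forall>c<l. \<forall>j<k. card {a\<in>color_class n (\<lambda>a. col (P a)) c. cl a = j} = \<sigma> j) \<longrightarrow>
          solution obj k n d l P (\<lambda>a. col (P a)) s ((1 + \<epsilon>) * agg obj {..<n} (\<lambda>a. zc obj d (P a) (\<nu> (cl a)))))"
      by (intro exI[of _ t] exI[of _ s] conjI ts T allI impI) (rule solution_mono[OF sol[rule_format] le], simp_all add: zc_nonneg)
  qed (use eps k in simp_all)
  then show ?thesis by blast
qed

theorem theorem5:
  "\<exists>p :: real poly. \<forall>(k :: nat) (\<epsilon> :: real). k \<ge> 1 \<longrightarrow> \<epsilon> > 0 \<longrightarrow>
     (\<forall>obj. \<exists>prog C. solves_within prog obj (1 + \<epsilon>) k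
        (\<lambda>n d. C * real d * real n powr (poly p (real k / \<epsilon>))))"
proof -
  \<comment> \<open>The 8 alone serves large \<open>\<epsilon>\<close>. For small
    \<open>\<epsilon>\<close> the exponent is 4 k E^2 + k + k^2 + 8, and the summands come from k
    \<le> 883 x and E \<le> x + 1 with x = k/eps.\<close>
  define p :: "real poly" where "p = [:8, 883:] + [:0, 883:] ^ 2 + [:0, 3532:] * [:1, 1:] ^ 2"
  have p: "poly p x = 8 + 883 * x + (883 * x)\<^sup>2 + 4 * (883 * x) * (x + 1)\<^sup>2" for x
    by (simp add: p_def algebra_simps)
  have "\<exists>prog C. solves_within prog obj (1 + \<epsilon>) k (\<lambda>n d. C * real d * real n powr (poly p (real k / \<epsilon>)))"
    if k: "k \<ge> 1" and eps: "\<epsilon> > 0" for k \<epsilon> obj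
  proof (cases "\<epsilon> < 883")
    case False
    then show ?thesis using k eps by (intro greedy_solves) (simp_all add: p)
  next
    case True
    let ?x = "real k / \<epsilon>"
    \<comment> \<open>Rounding up gives 1/E \<le> \<open>\<epsilon>\<close>; since k is at least 1,
      E exceeds k/eps by at most 1.\<close>
    define E where "E = nat \<lceil>1 / \<epsilon>\<rceil>"
    have E0: "real E \<ge> 1 / \<epsilon>" unfolding E_def by (rule real_nat_ceiling_ge)
    have pos: "1 / \<epsilon> > 0" using eps by simp
    then have "real E > 0" using E0 by linarith
    then have E1: "E \<ge> 1" by simp
    have E2: "1 / real E \<le> \<epsilon>" using E0 E1 eps by (simp add: field_simps)
    have x: "0 \<le> ?x" using eps by simp
    have kx: "real k \<le> 883 * ?x"
    proof -
      have "real k * \<epsilon> \<le> real k * 883" using True by (intro mult_left_mono) simp_all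
      then show ?thesis using eps by (simp add: field_simps)
    qed
    have "real E \<le> 1 / \<epsilon> + 1" using pos unfolding E_def by linarith
    also have "1 / \<epsilon> \<le> ?x" using k eps by (intro divide_right_mono) simp_all
    finally have "real E \<le> ?x + 1" by simp
    then have "(real E)\<^sup>2 \<le> (?x + 1)\<^sup>2" by (intro power_mono) simp_all
    then have "4 * real k * (real E)\<^sup>2 \<le> 4 * (883 * ?x) * (?x + 1)\<^sup>2" using kx x by (intro mult_mono) simp_all
    moreover have "(real k)\<^sup>2 \<le> (883 * ?x)\<^sup>2" using kx by (intro power_mono) simp_all
    moreover have "real (k * (4 * E\<^sup>2) + k + (k * k + 1) + 7) = 4 * real k * (real E)\<^sup>2 + real k + (real k)\<^sup>2 + 8"
      by (simp add: power2_eq_square)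
    ultimately have "real (k * (4 * E\<^sup>2) + k + (k * k + 1) + 7) \<le> poly p ?x"
      using kx unfolding p by linarith
    then show ?thesis by (rule threshold_solves[OF k E1 E2 eps])
  qed
  then show ?thesis by blast
qed

end
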